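(* The operators $\tilde L$ and $\tilde L^{+}$ are strictly accretive, and there are $\gamma\in\mathbb{R}$ and $\theta\in[0,\pi/2)$, determined by the coefficients of the operator $L$, such that the numerical ranges of $\tilde L$ and $\tilde L^{+}$ are contained in the sector $$\mathfrak{S}:=\{\zeta\in\mathbb{C}:\ |\arg(\zeta-\gamma)|\le\theta\}.$$
   Context: Let $n\ge 2$, $\alpha\in(0,1)$, and let $\Omega\subset\mathbb{E}^n$ ($n$-dimensional Euclidean space) be a bounded convex domain with $\mathfrak{d}:=\operatorname{diam}\Omega$. Fix $P\in\partial\Omega$. A point $Q\in\Omega$ is written $Q=P+r\mathbf{e}$ with $r=|P-Q|$ and $\mathbf{e}$ the unit vector from $P$ to $Q$; $d=d(\mathbf{e})$ is the length of the segment inside $\Omega$ of the ray from $P$ in direction $\mathbf{e}$; $T:=P+t\mathbf{e}$. Function spaces are complex; functions are extended by zero outside $\bar\Omega$. Kipriyanov fractional derivative: $$(\mathfrak{D}^{\alpha}f)(Q)=\frac{\alpha}{\Gamma(1-\alpha)}\int_0^r\frac{f(Q)-f(T)}{(r-t)^{\alpha+1}}\Big(\frac tr\Big)^{n-1}dt+C^{(\alpha)}_n f(Q)r^{-\alpha},\quad C^{(\alpha)}_n=\frac{(n-1)!}{\Gamma(n-\alpha)}.$$ Right-side directional fractional derivative: $\mathfrak{D}^{\alpha}_{d-}f=\lim_{\varepsilon\to0}\mathfrak{D}^{\alpha}_{d-,\varepsilon}f$ in $L_2(\Omega)$, with $(\mathfrak{D}^{\alpha}_{d-,\varepsilon}f)(Q)=\frac{f(Q)(d-r)^{-\alpha}}{\Gamma(1-\alpha)}+\frac{\alpha}{\Gamma(1-\alpha)}(\psi^{-}_{\varepsilon}f)(Q)$,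 where $(\psi^{-}_{\varepsilon}f)(Q)=\int_{r+\varepsilon}^{d}\frac{f(Q)-f(T)}{(t-r)^{\alpha+1}}dt$ for $0\le r\le d-\varepsilon$ and $(\psi^{-}_{\varepsilon}f)(Q)=\frac{f(Q)}{\alpha}\big(\varepsilon^{-\alpha}-(d-r)^{-\alpha}\big)$ for $d-\varepsilon<r\le d$. Operators in $L_2(\Omega)$ (summation over repeated indices $i,j=1,\dots,n$; $D_i$ weak partial derivatives): $$Lu=-D_j(a^{ij}D_iu)+\rho\,\mathfrak{D}^{\alpha}u,\qquad L^{+}u=-D_i(a^{ij}D_ju)+\mathfrak{D}^{\alpha}_{d-}(\rho u),\qquad \mathrm{D}(L)=\mathrm{D}(L^+)=H^2(\Omega)\cap H^1_0(\Omega).$$ Assumptions: $a^{ij}\in C^1(\bar\Omega)$ are real and $a^{ij}(Q)\xi_i\xi_j\ge a_0|\xi|^2$ for all $\xi\in\mathbb{R}^n$, with $a_0>0$; $\rho(Q)>0$ and $\rho\in\mathrm{Lip}\,\lambda$ with $\alpha<\lambda\le1$, i.e. $|\rho(Q_1)-\rho(Q_2)|\le M|Q_1-Q_2|^\lambda$ on $\bar\Omega$; and $\mu>0$, where $$\mu=\frac12\mathfrak{d}^{-\alpha}\Big(\frac1{\Gamma(1-\alpha)}+C^{(\alpha)}_n\Big)-\frac{\alpha M\mathfrak{d}^{\lambda-\alpha}}{2\Gamma(1-\alpha)(\lambda-\alpha)\inf\rho},$$ or, if $\rho$ is non-increasing in $t$ along every ray $t\mapsto P+t\mathbf{e}$,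 $\mu=\frac12\mathfrak{d}^{-\alpha}\big(\frac1{\Gamma(1-\alpha)}+C^{(\alpha)}_n\big)$. $L$, $L^+$ are closable, and a tilde denotes the closure. The numerical range of $A$ is $\Theta(A)=\{(Au,u)_{L_2(\Omega)}:u\in\mathrm{D}(A),\|u\|_{L_2(\Omega)}=1\}$. $A$ is strictly accretive if for some $c>0$, $\operatorname{Re}(Au,u)_{L_2(\Omega)}\ge c\|u\|^2_{L_2(\Omega)}$ for all $u\in\mathrm{D}(A)$. *)

theory Defs
  imports "HOL-Analysis.Analysis"
begin

text \<open>
  Elements of \<open>L\<^sub>2(\<Omega>)\<close> are represented by functions on the whole space whose values outside
  \<open>\<Omega>\<close> are irrelevant and which are identified when they agree almost everywhere on \<open>\<Omega>\<close>.
  Operators in \<open>L\<^sub>2(\<Omega>)\<close> are represented by their graphs, which are closed under this identification.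
\<close>

definition L2 :: "(real^'n) set \<Rightarrow> (real^'n \<Rightarrow> complex) set" where
  "L2 \<Omega> = {f. f \<in> borel_measurable (lebesgue_on \<Omega>) \<and>
              integrable (lebesgue_on \<Omega>) (\<lambda>x. (cmod (f x))\<^sup>2)}"

definition l2_inner :: "(real^'n) set \<Rightarrow> (real^'n \<Rightarrow> complex) \<Rightarrow> (real^'n \<Rightarrow> complex) \<Rightarrow> complex" where
  "l2_inner \<Omega> f g = (LINT x|lebesgue_on \<Omega>. f x * cnj (g x))"

definition l2_norm :: "(real^'n) set \<Rightarrow> (real^'n \<Rightarrow> complex) \<Rightarrow> real" where
  "l2_norm \<Omega> f = sqrt (LINT x|lebesgue_on \<Omega>. (cmod (f x))\<^sup>2)"

definition l2_tendsto ::
  "(real^'n) set \<Rightarrow> ('b \<Rightarrow> real^'n \<Rightarrow> complex) \<Rightarrow> (real^'n \<Rightarrow> complex) \<Rightarrow> 'b filter \<Rightarrow> bool" where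
  "l2_tendsto \<Omega> f g F \<longleftrightarrow> g \<in> L2 \<Omega> \<and> (\<forall>\<^sub>F k in F. f k \<in> L2 \<Omega>) \<and>
     ((\<lambda>k. l2_norm \<Omega> (\<lambda>x. f k x - g x)) \<longlongrightarrow> 0) F"


definition partial :: "'n \<Rightarrow> (real^'n \<Rightarrow> complex) \<Rightarrow> real^'n \<Rightarrow> complex" where
  "partial i f x = frechet_derivative f (at x) (axis i 1)"

primrec C_k :: "nat \<Rightarrow> (real^'n \<Rightarrow> complex) \<Rightarrow> bool" where
  "C_k 0 f \<longleftrightarrow> continuous_on UNIV f"
| "C_k (Suc k) f \<longleftrightarrow> (\<forall>x. f differentiable at x) \<and> (\<forall>i. C_k k (partial i f))"

definition test_function :: "(real^'n) set \<Rightarrow> (real^'n \<Rightarrow> complex) \<Rightarrow> bool" where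
  "test_function \<Omega> \<phi> \<longleftrightarrow> (\<forall>k. C_k k \<phi>) \<and>
     compact (closure {x. \<phi> x \<noteq> 0}) \<and> closure {x. \<phi> x \<noteq> 0} \<subseteq> \<Omega>"

definition locally_integrable :: "(real^'n) set \<Rightarrow> (real^'n \<Rightarrow> complex) \<Rightarrow> bool" where
  "locally_integrable \<Omega> f \<longleftrightarrow> (\<forall>K. compact K \<and> K \<subseteq> \<Omega> \<longrightarrow> integrable (lebesgue_on K) f)"

definition has_weak_partial ::
  "(real^'n) set \<Rightarrow> 'n \<Rightarrow> (real^'n \<Rightarrow> complex) \<Rightarrow> (real^'n \<Rightarrow> complex) \<Rightarrow> bool" where
  "has_weak_partial \<Omega> i u v \<longleftrightarrow> locally_integrable \<Omega> u \<and> locally_integrable \<Omega> v \<and>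
     (\<forall>\<phi>. test_function \<Omega> \<phi> \<longrightarrow>
        (LINT x|lebesgue_on \<Omega>. u x * partial i \<phi> x) = - (LINT x|lebesgue_on \<Omega>. v x * \<phi> x))"

text \<open>For open \<open>\<Omega>\<close>, weak derivatives are unique up to null sets, so the choice is immaterial.\<close>

definition weak_partial :: "(real^'n) set \<Rightarrow> 'n \<Rightarrow> (real^'n \<Rightarrow> complex) \<Rightarrow> real^'n \<Rightarrow> complex" where
  "weak_partial \<Omega> i u = (SOME v. has_weak_partial \<Omega> i u v)"

text \<open>The Sobolev space \<open>H\<^sup>k(\<Omega>)\<close>.\<close>

primrec sobolev :: "nat \<Rightarrow> (real^'n) set \<Rightarrow> (real^'n \<Rightarrow> complex) set" where
  "sobolev 0 \<Omega> = L2 \<Omega>"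
| "sobolev (Suc k) \<Omega> = {u \<in> L2 \<Omega>. \<forall>i. \<exists>v \<in> sobolev k \<Omega>. has_weak_partial \<Omega> i u v}"

text \<open>\<open>H\<^sup>1\<^sub>0(\<Omega>)\<close>, the closure of the test functions in \<open>H\<^sup>1(\<Omega>)\<close>.\<close>

definition sobolev10 :: "(real^'n) set \<Rightarrow> (real^'n \<Rightarrow> complex) set" where
  "sobolev10 \<Omega> = {u \<in> sobolev 1 \<Omega>. \<exists>\<phi> :: nat \<Rightarrow> real^'n \<Rightarrow> complex.
     (\<forall>k. test_function \<Omega> (\<phi> k)) \<and>
     l2_tendsto \<Omega> \<phi> u sequentially \<and>
     (\<forall>i. l2_tendsto \<Omega> (\<lambda>k. partial i (\<phi> k)) (weak_partial \<Omega> i u) sequentially)}"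

text \<open>\<open>C\<^sup>1\<close> up to the boundary: the gradient extends continuously to the closure.\<close>

definition C1_closure :: "(real^'n) set \<Rightarrow> (real^'n \<Rightarrow> real) \<Rightarrow> bool" where
  "C1_closure \<Omega> f \<longleftrightarrow> continuous_on (closure \<Omega>) f \<and>
     (\<exists>g. continuous_on (closure \<Omega>) g \<and> (\<forall>x\<in>\<Omega>. GDERIV f x :> g x))"


definition direction :: "real^'n \<Rightarrow> real^'n \<Rightarrow> real^'n" where
  "direction P Q = (Q - P) /\<^sub>R dist P Q"

text \<open>
  The length \<open>d(e)\<close> of the segment that the ray from the boundary point \<open>P\<close> cuts out of the
  convex domain \<open>\<Omega>\<close>; this segment has \<open>P\<close> as an end point.
  The integrals below therefore see only values of \<open>f\<close> in \<open>\<Omega>\<close>, up to end points, and no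
  extension by zero outside \<open>\<Omega>\<close> is needed.
\<close>

definition ray_length :: "(real^'n) set \<Rightarrow> real^'n \<Rightarrow> real^'n \<Rightarrow> real" where
  "ray_length \<Omega> P e = Sup {t. 0 < t \<and> P + t *\<^sub>R e \<in> \<Omega>}"

definition kip_const :: "nat \<Rightarrow> real \<Rightarrow> real" where
  "kip_const n \<alpha> = fact (n - 1) / Gamma (real n - \<alpha>)"

definition kipriyanov :: "real \<Rightarrow> real^'n \<Rightarrow> (real^'n \<Rightarrow> complex) \<Rightarrow> real^'n \<Rightarrow> complex" where
  "kipriyanov \<alpha> P f Q =
     (let r = dist P Q; e = direction P Q in
        (\<alpha> / Gamma (1 - \<alpha>)) *\<^sub>R
          (LINT t|lebesgue_on {0..r}.
             ((t / r) ^ (CARD('n) - 1) / (r - t) powr (\<alpha> + 1)) *\<^sub>R (f Q - f (P + t *\<^sub>R e)))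
        + (kip_const CARD('n) \<alpha> * r powr (- \<alpha>)) *\<^sub>R f Q)"

definition psi_minus ::
  "real \<Rightarrow> (real^'n) set \<Rightarrow> real^'n \<Rightarrow> real \<Rightarrow> (real^'n \<Rightarrow> complex) \<Rightarrow> real^'n \<Rightarrow> complex" where
  "psi_minus \<alpha> \<Omega> P \<epsilon> f Q =
     (let r = dist P Q; e = direction P Q; d = ray_length \<Omega> P e in
        if r \<le> d - \<epsilon>
        then (LINT t|lebesgue_on {r + \<epsilon>..d}.
                (1 / (t - r) powr (\<alpha> + 1)) *\<^sub>R (f Q - f (P + t *\<^sub>R e)))
        else ((\<epsilon> powr (- \<alpha>) - (d - r) powr (- \<alpha>)) / \<alpha>) *\<^sub>R f Q)"

definition right_frac_deriv_eps ::
  "real \<Rightarrow> (real^'n) set \<Rightarrow> real^'n \<Rightarrow> real \<Rightarrow> (real^'n \<Rightarrow> complex) \<Rightarrow> real^'n \<Rightarrow> complex" where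
  "right_frac_deriv_eps \<alpha> \<Omega> P \<epsilon> f Q =
     (let r = dist P Q; e = direction P Q; d = ray_length \<Omega> P e in
        ((d - r) powr (- \<alpha>) / Gamma (1 - \<alpha>)) *\<^sub>R f Q
        + (\<alpha> / Gamma (1 - \<alpha>)) *\<^sub>R psi_minus \<alpha> \<Omega> P \<epsilon> f Q)"

text \<open>The \<open>L\<^sub>2\<close> limit as \<open>\<epsilon>\<close> decreases to \<open>0\<close>, which is unique up to null sets.\<close>

definition right_frac_deriv ::
  "real \<Rightarrow> (real^'n) set \<Rightarrow> real^'n \<Rightarrow> (real^'n \<Rightarrow> complex) \<Rightarrow> real^'n \<Rightarrow> complex" where
  "right_frac_deriv \<alpha> \<Omega> P f =
     (SOME g. l2_tendsto \<Omega> (\<lambda>\<epsilon>. right_frac_deriv_eps \<alpha> \<Omega> P \<epsilon> f) g (at_right 0))"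


definition op_dom :: "(real^'n) set \<Rightarrow> (real^'n \<Rightarrow> complex) set" where
  "op_dom \<Omega> = sobolev 2 \<Omega> \<inter> sobolev10 \<Omega>"

definition L_op ::
  "(real^'n) set \<Rightarrow> real^'n \<Rightarrow> real \<Rightarrow> ('n \<Rightarrow> 'n \<Rightarrow> real^'n \<Rightarrow> real) \<Rightarrow> (real^'n \<Rightarrow> real)
     \<Rightarrow> (real^'n \<Rightarrow> complex) \<Rightarrow> real^'n \<Rightarrow> complex" where
  "L_op \<Omega> P \<alpha> a \<rho> u = (\<lambda>Q.
     - (\<Sum>j\<in>UNIV. \<Sum>i\<in>UNIV. weak_partial \<Omega> j (\<lambda>x. a i j x *\<^sub>R weak_partial \<Omega> i u x) Q)
     + \<rho> Q *\<^sub>R kipriyanov \<alpha> P u Q)"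

definition Lplus_op ::
  "(real^'n) set \<Rightarrow> real^'n \<Rightarrow> real \<Rightarrow> ('n \<Rightarrow> 'n \<Rightarrow> real^'n \<Rightarrow> real) \<Rightarrow> (real^'n \<Rightarrow> real)
     \<Rightarrow> (real^'n \<Rightarrow> complex) \<Rightarrow> real^'n \<Rightarrow> complex" where
  "Lplus_op \<Omega> P \<alpha> a \<rho> u = (\<lambda>Q.
     - (\<Sum>i\<in>UNIV. \<Sum>j\<in>UNIV. weak_partial \<Omega> i (\<lambda>x. a i j x *\<^sub>R weak_partial \<Omega> j u x) Q)
     + right_frac_deriv \<alpha> \<Omega> P (\<lambda>x. \<rho> x *\<^sub>R u x) Q)"

type_synonym 'n l2_op = "((real^'n \<Rightarrow> complex) \<times> (real^'n \<Rightarrow> complex)) set"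

definition op_graph ::
  "(real^'n) set \<Rightarrow> (real^'n \<Rightarrow> complex) set \<Rightarrow> ((real^'n \<Rightarrow> complex) \<Rightarrow> real^'n \<Rightarrow> complex)
     \<Rightarrow> 'n l2_op" where
  "op_graph \<Omega> D A = {(u, f). u \<in> D \<and> (AE x in lebesgue_on \<Omega>. f x = A u x)}"

definition op_closure :: "(real^'n) set \<Rightarrow> 'n l2_op \<Rightarrow> 'n l2_op" where
  "op_closure \<Omega> G = {(u, f). \<exists>U F. (\<forall>k::nat. (U k, F k) \<in> G) \<and>
     l2_tendsto \<Omega> U u sequentially \<and> l2_tendsto \<Omega> F f sequentially}"

definition numerical_range :: "(real^'n) set \<Rightarrow> 'n l2_op \<Rightarrow> complex set" where
  "numerical_range \<Omega> G = {l2_inner \<Omega> f u | u f. (u, f) \<in> G \<and> l2_norm \<Omega> u = 1}"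

definition strictly_accretive :: "(real^'n) set \<Rightarrow> 'n l2_op \<Rightarrow> bool" where
  "strictly_accretive \<Omega> G \<longleftrightarrow>
     (\<exists>c>0. \<forall>(u, f) \<in> G. Re (l2_inner \<Omega> f u) \<ge> c * (l2_norm \<Omega> u)\<^sup>2)"

text \<open>Since \<open>Arg 0 = 0\<close>, the vertex \<open>\<gamma>\<close> belongs to the sector.\<close>

definition sector :: "real \<Rightarrow> real \<Rightarrow> complex set" where
  "sector \<gamma> \<theta> = {\<zeta>. \<bar>Arg (\<zeta> - complex_of_real \<gamma>)\<bar> \<le> \<theta>}"


text \<open>The two values of \<open>\<mu>\<close>; \<open>\<delta>\<close> is the diameter of the domain and \<open>m\<close> the infimum of \<open>\<rho>\<close>,
  which is \<open>\<kappa>\<close>-Hoelder continuous with constant \<open>M\<close>.\<close>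

definition mu_monotone :: "nat \<Rightarrow> real \<Rightarrow> real \<Rightarrow> real" where
  "mu_monotone n \<alpha> \<delta> = 1/2 * \<delta> powr (- \<alpha>) * (1 / Gamma (1 - \<alpha>) + kip_const n \<alpha>)"

definition mu_general :: "nat \<Rightarrow> real \<Rightarrow> real \<Rightarrow> real \<Rightarrow> real \<Rightarrow> real \<Rightarrow> real" where
  "mu_general n \<alpha> \<kappa> M m \<delta> =
     1/2 * \<delta> powr (- \<alpha>) * (1 / Gamma (1 - \<alpha>) + kip_const n \<alpha>)
     - \<alpha> * M * \<delta> powr (\<kappa> - \<alpha>) / (2 * Gamma (1 - \<alpha>) * (\<kappa> - \<alpha>) * m)"

definition nonincreasing_on_rays :: "(real^'n) set \<Rightarrow> real^'n \<Rightarrow> (real^'n \<Rightarrow> real) \<Rightarrow> bool" where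
  "nonincreasing_on_rays \<Omega> P \<rho> \<longleftrightarrow>
     (\<forall>e s t. norm e = 1 \<and> 0 < s \<and> s \<le> t \<and> P + s *\<^sub>R e \<in> \<Omega> \<and> P + t *\<^sub>R e \<in> \<Omega>
        \<longrightarrow> \<rho> (P + t *\<^sub>R e) \<le> \<rho> (P + s *\<^sub>R e))"

end

theory Submission
  imports Defs "HOL-Real_Asymp.Real_Asymp"
begin

text \<open>
  Take \<open>P\<close> as the origin and write \<open>k(s) = (1-s)\<^sup>-\<^sup>\<alpha>\<^sup>-\<^sup>1 s\<^sup>n\<^sup>-\<^sup>1\<close>, \<open>q(s) = (1-s)\<^sup>-\<^sup>\<alpha>\<^sup>-\<^sup>1 s\<^sup>\<alpha>\<^sup>-\<^sup>1\<close> and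
  \<open>c = \<alpha> / \<Gamma>(1-\<alpha>)\<close>. Substituting \<open>t = r s\<close> and \<open>t = r / s\<close>, the left and right derivatives of functions
  extended by zero become averages over dilations,
  \<open>|x|\<^sup>-\<^sup>\<alpha> (c \<integral> k(s) (u(x) - u(s x)) ds + C u(x))\<close> and \<open>c |x|\<^sup>-\<^sup>\<alpha> \<integral> q(s) (f(x) - f(x/s)) ds\<close>, where the
  integrals run over \<open>0 < s < 1\<close>. For \<open>u\<close> in \<open>H\<^sup>1\<^sub>0\<close> the weighted norm of \<open>u(x) - u(s x)\<close> is bounded by
  the Dirichlet norm, with a factor of order \<open>1-s\<close>, so both derivatives are square integrable by
  Minkowski's inequality. As \<open>c \<integral> (q - k) = C\<close>, Fubini's theorem shows that \<open>u \<mapsto> D\<^sub>-(\<rho> u)\<close> is the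
  adjoint of \<open>u \<mapsto> \<rho> D u\<close>, so one estimate serves both operators.

  The real part of \<open>(\<rho> D u, u)\<close> is nonnegative: use \<open>Re (a cnj (a - b)) \<ge> (|a|\<^sup>2 - |b|\<^sup>2) / 2\<close>, move the
  dilation from \<open>u\<close> to \<open>\<rho>\<close>, and bound the average of \<open>q(s) \<rho>(x/s)\<close> by \<open>\<rho>(x)\<close> times that of
  \<open>k\<close> and twice \<open>C/c\<close>, which is where the hypothesis on \<open>\<mu>\<close> enters. The second-order part dominates the
  Dirichlet norm, hence by Hardy's inequality the \<open>L\<^sub>2\<close> norm, and both parts of the form are bounded by
  the Dirichlet norm. The numerical range therefore lies in a sector with vertex \<open>0\<close>, and all the
  inequalities pass to the closure.
\<close>

subsection \<open>Minkowski's inequality and dilations\<close>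

text \<open>The obstacle is that neither kernel is integrable at s = 1, where each behaves like
  (1-s)^(-\<alpha>-1). For upper bounds the factor 1-s in the increment estimate lowers this to
  (1-s)^(-\<alpha>). For the sign of the real part there is no such gain, because the inequality
  between squares separates the two terms of the difference. The integrals over s are therefore cut
  at some \<tau> < 1; the mass of k on (0, \<tau>), which diverges as \<tau> tends to 1, then occurs
  once with each sign and drops out before the limit is taken. Of the term 2 C / c, one half comes
  from exchanging q for k and the other from the hypothesis on \<mu>. The inequality between squares
  halves it, and c times what is left is C, exactly the coefficient of the zero-order term of the
  left derivative. The fractional derivatives see a function along rays, which are null sets.
  Functions are therefore replaced by Borel representatives, and statements valid almost everywhere
  are carried over to almost every ray. Estimates are proved for test functions, whose supports stay
  away from P, so that the weighted norms are finite before they are bounded.\<close>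

text \<open>Integrating 2 a b \<le> a^2 + b^2 with a = f(x) g(y) and b = f(y) g(x) in both variables
  gives the inequality directly, since every integrand is a product and the iterated integrals
  factor. Nothing is divided by a norm, so zero and infinite integrals need no separate
  treatment.\<close>

lemma nn_integral_Cauchy_Schwarz:
  fixes f g :: "'a \<Rightarrow> ennreal"
  assumes [measurable]: "f \<in> borel_measurable M" "g \<in> borel_measurable M"
  shows "(\<integral>\<^sup>+x. f x * g x \<partial>M)\<^sup>2 \<le> (\<integral>\<^sup>+x. (f x)\<^sup>2 \<partial>M) * (\<integral>\<^sup>+x. (g x)\<^sup>2 \<partial>M)"
proof -
  have am: "2 * (a * b) \<le> a\<^sup>2 + b\<^sup>2" for a b :: ennreal
  proof (cases a; cases b)
    fix r s assume "a = ennreal r" "0 \<le> r" "b = ennreal s" "0 \<le> s"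
    moreover have "ennreal (2 * (r * s)) \<le> ennreal (r\<^sup>2 + s\<^sup>2)"
      using zero_le_power2[of "r - s"] by (intro ennreal_leI) (simp add: power2_diff)
    ultimately show ?thesis
      by (simp add: ennreal_mult ennreal_plus ennreal_power)
  qed (auto simp: power2_eq_square ennreal_mult_top ennreal_top_mult)
  let ?A = "\<integral>\<^sup>+x. (f x)\<^sup>2 \<partial>M" and ?B = "\<integral>\<^sup>+x. (g x)\<^sup>2 \<partial>M"
  have "2 * (\<integral>\<^sup>+x. f x * g x \<partial>M)\<^sup>2 = (\<integral>\<^sup>+x. (\<integral>\<^sup>+y. 2 * ((f x * g y) * (f y * g x)) \<partial>M) \<partial>M)"
  proof -
    have "(\<integral>\<^sup>+x. (\<integral>\<^sup>+y. 2 * ((f x * g y) * (f y * g x)) \<partial>M) \<partial>M)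
        = (\<integral>\<^sup>+x. (2 * (f x * g x)) * (\<integral>\<^sup>+y. f y * g y \<partial>M) \<partial>M)"
      by (subst nn_integral_cmult[symmetric]) (auto simp: mult_ac intro!: nn_integral_cong)
    also have "\<dots> = (2 * (\<integral>\<^sup>+x. f x * g x \<partial>M)) * (\<integral>\<^sup>+y. f y * g y \<partial>M)"
      by (subst nn_integral_multc, simp, subst nn_integral_cmult) auto
    finally show ?thesis
      by (simp add: power2_eq_square mult.assoc)
  qed
  also have "\<dots> \<le> (\<integral>\<^sup>+x. (\<integral>\<^sup>+y. (f x * g y)\<^sup>2 + (f y * g x)\<^sup>2 \<partial>M) \<partial>M)"
    by (intro nn_integral_mono am)
  also have "\<dots> = 2 * (?A * ?B)"
    by (simp add: power_mult_distrib nn_integral_add nn_integral_cmult nn_integral_multc mult_2 mult.commute)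
  finally show ?thesis
    by (subst (asm) ennreal_mult_le_mult_iff) auto
qed

text \<open>The integral form of Minkowski's inequality, with \<open>b s\<close> times the root of
  \<open>B\<close> as upper bound for the norm at parameter s. The kernel is split as a = sqrt(a b)
  sqrt(a / b); after Cauchy-Schwarz in s and Tonelli's theorem the factor a / b meets b^2 and
  produces the integral of a b a second time.\<close>

lemma nn_integral_Minkowski_weight:
  fixes g :: "'a \<Rightarrow> real \<Rightarrow> ennreal" and a b :: "real \<Rightarrow> real"
  assumes M: "sigma_finite_measure M"
    and g[measurable]: "case_prod g \<in> borel_measurable (M \<Otimes>\<^sub>M lborel)"
    and ab[measurable]: "a \<in> borel_measurable borel" "b \<in> borel_measurable borel"
    and a0: "\<And>s. a s \<ge> 0" and b0: "\<And>s. a s \<noteq> 0 \<Longrightarrow> b s > 0"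
    and B: "\<And>s. a s \<noteq> 0 \<Longrightarrow> (\<integral>\<^sup>+x. (g x s)\<^sup>2 \<partial>M) \<le> ennreal ((b s)\<^sup>2) * B"
  shows "(\<integral>\<^sup>+x. (\<integral>\<^sup>+s. a s * g x s \<partial>lborel)\<^sup>2 \<partial>M) \<le> (\<integral>\<^sup>+s. a s * b s \<partial>lborel)\<^sup>2 * B"
proof -
  interpret sigma_finite_measure M by fact
  interpret P: pair_sigma_finite M "lborel :: real measure" ..
  let ?I = "\<integral>\<^sup>+s. a s * b s \<partial>lborel"
  have eq: "ennreal (a s) * G = ennreal (sqrt (a s * b s)) * (ennreal (sqrt (a s / b s)) * G)" for s G
  proof (cases "a s = 0")
    case False
    then have "sqrt (a s * b s) * sqrt (a s / b s) = a s"
      using a0[of s] b0[of s] by (simp flip: real_sqrt_mult)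
    with a0[of s] b0[of s] False show ?thesis
      by (simp flip: mult.assoc ennreal_mult)
  qed simp
  have sq1: "(ennreal (sqrt (a s * b s)))\<^sup>2 = ennreal (a s * b s)" for s
    using a0[of s] b0[of s] by (cases "a s = 0") (auto simp: ennreal_power)
  have sq2: "(ennreal (sqrt (a s / b s)) * G)\<^sup>2 = ennreal (a s / b s) * G\<^sup>2" for s G
    using a0[of s] b0[of s] by (cases "a s = 0") (auto simp: ennreal_power power_mult_distrib)
  have "(\<integral>\<^sup>+x. (\<integral>\<^sup>+s. a s * g x s \<partial>lborel)\<^sup>2 \<partial>M)
      \<le> (\<integral>\<^sup>+x. ?I * (\<integral>\<^sup>+s. ennreal (a s / b s) * (g x s)\<^sup>2 \<partial>lborel) \<partial>M)"
  proof (intro nn_integral_mono)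
    fix x assume x: "x \<in> space M"
    have [measurable]: "g x \<in> borel_measurable lborel"
      using g x by (auto dest: measurable_Pair2[of _ _ _ _ x])
    show "(\<integral>\<^sup>+s. a s * g x s \<partial>lborel)\<^sup>2 \<le> ?I * (\<integral>\<^sup>+s. ennreal (a s / b s) * (g x s)\<^sup>2 \<partial>lborel)"
      using nn_integral_Cauchy_Schwarz[of "\<lambda>s. ennreal (sqrt (a s * b s))" lborel
          "\<lambda>s. ennreal (sqrt (a s / b s)) * g x s"]
      by (simp only: eq[symmetric] sq1 sq2) simp
  qed
  also have "\<dots> = ?I * (\<integral>\<^sup>+x. (\<integral>\<^sup>+s. ennreal (a s / b s) * (g x s)\<^sup>2 \<partial>lborel) \<partial>M)"
    by (intro nn_integral_cmult) measurable
  also have "(\<integral>\<^sup>+x. (\<integral>\<^sup>+s. ennreal (a s / b s) * (g x s)\<^sup>2 \<partial>lborel) \<partial>M)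
      = (\<integral>\<^sup>+s. (\<integral>\<^sup>+x. ennreal (a s / b s) * (g x s)\<^sup>2 \<partial>M) \<partial>lborel)"
    by (rule P.Fubini'[symmetric]) measurable
  also have "\<dots> = (\<integral>\<^sup>+s. ennreal (a s / b s) * (\<integral>\<^sup>+x. (g x s)\<^sup>2 \<partial>M) \<partial>lborel)"
    by (intro nn_integral_cong nn_integral_cmult) measurable
  also have "\<dots> \<le> (\<integral>\<^sup>+s. ennreal (a s * b s) * B \<partial>lborel)"
  proof (intro nn_integral_mono)
    fix s
    show "ennreal (a s / b s) * (\<integral>\<^sup>+x. (g x s)\<^sup>2 \<partial>M) \<le> ennreal (a s * b s) * B"
    proof (cases "a s = 0")
      case False
      have "ennreal (a s / b s) * (\<integral>\<^sup>+x. (g x s)\<^sup>2 \<partial>M) \<le> ennreal (a s / b s) * (ennreal ((b s)\<^sup>2) * B)"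
        by (intro mult_left_mono B False) simp
      also have "\<dots> = ennreal (a s * b s) * B"
        using a0[of s] b0[OF False]
        by (simp add: mult.assoc[symmetric] ennreal_mult[symmetric] power2_eq_square)
      finally show ?thesis .
    qed simp
  qed
  also have "\<dots> = ?I * B"
    by (intro nn_integral_multc) measurable
  finally show ?thesis
    by (simp add: power2_eq_square mult.assoc mult_left_mono)
qed

lemma nn_integral_dilation:
  fixes F :: "'a::euclidean_space \<Rightarrow> ennreal"
  assumes [measurable]: "F \<in> borel_measurable borel" and s: "s > 0"
  shows "(\<integral>\<^sup>+x. F (s *\<^sub>R x) \<partial>lborel) = ennreal (s powr - real DIM('a)) * (\<integral>\<^sup>+x. F x \<partial>lborel)"
proof -
  have "(\<integral>\<^sup>+x. F x \<partial>lborel) = ennreal (s ^ DIM('a)) * (\<integral>\<^sup>+x. F (s *\<^sub>R x) \<partial>lborel)"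
    using s by (subst lborel_affine[of s 0])
      (auto simp: nn_integral_density nn_integral_distr nn_integral_cmult)
  moreover have "ennreal (s powr - real DIM('a)) * ennreal (s ^ DIM('a)) = 1"
    using s by (simp flip: ennreal_mult' add: powr_minus powr_realpow field_simps)
  ultimately show ?thesis by (simp flip: mult.assoc)
qed

lemma integrable_dilation:
  fixes F :: "'a::euclidean_space \<Rightarrow> 'b::{banach, second_countable_topology}"
  assumes F: "integrable lborel F" and s: "s > 0"
  shows "integrable lborel (\<lambda>x. F (s *\<^sub>R x))"
proof -
  have [measurable]: "F \<in> borel_measurable borel" using F by auto
  show ?thesis
    using F s unfolding integrable_iff_bounded
    by (auto simp: nn_integral_dilation[where F="\<lambda>x. ennreal (norm (F x))"] ennreal_mult_less_top)
qed

lemma integral_dilation: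
  fixes F :: "'a::euclidean_space \<Rightarrow> 'b::{banach, second_countable_topology}"
  assumes [measurable]: "F \<in> borel_measurable borel" and s: "s > 0"
  shows "(LINT x|lborel. F (s *\<^sub>R x)) = (s powr - real DIM('a)) *\<^sub>R (LINT x|lborel. F x)"
proof -
  have "(LINT x|lborel. F x) = (s ^ DIM('a)) *\<^sub>R (LINT x|lborel. F (s *\<^sub>R x))"
    using s by (subst lborel_affine[of s 0]) (auto simp: integral_density integral_distr)
  then show ?thesis using s by (simp add: powr_minus powr_realpow)
qed

text \<open>For each s > 0 the preimage of the null set under dilation by s is null, and Tonelli's
  theorem exchanges the two quantifiers. This carries identities that hold almost everywhere over to
  almost every ray from the origin.\<close>

lemma AE_dilation:
  fixes N :: "'a::euclidean_space set"
  assumes N: "N \<in> null_sets lborel"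
  shows "AE x in lborel. AE s in lborel. 0 < s \<longrightarrow> s *\<^sub>R x \<notin> N"
proof -
  have [measurable]: "N \<in> sets borel" using N by auto
  have e: "emeasure lborel N = 0" using N by auto
  have "AE x in lborel. s > 0 \<longrightarrow> s *\<^sub>R x \<notin> N" for s
  proof (cases "s > 0")
    case True
    have "(\<integral>\<^sup>+x. indicator N (s *\<^sub>R x) \<partial>lborel) = 0"
      using nn_integral_dilation[of "indicator N" s] True e by simp
    then have "AE x in lborel. indicator N (s *\<^sub>R x) = (0::ennreal)"
      by (subst (asm) nn_integral_0_iff_AE) auto
    then show ?thesis by eventually_elim (auto simp: indicator_def split: if_splits)
  qed simp
  then have "AE s in lborel. AE x in lborel. s > 0 \<longrightarrow> s *\<^sub>R x \<notin> N" by simp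
  moreover have "{x \<in> space (lborel \<Otimes>\<^sub>M lborel). snd x > 0 \<longrightarrow> snd x *\<^sub>R fst x \<notin> N}
      \<in> sets ((lborel::'a measure) \<Otimes>\<^sub>M lborel)"
    by measurable
  ultimately show ?thesis
    by (subst lborel_pair.AE_commute) auto
qed

subsection \<open>The kernels\<close>

text \<open>The substitutions \<open>t = r s\<close> and \<open>t = r / s\<close> turn the integrals over \<open>t\<close> in the left and right
  derivatives into integrals against these kernels.\<close>

definition left_kernel :: "nat \<Rightarrow> real \<Rightarrow> real \<Rightarrow> real" where
  "left_kernel n \<alpha> s = (if 0 < s \<and> s < 1 then (1 - s) powr (- \<alpha> - 1) * s ^ (n - 1) else 0)"

definition right_kernel :: "real \<Rightarrow> real \<Rightarrow> real" where
  "right_kernel \<alpha> s = (if 0 < s \<and> s < 1 then (1 - s) powr (- \<alpha> - 1) * s powr (\<alpha> - 1) else 0)"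

lemma borel_measurable_kernels [measurable]:
  "left_kernel n \<alpha> \<in> borel_measurable borel" "right_kernel \<alpha> \<in> borel_measurable borel"
  unfolding left_kernel_def right_kernel_def by measurable

lemma kernels_nonneg: "left_kernel n \<alpha> s \<ge> 0" "right_kernel \<alpha> s \<ge> 0"
  by (auto simp: left_kernel_def right_kernel_def)

text \<open>The factor s^(n-\<alpha>) is what the substitution x = s y produces in an integral with
  weight |x|^(-\<alpha>): s^n is the Jacobian and s^(-\<alpha>) comes from the weight. Moving a
  dilation from one factor of an integrand to the other thus turns q into k, which is the source of
  the adjointness.\<close>

lemma left_kernel_eq:
  assumes "n \<ge> 1"
  shows "left_kernel n \<alpha> s = right_kernel \<alpha> s * s powr (real n - \<alpha>)"
  using assms
  by (auto simp: left_kernel_def right_kernel_def of_nat_diff powr_realpow[symmetric] simp flip: powr_add)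

lemma left_kernel_le_right_kernel:
  assumes "\<alpha> < 1"
  shows "left_kernel n \<alpha> s \<le> right_kernel \<alpha> s"
proof (cases "0 < s \<and> s < 1")
  case True
  then have "s ^ (n - 1) \<le> 1" by (intro power_le_one) auto
  also have "1 \<le> s powr (\<alpha> - 1)"
    using True assms powr_mono'[of "\<alpha> - 1" 0 s] by simp
  finally have "s ^ (n - 1) \<le> s powr (\<alpha> - 1)" .
  then show ?thesis using True by (auto simp: left_kernel_def right_kernel_def intro!: mult_left_mono)
qed (auto simp: left_kernel_def right_kernel_def)

text \<open>The antiderivatives below are continuous up to the end points, but the kernels may blow
  up there, so differentiability is asked for inside the interval only.\<close>

lemma nn_integral_FTC_interior:
  fixes f F :: "real \<Rightarrow> real"
  assumes "a \<le> b" "continuous_on {a..b} F" and [measurable]: "f \<in> borel_measurable borel"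
    and "\<And>x. a < x \<Longrightarrow> x < b \<Longrightarrow> (F has_real_derivative f x) (at x)"
    and "\<And>x. a < x \<Longrightarrow> x < b \<Longrightarrow> f x \<ge> 0"
  shows "(\<integral>\<^sup>+x. ennreal (indicator {a<..<b} x * f x) \<partial>lborel) = ennreal (F b - F a)"
proof -
  have "(f has_integral F b - F a) {a..b}"
    using assms by (intro fundamental_theorem_of_calculus_interior)
      (auto simp: has_real_derivative_iff_has_vector_derivative)
  then have "(f has_integral F b - F a) {a<..<b}"
    by (simp add: has_integral_Icc_iff_Ioo)
  then have "((\<lambda>x. indicator {a<..<b} x * f x) has_integral F b - F a) UNIV"
    by (subst (asm) has_integral_restrict_UNIV[symmetric])
      (auto elim!: has_integral_eq[rotated] simp: indicator_def)
  then show ?thesis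
    by (intro nn_integral_has_integral_lborel) (auto simp: indicator_def assms)
qed

lemma nn_integral_beta_kernel_finite:
  assumes "a > -1" "b > -1"
  shows "(\<integral>\<^sup>+s. ennreal (indicator {0<..<1} s * ((1 - s) powr a * s powr b)) \<partial>lborel) < \<infinity>"
proof -
  have "((\<lambda>t. t powr b * (1 - t) powr a) has_integral Beta (b + 1) (a + 1)) {0<..<1}"
    using has_integral_Beta_real[of "b + 1" "a + 1"] assms by (simp add: has_integral_Icc_iff_Ioo)
  then have "((\<lambda>s. indicator {0<..<1} s * ((1 - s) powr a * s powr b)) has_integral Beta (b + 1) (a + 1)) UNIV"
    by (subst (asm) has_integral_restrict_UNIV[symmetric])
      (auto elim!: has_integral_eq[rotated] simp: indicator_def)
  then have "(\<integral>\<^sup>+s. ennreal (indicator {0<..<1} s * ((1 - s) powr a * s powr b)) \<partial>lborel) = ennreal (Beta (b + 1) (a + 1))"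
    by (intro nn_integral_has_integral_lborel) auto
  then show ?thesis by simp
qed

text \<open>Neither kernel is integrable near 1, but their difference is. With F as below, F' = q -
  k - b, where b is a Beta integrand, and F vanishes at 0 and at 1. The integral is therefore (n-1)
  / \<alpha> times the Beta value at (n-1, 1-\<alpha>), and this equals C / c.\<close>

lemma has_bochner_integral_kernel_difference:
  assumes \<alpha>: "0 < \<alpha>" "\<alpha> < 1" and n: "n \<ge> 2"
  shows "has_bochner_integral lborel (\<lambda>s. right_kernel \<alpha> s - left_kernel n \<alpha> s)
    (kip_const n \<alpha> * Gamma (1 - \<alpha>) / \<alpha>)"
proof -
  define F where "F s = (s powr \<alpha> - s ^ (n - 1)) * (1 - s) powr (- \<alpha>) / \<alpha>" for s
  define b where "b s = (real n - 1) / \<alpha> * (s powr (real n - 2) * (1 - s) powr (- \<alpha>))" for s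
  \<comment> \<open>Bernoulli's inequality bounds the numerator of F by a multiple of 1 - s. This
    outweighs (1-s)^(-\<alpha>) and makes F tend to 0 at s = 1.\<close>
  have bern: "0 \<le> s powr \<alpha> - s ^ (n - 1)" "s powr \<alpha> - s ^ (n - 1) \<le> real (n - 1) * (1 - s)"
    if "0 < s" "s < 1" for s
  proof -
    have "s ^ (n - 1) = s powr real (n - 1)" using that by (simp add: powr_realpow)
    also have "\<dots> \<le> s powr \<alpha>" using that \<alpha> n by (intro powr_mono') auto
    finally show "0 \<le> s powr \<alpha> - s ^ (n - 1)" by simp
    have "1 + real (n - 1) * (s - 1) \<le> (1 + (s - 1)) ^ (n - 1)"
      using that by (intro Bernoulli_inequality) auto
    moreover have "s powr \<alpha> \<le> 1" using that \<alpha> by (intro powr_le1) auto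
    ultimately show "s powr \<alpha> - s ^ (n - 1) \<le> real (n - 1) * (1 - s)"
      by (simp add: algebra_simps)
  qed
  have F1: "(F \<longlongrightarrow> F 1) (at 1 within {0..1})"
  proof -
    have "((\<lambda>s. real (n - 1) * (1 - s) powr (1 - \<alpha>) / \<alpha>) \<longlongrightarrow> real (n - 1) * (1 - 1) powr (1 - \<alpha>) / \<alpha>) (at 1 within {0..1})"
      using \<alpha> by (intro tendsto_intros) (auto simp: eventually_at_filter)
    moreover have "\<forall>\<^sub>F s in at 1 within {0..1}. norm (F s) \<le> real (n - 1) * (1 - s) powr (1 - \<alpha>) / \<alpha>"
    proof -
      have "\<forall>\<^sub>F s in at 1 within {0..1}. (0::real) < s"
        by (intro order_tendstoD(1)[OF tendsto_ident_at]) simp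
      moreover have "\<forall>\<^sub>F s in at (1::real) within {0..1}. s < 1"
        by (auto simp: eventually_at_filter)
      ultimately show ?thesis
      proof eventually_elim
        case (elim s)
        have "norm (F s) = (s powr \<alpha> - s ^ (n - 1)) * (1 - s) powr (- \<alpha>) / \<alpha>"
          using bern[OF elim] \<alpha> by (simp add: F_def abs_mult)
        also have "\<dots> \<le> real (n - 1) * (1 - s) * (1 - s) powr (- \<alpha>) / \<alpha>"
          using bern[OF elim] \<alpha> by (intro divide_right_mono mult_right_mono) auto
        also have "\<dots> = real (n - 1) * (1 - s) powr (1 - \<alpha>) / \<alpha>"
          using elim by (simp add: powr_diff powr_minus field_simps)
        finally show ?case .
      qed
    qed
    ultimately have "(F \<longlongrightarrow> 0) (at 1 within {0..1})"
      by (auto intro: Lim_null_comparison)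
    then show ?thesis by (simp add: F_def)
  qed
  have "continuous_on {0..<1} F"
    unfolding F_def using \<alpha>
    by (intro continuous_on_divide continuous_on_mult continuous_on_diff continuous_on_powr' continuous_intros) auto
  have F: "continuous_on {0..1} F"
    unfolding continuous_on_def
  proof
    fix x :: real assume x: "x \<in> {0..1}"
    show "(F \<longlongrightarrow> F x) (at x within {0..1})"
    proof (cases "x = 1")
      case False
      have "at x within {0..1} = at x within {0..<1}"
        using x False by (intro at_within_nhd[of x "{..<1}"]) auto
      with \<open>continuous_on {0..<1} F\<close> x False show ?thesis
        by (auto simp: continuous_on_def)
    qed (use F1 in simp)
  qed
  have "((\<lambda>s. right_kernel \<alpha> s - left_kernel n \<alpha> s - b s) has_integral F 1 - F 0) {0..1}"
  proof (rule fundamental_theorem_of_calculus_interior)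
    fix s :: real assume s: "s \<in> {0<..<1}"
    obtain m where m: "n = Suc (Suc m)" using n by (metis Suc_le_D numeral_2_eq_2 Suc_le_mono)
    have e: "(1 - s) powr (- \<alpha>) = (1 - s) * (1 - s) powr (- \<alpha> - 1)" "s powr \<alpha> = s * s powr (\<alpha> - 1)"
      "s ^ (n - 1) = s * s powr (real n - 2)" "s ^ (n - 1 - 1) = s powr (real n - 2)"
      using s by (auto simp: powr_mult_base m powr_realpow)
    have "(F has_real_derivative ((\<alpha> * s powr (\<alpha> - 1) - real (n - 1) * s ^ (n - 1 - 1)) * (1 - s) powr (- \<alpha>)
        + (s powr \<alpha> - s ^ (n - 1)) * (\<alpha> * (1 - s) powr (- \<alpha> - 1))) / \<alpha>) (at s)"
      unfolding F_def using s \<alpha> by (auto intro!: derivative_eq_intros)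
    also have "((\<alpha> * s powr (\<alpha> - 1) - real (n - 1) * s ^ (n - 1 - 1)) * (1 - s) powr (- \<alpha>)
        + (s powr \<alpha> - s ^ (n - 1)) * (\<alpha> * (1 - s) powr (- \<alpha> - 1))) / \<alpha> = right_kernel \<alpha> s - left_kernel n \<alpha> s - b s"
      using s \<alpha> unfolding left_kernel_def right_kernel_def b_def e by (simp add: m field_simps)
    finally show "(F has_vector_derivative right_kernel \<alpha> s - left_kernel n \<alpha> s - b s) (at s)"
      by (simp add: has_real_derivative_iff_has_vector_derivative)
  qed (use F in auto)
  moreover have "(b has_integral (real n - 1) / \<alpha> * Beta (real n - 1) (1 - \<alpha>)) {0..1}"
    unfolding b_def using has_integral_Beta_real[of "real n - 1" "1 - \<alpha>"] \<alpha> n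
    by (intro has_integral_mult_right) auto
  ultimately have "((\<lambda>s. right_kernel \<alpha> s - left_kernel n \<alpha> s) has_integral
      (F 1 - F 0 + (real n - 1) / \<alpha> * Beta (real n - 1) (1 - \<alpha>))) {0..1}"
    by (auto dest: has_integral_add)
  also have "F 1 - F 0 + (real n - 1) / \<alpha> * Beta (real n - 1) (1 - \<alpha>) = kip_const n \<alpha> * Gamma (1 - \<alpha>) / \<alpha>"
  proof -
    have "fact (n - Suc 0) = (real n - 1) * Gamma (real n - 1)"
      using Gamma_plus1[of "real n - 1"] Gamma_fact[of "n - 1", where 'a=real] n
      by (auto simp: of_nat_diff nonpos_Ints_def)
    moreover have "F 1 - F 0 = 0" using n by (simp add: F_def power_0_left)
    moreover have "Gamma (real n - 1 + (1 - \<alpha>)) = Gamma (real n - \<alpha>)" by (simp add: algebra_simps)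
    ultimately show ?thesis
      by (simp add: Beta_def kip_const_def mult_ac)
  qed
  finally have "((\<lambda>s. right_kernel \<alpha> s - left_kernel n \<alpha> s) has_integral kip_const n \<alpha> * Gamma (1 - \<alpha>) / \<alpha>) UNIV"
    by (rule has_integral_on_superset) (auto simp: left_kernel_def right_kernel_def)
  then have "(\<integral>\<^sup>+s. ennreal (right_kernel \<alpha> s - left_kernel n \<alpha> s) \<partial>lborel) = ennreal (kip_const n \<alpha> * Gamma (1 - \<alpha>) / \<alpha>)"
    using left_kernel_le_right_kernel[OF \<alpha>(2), of n] by (intro nn_integral_has_integral_lborel) auto
  moreover have "kip_const n \<alpha> * Gamma (1 - \<alpha>) / \<alpha> \<ge> 0"
    using \<alpha> n by (auto simp: kip_const_def intro!: divide_nonneg_nonneg mult_nonneg_nonneg Gamma_real_nonneg)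
  ultimately show ?thesis
    using left_kernel_le_right_kernel[OF \<alpha>(2), of n] by (intro has_bochner_integral_nn_integral) auto
qed

text \<open>With v = s / (1-s) the measure q(s) ds becomes v^(\<alpha>-1) dv, whence the
  antiderivative v^\<alpha> / \<alpha>.\<close>

lemma nn_integral_right_kernel:
  assumes "0 < \<alpha>" "0 \<le> a" "a \<le> b" "b < 1"
  shows "(\<integral>\<^sup>+s. ennreal (indicator {a<..<b} s * right_kernel \<alpha> s) \<partial>lborel)
    = ennreal (((b / (1 - b)) powr \<alpha> - (a / (1 - a)) powr \<alpha>) / \<alpha>)"
proof -
  have "(\<integral>\<^sup>+s. ennreal (indicator {a<..<b} s * right_kernel \<alpha> s) \<partial>lborel)
    = ennreal ((b / (1 - b)) powr \<alpha> / \<alpha> - (a / (1 - a)) powr \<alpha> / \<alpha>)"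
  proof (rule nn_integral_FTC_interior)
    show "continuous_on {a..b} (\<lambda>s. (s / (1 - s)) powr \<alpha> / \<alpha>)"
      using assms by (intro continuous_on_divide continuous_on_powr' continuous_intros) auto
    fix s assume s: "a < s" "s < b"
    have "((\<lambda>s. s / (1 - s)) has_real_derivative 1 / (1 - s)\<^sup>2) (at s)"
      using s assms by (auto intro!: derivative_eq_intros simp: power2_eq_square)
    from DERIV_cdivide[OF DERIV_fun_powr[OF this, of \<alpha>], of \<alpha>]
    have "((\<lambda>s. (s / (1 - s)) powr \<alpha> / \<alpha>) has_real_derivative
        (s / (1 - s)) powr (\<alpha> - 1) * (1 / (1 - s)\<^sup>2)) (at s)"
      using s assms by simp
    also have "(s / (1 - s)) powr (\<alpha> - 1) * (1 / (1 - s)\<^sup>2)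
        = s powr (\<alpha> - 1) * ((1 - s) powr (- (\<alpha> - 1)) * (1 - s) powr (- 2))"
      using s assms by (simp add: powr_divide powr_minus_divide[of _ "\<alpha> - 1"] powr_minus_divide[of _ 2] del: minus_diff_eq)
    also have "\<dots> = right_kernel \<alpha> s"
      using s assms unfolding powr_add[symmetric] by (simp add: right_kernel_def minus_diff_commute)
    finally show "((\<lambda>s. (s / (1 - s)) powr \<alpha> / \<alpha>) has_real_derivative right_kernel \<alpha> s) (at s)" .
  qed (use assms kernels_nonneg in auto)
  then show ?thesis by (simp add: diff_divide_distrib)
qed

text \<open>In the variable v = s / (1-s) the integrand is v^(\<alpha>-\<kappa>-1) dv, which is
  integrable at infinity, that is at s = 1, because \<kappa> > \<alpha>. This is how Hoelder
  continuity of \<rho> compensates the singularity of q.\<close>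

lemma nn_integral_right_kernel_weighted:
  assumes "0 < a" "a < 1" "\<alpha> < \<kappa>"
  shows "(\<integral>\<^sup>+s. ennreal (indicator {a<..<1} s * (right_kernel \<alpha> s * ((1 - s) / s) powr \<kappa>)) \<partial>lborel)
    = ennreal (((1 - a) / a) powr (\<kappa> - \<alpha>) / (\<kappa> - \<alpha>))"
proof -
  have "(\<integral>\<^sup>+s. ennreal (indicator {a<..<1} s * (right_kernel \<alpha> s * ((1 - s) / s) powr \<kappa>)) \<partial>lborel)
    = ennreal (- (((1 - 1) / 1) powr (\<kappa> - \<alpha>) / (\<kappa> - \<alpha>)) - - (((1 - a) / a) powr (\<kappa> - \<alpha>) / (\<kappa> - \<alpha>)))"
  proof (rule nn_integral_FTC_interior)
    show "continuous_on {a..1} (\<lambda>s. - (((1 - s) / s) powr (\<kappa> - \<alpha>) / (\<kappa> - \<alpha>)))"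
      using assms by (intro continuous_on_minus continuous_on_divide continuous_on_powr' continuous_intros) auto
    fix s assume s: "a < s" "s < 1"
    have "((\<lambda>s. (1 - s) / s) has_real_derivative - (1 / s\<^sup>2)) (at s)"
      using s assms by (auto intro!: derivative_eq_intros simp: power2_eq_square field_simps)
    from DERIV_minus[OF DERIV_cdivide[OF DERIV_fun_powr[OF this, of "\<kappa> - \<alpha>"], of "\<kappa> - \<alpha>"]]
    have "((\<lambda>s. - (((1 - s) / s) powr (\<kappa> - \<alpha>) / (\<kappa> - \<alpha>))) has_real_derivative
        ((1 - s) / s) powr (\<kappa> - \<alpha> - 1) * (1 / s\<^sup>2)) (at s)"
      using s assms by simp
    also have "((1 - s) / s) powr (\<kappa> - \<alpha> - 1) * (1 / s\<^sup>2)
        = ((1 - s) / s) powr \<kappa> * (((1 - s) / s) powr (- \<alpha> - 1) * s powr (- 2))"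
      using s assms by (simp add: powr_minus_divide[of _ 2] mult.assoc[symmetric] powr_add[symmetric])
        (simp add: algebra_simps)
    also have "((1 - s) / s) powr (- \<alpha> - 1) * s powr (- 2) = (1 - s) powr (- \<alpha> - 1) * (s powr (- (- \<alpha> - 1)) * s powr (- 2))"
      using s assms by (simp add: powr_divide powr_minus_divide[of _ "- \<alpha> - 1"] del: minus_diff_eq)
    also have "\<dots> = right_kernel \<alpha> s"
      using s assms unfolding powr_add[symmetric] by (simp add: right_kernel_def minus_diff_commute)
    also have "((1 - s) / s) powr \<kappa> * right_kernel \<alpha> s = right_kernel \<alpha> s * ((1 - s) / s) powr \<kappa>"
      by simp
    finally show "((\<lambda>s. - (((1 - s) / s) powr (\<kappa> - \<alpha>) / (\<kappa> - \<alpha>))) has_real_derivative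
      right_kernel \<alpha> s * ((1 - s) / s) powr \<kappa>) (at s)" .
  qed (use assms kernels_nonneg in auto)
  then show ?thesis by simp
qed

subsection \<open>Mollification and weak derivatives\<close>

lemma differentiable_imp_continuous_UNIV:
  "(\<And>x. f differentiable at x) \<Longrightarrow> continuous_on UNIV f"
  by (rule differentiable_imp_continuous_on) (simp add: differentiable_on_def)

lemma C_k_continuous:
  assumes "C_k k f"
  shows "continuous_on UNIV f"
proof (cases k)
  case (Suc m)
  show ?thesis
    by (rule differentiable_imp_continuous_UNIV) (use assms Suc in simp)
qed (use assms in simp)

lemma C_k_mono: "C_k (Suc k) f \<Longrightarrow> C_k k f"
proof (induction k arbitrary: f)
  case 0
  from C_k_continuous[OF this] show ?case by simp
qed simp

lemma partial_eqI:
  "(f has_derivative D) (at x) \<Longrightarrow> partial i f x = D (axis i 1)"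
  unfolding partial_def by (metis frechet_derivative_at)

lemma differentiable_has_derivative:
  "f differentiable at x \<Longrightarrow> (f has_derivative frechet_derivative f (at x)) (at x)"
  by (simp add: frechet_derivative_works)

lemma frechet_derivative_partial:
  fixes f :: "real^'n \<Rightarrow> complex"
  assumes "f differentiable at x"
  shows "frechet_derivative f (at x) h = (\<Sum>i\<in>UNIV. (h $ i) *\<^sub>R partial i f x)"
proof -
  interpret linear "frechet_derivative f (at x)" using assms by (rule linear_frechet_derivative)
  have "frechet_derivative f (at x) (\<Sum>i\<in>UNIV. (h $ i) *\<^sub>R axis i 1) = (\<Sum>i\<in>UNIV. (h $ i) *\<^sub>R partial i f x)"
    by (simp add: sum scaleR partial_def)
  moreover have "(\<Sum>i\<in>UNIV. (h $ i) *\<^sub>R axis i 1) = h"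
    using basis_expansion[of h] by (simp add: scalar_mult_eq_scaleR)
  ultimately show ?thesis by simp
qed

lemma partial_mult:
  fixes f g :: "real^'n \<Rightarrow> complex"
  assumes "f differentiable at x" "g differentiable at x"
  shows "partial i (\<lambda>x. f x * g x) x = f x * partial i g x + partial i f x * g x"
  using partial_eqI[OF has_derivative_mult[OF assms[THEN differentiable_has_derivative]]]
  by (simp add: partial_def)

lemma partial_add:
  fixes f g :: "real^'n \<Rightarrow> complex"
  assumes "f differentiable at x" "g differentiable at x"
  shows "partial i (\<lambda>x. f x + g x) x = partial i f x + partial i g x"
  using partial_eqI[OF has_derivative_add[OF assms[THEN differentiable_has_derivative]]]
  by (simp add: partial_def)

lemma partial_cnj:
  fixes f :: "real^'n \<Rightarrow> complex"
  assumes "f differentiable at x"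
  shows "(\<lambda>x. cnj (f x)) differentiable at x" "partial i (\<lambda>x. cnj (f x)) x = cnj (partial i f x)"
proof -
  note * = bounded_linear.has_derivative[OF bounded_linear_cnj differentiable_has_derivative[OF assms]]
  show "(\<lambda>x. cnj (f x)) differentiable at x" using * by (auto simp: differentiable_def)
  show "partial i (\<lambda>x. cnj (f x)) x = cnj (partial i f x)"
    using partial_eqI[OF *] by (simp add: partial_def)
qed

lemma partial_affine:
  fixes f :: "real^'n \<Rightarrow> complex"
  assumes "\<And>x. f differentiable at x"
  shows "(\<lambda>x. f (b + c *\<^sub>R x)) differentiable at x"
    "partial i (\<lambda>x. f (b + c *\<^sub>R x)) x = of_real c * partial i f (b + c *\<^sub>R x)"
proof -
  interpret linear "frechet_derivative f (at (b + c *\<^sub>R x))" using assms by (rule linear_frechet_derivative)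
  have "((\<lambda>x. b + c *\<^sub>R x) has_derivative (\<lambda>h. c *\<^sub>R h)) (at x)"
    by (auto intro!: derivative_eq_intros)
  from has_derivative_compose[OF this differentiable_has_derivative[OF assms]]
  have *: "((\<lambda>x. f (b + c *\<^sub>R x)) has_derivative (\<lambda>h. frechet_derivative f (at (b + c *\<^sub>R x)) (c *\<^sub>R h))) (at x)" .
  show "(\<lambda>x. f (b + c *\<^sub>R x)) differentiable at x" using * by (auto simp: differentiable_def)
  show "partial i (\<lambda>x. f (b + c *\<^sub>R x)) x = of_real c * partial i f (b + c *\<^sub>R x)"
    using partial_eqI[OF *] by (simp add: partial_def scaleR) (simp add: scaleR_conv_of_real)
qed

lemma partial_const: "partial i (\<lambda>x. c) = (\<lambda>x. 0)"
  by (simp add: fun_eq_iff partial_eqI[OF has_derivative_const])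

lemma C_k_const: "C_k k (\<lambda>x. c)"
  by (induction k arbitrary: c) (auto simp: partial_const)

lemma C_k_add: "C_k k f \<Longrightarrow> C_k k g \<Longrightarrow> C_k k (\<lambda>x. f x + g x)"
proof (induction k arbitrary: f g)
  case (Suc k)
  have "partial i (\<lambda>x. f x + g x) = (\<lambda>x. partial i f x + partial i g x)" for i
    using Suc.prems by (simp add: fun_eq_iff partial_add)
  then show ?case using Suc by simp
qed (auto intro: continuous_intros)

lemma C_k_mult: "C_k k f \<Longrightarrow> C_k k g \<Longrightarrow> C_k k (\<lambda>x. f x * g x)"
proof (induction k arbitrary: f g)
  case (Suc k)
  have "partial i (\<lambda>x. f x * g x) = (\<lambda>x. f x * partial i g x + partial i f x * g x)" for i
    using Suc.prems by (simp add: fun_eq_iff partial_mult)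
  moreover have "C_k k (\<lambda>x. f x * partial i g x + partial i f x * g x)" for i
    using Suc.prems C_k_mono[OF Suc.prems(1)] C_k_mono[OF Suc.prems(2)]
    by (intro C_k_add Suc.IH) auto
  ultimately show ?case using Suc.prems by simp
qed (auto intro: continuous_intros)

lemma C_k_cnj: "C_k k f \<Longrightarrow> C_k k (\<lambda>x. cnj (f x))"
proof (induction k arbitrary: f)
  case (Suc k)
  have "partial i (\<lambda>x. cnj (f x)) = (\<lambda>x. cnj (partial i f x))" for i
    using Suc.prems by (simp add: fun_eq_iff partial_cnj)
  then show ?case using Suc by (simp add: partial_cnj)
qed (auto intro: continuous_intros)

lemma C_k_affine: "C_k k f \<Longrightarrow> C_k k (\<lambda>x. f (b + c *\<^sub>R x))"
proof (induction k arbitrary: f)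
  case 0
  then show ?case by (auto intro!: continuous_on_compose2[of UNIV f] continuous_intros)
next
  case (Suc k)
  have "partial i (\<lambda>x. f (b + c *\<^sub>R x)) = (\<lambda>x. of_real c * partial i f (b + c *\<^sub>R x))" for i
    using Suc.prems by (simp add: fun_eq_iff partial_affine)
  moreover have "C_k k (\<lambda>x. of_real c * partial i f (b + c *\<^sub>R x))" for i
    using Suc.prems by (intro C_k_mult C_k_const Suc.IH) auto
  ultimately show ?case using Suc.prems by (simp add: partial_affine)
qed

lemma partial_eq_0:
  fixes f :: "real^'n \<Rightarrow> complex"
  assumes "open U" "x \<in> U" "\<And>y. y \<in> U \<Longrightarrow> f y = 0"
  shows "f differentiable at x" "partial i f x = 0"
proof -
  have *: "(f has_derivative (\<lambda>h. 0)) (at x)"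
    using assms by (intro has_derivative_transform_within_open[OF has_derivative_const assms(1,2)]) auto
  show "f differentiable at x" using * by (auto simp: differentiable_def)
  show "partial i f x = 0" using partial_eqI[OF *] by simp
qed

section \<open>Convolution and mollification\<close>

text \<open>Expresses an integral over the whole space as one over a fixed box, the form in which
  differentiation under the integral sign is applied to convolutions.\<close>

lemma integrable_continuous_cbox_support:
  fixes h :: "real^'n \<Rightarrow> complex"
  assumes h: "continuous_on UNIV h" "\<And>y. y \<notin> cbox a b \<Longrightarrow> h y = 0"
  shows "integrable lborel h" "(LINT y|lborel. h y) = integral (cbox a b) h"
proof -
  have eq: "(\<lambda>x. indicator (cbox a b) x *\<^sub>R h x) = h"
    using h(2) by (auto simp: indicator_def fun_eq_iff)
  have "integrable lborel (\<lambda>x. indicator (cbox a b) x *\<^sub>R h x)"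
    by (rule borel_integrable_compact) (auto intro: continuous_on_subset[OF h(1)])
  then show i: "integrable lborel h" unfolding eq .
  have "(LINT y|lborel. h y) = integral UNIV h"
    using integral_lborel[OF i] by simp
  also have "\<dots> = integral UNIV (\<lambda>y. if y \<in> cbox a b then h y else 0)"
    using h(2) by (intro integral_cong) auto
  also have "\<dots> = integral (cbox a b) h" by (rule integral_restrict_UNIV)
  finally show "(LINT y|lborel. h y) = integral (cbox a b) h" .
qed

definition convolution :: "(real^'n \<Rightarrow> complex) \<Rightarrow> (real^'n \<Rightarrow> complex) \<Rightarrow> real^'n \<Rightarrow> complex" where
  "convolution g \<eta> x = (LINT y|lborel. g y * \<eta> (x - y))"

text \<open>The derivative falls on \<eta>, so that g has to be continuous only. The derivative in x
  is packed into the bounded linear maps \<open>fx x t\<close>; their joint continuity in x and t is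
  tested on the coordinate axes, where they are g(t) times a partial derivative of \<eta>.\<close>

lemma convolution_partial:
  fixes g \<eta> :: "real^'n \<Rightarrow> complex"
  assumes g: "continuous_on UNIV g" "\<And>y. y \<notin> cbox a b \<Longrightarrow> g y = 0" and \<eta>: "C_k 1 \<eta>"
  shows "convolution g \<eta> differentiable at x" "partial i (convolution g \<eta>) x = convolution g (partial i \<eta>) x"
proof -
  have dif: "\<eta> differentiable at x" and con: "continuous_on UNIV (partial i \<eta>)" for x i using \<eta> by auto
  have \<eta>c: "continuous_on UNIV \<eta>" using \<eta> by (rule C_k_continuous)
  note [continuous_intros] = continuous_on_compose2[OF g(1)] continuous_on_compose2[OF \<eta>c] continuous_on_compose2[OF con]
  have conv: "convolution g h x = integral (cbox a b) (\<lambda>y. g y * h (x - y))" if h: "continuous_on UNIV h" for h x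
    unfolding convolution_def using g(2)
    by (intro integrable_continuous_cbox_support(2) continuous_intros g(1) continuous_on_compose2[OF h]) auto
  define fx where "fx x t = Blinfun (\<lambda>h. g t * frechet_derivative \<eta> (at (x - t)) h)" for x t
  have fx: "blinfun_apply (fx x t) = (\<lambda>h. g t * frechet_derivative \<eta> (at (x - t)) h)" for x t
  proof -
    have "bounded_linear (frechet_derivative \<eta> (at (x - t)))"
      using dif by (intro has_derivative_bounded_linear[OF differentiable_has_derivative])
    then show ?thesis
      unfolding fx_def by (intro bounded_linear_Blinfun_apply bounded_linear_const_mult)
  qed
  have fx_axis: "blinfun_apply (fx x t) (axis i 1) = g t * partial i \<eta> (x - t)" for x t i
    by (simp add: fx partial_def)
  have cont_fx: "continuous_on (UNIV \<times> cbox a b) (\<lambda>(x, t). fx x t)"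
  proof (rule continuous_on_blinfun_componentwise)
    fix e :: "real^'n" assume "e \<in> Basis"
    then obtain i where e: "e = axis i 1" by (auto simp: Basis_vec_def)
    show "continuous_on (UNIV \<times> cbox a b) (\<lambda>p. blinfun_apply (case p of (x, t) \<Rightarrow> fx x t) e)"
      unfolding e split_beta fx_axis by (intro continuous_intros) auto
  qed
  have "((\<lambda>x. integral (cbox a b) (\<lambda>t. g t * \<eta> (x - t))) has_derivative integral (cbox a b) (fx x)) (at x within UNIV)"
  proof (rule leibniz_rule)
    fix x t :: "real^'n"
    have "((\<lambda>x. x - t) has_derivative (\<lambda>h. h)) (at x)" by (auto intro!: derivative_eq_intros)
    from has_derivative_compose[OF this differentiable_has_derivative[OF dif[of "x - t"]]]
    show "((\<lambda>x. g t * \<eta> (x - t)) has_derivative blinfun_apply (fx x t)) (at x within UNIV)"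
      unfolding fx by (intro has_derivative_mult_right) simp
  next
    fix x show "(\<lambda>t. g t * \<eta> (x - t)) integrable_on cbox a b"
      by (intro integrable_continuous continuous_intros) auto
  qed (use cont_fx in auto)
  then have *: "(convolution g \<eta> has_derivative blinfun_apply (integral (cbox a b) (fx x))) (at x)"
    by (simp add: conv[OF \<eta>c, abs_def])
  then show "convolution g \<eta> differentiable at x" by (auto simp: differentiable_def)
  have "continuous_on (cbox a b) (\<lambda>t. case (x, t) of (x, t) \<Rightarrow> fx x t)"
    by (rule continuous_on_compose2[OF cont_fx]) (auto intro!: continuous_intros)
  then have "fx x integrable_on cbox a b"
    by (intro integrable_continuous) simp
  then show "partial i (convolution g \<eta>) x = convolution g (partial i \<eta>) x"
    using partial_eqI[OF *] by (simp add: blinfun_apply_integral fx_axis conv[OF con])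
qed

text \<open>The induction is generalised over \<eta>: a derivative of the convolution is the
  convolution with a derivative of \<eta>, which again belongs to every class
  \<open>C_k\<close>.\<close>

lemma C_k_convolution:
  assumes g: "continuous_on UNIV g" "\<And>y. y \<notin> cbox a b \<Longrightarrow> g y = 0"
  shows "(\<And>k. C_k k \<eta>) \<Longrightarrow> C_k k (convolution g \<eta>)"
proof (induction k arbitrary: \<eta>)
  case 0
  then show ?case
    using convolution_partial(1)[OF g 0[of 1]]
    by (auto intro: differentiable_imp_continuous_UNIV)
next
  case (Suc k)
  have "C_k k' (partial i \<eta>)" for k' i using Suc.prems[of "Suc k'"] by simp
  moreover have "partial i (convolution g \<eta>) = convolution g (partial i \<eta>)" for i
    by (rule ext) (rule convolution_partial(2)[OF g Suc.prems])
  ultimately show ?case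
    using convolution_partial(1)[OF g Suc.prems] Suc.IH by simp
qed

lemma integral_reflect:
  fixes F :: "'a::euclidean_space \<Rightarrow> complex"
  assumes [measurable]: "F \<in> borel_measurable borel"
  shows "(LINT y|lborel. F (x - y)) = (LINT y|lborel. F y)"
  by (subst (2) lborel_affine[of "-1" x]) (auto simp: density_1 integral_distr)

lemma convolution_commute:
  assumes "continuous_on UNIV g" "continuous_on UNIV \<eta>"
  shows "convolution g \<eta> x = convolution \<eta> g x"
proof -
  have [measurable]: "g \<in> borel_measurable borel" "\<eta> \<in> borel_measurable borel"
    using assms by (auto intro: borel_measurable_continuous_onI)
  have "convolution g \<eta> x = (LINT y|lborel. (\<lambda>z. \<eta> z * g (x - z)) (x - y))"
    by (simp add: convolution_def mult.commute)
  also have "\<dots> = convolution \<eta> g x"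
    unfolding convolution_def by (rule integral_reflect) measurable
  finally show ?thesis .
qed

lemma uniformly_continuous_compact_support:
  fixes g :: "real^'n \<Rightarrow> complex"
  assumes g: "continuous_on UNIV g" "\<And>y. y \<notin> K \<Longrightarrow> g y = 0" and K: "bounded K" and e: "e > 0"
  obtains d where "d > 0" "\<And>x y. dist x y < d \<Longrightarrow> cmod (g x - g y) < e"
proof -
  obtain R where R: "K \<subseteq> ball 0 R" using K bounded_subset_ballD by blast
  have "uniformly_continuous_on (cball 0 (R + 1)) g"
    by (intro compact_uniformly_continuous continuous_on_subset[OF g(1)]) auto
  then obtain d where d: "d > 0" "\<And>x y. x \<in> cball 0 (R + 1) \<Longrightarrow> y \<in> cball 0 (R + 1) \<Longrightarrow> dist y x < d \<Longrightarrow> dist (g y) (g x) < e"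
    unfolding uniformly_continuous_on_def using e by meson
  show ?thesis
  proof (rule that[of "min d 1"])
    fix x y :: "real^'n" assume xy: "dist x y < min d 1"
    show "cmod (g x - g y) < e"
    proof (cases "x \<in> cball 0 (R + 1) \<and> y \<in> cball 0 (R + 1)")
      case True
      with d(2)[of y x] xy show ?thesis by (simp add: dist_norm)
    next
      \<comment> \<open>If one of the points lies outside the ball of radius R + 1 and their
        distance is below 1, both lie outside the ball of radius R, where g vanishes.\<close>
      case False
      have "norm x \<le> norm y + dist x y" "norm y \<le> norm x + dist x y"
        unfolding dist_norm by norm+
      with False xy have "norm x > R \<and> norm y > R" by auto
      then have "x \<notin> K" "y \<notin> K" using R by auto
      then show ?thesis using g(2) e by simp
    qed
  qed (use d in auto)
qed

text \<open>If the integral were 0, the set where f does not vanish would be a nonempty open null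
  set. The lemma is what makes the normalisation of the mollifier possible.\<close>

lemma norm_sq_integral_pos:
  fixes f :: "real^'n \<Rightarrow> complex"
  assumes f: "continuous_on UNIV f" and supp: "\<And>y. y \<notin> cbox a b \<Longrightarrow> f y = 0" and x: "f x \<noteq> 0"
  shows "(LINT y|lborel. (cmod (f y))\<^sup>2) > 0"
proof -
  have cont: "continuous_on UNIV (\<lambda>y. complex_of_real ((cmod (f y))\<^sup>2))"
    by (intro continuous_intros f)
  have i: "integrable lborel (\<lambda>y. (cmod (f y))\<^sup>2)"
    using integrable_norm[OF integrable_continuous_cbox_support(1)[OF cont, of a b]] supp by (auto simp: norm_power)
  have "(LINT y|lborel. (cmod (f y))\<^sup>2) \<noteq> 0"
  proof
    assume "(LINT y|lborel. (cmod (f y))\<^sup>2) = 0"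
    then have "AE y in lborel. (cmod (f y))\<^sup>2 = 0"
      using integral_nonneg_eq_0_iff_AE[OF i] by simp
    then have "AE y in lebesgue. f y = 0"
      by (auto intro: AE_completion)
    then have "negligible {y. f y \<noteq> 0}"
      by (auto simp: negligible_iff_null_sets AE_iff_null_sets[symmetric] eventually_ae_filter
          elim: null_sets_completion_subset)
    moreover have "open {y. f y \<noteq> 0}"
      using open_Collect_neq[OF f continuous_on_const] .
    ultimately show False using open_not_negligible x by blast
  qed
  moreover have "(LINT y|lborel. (cmod (f y))\<^sup>2) \<ge> 0" by (intro integral_nonneg_AE) auto
  ultimately show ?thesis by linarith
qed

text \<open>The squared modulus of any nonzero test function, rescaled, serves as mollifier; this avoids the
  construction of an explicit bump function.\<close>

lemma smooth_kernel:
  fixes \<phi> :: "real^'n \<Rightarrow> complex"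
  assumes \<phi>: "test_function \<Omega> \<phi>" "\<phi> x0 \<noteq> 0" and d: "d > 0"
  shows "\<exists>k :: real^'n \<Rightarrow> complex. (\<forall>j. C_k j k) \<and> (\<forall>x. complex_of_real (cmod (k x)) = k x) \<and>
    (\<forall>x. norm x > d \<longrightarrow> k x = 0) \<and> (LINT x|lborel. k x) = 1"
proof -
  obtain R where R: "R > 0" "{x. \<phi> x \<noteq> 0} \<subseteq> ball x0 R"
  proof -
    have "bounded {x. \<phi> x \<noteq> 0}"
      using \<phi>(1) by (auto simp: test_function_def intro: bounded_subset[OF compact_imp_bounded closure_subset])
    then show ?thesis using bounded_subset_ballD that by blast
  qed
  define \<psi> where "\<psi> x = \<phi> (x0 + (R / d) *\<^sub>R x)" for x
  have \<psi>C: "C_k j \<psi>" for j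
    unfolding \<psi>_def using \<phi>(1) by (intro C_k_affine) (simp add: test_function_def)
  have \<psi>0: "\<psi> x = 0" if "norm x \<ge> d" for x
  proof (rule ccontr)
    assume "\<psi> x \<noteq> 0"
    then have "dist x0 (x0 + (R / d) *\<^sub>R x) < R" using R unfolding \<psi>_def by (auto simp: subset_iff)
    then have "R / d * norm x < R" using R d by (simp add: dist_norm)
    then have "norm x < d" using R d by (simp add: field_simps)
    with that show False by simp
  qed
  obtain a b where ab: "cball 0 d \<subseteq> cbox a (b :: real^'n)"
    using bounded_subset_cbox_symmetric[OF bounded_cball, of 0 d] by blast
  have supp: "\<psi> x = 0" if "x \<notin> cbox a b" for x
    using that ab by (intro \<psi>0) (auto simp: subset_iff dest!: spec[of _ x])
  define I where "I = (LINT y|lborel. (cmod (\<psi> y))\<^sup>2)"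
  have I: "I > 0" unfolding I_def
    by (rule norm_sq_integral_pos[where x=0 and a=a and b=b, OF C_k_continuous[OF \<psi>C[of 0]] supp])
      (auto simp: \<psi>_def \<phi>)
  define k where "k x = complex_of_real (1 / I) * (\<psi> x * cnj (\<psi> x))" for x
  have k_eq: "k x = complex_of_real ((cmod (\<psi> x))\<^sup>2 / I)" for x
    unfolding k_def complex_norm_square[symmetric] by simp
  show ?thesis
  proof (intro exI[of _ k] conjI allI impI)
    show "C_k j k" for j unfolding k_def by (intro C_k_mult C_k_const C_k_cnj \<psi>C)
    show "complex_of_real (cmod (k x)) = k x" for x unfolding k_eq using I by (simp add: norm_divide norm_power)
    show "k x = 0" if "norm x > d" for x using \<psi>0[of x] that by (simp add: k_eq)
    show "(LINT x|lborel. k x) = 1"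
      unfolding k_eq using I by (simp add: I_def[symmetric] del: of_real_divide of_real_power)
  qed
qed

text \<open>The condition on \<open>cmod (k x)\<close> says that k is real and nonnegative. As its
  integral is 1, the convolution averages values of g at distance at most d from x.\<close>

lemma convolution_close:
  fixes g k :: "real^'n \<Rightarrow> complex"
  assumes g: "continuous_on UNIV g" and k: "continuous_on UNIV k" "\<And>x. complex_of_real (cmod (k x)) = k x"
    "\<And>x. norm x > d \<Longrightarrow> k x = 0" "(LINT x|lborel. k x) = 1"
    and close: "\<And>x y. dist x y \<le> d \<Longrightarrow> cmod (g x - g y) \<le> e"
  shows "cmod (convolution g k x - g x) \<le> e"
proof -
  obtain a b where ab: "cball 0 d \<subseteq> cbox a (b :: real^'n)"
    using bounded_subset_cbox_symmetric[OF bounded_cball, of 0 d] by blast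
  have supp: "k y = 0" if "y \<notin> cbox a b" for y
    using that ab by (intro k(3)) (auto simp: subset_iff dest!: spec[of _ y])
  have ik: "integrable lborel k"
    by (rule integrable_continuous_cbox_support(1)[OF k(1) supp])
  have i1: "integrable lborel (\<lambda>y. k y * g (x - y))"
    by (rule integrable_continuous_cbox_support(1)[of _ a b])
      (use supp in \<open>auto intro!: continuous_intros k(1) continuous_on_compose2[OF g]\<close>)
  have "convolution g k x - g x = (LINT y|lborel. k y * g (x - y)) - (LINT y|lborel. k y * g x)"
    unfolding convolution_commute[OF g k(1)] using k(4) by (simp add: convolution_def)
  also have "\<dots> = (LINT y|lborel. k y * (g (x - y) - g x))"
    using i1 ik by (subst Bochner_Integration.integral_diff[symmetric]) (auto simp: algebra_simps)
  also have "cmod \<dots> \<le> (LINT y|lborel. cmod (k y) * e)"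
  proof (rule Bochner_Integration.integral_norm_bound_integral)
    show "integrable lborel (\<lambda>y. k y * (g (x - y) - g x))"
      using Bochner_Integration.integrable_diff[OF i1 integrable_mult_left[OF ik, of "g x"]] by (simp add: algebra_simps)
    show "integrable lborel (\<lambda>y. cmod (k y) * e)" using ik by (intro integrable_mult_left integrable_norm)
    show "norm (k y * (g (x - y) - g x)) \<le> cmod (k y) * e" for y
    proof (cases "norm y > d")
      case False
      then have "cmod (g (x - y) - g x) \<le> e" by (intro close) (simp add: dist_norm)
      then show ?thesis by (simp add: norm_mult mult_left_mono)
    qed (simp add: k(3))
  qed
  also have "\<dots> = (LINT y|lborel. cmod (k y)) * e" by simp
  also have "(LINT y|lborel. cmod (k y)) = 1"
  proof -
    have "complex_of_real (LINT y|lborel. cmod (k y)) = (LINT y|lborel. complex_of_real (cmod (k y)))"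
      by (rule integral_complex_of_real[symmetric])
    also have "\<dots> = 1" by (simp only: k(2) k(4))
    finally show ?thesis by (simp only: of_real_eq_1_iff)
  qed
  finally show ?thesis by simp
qed

text \<open>The function \<phi> is only the seed from which the mollifier is made, which is why its
  domain \<Omega>' is unrelated to \<Omega>. The compact set K' is chosen before e: later errors are
  bounded by e times an integral over K', and that integral must not depend on e. The implication
  from \<open>C_k 1 g\<close> lets one statement serve both continuous and continuously
  differentiable g.\<close>

lemma mollification:
  fixes g \<phi> :: "real^'n \<Rightarrow> complex"
  assumes \<phi>: "test_function \<Omega>' \<phi>" "\<phi> x0 \<noteq> 0" and \<Omega>: "open \<Omega>" and K: "compact K" "K \<subseteq> \<Omega>"
    and g: "continuous_on UNIV g" "\<And>x. x \<notin> K \<Longrightarrow> g x = 0"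
  obtains K' where "compact K'" "K' \<subseteq> \<Omega>" "K \<subseteq> K'"
    "\<And>e. e > 0 \<Longrightarrow> \<exists>G. test_function \<Omega> G \<and> (\<forall>x. x \<notin> K' \<longrightarrow> G x = 0) \<and> (\<forall>x. cmod (G x - g x) \<le> e) \<and>
      (C_k 1 g \<longrightarrow> (\<forall>i x. cmod (partial i G x - partial i g x) \<le> e))"
proof -
  obtain r where r: "r > 0" "(\<Union>x\<in>K. cball x r) \<subseteq> \<Omega>"
    using compact_subset_open_imp_cball_epsilon_subset[OF K(1) \<Omega> K(2)] by blast
  define K' where "K' = {x + y | x y. x \<in> K \<and> y \<in> cball 0 r}"
  have K': "compact K'" unfolding K'_def using K(1) by (intro compact_sums) auto
  have K'sub: "K' \<subseteq> \<Omega>"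
  proof -
    have "x + y \<in> cball x r" if "y \<in> cball 0 r" for x y :: "real^'n" using that by (simp add: dist_norm)
    with r(2) show ?thesis unfolding K'_def by blast
  qed
  have KK': "K \<subseteq> K'" unfolding K'_def using r(1) by force
  have bK: "bounded K" using K(1) by (rule compact_imp_bounded)
  obtain a b where ab: "K \<subseteq> cbox a b" using bounded_subset_cbox_symmetric[OF bK] by blast
  have gab: "g y = 0" if "y \<notin> cbox a b" for y using that ab g(2) by blast
  show ?thesis
  proof (rule that[OF K' K'sub KK'])
    fix e :: real assume e: "e > 0"
    \<comment> \<open>\<open>None\<close> stands for g itself and \<open>Some i\<close> for its i-th
      partial derivative, so that a single radius can be chosen for all of them.\<close>
    let ?F = "\<lambda>j. if j = None then g else partial (the j) g"
    have dex: "\<exists>d>0. \<forall>x y. dist x y < d \<longrightarrow> cmod (?F j x - ?F j y) < e" if j: "j = None \<or> C_k 1 g" for j :: "'n option"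
    proof -
      have 1: "continuous_on UNIV (?F j)" using g j by (cases j) auto
      have 2: "?F j y = 0" if "y \<notin> K" for y
      proof (cases j)
        case (Some i)
        have "partial i g y = 0"
          using that g(2) K(1) by (intro partial_eq_0(2)[of "- K"]) (auto simp: compact_imp_closed open_Compl)
        then show ?thesis using Some by simp
      qed (use g that in simp)
      obtain d where "d > 0" "\<And>x y. dist x y < d \<Longrightarrow> cmod (?F j x - ?F j y) < e"
        by (rule uniformly_continuous_compact_support[OF 1 2 bK e]) auto
      then show ?thesis by blast
    qed
    define J :: "'n option set" where "J = {j. j = None \<or> C_k 1 g}"
    have "\<forall>j\<in>J. \<exists>d>0. \<forall>x y. dist x y < d \<longrightarrow> cmod (?F j x - ?F j y) < e"
      using dex unfolding J_def by blast
    from bchoice[OF this] obtain d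
      where d: "\<And>j. j \<in> J \<Longrightarrow> d j > 0 \<and> (\<forall>x y. dist x y < d j \<longrightarrow> cmod (?F j x - ?F j y) < e)"
      by blast
    \<comment> \<open>The bound by r keeps the support of the mollified function in K'. Halving the
      minimum makes d0 strictly smaller than each \<open>d j\<close>, as needed for points at
      distance exactly d0.\<close>
    define d0 where "d0 = min r (Min (d ` J) / 2)"
    have J: "finite J" "J \<noteq> {}" by (simp_all add: J_def ex_in_conv[symmetric] exI[of _ None])
    have "Min (d ` J) > 0" using J d by (subst Min_gr_iff) auto
    then have d0: "d0 > 0" "d0 \<le> r" using r by (auto simp: d0_def)
    have d0J: "d0 < d j" if "j \<in> J" for j
    proof -
      have "Min (d ` J) \<le> d j" using J that by simp
      then show ?thesis using \<open>Min (d ` J) > 0\<close> by (auto simp: d0_def min_def)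
    qed
    obtain k :: "real^'n \<Rightarrow> complex" where "(\<forall>j. C_k j k) \<and> (\<forall>x. complex_of_real (cmod (k x)) = k x) \<and>
        (\<forall>x. norm x > d0 \<longrightarrow> k x = 0) \<and> (LINT x|lborel. k x) = 1"
      using smooth_kernel[OF \<phi> d0(1)] by (rule exE)
    then have k: "\<And>j. C_k j k" "\<And>x. complex_of_real (cmod (k x)) = k x"
      "\<And>x. norm x > d0 \<Longrightarrow> k x = 0" "(LINT x|lborel. k x) = 1"
      by auto
    have kc: "continuous_on UNIV k" using k(1) by (rule C_k_continuous)
    obtain a' b' where ab': "cball 0 d0 \<subseteq> cbox a' (b' :: real^'n)"
      using bounded_subset_cbox_symmetric[OF bounded_cball, of 0 d0] by blast
    have kab: "k y = 0" if "y \<notin> cbox a' b'" for y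
      using that ab' by (intro k(3)) (auto simp: subset_iff dest!: spec[of _ y])
    define G where "G = convolution g k"
    have G0: "G x = 0" if "x \<notin> K'" for x
    proof -
      have "g y * k (x - y) = 0" for y
      proof (cases "y \<in> K")
        case True
        have "norm (x - y) > d0"
        proof (rule ccontr)
          assume "\<not> norm (x - y) > d0"
          then have "x = y + (x - y) \<and> y \<in> K \<and> x - y \<in> cball 0 r" using True d0 by auto
          with that show False unfolding K'_def by blast
        qed
        then show ?thesis by (simp add: k(3))
      qed (simp add: g(2))
      then show ?thesis by (simp only: G_def convolution_def) simp
    qed
    have close: "cmod (convolution (?F j) k x - ?F j x) \<le> e" if j: "j \<in> J" for j x
    proof (rule convolution_close[OF _ kc k(2-4)])
      show "continuous_on UNIV (?F j)" using g j by (cases j) (auto simp: J_def)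
      show "cmod (?F j x - ?F j y) \<le> e" if "dist x y \<le> d0" for x y
        using d[OF j] d0J[OF j] that by (auto intro: less_imp_le)
    qed
    show "\<exists>G. test_function \<Omega> G \<and> (\<forall>x. x \<notin> K' \<longrightarrow> G x = 0) \<and> (\<forall>x. cmod (G x - g x) \<le> e) \<and>
      (C_k 1 g \<longrightarrow> (\<forall>i x. cmod (partial i G x - partial i g x) \<le> e))"
    proof (intro exI conjI allI impI)
      have sub: "closure {x. G x \<noteq> 0} \<subseteq> K'"
        using G0 K' by (intro closure_minimal) (auto simp: compact_imp_closed)
      have "compact (closure {x. G x \<noteq> 0})"
        using compact_Int_closed[OF K' closed_closure, of "{x. G x \<noteq> 0}"] sub by (simp add: Int_absorb1)
      moreover have "C_k j G" for j unfolding G_def by (rule C_k_convolution[OF g(1) gab k(1)])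
      ultimately show "test_function \<Omega> G"
        using sub K'sub by (auto simp: test_function_def)
      show "G x = 0" if "x \<notin> K'" for x using G0 that .
      show "cmod (G x - g x) \<le> e" for x using close[of None x] by (simp add: J_def G_def)
      show "cmod (partial i G x - partial i g x) \<le> e" if C: "C_k 1 g" for i x
      proof -
        have pc: "continuous_on UNIV (partial i g)" using C by simp
        \<comment> \<open>After exchanging the factors, k plays the part of the compactly supported
          continuous factor and the derivative falls on g.\<close>
        have "G = convolution k g" unfolding G_def by (rule ext) (rule convolution_commute[OF g(1) kc])
        then have "partial i G x = convolution k (partial i g) x"
          using convolution_partial(2)[OF kc kab C] by simp
        also have "\<dots> = convolution (partial i g) k x" by (rule convolution_commute[OF kc pc])
        finally show ?thesis using close[of "Some i" x] C by (simp add: J_def)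
      qed
    qed
  qed
qed

section \<open>Weak derivatives tested with functions of low regularity\<close>

lemma integrable_locally_mult:
  fixes h v :: "real^'n \<Rightarrow> complex"
  assumes \<Omega>: "open \<Omega>" and v: "locally_integrable \<Omega> v" and K: "compact K" "K \<subseteq> \<Omega>"
    and h: "continuous_on K h" "\<And>x. x \<in> \<Omega> \<Longrightarrow> x \<notin> K \<Longrightarrow> h x = 0"
  shows "integrable (lebesgue_on \<Omega>) (\<lambda>x. v x * h x)"
    and "(\<And>x. x \<in> K \<Longrightarrow> cmod (h x) \<le> e) \<Longrightarrow>
      cmod (LINT x|lebesgue_on \<Omega>. v x * h x) \<le> e * (LINT x|lebesgue_on K. cmod (v x))"
proof -
  have [measurable]: "K \<in> sets lebesgue" "\<Omega> \<in> sets lebesgue"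
    using fmeasurableD[OF lmeasurable_compact[OF K(1)]] \<Omega> by auto
  have vK: "integrable (lebesgue_on K) v" using v K by (auto simp: locally_integrable_def)
  have hm: "h \<in> borel_measurable (lebesgue_on K)"
    using h(1) by (rule continuous_imp_measurable_on_sets_lebesgue) auto
  have vm: "v \<in> borel_measurable (lebesgue_on K)" using vK by auto
  have eq: "indicator \<Omega> x *\<^sub>R (v x * h x) = indicator K x *\<^sub>R (v x * h x)" for x
    using K(2) h(2)[of x] by (auto simp: indicator_def)
  have bnd: "integrable (lebesgue_on K) (\<lambda>x. v x * h x)"
    "(LINT x|lebesgue_on K. cmod (v x * h x)) \<le> c * (LINT x|lebesgue_on K. cmod (v x))"
    if c: "\<And>x. x \<in> K \<Longrightarrow> cmod (h x) \<le> c" for c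
  proof -
    have le: "cmod (v x * h x) \<le> c * cmod (v x)" if "x \<in> K" for x
      using mult_right_mono[OF c[OF that], of "cmod (v x)"] by (simp add: norm_mult mult.commute)
    show i: "integrable (lebesgue_on K) (\<lambda>x. v x * h x)"
    proof (rule Bochner_Integration.integrable_bound[OF integrable_mult_right[OF integrable_norm[OF vK], of c]])
      show "AE x in lebesgue_on K. norm (v x * h x) \<le> norm (c * norm (v x))"
        using le by (intro AE_I2) (force simp: space_restrict_space)
    qed (use hm vm in measurable)
    have "(LINT x|lebesgue_on K. cmod (v x * h x)) \<le> (LINT x|lebesgue_on K. c * cmod (v x))"
      using le by (intro integral_mono integrable_norm i integrable_mult_right vK) (auto simp: space_restrict_space)
    then show "(LINT x|lebesgue_on K. cmod (v x * h x)) \<le> c * (LINT x|lebesgue_on K. cmod (v x))" by simp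
  qed
  obtain c where "\<And>x. x \<in> K \<Longrightarrow> cmod (h x) \<le> c"
    using compact_imp_bounded[OF compact_continuous_image[OF h(1) K(1)]] by (auto simp: bounded_iff)
  from bnd(1)[OF this] have iK: "integrable (lebesgue_on K) (\<lambda>x. v x * h x)" .
  then show "integrable (lebesgue_on \<Omega>) (\<lambda>x. v x * h x)"
    by (simp add: integrable_restrict_space eq)
  assume e: "\<And>x. x \<in> K \<Longrightarrow> cmod (h x) \<le> e"
  have "(LINT x|lebesgue_on \<Omega>. v x * h x) = (LINT x|lebesgue_on K. v x * h x)"
    by (simp add: integral_restrict_space eq)
  also have "cmod \<dots> \<le> (LINT x|lebesgue_on K. cmod (v x * h x))" by (rule integral_norm_bound)
  also have "\<dots> \<le> e * (LINT x|lebesgue_on K. cmod (v x))" by (rule bnd(2)[OF e])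
  finally show "cmod (LINT x|lebesgue_on \<Omega>. v x * h x) \<le> e * (LINT x|lebesgue_on K. cmod (v x))" .
qed

lemma integral_locally_mult_close:
  fixes h h' v :: "real^'n \<Rightarrow> complex"
  assumes \<Omega>: "open \<Omega>" and v: "locally_integrable \<Omega> v" and K: "compact K" "K \<subseteq> \<Omega>"
    and h: "continuous_on UNIV h" "\<And>x. x \<notin> K \<Longrightarrow> h x = 0"
    and h': "continuous_on UNIV h'" "\<And>x. x \<notin> K \<Longrightarrow> h' x = 0"
    and e: "\<And>x. cmod (h x - h' x) \<le> e"
  shows "cmod ((LINT x|lebesgue_on \<Omega>. v x * h x) - (LINT x|lebesgue_on \<Omega>. v x * h' x)) \<le> e * (LINT x|lebesgue_on K. cmod (v x))"
proof -
  have "(LINT x|lebesgue_on \<Omega>. v x * h x) - (LINT x|lebesgue_on \<Omega>. v x * h' x) = (LINT x|lebesgue_on \<Omega>. v x * (h x - h' x))"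
    using integrable_locally_mult(1)[OF \<Omega> v K continuous_on_subset[OF h(1)] h(2)]
      integrable_locally_mult(1)[OF \<Omega> v K continuous_on_subset[OF h'(1)] h'(2)]
    by (simp add: right_diff_distrib)
  also have "cmod \<dots> \<le> e * (LINT x|lebesgue_on K. cmod (v x))"
    using h h' e by (intro integrable_locally_mult(2)[OF \<Omega> v K] continuous_on_diff) (auto intro: continuous_on_subset)
  finally show ?thesis .
qed

lemma le_all_eps_imp_zero:
  assumes "\<And>e::real. e > 0 \<Longrightarrow> cmod z \<le> e * C"
  shows "z = 0"
proof (rule ccontr)
  assume "z \<noteq> 0"
  then have z: "cmod z > 0" by simp
  have "cmod z \<le> cmod z / (2 * (\<bar>C\<bar> + 1)) * C" using z by (intro assms) auto
  also have "\<dots> \<le> cmod z / (2 * (\<bar>C\<bar> + 1)) * (\<bar>C\<bar> + 1)" using z by (intro mult_left_mono) auto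
  also have "\<dots> = cmod z / 2" by (simp add: field_simps)
  finally show False using z by simp
qed

text \<open>The identity that defines weak derivatives concerns smooth functions; mollifying g
  inside a fixed compact set K' extends it, with an error of at most e times the integrals of |u|
  and |v| over K'. The extension is needed because a \<phi> is not smooth when the coefficient a is
  only in C^1.\<close>

lemma weak_partial_tested_C1:
  fixes g \<phi> u v :: "real^'n \<Rightarrow> complex"
  assumes \<phi>: "test_function \<Omega>' \<phi>" "\<phi> x0 \<noteq> 0" and \<Omega>: "open \<Omega>" and uv: "has_weak_partial \<Omega> i u v"
    and K: "compact K" "K \<subseteq> \<Omega>" and g: "C_k 1 g" "\<And>x. x \<notin> K \<Longrightarrow> g x = 0"
  shows "(LINT x|lebesgue_on \<Omega>. u x * partial i g x) = - (LINT x|lebesgue_on \<Omega>. v x * g x)"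
proof -
  have gc: "continuous_on UNIV g" using g(1) by (rule C_k_continuous)
  obtain K' where K': "compact K'" "K' \<subseteq> \<Omega>" "K \<subseteq> K'"
    and ex: "\<And>e. e > 0 \<Longrightarrow> \<exists>G. test_function \<Omega> G \<and> (\<forall>x. x \<notin> K' \<longrightarrow> G x = 0) \<and> (\<forall>x. cmod (G x - g x) \<le> e) \<and>
      (C_k 1 g \<longrightarrow> (\<forall>i x. cmod (partial i G x - partial i g x) \<le> e))"
    using mollification[OF \<phi> \<Omega> K gc g(2)] by metis
  have u: "locally_integrable \<Omega> u" and v: "locally_integrable \<Omega> v" using uv by (auto simp: has_weak_partial_def)
  have p0: "partial i h x = 0" if "\<And>x. x \<notin> K' \<Longrightarrow> h x = 0" "x \<notin> K'" for h :: "real^'n \<Rightarrow> complex" and x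
    using that K'(1) by (intro partial_eq_0(2)[of "- K'"]) (auto simp: compact_imp_closed open_Compl)
  have g0: "g x = 0" if "x \<notin> K'" for x using that g(2) K'(3) by blast
  have "(LINT x|lebesgue_on \<Omega>. u x * partial i g x) + (LINT x|lebesgue_on \<Omega>. v x * g x) = 0"
  proof (rule le_all_eps_imp_zero)
    fix e :: real assume "e > 0"
    from ex[OF this] obtain G where G: "test_function \<Omega> G" "\<And>x. x \<notin> K' \<Longrightarrow> G x = 0" "\<And>x. cmod (G x - g x) \<le> e"
      "\<And>i x. cmod (partial i G x - partial i g x) \<le> e" using g(1) by blast
    have GC: "C_k 1 G" using G(1) by (auto simp: test_function_def)
    have 1: "cmod ((LINT x|lebesgue_on \<Omega>. u x * partial i G x) - (LINT x|lebesgue_on \<Omega>. u x * partial i g x))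
        \<le> e * (LINT x|lebesgue_on K'. cmod (u x))"
      by (rule integral_locally_mult_close[OF \<Omega> u K'(1,2)]) (use GC g(1) p0 G(2) g0 G(4) in auto)
    have 2: "cmod ((LINT x|lebesgue_on \<Omega>. v x * G x) - (LINT x|lebesgue_on \<Omega>. v x * g x))
        \<le> e * (LINT x|lebesgue_on K'. cmod (v x))"
      by (rule integral_locally_mult_close[OF \<Omega> v K'(1,2)]) (use C_k_continuous[OF GC] gc G(2) g0 G(3) in auto)
    have 3: "(LINT x|lebesgue_on \<Omega>. u x * partial i G x) = - (LINT x|lebesgue_on \<Omega>. v x * G x)"
      using uv G(1) by (auto simp: has_weak_partial_def)
    have "cmod ((LINT x|lebesgue_on \<Omega>. u x * partial i g x) + (LINT x|lebesgue_on \<Omega>. v x * g x))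
      \<le> cmod ((LINT x|lebesgue_on \<Omega>. u x * partial i G x) - (LINT x|lebesgue_on \<Omega>. u x * partial i g x))
        + cmod ((LINT x|lebesgue_on \<Omega>. v x * G x) - (LINT x|lebesgue_on \<Omega>. v x * g x))"
      unfolding 3 by norm
    with 1 2 show "cmod ((LINT x|lebesgue_on \<Omega>. u x * partial i g x) + (LINT x|lebesgue_on \<Omega>. v x * g x))
      \<le> e * ((LINT x|lebesgue_on K'. cmod (u x)) + (LINT x|lebesgue_on K'. cmod (v x)))"
      by (simp add: distrib_left)
  qed
  then show ?thesis by (simp add: eq_neg_iff_add_eq_0)
qed

text \<open>Two weak derivatives of u agree when tested with smooth functions, hence by
  mollification also with continuous ones of compact support. This allows the derivative selected by
  \<open>weak_partial\<close> to be traded for a representative that is known to be weakly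
  differentiable itself.\<close>

lemma weak_partial_tested_unique:
  fixes g \<phi> u v :: "real^'n \<Rightarrow> complex"
  assumes \<phi>: "test_function \<Omega>' \<phi>" "\<phi> x0 \<noteq> 0" and \<Omega>: "open \<Omega>"
    and uv: "has_weak_partial \<Omega> i u v" and uv': "has_weak_partial \<Omega> i u v'"
    and K: "compact K" "K \<subseteq> \<Omega>" and g: "continuous_on UNIV g" "\<And>x. x \<notin> K \<Longrightarrow> g x = 0"
  shows "(LINT x|lebesgue_on \<Omega>. v x * g x) = (LINT x|lebesgue_on \<Omega>. v' x * g x)"
proof -
  obtain K' where K': "compact K'" "K' \<subseteq> \<Omega>" "K \<subseteq> K'"
    and ex: "\<And>e. e > 0 \<Longrightarrow> \<exists>G. test_function \<Omega> G \<and> (\<forall>x. x \<notin> K' \<longrightarrow> G x = 0) \<and> (\<forall>x. cmod (G x - g x) \<le> e)"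
    using mollification[OF \<phi> \<Omega> K g] by metis
  have v: "locally_integrable \<Omega> v" and v': "locally_integrable \<Omega> v'" using uv uv' by (auto simp: has_weak_partial_def)
  have g0: "g x = 0" if "x \<notin> K'" for x using that g(2) K'(3) by blast
  have "(LINT x|lebesgue_on \<Omega>. v x * g x) - (LINT x|lebesgue_on \<Omega>. v' x * g x) = 0"
  proof (rule le_all_eps_imp_zero)
    fix e :: real assume "e > 0"
    from ex[OF this] obtain G where G: "test_function \<Omega> G" "\<And>x. x \<notin> K' \<Longrightarrow> G x = 0" "\<And>x. cmod (G x - g x) \<le> e" by blast
    have Gc: "continuous_on UNIV G" using G(1) C_k_continuous by (auto simp: test_function_def)
    have 1: "cmod ((LINT x|lebesgue_on \<Omega>. v x * G x) - (LINT x|lebesgue_on \<Omega>. v x * g x)) \<le> e * (LINT x|lebesgue_on K'. cmod (v x))"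
      by (rule integral_locally_mult_close[OF \<Omega> v K'(1,2) Gc G(2) g(1) g0 G(3)])
    have 2: "cmod ((LINT x|lebesgue_on \<Omega>. v' x * G x) - (LINT x|lebesgue_on \<Omega>. v' x * g x)) \<le> e * (LINT x|lebesgue_on K'. cmod (v' x))"
      by (rule integral_locally_mult_close[OF \<Omega> v' K'(1,2) Gc G(2) g(1) g0 G(3)])
    have 3: "(LINT x|lebesgue_on \<Omega>. v x * G x) = (LINT x|lebesgue_on \<Omega>. v' x * G x)"
      using uv uv' G(1) by (auto simp: has_weak_partial_def)
    have "cmod ((LINT x|lebesgue_on \<Omega>. v x * g x) - (LINT x|lebesgue_on \<Omega>. v' x * g x))
      \<le> cmod ((LINT x|lebesgue_on \<Omega>. v x * G x) - (LINT x|lebesgue_on \<Omega>. v x * g x))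
        + cmod ((LINT x|lebesgue_on \<Omega>. v' x * G x) - (LINT x|lebesgue_on \<Omega>. v' x * g x))"
      unfolding 3 by norm
    with 1 2 show "cmod ((LINT x|lebesgue_on \<Omega>. v x * g x) - (LINT x|lebesgue_on \<Omega>. v' x * g x))
      \<le> e * ((LINT x|lebesgue_on K'. cmod (v x)) + (LINT x|lebesgue_on K'. cmod (v' x)))"
      by (simp add: distrib_left)
  qed
  then show ?thesis by simp
qed

lemma locally_integrable_scaleR:
  fixes v :: "real^'n \<Rightarrow> complex" and a :: "real^'n \<Rightarrow> real"
  assumes a: "continuous_on \<Omega> a" and v: "locally_integrable \<Omega> v"
  shows "locally_integrable \<Omega> (\<lambda>x. a x *\<^sub>R v x)"
  unfolding locally_integrable_def
proof (intro allI impI)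
  fix K assume K: "compact K \<and> K \<subseteq> \<Omega>"
  then have vK: "integrable (lebesgue_on K) v" using v by (auto simp: locally_integrable_def)
  have aK: "continuous_on K a" using a K continuous_on_subset by blast
  obtain c where c: "\<And>x. x \<in> K \<Longrightarrow> \<bar>a x\<bar> \<le> c"
    using compact_imp_bounded[OF compact_continuous_image[OF aK]] K by (auto simp: bounded_iff)
  have am: "a \<in> borel_measurable (lebesgue_on K)"
    using aK fmeasurableD[OF lmeasurable_compact[of K]] K by (auto intro: continuous_imp_measurable_on_sets_lebesgue)
  have vm: "v \<in> borel_measurable (lebesgue_on K)" using vK by auto
  show "integrable (lebesgue_on K) (\<lambda>x. a x *\<^sub>R v x)"
  proof (rule Bochner_Integration.integrable_bound[OF integrable_mult_right[OF integrable_norm[OF vK], of c]])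
    show "AE x in lebesgue_on K. norm (a x *\<^sub>R v x) \<le> norm (c * norm (v x))"
      using c by (intro AE_I2) (force simp: space_restrict_space abs_mult intro!: mult_right_mono)
  qed (use am vm in measurable)
qed

lemma locally_integrable_add:
  "locally_integrable \<Omega> u \<Longrightarrow> locally_integrable \<Omega> v \<Longrightarrow> locally_integrable \<Omega> (\<lambda>x. u x + v x)"
  by (auto simp: locally_integrable_def)

text \<open>The product rule, obtained by testing with a \<phi>: the derivative is a w plus v times
  the j-th partial derivative of a. Both v and v' are derivatives of u; v is the one whose own
  derivative w is at hand, and v' will be the one selected by \<open>weak_partial\<close> inside the
  operators.\<close>

lemma ex_weak_partial_C1_mult:
  fixes u v v' w :: "real^'n \<Rightarrow> complex" and a :: "real^'n \<Rightarrow> real"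
  assumes \<Omega>: "open \<Omega>" and a: "\<And>x. x \<in> \<Omega> \<Longrightarrow> GDERIV a x :> ga x" and ga: "continuous_on \<Omega> ga"
    and uv: "has_weak_partial \<Omega> i u v" and uv': "has_weak_partial \<Omega> i u v'" and vw: "has_weak_partial \<Omega> j v w"
  shows "\<exists>z. has_weak_partial \<Omega> j (\<lambda>x. a x *\<^sub>R v' x) z"
proof -
  have ac: "continuous_on \<Omega> a"
    using a unfolding gderiv_def by (auto intro!: continuous_at_imp_continuous_on has_derivative_continuous)
  have gac: "continuous_on \<Omega> (\<lambda>x. ga x $ j)" using ga by (intro continuous_intros)
  have li: "locally_integrable \<Omega> v" "locally_integrable \<Omega> v'" "locally_integrable \<Omega> w"
    using uv uv' vw by (auto simp: has_weak_partial_def)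
  have av': "locally_integrable \<Omega> (\<lambda>x. a x *\<^sub>R v' x)" by (rule locally_integrable_scaleR[OF ac li(2)])
  define z where "z x = a x *\<^sub>R w x + (ga x $ j) *\<^sub>R v x" for x
  have lz: "locally_integrable \<Omega> z"
    unfolding z_def by (intro locally_integrable_add locally_integrable_scaleR ac gac li)
  have "(LINT x|lebesgue_on \<Omega>. a x *\<^sub>R v' x * partial j \<phi> x) = - (LINT x|lebesgue_on \<Omega>. z x * \<phi> x)"
    if \<phi>: "test_function \<Omega> \<phi>" for \<phi>
  \<comment> \<open>For \<phi> = 0 both sides vanish; otherwise \<phi> is itself a seed for the
    mollifier.\<close>
  proof (cases "\<exists>x. \<phi> x \<noteq> 0")
    case False
    then have "\<phi> = (\<lambda>x. 0)" by auto
    then show ?thesis by (simp add: partial_const)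
  next
    case True
    then obtain x0 where x0: "\<phi> x0 \<noteq> 0" by blast
    define K where "K = closure {x. \<phi> x \<noteq> 0}"
    have K: "compact K" "K \<subseteq> \<Omega>" and \<phi>C: "C_k k \<phi>" for k
      using \<phi> by (auto simp: test_function_def K_def)
    have oK: "open (- K)" by (simp add: K_def open_Compl)
    \<comment> \<open>Continuity on the whole space is checked on these two open sets: the
      coefficient is controlled on \<Omega>, and off K all products with \<phi> and its derivatives
      vanish.\<close>
    have cov: "\<Omega> \<union> - K = UNIV" using K by auto
    have \<phi>0: "\<phi> x = 0" if "x \<notin> K" for x using that closure_subset by (force simp: K_def)
    have \<phi>d: "\<phi> differentiable at x" and \<phi>pc: "continuous_on UNIV (partial j \<phi>)" for x using \<phi>C[of 1] by auto
    have \<phi>c: "continuous_on UNIV \<phi>" using \<phi>C by (rule C_k_continuous)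
    have p\<phi>0: "partial j \<phi> x = 0" if "x \<notin> K" for x
      using that oK \<phi>0 by (intro partial_eq_0(2)[of "- K"]) auto
    define g where "g x = complex_of_real (a x) * \<phi> x" for x
    have g0: "g x = 0" if "x \<notin> K" for x using \<phi>0[OF that] by (simp add: g_def)
    have gder: "(g has_derivative (\<lambda>h. complex_of_real (a x) * frechet_derivative \<phi> (at x) h + complex_of_real (h \<bullet> ga x) * \<phi> x)) (at x)"
      if "x \<in> \<Omega>" for x
    proof -
      have "((\<lambda>x. complex_of_real (a x)) has_derivative (\<lambda>h. complex_of_real (h \<bullet> ga x))) (at x)"
        using a[OF that] unfolding gderiv_def by (rule has_derivative_of_real)
      from has_derivative_mult[OF this differentiable_has_derivative[OF \<phi>d]]
      show ?thesis unfolding g_def .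
    qed
    have gp: "partial k g x = complex_of_real (a x) * partial k \<phi> x + complex_of_real (ga x $ k) * \<phi> x" if "x \<in> \<Omega>" for x k
      using partial_eqI[OF gder[OF that]] by (simp add: partial_def inner_axis inner_commute[of _ "ga x"])
    have gd: "g differentiable at x" for x
    proof (cases "x \<in> \<Omega>")
      case True
      then show ?thesis using gder by (auto simp: differentiable_def)
    next
      case False
      then show ?thesis using K g0 oK by (intro partial_eq_0(1)[of "- K"]) auto
    qed
    have "continuous_on UNIV (partial k g)" for k
    proof -
      have "continuous_on \<Omega> (\<lambda>x. complex_of_real (a x) * partial k \<phi> x + complex_of_real (ga x $ k) * \<phi> x)"
        using \<phi>C[of 1] by (intro continuous_intros ac ga) (auto intro: continuous_on_subset[OF \<phi>c] continuous_on_subset[of UNIV])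
      then have "continuous_on \<Omega> (partial k g)" by (rule continuous_on_eq) (simp add: gp)
      moreover have "continuous_on (- K) (partial k g)"
        by (rule continuous_on_eq[OF continuous_on_const[of _ 0]])
          (use g0 oK in \<open>auto intro!: partial_eq_0(2)[of "- K"]\<close>)
      ultimately have "continuous_on (\<Omega> \<union> - K) (partial k g)"
        using \<Omega> oK by (intro continuous_on_open_Un)
      then show ?thesis unfolding cov .
    qed
    then have gC: "C_k 1 g" using gd by simp
    define h where "h x = complex_of_real (a x) * partial j \<phi> x" for x
    define l where "l x = complex_of_real (ga x $ j) * \<phi> x" for x
    have contUN: "continuous_on UNIV f" if "continuous_on \<Omega> f" "\<And>x. x \<notin> K \<Longrightarrow> f x = 0" for f :: "real^'n \<Rightarrow> complex"
    proof -
      have "continuous_on (- K) f"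
        by (rule continuous_on_eq[OF continuous_on_const[of _ 0]]) (use that(2) in auto)
      then have "continuous_on (\<Omega> \<union> - K) f" using that(1) \<Omega> oK by (intro continuous_on_open_Un)
      then show ?thesis unfolding cov .
    qed
    have h0: "h x = 0" and l0: "l x = 0" if "x \<notin> K" for x using that by (auto simp: h_def l_def p\<phi>0 \<phi>0)
    have hc: "continuous_on UNIV h"
      by (rule contUN[OF _ h0]) (auto simp: h_def intro!: continuous_intros ac continuous_on_subset[OF \<phi>pc])
    have lc: "continuous_on UNIV l"
      by (rule contUN[OF _ l0]) (auto simp: l_def intro!: continuous_intros gac continuous_on_subset[OF \<phi>c])
    note int = integrable_locally_mult(1)[OF \<Omega> _ K]
    have iv: "integrable (lebesgue_on \<Omega>) (\<lambda>x. v x * h x)" "integrable (lebesgue_on \<Omega>) (\<lambda>x. v x * l x)"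
      "integrable (lebesgue_on \<Omega>) (\<lambda>x. w x * g x)"
      by (auto intro!: int li h0 l0 g0 intro: continuous_on_subset[OF hc] continuous_on_subset[OF lc] continuous_on_subset[OF C_k_continuous[OF gC]])
    have "(LINT x|lebesgue_on \<Omega>. a x *\<^sub>R v' x * partial j \<phi> x) = (LINT x|lebesgue_on \<Omega>. v' x * h x)"
      by (intro Bochner_Integration.integral_cong) (auto simp: h_def scaleR_conv_of_real)
    also have "\<dots> = (LINT x|lebesgue_on \<Omega>. v x * h x)"
      by (rule weak_partial_tested_unique[OF \<phi> x0 \<Omega> uv' uv K hc h0])
    also have "\<dots> = (LINT x|lebesgue_on \<Omega>. v x * partial j g x) - (LINT x|lebesgue_on \<Omega>. v x * l x)"
    proof -
      have "(LINT x|lebesgue_on \<Omega>. v x * partial j g x) = (LINT x|lebesgue_on \<Omega>. v x * h x + v x * l x)"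
        by (intro Bochner_Integration.integral_cong) (auto simp: gp h_def l_def space_restrict_space distrib_left)
      then show ?thesis using iv by simp
    qed
    also have "(LINT x|lebesgue_on \<Omega>. v x * partial j g x) = - (LINT x|lebesgue_on \<Omega>. w x * g x)"
      by (rule weak_partial_tested_C1[OF \<phi> x0 \<Omega> vw K gC g0])
    also have "- (LINT x|lebesgue_on \<Omega>. w x * g x) - (LINT x|lebesgue_on \<Omega>. v x * l x)
        = - (LINT x|lebesgue_on \<Omega>. w x * g x + v x * l x)" using iv by simp
    also have "(LINT x|lebesgue_on \<Omega>. w x * g x + v x * l x) = (LINT x|lebesgue_on \<Omega>. z x * \<phi> x)"
      by (intro Bochner_Integration.integral_cong) (auto simp: z_def g_def l_def scaleR_conv_of_real algebra_simps)
    finally show ?thesis .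
  qed
  then show ?thesis using av' lz by (auto simp: has_weak_partial_def)
qed

lemma has_weak_partial_weak_partial:
  "has_weak_partial \<Omega> i u v \<Longrightarrow> has_weak_partial \<Omega> i u (weak_partial \<Omega> i u)"
  unfolding weak_partial_def by (rule someI[of "\<lambda>v. has_weak_partial \<Omega> i u v"])

text \<open>Membership in H^2 provides some representative of each first derivative that can be
  differentiated once more. The product rule passes this on to the selected representative, so that
  the choices made in the two operators are genuine weak derivatives.\<close>

lemma op_dom_weak_partials:
  assumes u: "u \<in> op_dom \<Omega>" and \<Omega>: "open \<Omega>" and a: "C1_closure \<Omega> a"
  shows "has_weak_partial \<Omega> i u (weak_partial \<Omega> i u)"
    "has_weak_partial \<Omega> j (\<lambda>x. a x *\<^sub>R weak_partial \<Omega> i u x) (weak_partial \<Omega> j (\<lambda>x. a x *\<^sub>R weak_partial \<Omega> i u x))"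
proof -
  have "u \<in> sobolev (Suc (Suc 0)) \<Omega>" using u by (simp add: op_dom_def numeral_2_eq_2)
  then obtain v where v: "v \<in> sobolev (Suc 0) \<Omega>" "has_weak_partial \<Omega> i u v"
    unfolding sobolev.simps(2)[of "Suc 0"] by blast
  then obtain w where w: "has_weak_partial \<Omega> j v w" unfolding sobolev.simps(2) by blast
  show uw: "has_weak_partial \<Omega> i u (weak_partial \<Omega> i u)"
    using v(2) by (rule has_weak_partial_weak_partial)
  obtain ga where ga: "continuous_on (closure \<Omega>) ga" "\<And>x. x \<in> \<Omega> \<Longrightarrow> GDERIV a x :> ga x"
    using a by (auto simp: C1_closure_def)
  have "continuous_on \<Omega> ga" using ga(1) closure_subset continuous_on_subset by blast
  from ex_weak_partial_C1_mult[OF \<Omega> ga(2) this v(2) uw w]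
  show "has_weak_partial \<Omega> j (\<lambda>x. a x *\<^sub>R weak_partial \<Omega> i u x) (weak_partial \<Omega> j (\<lambda>x. a x *\<^sub>R weak_partial \<Omega> i u x))"
    using has_weak_partial_weak_partial by blast
qed

text \<open>Here \<open>g s = \<rho>(x/s)\<close> vanishes for \<open>s \<le> s0\<close>, that is, where \<open>x/s\<close> has left the domain; the premise
  \<open>cond\<close> is what positivity of \<open>\<mu>\<close> provides.\<close>

lemma kernel_subordinate:
  fixes g :: "real \<Rightarrow> real"
  assumes \<alpha>: "0 < \<alpha>" "\<alpha> < 1" and n: "n \<ge> 2" and \<kappa>: "\<alpha> < \<kappa>"
    and s0: "0 < s0" "s0 < 1" and \<tau>: "0 < \<tau>" "\<tau> < 1"
    and r0: "r0 \<ge> 0" and A: "A \<ge> 0"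
    and g_out: "\<And>s. 0 < s \<Longrightarrow> s \<le> s0 \<Longrightarrow> g s = 0"
    and g_le: "\<And>s. s0 < s \<Longrightarrow> s < 1 \<Longrightarrow> g s \<le> r0 + A * ((1 - s) / s) powr \<kappa>"
    and cond: "A * (((1 - s0) / s0) powr (\<kappa> - \<alpha>) / (\<kappa> - \<alpha>))
      \<le> r0 * ((s0 / (1 - s0)) powr \<alpha> / \<alpha> + kip_const n \<alpha> * Gamma (1 - \<alpha>) / \<alpha>)"
  shows "(\<integral>\<^sup>+s. ennreal (indicator {0<..<\<tau>} s * (right_kernel \<alpha> s * g s)) \<partial>lborel)
      \<le> ennreal r0 * ((\<integral>\<^sup>+s. ennreal (indicator {0<..<\<tau>} s * left_kernel n \<alpha> s) \<partial>lborel)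
          + ennreal (2 * (kip_const n \<alpha> * Gamma (1 - \<alpha>) / \<alpha>)))"
proof (cases "s0 < \<tau>")
  case False
  have "indicator {0<..<\<tau>} s * (right_kernel \<alpha> s * g s) = 0" for s
    using False by (cases "0 < s \<and> s < \<tau>") (auto simp: g_out)
  then show ?thesis by (simp only: ennreal_0 nn_integral_const) simp
next
  case True
  define Q where "Q = kip_const n \<alpha> * Gamma (1 - \<alpha>) / \<alpha>"
  define z where "z s = (s / (1 - s)) powr \<alpha> / \<alpha>" for s
  let ?\<kappa> = "\<integral>\<^sup>+s. ennreal (indicator {0<..<\<tau>} s * left_kernel n \<alpha> s) \<partial>lborel"
  have Q0: "Q \<ge> 0"
    using \<alpha> n unfolding Q_def kip_const_def
    by (auto intro!: divide_nonneg_nonneg mult_nonneg_nonneg Gamma_real_nonneg)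
  have z0: "z s \<ge> 0" for s using \<alpha> by (simp add: z_def)
  have Qint: "(\<integral>\<^sup>+s. ennreal (right_kernel \<alpha> s - left_kernel n \<alpha> s) \<partial>lborel) = ennreal Q"
    using has_bochner_integral_kernel_difference[OF \<alpha> n] left_kernel_le_right_kernel[OF \<alpha>(2), of n]
    by (simp add: nn_integral_eq_integral has_bochner_integral_iff Q_def)
  \<comment> \<open>The integral of q up to \<tau> is z(\<tau>), and q = k + (q - k), where q - k
    has total mass Q. This accounts for one of the two Q in the conclusion.\<close>
  have z\<tau>: "ennreal (z \<tau>) \<le> ?\<kappa> + ennreal Q"
  proof -
    have "ennreal (z \<tau>) = (\<integral>\<^sup>+s. ennreal (indicator {0<..<\<tau>} s * right_kernel \<alpha> s) \<partial>lborel)"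
      using nn_integral_right_kernel[of \<alpha> 0 \<tau>] \<alpha> \<tau> by (simp add: z_def)
    also have "\<dots> \<le> (\<integral>\<^sup>+s. ennreal (indicator {0<..<\<tau>} s * left_kernel n \<alpha> s) + ennreal (right_kernel \<alpha> s - left_kernel n \<alpha> s) \<partial>lborel)"
      using left_kernel_le_right_kernel[OF \<alpha>(2), of n]
      by (intro nn_integral_mono) (auto simp: indicator_def kernels_nonneg simp flip: ennreal_plus)
    also have "\<dots> = ?\<kappa> + ennreal Q"
      by (subst nn_integral_add) (auto simp: Qint)
    finally show ?thesis .
  qed
  have "(\<integral>\<^sup>+s. ennreal (indicator {0<..<\<tau>} s * (right_kernel \<alpha> s * g s)) \<partial>lborel)
    \<le> (\<integral>\<^sup>+s. ennreal r0 * ennreal (indicator {s0<..<\<tau>} s * right_kernel \<alpha> s)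
      + ennreal A * ennreal (indicator {s0<..<1} s * (right_kernel \<alpha> s * ((1 - s) / s) powr \<kappa>)) \<partial>lborel)"
  proof (intro nn_integral_mono)
    fix s
    have "indicator {0<..<\<tau>} s * (right_kernel \<alpha> s * g s)
        \<le> r0 * (indicator {s0<..<\<tau>} s * right_kernel \<alpha> s) + A * (indicator {s0<..<1} s * (right_kernel \<alpha> s * ((1 - s) / s) powr \<kappa>))"
    proof (cases "s0 < s \<and> s < \<tau>")
      case True
      then have "right_kernel \<alpha> s * g s \<le> right_kernel \<alpha> s * (r0 + A * ((1 - s) / s) powr \<kappa>)"
        using \<tau> by (intro mult_left_mono g_le) (auto simp: kernels_nonneg)
      then show ?thesis using True s0 \<tau> by (simp add: algebra_simps)
    next
      case False
      then have "indicator {0<..<\<tau>} s * (right_kernel \<alpha> s * g s) = 0"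
        by (auto simp: indicator_def g_out)
      then show ?thesis using r0 A
        by (auto intro!: add_nonneg_nonneg mult_nonneg_nonneg simp: kernels_nonneg)
    qed
    from ennreal_leI[OF this] show "ennreal (indicator {0<..<\<tau>} s * (right_kernel \<alpha> s * g s)) \<le>
      ennreal r0 * ennreal (indicator {s0<..<\<tau>} s * right_kernel \<alpha> s)
      + ennreal A * ennreal (indicator {s0<..<1} s * (right_kernel \<alpha> s * ((1 - s) / s) powr \<kappa>))"
      using r0 A by (simp add: kernels_nonneg ennreal_plus ennreal_mult del: ennreal_plus[symmetric])
  qed
  also have "\<dots> = ennreal r0 * (\<integral>\<^sup>+s. ennreal (indicator {s0<..<\<tau>} s * right_kernel \<alpha> s) \<partial>lborel)
      + ennreal A * (\<integral>\<^sup>+s. ennreal (indicator {s0<..<1} s * (right_kernel \<alpha> s * ((1 - s) / s) powr \<kappa>)) \<partial>lborel)"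
    by (subst nn_integral_add) (auto simp: nn_integral_cmult)
  also have "\<dots> = ennreal r0 * ennreal (z \<tau> - z s0) + ennreal A * ennreal (((1 - s0) / s0) powr (\<kappa> - \<alpha>) / (\<kappa> - \<alpha>))"
    using nn_integral_right_kernel[of \<alpha> s0 \<tau>] nn_integral_right_kernel_weighted[of s0 \<alpha> \<kappa>] \<alpha> \<kappa> s0 \<tau> True
    by (simp add: z_def diff_divide_distrib)
  also have "\<dots> = ennreal (r0 * (z \<tau> - z s0) + A * (((1 - s0) / s0) powr (\<kappa> - \<alpha>) / (\<kappa> - \<alpha>)))"
  proof -
    have "s0 / (1 - s0) \<le> \<tau> / (1 - \<tau>)" using True s0 \<tau> by (intro frac_le) auto
    then have "z s0 \<le> z \<tau>"
      unfolding z_def using \<alpha> s0 by (intro divide_right_mono powr_mono2) auto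
    then show ?thesis
      unfolding ennreal_mult'[OF r0, symmetric] ennreal_mult'[OF A, symmetric]
      using r0 A \<kappa> by (intro ennreal_plus[symmetric] mult_nonneg_nonneg) auto
  qed
  \<comment> \<open>By \<open>cond\<close> the Hoelder term is at most r0 (z(s0) + Q). The term
    z(s0) cancels against the one lost by starting at s0, and the second Q remains.\<close>
  also have "\<dots> \<le> ennreal (r0 * (z \<tau> + Q))"
    using cond by (intro ennreal_leI) (simp add: z_def Q_def algebra_simps)
  also have "\<dots> = ennreal r0 * (ennreal (z \<tau>) + ennreal Q)"
    using r0 z0[of \<tau>] Q0 by (simp add: ennreal_mult)
  also have "\<dots> \<le> ennreal r0 * ((?\<kappa> + ennreal Q) + ennreal Q)"
    by (intro mult_left_mono add_mono z\<tau>) auto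
  also have "\<dots> = ennreal r0 * (?\<kappa> + ennreal (2 * Q))"
    by (simp only: mult_2 ennreal_plus[OF Q0 Q0] add.assoc)
  finally show ?thesis by (simp add: Q_def)
qed

subsection \<open>Hardy's inequality and dilation estimates\<close>

text \<open>The power 2^n bounds the Jacobian t^(-n) for t \<ge> 1/2. The remaining factor 4 bounds
  2^(2-2\<alpha>), which arises because |t x| \<le> \<delta> gives |x| \<le> 2 \<delta>.\<close>

definition dil_const :: "nat \<Rightarrow> real \<Rightarrow> real \<Rightarrow> real" where
  "dil_const n \<alpha> \<delta> = 2 ^ (n + 2) * \<delta> powr (2 - 2 * \<alpha>)"

text \<open>With \<eta> = (q-1)/2 this is (1 + 1/\<eta>) / \<eta> times a quarter of
  \<open>dil_const\<close>; the quarter is (1-s)^2 at s = 1/2, and q is the factor gained by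
  scaling.\<close>

definition hardy_const :: "nat \<Rightarrow> real \<Rightarrow> real \<Rightarrow> real" where
  "hardy_const n \<alpha> \<delta> = (let q = 2 powr (n - 2 * \<alpha>) in 2 / (q - 1) * (1 + 2 / (q - 1)) * (dil_const n \<alpha> \<delta> / 4))"

text \<open>\<open>dil_const\<close> serves s \<ge> 1/2. For s < 1/2 the triangle inequality costs a
  factor 4 and the lower bound (1-s)^2 \<ge> 1/4 another 4, which gives the 16.\<close>

definition class_const :: "nat \<Rightarrow> real \<Rightarrow> real \<Rightarrow> real" where
  "class_const n \<alpha> \<delta> = dil_const n \<alpha> \<delta> + 16 * hardy_const n \<alpha> \<delta>"

lemma dil_const_nonneg: "dil_const n \<alpha> \<delta> \<ge> 0"
  by (simp add: dil_const_def)

lemma hardy_const_nonneg: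
  assumes "\<alpha> < 1" "n \<ge> 2"
  shows "hardy_const n \<alpha> \<delta> \<ge> 0"
proof -
  have "2 powr (n - 2 * \<alpha>) > 1" using assms by (intro gr_one_powr) auto
  then show ?thesis
    by (auto simp: hardy_const_def Let_def dil_const_nonneg intro!: mult_nonneg_nonneg add_nonneg_nonneg)
qed

lemma nn_integral_dilated_weight:
  fixes \<psi> :: "'a::euclidean_space \<Rightarrow> complex"
  assumes [measurable]: "\<psi> \<in> borel_measurable borel" and s: "s > 0"
  shows "(\<integral>\<^sup>+x. ennreal (norm x powr a * (cmod (\<psi> (s *\<^sub>R x)))\<^sup>2) \<partial>lborel)
    = ennreal (s powr (- a - DIM('a))) * (\<integral>\<^sup>+x. ennreal (norm x powr a * (cmod (\<psi> x))\<^sup>2) \<partial>lborel)"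
proof -
  have "(\<integral>\<^sup>+x. ennreal (norm x powr a * (cmod (\<psi> (s *\<^sub>R x)))\<^sup>2) \<partial>lborel)
      = (\<integral>\<^sup>+x. ennreal (s powr (- a)) * ennreal (norm (s *\<^sub>R x) powr a * (cmod (\<psi> (s *\<^sub>R x)))\<^sup>2) \<partial>lborel)"
  proof (intro nn_integral_cong)
    fix x
    have "s powr (- a) * (norm (s *\<^sub>R x) powr a * (cmod (\<psi> (s *\<^sub>R x)))\<^sup>2)
        = (s powr (- a) * s powr a) * (norm x powr a * (cmod (\<psi> (s *\<^sub>R x)))\<^sup>2)"
      using s by (simp add: powr_mult)
    also have "s powr (- a) * s powr a = 1" using s by (simp flip: powr_add)
    finally show "ennreal (norm x powr a * (cmod (\<psi> (s *\<^sub>R x)))\<^sup>2)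
        = ennreal (s powr (- a)) * ennreal (norm (s *\<^sub>R x) powr a * (cmod (\<psi> (s *\<^sub>R x)))\<^sup>2)"
      by (simp only: ennreal_mult'[symmetric] powr_ge_zero mult_1)
  qed
  also have "\<dots> = ennreal (s powr (- a)) * (\<integral>\<^sup>+x. ennreal (norm (s *\<^sub>R x) powr a * (cmod (\<psi> (s *\<^sub>R x)))\<^sup>2) \<partial>lborel)"
    by (intro nn_integral_cmult) measurable
  also have "(\<integral>\<^sup>+x. ennreal (norm (s *\<^sub>R x) powr a * (cmod (\<psi> (s *\<^sub>R x)))\<^sup>2) \<partial>lborel)
      = ennreal (s powr - real DIM('a)) * (\<integral>\<^sup>+x. ennreal (norm x powr a * (cmod (\<psi> x))\<^sup>2) \<partial>lborel)"
    by (rule nn_integral_dilation[OF _ s, where F="\<lambda>x. ennreal (norm x powr a * (cmod (\<psi> x))\<^sup>2)"]) measurable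
  finally show ?thesis
    by (simp add: powr_add[symmetric] flip: mult.assoc ennreal_mult)
qed

text \<open>The model is a test function \<psi> centred at P, with g the squared length of its
  gradient and A its Dirichlet integral; \<open>increment\<close> is the only link between \<psi>
  and g. The premise \<open>finite_weight\<close> is qualitative: a multiple of the weighted norm
  will be moved from one side of an inequality to the other, and the resulting bounds do not involve
  its value.\<close>

locale dilation_estimate =
  fixes \<psi> :: "'a::euclidean_space \<Rightarrow> complex" and g :: "'a \<Rightarrow> real" and \<alpha> \<delta> A :: real
  assumes alpha: "0 < \<alpha>" "\<alpha> < 1" and dim: "2 \<le> DIM('a)"
    and psi_meas [measurable]: "\<psi> \<in> borel_measurable borel"
    and g_meas [measurable]: "g \<in> borel_measurable borel"
    and g_nonneg: "\<And>x. g x \<ge> 0" and g_out: "\<And>x. norm x > \<delta> \<Longrightarrow> g x = 0"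
    and g_int: "(\<integral>\<^sup>+x. ennreal (g x) \<partial>lborel) \<le> ennreal A" and A_nonneg: "A \<ge> 0"
    and increment: "\<And>x s. 0 < s \<Longrightarrow> s < 1 \<Longrightarrow> ennreal ((cmod (\<psi> x - \<psi> (s *\<^sub>R x)))\<^sup>2)
      \<le> ennreal (1 - s) * (\<integral>\<^sup>+t. ennreal (indicator {s..1} t * ((norm x)\<^sup>2 * g (t *\<^sub>R x))) \<partial>lborel)"
    and finite_weight: "(\<integral>\<^sup>+x. ennreal (norm x powr (- 2 * \<alpha>) * (cmod (\<psi> x))\<^sup>2) \<partial>lborel) < \<infinity>"
begin

text \<open>One factor 1 - s is explicit in \<open>increment\<close>, the other is the length of the
  interval of integration in t. Tonelli's theorem reduces the claim to a single t, where t x is the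
  new variable; t \<ge> 1/2 controls the Jacobian and, where g does not vanish, also |x|.\<close>

lemma dil_half:
  assumes s: "1 / 2 \<le> s" "s < 1"
  shows "(\<integral>\<^sup>+x. ennreal (norm x powr (- 2 * \<alpha>) * (cmod (\<psi> x - \<psi> (s *\<^sub>R x)))\<^sup>2) \<partial>lborel)
    \<le> ennreal ((1 - s)\<^sup>2 * (dil_const DIM('a) \<alpha> \<delta> * A))"
proof -
  have s0: "s > 0" using s by simp
  have inner: "(\<integral>\<^sup>+x. ennreal (norm x powr (2 - 2 * \<alpha>) * g (t *\<^sub>R x)) \<partial>lborel) \<le> ennreal (dil_const DIM('a) \<alpha> \<delta> * A)"
    if t: "s \<le> t" "t \<le> 1" for t
  proof -
    have t0: "t > 0" using s t by simp
    have "(\<integral>\<^sup>+x. ennreal (norm x powr (2 - 2 * \<alpha>) * g (t *\<^sub>R x)) \<partial>lborel)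
        \<le> (\<integral>\<^sup>+x. ennreal (4 * \<delta> powr (2 - 2 * \<alpha>)) * ennreal (g (t *\<^sub>R x)) \<partial>lborel)"
    proof (intro nn_integral_mono)
      fix x
      show "ennreal (norm x powr (2 - 2 * \<alpha>) * g (t *\<^sub>R x)) \<le> ennreal (4 * \<delta> powr (2 - 2 * \<alpha>)) * ennreal (g (t *\<^sub>R x))"
      proof (cases "norm (t *\<^sub>R x) > \<delta>")
        case False
        then have "t * norm x \<le> \<delta>" using t0 by simp
        moreover have "1 / 2 * norm x \<le> t * norm x" using s t by (intro mult_right_mono) auto
        ultimately have "norm x \<le> 2 * \<delta>" by simp
        moreover from this have "\<delta> \<ge> 0" using norm_ge_zero[of x] by linarith
        ultimately have "norm x powr (2 - 2 * \<alpha>) \<le> (2 * \<delta>) powr (2 - 2 * \<alpha>)"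
          using alpha by (intro powr_mono2) auto
        also have "\<dots> = 2 powr (2 - 2 * \<alpha>) * \<delta> powr (2 - 2 * \<alpha>)" by (simp add: powr_mult)
        also have "\<dots> \<le> 2 powr 2 * \<delta> powr (2 - 2 * \<alpha>)"
          using alpha by (intro mult_right_mono powr_mono) auto
        finally have "norm x powr (2 - 2 * \<alpha>) * g (t *\<^sub>R x) \<le> (4 * \<delta> powr (2 - 2 * \<alpha>)) * g (t *\<^sub>R x)"
          by (intro mult_right_mono g_nonneg) simp
        then show ?thesis by (simp add: g_nonneg ennreal_leI flip: ennreal_mult)
      qed (simp add: g_out)
    qed
    also have "\<dots> = ennreal (4 * \<delta> powr (2 - 2 * \<alpha>)) * (ennreal (t powr - real DIM('a)) * (\<integral>\<^sup>+x. ennreal (g x) \<partial>lborel))"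
      using nn_integral_dilation[of "\<lambda>x. ennreal (g x)" t] t0 by (simp add: nn_integral_cmult)
    also have "\<dots> \<le> ennreal (4 * \<delta> powr (2 - 2 * \<alpha>)) * (ennreal (2 ^ DIM('a)) * ennreal A)"
    proof (intro mult_left_mono mult_mono g_int ennreal_leI)
      have "t powr - real DIM('a) \<le> (1/2) powr - real DIM('a)" using s t by (intro powr_mono2') auto
      also have "\<dots> = 2 ^ DIM('a)" by (simp add: powr_minus powr_divide powr_realpow)
      finally show "t powr - real DIM('a) \<le> 2 ^ DIM('a)" .
    qed auto
    also have "\<dots> = ennreal (dil_const DIM('a) \<alpha> \<delta> * A)"
      using A_nonneg by (simp add: dil_const_def mult_ac power_add flip: ennreal_mult)
    finally show ?thesis .
  qed
  have "(\<integral>\<^sup>+x. ennreal (norm x powr (- 2 * \<alpha>) * (cmod (\<psi> x - \<psi> (s *\<^sub>R x)))\<^sup>2) \<partial>lborel)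
    \<le> (\<integral>\<^sup>+x. ennreal (1 - s) * (\<integral>\<^sup>+t. ennreal (indicator {s..1} t) * ennreal (norm x powr (2 - 2 * \<alpha>) * g (t *\<^sub>R x)) \<partial>lborel) \<partial>lborel)"
  proof (intro nn_integral_mono)
    fix x :: 'a
    have e: "norm x powr (- 2 * \<alpha>) * (norm x)\<^sup>2 = norm x powr (2 - 2 * \<alpha>)"
      by (cases "x = 0") (simp_all add: powr_add[symmetric] flip: powr_numeral)
    have "ennreal (norm x powr (- 2 * \<alpha>) * (cmod (\<psi> x - \<psi> (s *\<^sub>R x)))\<^sup>2)
      \<le> ennreal (norm x powr (- 2 * \<alpha>)) * (ennreal (1 - s) * (\<integral>\<^sup>+t. ennreal (indicator {s..1} t * ((norm x)\<^sup>2 * g (t *\<^sub>R x))) \<partial>lborel))"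
      using increment[OF s0 s(2), of x] by (simp add: ennreal_mult' mult_left_mono)
    also have "\<dots> = ennreal (1 - s) * (\<integral>\<^sup>+t. ennreal (norm x powr (- 2 * \<alpha>)) * ennreal (indicator {s..1} t * ((norm x)\<^sup>2 * g (t *\<^sub>R x))) \<partial>lborel)"
      by (subst nn_integral_cmult) (auto simp: mult_ac)
    also have "(\<lambda>t. ennreal (norm x powr (- 2 * \<alpha>)) * ennreal (indicator {s..1} t * ((norm x)\<^sup>2 * g (t *\<^sub>R x))))
        = (\<lambda>t. ennreal (indicator {s..1} t) * ennreal (norm x powr (2 - 2 * \<alpha>) * g (t *\<^sub>R x)))"
      by (simp only: e[symmetric]) (simp add: mult_ac flip: ennreal_mult')
    finally show "ennreal (norm x powr (- 2 * \<alpha>) * (cmod (\<psi> x - \<psi> (s *\<^sub>R x)))\<^sup>2)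
      \<le> ennreal (1 - s) * (\<integral>\<^sup>+t. ennreal (indicator {s..1} t) * ennreal (norm x powr (2 - 2 * \<alpha>) * g (t *\<^sub>R x)) \<partial>lborel)" .
  qed
  also have "\<dots> = ennreal (1 - s) * (\<integral>\<^sup>+x. (\<integral>\<^sup>+t. ennreal (indicator {s..1} t) * ennreal (norm x powr (2 - 2 * \<alpha>) * g (t *\<^sub>R x)) \<partial>lborel) \<partial>lborel)"
    by (intro nn_integral_cmult) measurable
  also have "(\<integral>\<^sup>+x. (\<integral>\<^sup>+t. ennreal (indicator {s..1} t) * ennreal (norm x powr (2 - 2 * \<alpha>) * g (t *\<^sub>R x)) \<partial>lborel) \<partial>lborel)
    = (\<integral>\<^sup>+t. (\<integral>\<^sup>+x. ennreal (indicator {s..1} t) * ennreal (norm x powr (2 - 2 * \<alpha>) * g (t *\<^sub>R x)) \<partial>lborel) \<partial>lborel)"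
    by (rule lborel_pair.Fubini'[symmetric]) measurable
  also have "\<dots> \<le> (\<integral>\<^sup>+t. ennreal (dil_const DIM('a) \<alpha> \<delta> * A) * indicator {s..1} t \<partial>lborel)"
    by (intro nn_integral_mono) (auto simp: indicator_def inner)
  also have "\<dots> = ennreal (dil_const DIM('a) \<alpha> \<delta> * A) * ennreal (1 - s)"
    using s by (simp add: nn_integral_cmult)
  also have "ennreal (1 - s) * \<dots> = ennreal ((1 - s)\<^sup>2 * (dil_const DIM('a) \<alpha> \<delta> * A))"
    using s A_nonneg dil_const_nonneg[of "DIM('a)" \<alpha> \<delta>]
    by (simp add: power2_eq_square mult_ac flip: ennreal_mult)
  finally show ?thesis by (simp add: mult_left_mono)
qed

text \<open>Scaling by \<open>1/2\<close> multiplies the weighted norm by more than \<open>1\<close>, so the weighted norm is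
  controlled by that of the increment.\<close>

lemma hardy_estimate:
  "(\<integral>\<^sup>+x. ennreal (norm x powr (- 2 * \<alpha>) * (cmod (\<psi> x))\<^sup>2) \<partial>lborel) \<le> ennreal (hardy_const DIM('a) \<alpha> \<delta> * A)"
proof -
  define q where "q = 2 powr (DIM('a) - 2 * \<alpha>)"
  \<comment> \<open>Half of the excess of q over 1, which is positive because n \<ge> 2 > 2
    \<alpha>. Young's inequality then costs a factor 1 + \<eta>, still less than q, and \<eta> times
    the norm survives on the left.\<close>
  define \<eta> where "\<eta> = (q - 1) / 2"
  define K where "K = dil_const DIM('a) \<alpha> \<delta> / 4 * A"
  have q: "q > 1" unfolding q_def using alpha dim by (intro gr_one_powr) auto
  then have \<eta>: "\<eta> > 0" by (simp add: \<eta>_def)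
  obtain \<Lambda> where \<Lambda>: "(\<integral>\<^sup>+x. ennreal (norm x powr (- 2 * \<alpha>) * (cmod (\<psi> x))\<^sup>2) \<partial>lborel) = ennreal \<Lambda>" "\<Lambda> \<ge> 0"
    using finite_weight by (cases "\<integral>\<^sup>+x. ennreal (norm x powr (- 2 * \<alpha>) * (cmod (\<psi> x))\<^sup>2) \<partial>lborel") auto
  have K0: "K \<ge> 0" using A_nonneg dil_const_nonneg[of "DIM('a)" \<alpha> \<delta>] by (simp add: K_def)
  have half: "(\<integral>\<^sup>+x. ennreal (norm x powr (- 2 * \<alpha>) * (cmod (\<psi> x - \<psi> ((1/2) *\<^sub>R x)))\<^sup>2) \<partial>lborel) \<le> ennreal K"
    using dil_half[of "1/2"] by (simp add: K_def power2_eq_square)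
  have "ennreal (q * \<Lambda>) = ennreal q * (\<integral>\<^sup>+x. ennreal (norm x powr (- 2 * \<alpha>) * (cmod (\<psi> x))\<^sup>2) \<partial>lborel)"
    using \<Lambda> q by (simp add: ennreal_mult)
  also have "ennreal q = ennreal ((1/2) powr (- (- 2 * \<alpha>) - DIM('a)))"
    unfolding q_def by (simp add: powr_divide powr_minus_divide[symmetric])
  also have "ennreal ((1/2) powr (- (- 2 * \<alpha>) - DIM('a))) * (\<integral>\<^sup>+x. ennreal (norm x powr (- 2 * \<alpha>) * (cmod (\<psi> x))\<^sup>2) \<partial>lborel)
      = (\<integral>\<^sup>+x. ennreal (norm x powr (- 2 * \<alpha>) * (cmod (\<psi> ((1/2) *\<^sub>R x)))\<^sup>2) \<partial>lborel)"
    by (rule nn_integral_dilated_weight[symmetric]) auto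
  also have "\<dots> \<le> (\<integral>\<^sup>+x. ennreal (1 + \<eta>) * ennreal (norm x powr (- 2 * \<alpha>) * (cmod (\<psi> x))\<^sup>2)
      + ennreal (1 + 1 / \<eta>) * ennreal (norm x powr (- 2 * \<alpha>) * (cmod (\<psi> x - \<psi> ((1/2) *\<^sub>R x)))\<^sup>2) \<partial>lborel)"
  proof (intro nn_integral_mono)
    fix x
    let ?a = "cmod (\<psi> x)" and ?b = "cmod (\<psi> x - \<psi> ((1/2) *\<^sub>R x))" and ?n = "norm x powr (- 2 * \<alpha>)"
    have "cmod (\<psi> ((1/2) *\<^sub>R x)) \<le> ?a + ?b" by norm
    then have "(cmod (\<psi> ((1/2) *\<^sub>R x)))\<^sup>2 \<le> (?a + ?b)\<^sup>2" by (intro power_mono) auto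
    also have "\<dots> \<le> (1 + \<eta>) * ?a\<^sup>2 + (1 + 1 / \<eta>) * ?b\<^sup>2"
    proof -
      have "0 \<le> (\<eta> * ?a - ?b)\<^sup>2 / \<eta>" using \<eta> by simp
      also have "\<dots> = \<eta> * ?a\<^sup>2 - 2 * ?a * ?b + ?b\<^sup>2 / \<eta>"
        using \<eta> by (simp add: power2_eq_square field_simps)
      finally show ?thesis by (simp add: power2_sum algebra_simps)
    qed
    finally have "?n * (cmod (\<psi> ((1/2) *\<^sub>R x)))\<^sup>2 \<le> ?n * ((1 + \<eta>) * ?a\<^sup>2 + (1 + 1 / \<eta>) * ?b\<^sup>2)"
      by (rule mult_left_mono) simp
    also have "\<dots> = (1 + \<eta>) * (?n * ?a\<^sup>2) + (1 + 1 / \<eta>) * (?n * ?b\<^sup>2)"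
      by (simp add: algebra_simps)
    finally have "ennreal (?n * (cmod (\<psi> ((1/2) *\<^sub>R x)))\<^sup>2) \<le> ennreal ((1 + \<eta>) * (?n * ?a\<^sup>2) + (1 + 1 / \<eta>) * (?n * ?b\<^sup>2))"
      by (rule ennreal_leI)
    also have "\<dots> = ennreal (1 + \<eta>) * ennreal (?n * ?a\<^sup>2) + ennreal (1 + 1 / \<eta>) * ennreal (?n * ?b\<^sup>2)"
      using \<eta> by (subst ennreal_plus) (auto simp: ennreal_mult')
    finally show "ennreal (?n * (cmod (\<psi> ((1/2) *\<^sub>R x)))\<^sup>2) \<le> ennreal (1 + \<eta>) * ennreal (?n * ?a\<^sup>2) + ennreal (1 + 1 / \<eta>) * ennreal (?n * ?b\<^sup>2)" .
  qed
  also have "\<dots> = ennreal (1 + \<eta>) * ennreal \<Lambda> + ennreal (1 + 1 / \<eta>) * (\<integral>\<^sup>+x. ennreal (norm x powr (- 2 * \<alpha>) * (cmod (\<psi> x - \<psi> ((1/2) *\<^sub>R x)))\<^sup>2) \<partial>lborel)"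
    unfolding \<Lambda>(1)[symmetric] by (subst nn_integral_add) (auto simp: nn_integral_cmult)
  also have "\<dots> \<le> ennreal (1 + \<eta>) * ennreal \<Lambda> + ennreal (1 + 1 / \<eta>) * ennreal K"
    by (intro add_mono mult_left_mono half) auto
  also have "\<dots> = ennreal ((1 + \<eta>) * \<Lambda> + (1 + 1 / \<eta>) * K)"
    using \<eta> \<Lambda> K0 by (subst ennreal_plus) (auto simp: ennreal_mult')
  finally have "q * \<Lambda> \<le> (1 + \<eta>) * \<Lambda> + (1 + 1 / \<eta>) * K"
    using \<eta> \<Lambda> K0 by (subst (asm) ennreal_le_iff) auto
  moreover have "q * \<Lambda> = (1 + 2 * \<eta>) * \<Lambda>" by (simp add: \<eta>_def field_simps)
  ultimately have "\<eta> * \<Lambda> \<le> (1 + 1 / \<eta>) * K" by (simp add: algebra_simps)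
  then have "\<Lambda> \<le> 1 / \<eta> * ((1 + 1 / \<eta>) * K)" using \<eta> by (simp add: field_simps)
  also have "\<dots> = hardy_const DIM('a) \<alpha> \<delta> * A"
    by (simp add: \<eta>_def K_def hardy_const_def q_def Let_def)
  finally show ?thesis unfolding \<Lambda>(1) by (rule ennreal_leI)
qed

text \<open>For s < 1/2 the increment is no better than its two terms, and s^(2\<alpha>-n) is the
  growth of the weighted norm under dilation. Keeping (1-s)^2 there as well, at the cost of a
  constant, gives one formula for all s in (0, 1).\<close>

lemma dilation_class_estimates:
  "(\<integral>\<^sup>+x. ennreal (norm x powr (- 2 * \<alpha>) * (cmod (\<psi> x))\<^sup>2) \<partial>lborel) \<le> ennreal (class_const DIM('a) \<alpha> \<delta> * A)"
  "0 < s \<Longrightarrow> s < 1 \<Longrightarrow>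
    (\<integral>\<^sup>+x. ennreal (norm x powr (- 2 * \<alpha>) * (cmod (\<psi> x - \<psi> (s *\<^sub>R x)))\<^sup>2) \<partial>lborel)
      \<le> ennreal ((1 - s)\<^sup>2 * s powr (2 * \<alpha> - DIM('a))) * ennreal (class_const DIM('a) \<alpha> \<delta> * A)"
proof -
  have hc: "hardy_const DIM('a) \<alpha> \<delta> \<ge> 0" using alpha dim by (intro hardy_const_nonneg) auto
  note dc = dil_const_nonneg[of "DIM('a)" \<alpha> \<delta>]
  have "hardy_const DIM('a) \<alpha> \<delta> * A \<le> class_const DIM('a) \<alpha> \<delta> * A"
    using hc dc A_nonneg by (intro mult_right_mono) (auto simp: class_const_def)
  then show "(\<integral>\<^sup>+x. ennreal (norm x powr (- 2 * \<alpha>) * (cmod (\<psi> x))\<^sup>2) \<partial>lborel) \<le> ennreal (class_const DIM('a) \<alpha> \<delta> * A)"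
    using hardy_estimate by (blast intro: order_trans ennreal_leI)
  assume s: "0 < s" "s < 1"
  have p1: "1 \<le> s powr (2 * \<alpha> - DIM('a))"
    using s alpha dim powr_mono'[of "2 * \<alpha> - DIM('a)" 0 s] by simp
  show "(\<integral>\<^sup>+x. ennreal (norm x powr (- 2 * \<alpha>) * (cmod (\<psi> x - \<psi> (s *\<^sub>R x)))\<^sup>2) \<partial>lborel)
      \<le> ennreal ((1 - s)\<^sup>2 * s powr (2 * \<alpha> - DIM('a))) * ennreal (class_const DIM('a) \<alpha> \<delta> * A)"
  proof (cases "1 / 2 \<le> s")
    case True
    have "(1 - s)\<^sup>2 * 1 * (dil_const DIM('a) \<alpha> \<delta> * A) \<le> (1 - s)\<^sup>2 * s powr (2 * \<alpha> - DIM('a)) * (class_const DIM('a) \<alpha> \<delta> * A)"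
      using p1 hc dc A_nonneg by (intro mult_mono) (auto simp: class_const_def)
    then have "ennreal ((1 - s)\<^sup>2 * (dil_const DIM('a) \<alpha> \<delta> * A))
      \<le> ennreal ((1 - s)\<^sup>2 * s powr (2 * \<alpha> - DIM('a)) * (class_const DIM('a) \<alpha> \<delta> * A))"
      by (intro ennreal_leI) simp
    then show ?thesis
      using dil_half[OF True s(2)] by (simp add: ennreal_mult' mult.assoc)
  next
    case False
    let ?L = "\<integral>\<^sup>+x. ennreal (norm x powr (- 2 * \<alpha>) * (cmod (\<psi> x))\<^sup>2) \<partial>lborel"
    have "(\<integral>\<^sup>+x. ennreal (norm x powr (- 2 * \<alpha>) * (cmod (\<psi> x - \<psi> (s *\<^sub>R x)))\<^sup>2) \<partial>lborel)
      \<le> (\<integral>\<^sup>+x. 2 * ennreal (norm x powr (- 2 * \<alpha>) * (cmod (\<psi> x))\<^sup>2) + 2 * ennreal (norm x powr (- 2 * \<alpha>) * (cmod (\<psi> (s *\<^sub>R x)))\<^sup>2) \<partial>lborel)"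
    proof (intro nn_integral_mono)
      fix x
      have "(cmod (\<psi> x - \<psi> (s *\<^sub>R x)))\<^sup>2 \<le> (cmod (\<psi> x) + cmod (\<psi> (s *\<^sub>R x)))\<^sup>2"
        by (intro power_mono norm_triangle_ineq4) auto
      also have "\<dots> \<le> 2 * (cmod (\<psi> x))\<^sup>2 + 2 * (cmod (\<psi> (s *\<^sub>R x)))\<^sup>2"
        using zero_le_power2[of "cmod (\<psi> x) - cmod (\<psi> (s *\<^sub>R x))"] by (simp add: power2_diff power2_sum)
      finally have "norm x powr (- 2 * \<alpha>) * (cmod (\<psi> x - \<psi> (s *\<^sub>R x)))\<^sup>2
        \<le> norm x powr (- 2 * \<alpha>) * (2 * (cmod (\<psi> x))\<^sup>2 + 2 * (cmod (\<psi> (s *\<^sub>R x)))\<^sup>2)"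
        by (rule mult_left_mono) simp
      from ennreal_leI[OF this]
      show "ennreal (norm x powr (- 2 * \<alpha>) * (cmod (\<psi> x - \<psi> (s *\<^sub>R x)))\<^sup>2)
        \<le> 2 * ennreal (norm x powr (- 2 * \<alpha>) * (cmod (\<psi> x))\<^sup>2) + 2 * ennreal (norm x powr (- 2 * \<alpha>) * (cmod (\<psi> (s *\<^sub>R x)))\<^sup>2)"
        by (simp add: distrib_left mult.left_commute[of _ 2] ennreal_mult)
    qed
    also have "\<dots> = 2 * ?L + 2 * (ennreal (s powr (2 * \<alpha> - DIM('a))) * ?L)"
      using nn_integral_dilated_weight[OF psi_meas s(1), of "- 2 * \<alpha>"]
      by (subst nn_integral_add) (auto simp: nn_integral_cmult)
    also have "\<dots> \<le> 2 * (ennreal (s powr (2 * \<alpha> - DIM('a))) * ?L) + 2 * (ennreal (s powr (2 * \<alpha> - DIM('a))) * ?L)"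
    proof (intro add_mono mult_left_mono)
      show "?L \<le> ennreal (s powr (2 * \<alpha> - DIM('a))) * ?L"
        using mult_right_mono[of 1 "ennreal (s powr (2 * \<alpha> - DIM('a)))" ?L] p1 by simp
    qed auto
    also have "\<dots> = 4 * (ennreal (s powr (2 * \<alpha> - DIM('a))) * ?L)"
      by (simp flip: distrib_right)
    also have "\<dots> \<le> 4 * (ennreal (s powr (2 * \<alpha> - DIM('a))) * ennreal (hardy_const DIM('a) \<alpha> \<delta> * A))"
      by (intro mult_left_mono hardy_estimate) auto
    also have "\<dots> = ennreal (4 * (s powr (2 * \<alpha> - DIM('a)) * (hardy_const DIM('a) \<alpha> \<delta> * A)))"
      using hc A_nonneg by (simp add: ennreal_mult)
    also have "\<dots> \<le> ennreal ((1 - s)\<^sup>2 * s powr (2 * \<alpha> - DIM('a)) * (class_const DIM('a) \<alpha> \<delta> * A))"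
    proof (rule ennreal_leI)
      have "1 / 4 \<le> (1 - s)\<^sup>2"
        using power_mono[of "1/2" "1 - s" 2] False by (simp add: power2_eq_square)
      then have "1 / 4 * s powr (2 * \<alpha> - DIM('a)) * (16 * hardy_const DIM('a) \<alpha> \<delta> * A)
        \<le> (1 - s)\<^sup>2 * s powr (2 * \<alpha> - DIM('a)) * (class_const DIM('a) \<alpha> \<delta> * A)"
        using hc dc A_nonneg by (intro mult_mono mult_right_mono) (auto simp: class_const_def)
      then show "4 * (s powr (2 * \<alpha> - DIM('a)) * (hardy_const DIM('a) \<alpha> \<delta> * A)) \<le> (1 - s)\<^sup>2 * s powr (2 * \<alpha> - DIM('a)) * (class_const DIM('a) \<alpha> \<delta> * A)"
        by (simp add: mult_ac)
    qed
    also have "\<dots> = ennreal ((1 - s)\<^sup>2 * s powr (2 * \<alpha> - DIM('a))) * ennreal (class_const DIM('a) \<alpha> \<delta> * A)"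
      by (rule ennreal_mult') simp
    finally show ?thesis .
  qed
qed

end

lemma AE_dilation1:
  fixes P :: "'a::euclidean_space \<Rightarrow> bool"
  assumes "AE x in lborel. P x" and s: "s > 0"
  shows "AE x in lborel. P (s *\<^sub>R x)"
proof -
  from assms(1) obtain N where N: "N \<in> null_sets lborel" "{x. \<not> P x} \<subseteq> N"
    by (auto simp: eventually_ae_filter)
  then have [measurable]: "N \<in> sets borel" and e: "emeasure lborel N = 0" by auto
  have "(\<integral>\<^sup>+x. indicator N (s *\<^sub>R x) \<partial>lborel) = 0"
    using nn_integral_dilation[of "indicator N" s] s e by simp
  then have "AE x in lborel. indicator N (s *\<^sub>R x) = (0::ennreal)"
    by (subst (asm) nn_integral_0_iff_AE) auto
  then show ?thesis
    by eventually_elim (use N(2) in \<open>auto simp: indicator_def split: if_splits\<close>)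
qed

text \<open>Fatou's lemma, in the form that carries weighted estimates from test functions to their
  limit in H^1_0; \<open>B\<close> will be a multiple of the Dirichlet integrals of the
  approximations, which converge.\<close>

lemma nn_integral_le_limit:
  fixes u :: "nat \<Rightarrow> 'a \<Rightarrow> complex" and B :: "nat \<Rightarrow> real"
  assumes [measurable]: "\<And>k. u k \<in> borel_measurable M" "\<rho> \<in> borel_measurable M"
    and lim: "AE x in M. (\<lambda>k. u k x) \<longlonglongrightarrow> v x"
    and le: "\<And>k. (\<integral>\<^sup>+x. ennreal (\<rho> x * (cmod (u k x))\<^sup>2) \<partial>M) \<le> C * ennreal (B k)"
    and B: "B \<longlonglongrightarrow> b" and C: "C < \<infinity>"
  shows "(\<integral>\<^sup>+x. ennreal (\<rho> x * (cmod (v x))\<^sup>2) \<partial>M) \<le> C * ennreal b"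
proof -
  have "(\<integral>\<^sup>+x. ennreal (\<rho> x * (cmod (v x))\<^sup>2) \<partial>M) = (\<integral>\<^sup>+x. liminf (\<lambda>k. ennreal (\<rho> x * (cmod (u k x))\<^sup>2)) \<partial>M)"
  proof (rule nn_integral_cong_AE)
    show "AE x in M. ennreal (\<rho> x * (cmod (v x))\<^sup>2) = liminf (\<lambda>k. ennreal (\<rho> x * (cmod (u k x))\<^sup>2))"
      using lim
    proof eventually_elim
      case (elim x)
      then have "(\<lambda>k. ennreal (\<rho> x * (cmod (u k x))\<^sup>2)) \<longlonglongrightarrow> ennreal (\<rho> x * (cmod (v x))\<^sup>2)"
        by (intro tendsto_intros) auto
      then show ?case by (intro lim_imp_Liminf[symmetric]) auto
    qed
  qed
  also have "\<dots> \<le> liminf (\<lambda>k. \<integral>\<^sup>+x. ennreal (\<rho> x * (cmod (u k x))\<^sup>2) \<partial>M)"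
    by (rule nn_integral_liminf) measurable
  also have "\<dots> \<le> liminf (\<lambda>k. C * ennreal (B k))"
    by (rule Liminf_mono) (auto simp: le)
  also have "\<dots> = C * ennreal b"
    using C B by (intro lim_imp_Liminf ennreal_tendsto_cmult tendsto_ennrealI) auto
  finally show ?thesis .
qed

lemma sq_integrable_iff_nn:
  fixes f :: "'a \<Rightarrow> complex"
  assumes [measurable]: "f \<in> borel_measurable M"
  shows "integrable M (\<lambda>x. (cmod (f x))\<^sup>2) \<longleftrightarrow> (\<integral>\<^sup>+x. ennreal ((cmod (f x))\<^sup>2) \<partial>M) < \<infinity>"
  unfolding integrable_iff_bounded by simp

lemma sq_integrable_bound:
  fixes f :: "'a \<Rightarrow> complex"
  assumes [measurable]: "f \<in> borel_measurable M"
    and le: "(\<integral>\<^sup>+x. ennreal ((cmod (f x))\<^sup>2) \<partial>M) \<le> ennreal B" and "B \<ge> 0"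
  shows "integrable M (\<lambda>x. (cmod (f x))\<^sup>2)" "(LINT x|M. (cmod (f x))\<^sup>2) \<le> B"
proof -
  show i: "integrable M (\<lambda>x. (cmod (f x))\<^sup>2)"
    using le by (simp add: sq_integrable_iff_nn order_le_less_trans)
  show "(LINT x|M. (cmod (f x))\<^sup>2) \<le> B"
    using le \<open>B \<ge> 0\<close> by (simp add: nn_integral_eq_integral[OF i] ennreal_le_iff)
qed

lemma Cauchy_Schwarz_integral:
  fixes f g :: "'a \<Rightarrow> complex"
  assumes [measurable]: "f \<in> borel_measurable M" "g \<in> borel_measurable M"
    and f: "integrable M (\<lambda>x. (cmod (f x))\<^sup>2)" and g: "integrable M (\<lambda>x. (cmod (g x))\<^sup>2)"
  shows "integrable M (\<lambda>x. f x * g x)"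
    and "cmod (LINT x|M. f x * g x) \<le> sqrt (LINT x|M. (cmod (f x))\<^sup>2) * sqrt (LINT x|M. (cmod (g x))\<^sup>2)"
proof -
  show i: "integrable M (\<lambda>x. f x * g x)"
  proof (rule Bochner_Integration.integrable_bound)
    show "integrable M (\<lambda>x. ((cmod (f x))\<^sup>2 + (cmod (g x))\<^sup>2) / 2)" using f g by simp
    have "cmod (f x) * cmod (g x) \<le> ((cmod (f x))\<^sup>2 + (cmod (g x))\<^sup>2) / 2" for x
      using sum_squares_bound[of "cmod (f x)" "cmod (g x)"] by simp
    then show "AE x in M. norm (f x * g x) \<le> norm (((cmod (f x))\<^sup>2 + (cmod (g x))\<^sup>2) / 2)"
      by (auto simp: norm_mult)
  qed simp
  have "ennreal ((cmod (LINT x|M. f x * g x))\<^sup>2) \<le> (\<integral>\<^sup>+x. ennreal (cmod (f x * g x)) \<partial>M)\<^sup>2"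
    using i by (auto simp: ennreal_power[symmetric] nn_integral_eq_integral intro!: power_mono ennreal_leI)
  also have "\<dots> \<le> (\<integral>\<^sup>+x. (ennreal (cmod (f x)))\<^sup>2 \<partial>M) * (\<integral>\<^sup>+x. (ennreal (cmod (g x)))\<^sup>2 \<partial>M)"
    using nn_integral_Cauchy_Schwarz[of "\<lambda>x. ennreal (cmod (f x))" M "\<lambda>x. ennreal (cmod (g x))"]
    by (simp add: norm_mult ennreal_mult)
  also have "\<dots> = ennreal ((LINT x|M. (cmod (f x))\<^sup>2) * (LINT x|M. (cmod (g x))\<^sup>2))"
    using f g by (simp add: ennreal_power nn_integral_eq_integral ennreal_mult)
  finally have "(cmod (LINT x|M. f x * g x))\<^sup>2 \<le> (LINT x|M. (cmod (f x))\<^sup>2) * (LINT x|M. (cmod (g x))\<^sup>2)"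
    by (simp add: ennreal_le_iff)
  then show "cmod (LINT x|M. f x * g x) \<le> sqrt (LINT x|M. (cmod (f x))\<^sup>2) * sqrt (LINT x|M. (cmod (g x))\<^sup>2)"
    by (simp add: real_le_rsqrt flip: real_sqrt_mult)
qed

lemma ennreal_sum_sq_le: "((a::ennreal) + b)\<^sup>2 \<le> 2 * a\<^sup>2 + 2 * b\<^sup>2"
proof (cases a; cases b)
  fix r s assume rs: "a = ennreal r" "0 \<le> r" "b = ennreal s" "0 \<le> s"
  have "(r + s)\<^sup>2 \<le> 2 * r\<^sup>2 + 2 * s\<^sup>2"
    using zero_le_power2[of "r - s"] by (simp add: power2_diff power2_sum)
  then have "ennreal ((r + s)\<^sup>2) \<le> ennreal (2 * r\<^sup>2 + 2 * s\<^sup>2)" by (rule ennreal_leI)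
  moreover have "(a + b)\<^sup>2 = ennreal ((r + s)\<^sup>2)"
    using rs by (simp add: ennreal_power flip: ennreal_plus)
  ultimately show ?thesis using rs by (simp add: ennreal_mult ennreal_power)
qed (auto simp: power2_eq_square ennreal_mult_top ennreal_top_mult)

subsection \<open>The fractional derivatives as averages over dilations\<close>

text \<open>The factor that Minkowski's inequality yields for the left derivative: the kernel is
  integrated against the bound (1-s) s^(\<alpha>-n/2) for the norm of an increment. The product is
  the Beta integrand (1-s)^(-\<alpha>) s^(n/2+\<alpha>-1), so the value is finite.\<close>

definition left_const :: "nat \<Rightarrow> real \<Rightarrow> real" where
  "left_const n \<alpha> = enn2real (\<integral>\<^sup>+s. ennreal (left_kernel n \<alpha> s * ((1 - s) * s powr (\<alpha> - n / 2))) \<partial>lborel)"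

lemma left_const:
  assumes "0 < \<alpha>" "\<alpha> < 1" "n \<ge> 1"
  shows "(\<integral>\<^sup>+s. ennreal (left_kernel n \<alpha> s * ((1 - s) * s powr (\<alpha> - n / 2))) \<partial>lborel) = ennreal (left_const n \<alpha>)"
proof -
  have "left_kernel n \<alpha> s * ((1 - s) * s powr (\<alpha> - n / 2)) = indicator {0<..<1} s * ((1 - s) powr (- \<alpha>) * s powr (n / 2 + \<alpha> - 1))" for s
  proof (cases "0 < s \<and> s < 1")
    case True
    then have *: "s ^ (n - 1) = s powr (real n - 1)" using assms by (simp add: of_nat_diff flip: powr_realpow)
    have **: "s powr (real n - 1) * s powr (\<alpha> - n / 2) = s powr (n / 2 + \<alpha> - 1)"
      by (simp add: add_diff_eq flip: powr_add)
    have "left_kernel n \<alpha> s * ((1 - s) * s powr (\<alpha> - n / 2))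
        = (1 - s) * (1 - s) powr (- \<alpha> - 1) * (s powr (real n - 1) * s powr (\<alpha> - n / 2))"
      using True * by (simp add: left_kernel_def)
    also have "(1 - s) * (1 - s) powr (- \<alpha> - 1) = (1 - s) powr (- \<alpha>)" using True by (simp add: powr_mult_base)
    finally show ?thesis using True ** by simp
  qed (auto simp: left_kernel_def)
  then show ?thesis
    using nn_integral_beta_kernel_finite[of "- \<alpha>" "n / 2 + \<alpha> - 1"] assms
    by (simp add: left_const_def)
qed

lemma left_const_nonneg [simp]: "left_const n \<alpha> \<ge> 0"
  by (simp add: left_const_def)

definition frac_left :: "real \<Rightarrow> ('a::euclidean_space \<Rightarrow> complex) \<Rightarrow> 'a \<Rightarrow> complex" where
  "frac_left \<alpha> w x = norm x powr (- \<alpha>) *\<^sub>R ((\<alpha> / Gamma (1 - \<alpha>)) *\<^sub>R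
     (LINT s|lborel. left_kernel DIM('a) \<alpha> s *\<^sub>R (w x - w (s *\<^sub>R x))) + kip_const DIM('a) \<alpha> *\<^sub>R w x)"

text \<open>No boundary term appears: for f extended by zero, f(Q) (d-r)^(-\<alpha>) /
  \<Gamma>(1-\<alpha>) is the part of the average over s \<le> r/d, where x/s has left the
  domain.\<close>

definition frac_right :: "real \<Rightarrow> ('a::euclidean_space \<Rightarrow> complex) \<Rightarrow> 'a \<Rightarrow> complex" where
  "frac_right \<alpha> f x = norm x powr (- \<alpha>) *\<^sub>R ((\<alpha> / Gamma (1 - \<alpha>)) *\<^sub>R
     (LINT s|lborel. right_kernel \<alpha> s *\<^sub>R (f x - f (x /\<^sub>R s))))"

definition frac_const :: "nat \<Rightarrow> real \<Rightarrow> real" where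
  "frac_const n \<alpha> = 2 * ((\<alpha> / Gamma (1 - \<alpha>) * left_const n \<alpha>)\<^sup>2 + (kip_const n \<alpha>)\<^sup>2)"

lemma frac_const_nonneg [simp]: "frac_const n \<alpha> \<ge> 0"
  by (simp add: frac_const_def)

text \<open>What is retained of membership in H^1_0: D is the domain moved so that P becomes the
  origin, star-shaped about this point although the point is not in D; w is a Borel representative
  extended by zero, and B will be a constant times its Dirichlet integral.\<close>

locale dilation_class =
  fixes D :: "'a::euclidean_space set" and \<alpha> \<delta> B :: real and w :: "'a \<Rightarrow> complex"
  assumes alpha: "0 < \<alpha>" "\<alpha> < 1" and dim: "2 \<le> DIM('a)"
    and D_borel [measurable]: "D \<in> sets borel"
    and D_star: "\<And>x s. x \<in> D \<Longrightarrow> 0 < s \<Longrightarrow> s \<le> 1 \<Longrightarrow> s *\<^sub>R x \<in> D"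
    and D_bdd: "\<And>x. x \<in> D \<Longrightarrow> norm x \<le> \<delta>" and D_0: "0 \<notin> D"
    and w_meas [measurable]: "w \<in> borel_measurable borel" and w_out: "\<And>x. x \<notin> D \<Longrightarrow> w x = 0"
    and B_nonneg: "B \<ge> 0"
    and hardy: "(\<integral>\<^sup>+x. ennreal (norm x powr (- 2 * \<alpha>) * (cmod (w x))\<^sup>2) \<partial>lborel) \<le> ennreal B"
    and dil: "\<And>s. 0 < s \<Longrightarrow> s < 1 \<Longrightarrow>
      (\<integral>\<^sup>+x. ennreal (norm x powr (- 2 * \<alpha>) * (cmod (w x - w (s *\<^sub>R x)))\<^sup>2) \<partial>lborel)
        \<le> ennreal ((1 - s)\<^sup>2 * s powr (2 * \<alpha> - DIM('a))) * ennreal B"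
begin

lemma Gamma_pos: "Gamma (1 - \<alpha>) > 0"
  using alpha by (intro Gamma_real_pos) auto

lemma kip_nonneg: "kip_const DIM('a) \<alpha> \<ge> 0"
  using alpha dim by (auto simp: kip_const_def intro!: divide_nonneg_nonneg Gamma_real_nonneg)

lemma sq_eq: "(ennreal (norm x powr (- \<alpha>) * cmod z))\<^sup>2 = ennreal (norm (x::'a) powr (- 2 * \<alpha>) * (cmod z)\<^sup>2)"
  by (simp add: ennreal_power power_mult_distrib power2_eq_square[of "norm x powr _"] flip: powr_add)

text \<open>Minkowski's inequality, where the factor 1 - s in \<open>dil\<close> lowers the
  singularity of k at 1 to the integrable (1-s)^(-\<alpha>).\<close>

lemma left_bound:
  "(\<integral>\<^sup>+x. (\<integral>\<^sup>+s. ennreal (left_kernel DIM('a) \<alpha> s) * ennreal (norm x powr (- \<alpha>) * cmod (w x - w (s *\<^sub>R x))) \<partial>lborel)\<^sup>2 \<partial>lborel)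
    \<le> ennreal ((left_const DIM('a) \<alpha>)\<^sup>2 * B)"
proof -
  have "(\<integral>\<^sup>+x. (\<integral>\<^sup>+s. ennreal (left_kernel DIM('a) \<alpha> s) * ennreal (norm x powr (- \<alpha>) * cmod (w x - w (s *\<^sub>R x))) \<partial>lborel)\<^sup>2 \<partial>lborel)
    \<le> (\<integral>\<^sup>+s. ennreal (left_kernel DIM('a) \<alpha> s * ((1 - s) * s powr (\<alpha> - DIM('a) / 2))) \<partial>lborel)\<^sup>2 * ennreal B"
  proof (rule nn_integral_Minkowski_weight)
    fix s assume "left_kernel DIM('a) \<alpha> s \<noteq> 0"
    then have s: "0 < s" "s < 1" by (auto simp: left_kernel_def split: if_splits)
    then show "0 < (1 - s) * s powr (\<alpha> - DIM('a) / 2)" by simp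
    have "((1 - s) * s powr (\<alpha> - DIM('a) / 2))\<^sup>2 = (1 - s)\<^sup>2 * s powr (2 * \<alpha> - DIM('a))"
      by (simp add: power_mult_distrib power2_eq_square[of "_ powr _"] flip: powr_add)
    then show "(\<integral>\<^sup>+x. (ennreal (norm x powr (- \<alpha>) * cmod (w x - w (s *\<^sub>R x))))\<^sup>2 \<partial>lborel)
        \<le> ennreal (((1 - s) * s powr (\<alpha> - DIM('a) / 2))\<^sup>2) * ennreal B"
      using dil[OF s] by (simp only: sq_eq)
  qed (auto simp: kernels_nonneg lborel.sigma_finite_measure_axioms)
  also have "\<dots> = ennreal ((left_const DIM('a) \<alpha>)\<^sup>2 * B)"
    using alpha dim B_nonneg by (simp add: left_const ennreal_power ennreal_mult)
  finally show ?thesis .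
qed

lemma frac_left_measurable [measurable]: "frac_left \<alpha> w \<in> borel_measurable borel"
  unfolding frac_left_def by measurable

lemma norm_frac_left_le:
  "ennreal (cmod (frac_left \<alpha> w x)) \<le> ennreal (\<alpha> / Gamma (1 - \<alpha>)) *
     (\<integral>\<^sup>+s. ennreal (left_kernel DIM('a) \<alpha> s) * ennreal (norm x powr (- \<alpha>) * cmod (w x - w (s *\<^sub>R x))) \<partial>lborel)
   + ennreal (kip_const DIM('a) \<alpha>) * ennreal (norm x powr (- \<alpha>) * cmod (w x))"
proof -
  let ?I = "LINT s|lborel. left_kernel DIM('a) \<alpha> s *\<^sub>R (w x - w (s *\<^sub>R x))"
  have "cmod (frac_left \<alpha> w x) \<le> \<alpha> / Gamma (1 - \<alpha>) * (norm x powr (- \<alpha>) * cmod ?I)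
      + kip_const DIM('a) \<alpha> * (norm x powr (- \<alpha>) * cmod (w x))"
  proof -
    have "cmod (frac_left \<alpha> w x) = norm x powr (- \<alpha>) * cmod ((\<alpha> / Gamma (1 - \<alpha>)) *\<^sub>R ?I + kip_const DIM('a) \<alpha> *\<^sub>R w x)"
      by (simp add: frac_left_def)
    also have "\<dots> \<le> norm x powr (- \<alpha>) * (cmod ((\<alpha> / Gamma (1 - \<alpha>)) *\<^sub>R ?I) + cmod (kip_const DIM('a) \<alpha> *\<^sub>R w x))"
      by (intro mult_left_mono norm_triangle_ineq) simp
    finally have "cmod (frac_left \<alpha> w x) \<le> norm x powr (- \<alpha>) * (cmod ((\<alpha> / Gamma (1 - \<alpha>)) *\<^sub>R ?I) + cmod (kip_const DIM('a) \<alpha> *\<^sub>R w x))" .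
    then show ?thesis
      using alpha Gamma_pos kip_nonneg by (simp add: algebra_simps)
  qed
  then have "ennreal (cmod (frac_left \<alpha> w x)) \<le> ennreal (\<alpha> / Gamma (1 - \<alpha>)) * (ennreal (norm x powr (- \<alpha>)) * ennreal (cmod ?I))
      + ennreal (kip_const DIM('a) \<alpha>) * ennreal (norm x powr (- \<alpha>) * cmod (w x))"
    using alpha Gamma_pos kip_nonneg
    by (subst ennreal_mult[symmetric] ennreal_plus[symmetric], simp, simp)+ (rule ennreal_leI)
  \<comment> \<open>Where the integrand is not integrable the Bochner integral is 0 by convention,
    so the bound holds at every point and not only almost everywhere.\<close>
  also have "ennreal (cmod ?I) \<le> (\<integral>\<^sup>+s. ennreal (left_kernel DIM('a) \<alpha> s) * ennreal (cmod (w x - w (s *\<^sub>R x))) \<partial>lborel)"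
  proof (cases "integrable lborel (\<lambda>s. left_kernel DIM('a) \<alpha> s *\<^sub>R (w x - w (s *\<^sub>R x)))")
    case True
    then show ?thesis
      using integral_norm_bound_ennreal[OF True] by (simp add: kernels_nonneg ennreal_mult)
  qed (simp add: not_integrable_integral_eq)
  also have "ennreal (norm x powr (- \<alpha>)) * (\<integral>\<^sup>+s. ennreal (left_kernel DIM('a) \<alpha> s) * ennreal (cmod (w x - w (s *\<^sub>R x))) \<partial>lborel)
      = (\<integral>\<^sup>+s. ennreal (left_kernel DIM('a) \<alpha> s) * ennreal (norm x powr (- \<alpha>) * cmod (w x - w (s *\<^sub>R x))) \<partial>lborel)"
    by (subst nn_integral_cmult[symmetric]) (auto simp: ennreal_mult mult_ac)
  finally show ?thesis by (simp add: mult_left_mono)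
qed

lemma frac_left_sq_le: "(\<integral>\<^sup>+x. ennreal ((cmod (frac_left \<alpha> w x))\<^sup>2) \<partial>lborel) \<le> ennreal (frac_const DIM('a) \<alpha> * B)"
proof -
  let ?c = "\<alpha> / Gamma (1 - \<alpha>)" and ?C = "kip_const DIM('a) \<alpha>"
  have c: "?c \<ge> 0" using alpha Gamma_pos by simp
  let ?J = "\<lambda>x. \<integral>\<^sup>+s. ennreal (left_kernel DIM('a) \<alpha> s) * ennreal (norm x powr (- \<alpha>) * cmod (w x - w (s *\<^sub>R x))) \<partial>lborel"
  have "(\<integral>\<^sup>+x. ennreal ((cmod (frac_left \<alpha> w x))\<^sup>2) \<partial>lborel) \<le>
    (\<integral>\<^sup>+x. 2 * (ennreal ?c * ?J x)\<^sup>2 + 2 * (ennreal ?C * ennreal (norm x powr (- \<alpha>) * cmod (w x)))\<^sup>2 \<partial>lborel)"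
  proof (intro nn_integral_mono)
    fix x
    have "ennreal ((cmod (frac_left \<alpha> w x))\<^sup>2) = (ennreal (cmod (frac_left \<alpha> w x)))\<^sup>2"
      by (simp add: ennreal_power)
    also have "\<dots> \<le> (ennreal ?c * ?J x + ennreal ?C * ennreal (norm x powr (- \<alpha>) * cmod (w x)))\<^sup>2"
      by (intro power_mono norm_frac_left_le) auto
    also note ennreal_sum_sq_le
    finally show "ennreal ((cmod (frac_left \<alpha> w x))\<^sup>2) \<le>
      2 * (ennreal ?c * ?J x)\<^sup>2 + 2 * (ennreal ?C * ennreal (norm x powr (- \<alpha>) * cmod (w x)))\<^sup>2" .
  qed
  also have "\<dots> = (2 * ennreal (?c\<^sup>2)) * (\<integral>\<^sup>+x. (?J x)\<^sup>2 \<partial>lborel)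
      + (2 * ennreal (?C\<^sup>2)) * (\<integral>\<^sup>+x. ennreal (norm x powr (- 2 * \<alpha>) * (cmod (w x))\<^sup>2) \<partial>lborel)"
    using c kip_nonneg
    by (simp only: power_mult_distrib sq_eq ennreal_power mult.assoc[symmetric])
      (simp add: nn_integral_add nn_integral_cmult)
  also have "\<dots> \<le> (2 * ennreal (?c\<^sup>2)) * ennreal ((left_const DIM('a) \<alpha>)\<^sup>2 * B) + (2 * ennreal (?C\<^sup>2)) * ennreal B"
    by (intro add_mono mult_left_mono left_bound hardy) auto
  also have "\<dots> = ennreal (frac_const DIM('a) \<alpha> * B)"
    using B_nonneg by (simp add: frac_const_def algebra_simps power_mult_distrib power_divide ennreal_mult flip: ennreal_numeral ennreal_mult)
  finally show ?thesis .
qed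

lemma D_pos: "x \<in> D \<Longrightarrow> 0 < norm x"
  using D_0 by auto

lemma delta_pos: "x \<in> D \<Longrightarrow> 0 < \<delta>"
  using D_pos[of x] D_bdd[of x] by linarith

lemma v_L2: "integrable lborel (\<lambda>x. (cmod (norm x powr (- \<alpha>) *\<^sub>R w x))\<^sup>2)"
  and v_L2_le: "(LINT x|lborel. (cmod (norm x powr (- \<alpha>) *\<^sub>R w x))\<^sup>2) \<le> B"
proof -
  have *: "(cmod (norm x powr (- \<alpha>) *\<^sub>R w x))\<^sup>2 = norm x powr (- 2 * \<alpha>) * (cmod (w x))\<^sup>2" for x
    by (simp add: power_mult_distrib power2_eq_square[of "norm x powr _"] flip: powr_add)
  have **: "(\<integral>\<^sup>+x. ennreal ((cmod (norm x powr (- \<alpha>) *\<^sub>R w x))\<^sup>2) \<partial>lborel) \<le> ennreal B"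
    using hardy by (simp only: *)
  show "integrable lborel (\<lambda>x. (cmod (norm x powr (- \<alpha>) *\<^sub>R w x))\<^sup>2)"
    by (rule sq_integrable_bound(1)[OF _ ** B_nonneg]) measurable
  show "(LINT x|lborel. (cmod (norm x powr (- \<alpha>) *\<^sub>R w x))\<^sup>2) \<le> B"
    by (rule sq_integrable_bound(2)[OF _ ** B_nonneg]) measurable
qed

lemma cmod_w_le: "cmod (w x) \<le> \<delta> powr \<alpha> * cmod (norm x powr (- \<alpha>) *\<^sub>R w x)"
proof (cases "x \<in> D")
  case True
  have "1 \<le> (\<delta> / norm x) powr \<alpha>"
    using alpha D_pos[OF True] D_bdd[OF True] by (intro ge_one_powr_ge_zero) auto
  also have "\<dots> = \<delta> powr \<alpha> * norm x powr (- \<alpha>)"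
    using D_pos[OF True] delta_pos[OF True] by (simp add: powr_divide powr_minus_divide)
  finally have "1 * cmod (w x) \<le> \<delta> powr \<alpha> * norm x powr (- \<alpha>) * cmod (w x)"
    by (intro mult_right_mono) auto
  then show ?thesis by simp
qed (simp add: w_out)

text \<open>Poincare's inequality as a consequence of Hardy's: on D the weight |x|^(-2\<alpha>) is
  at least \<delta>^(-2\<alpha>).\<close>

lemma w_L2: "integrable lborel (\<lambda>x. (cmod (w x))\<^sup>2)"
  and w_L2_le: "(LINT x|lborel. (cmod (w x))\<^sup>2) \<le> \<delta> powr (2 * \<alpha>) * B"
proof -
  have le: "(cmod (w x))\<^sup>2 \<le> \<delta> powr (2 * \<alpha>) * (cmod (norm x powr (- \<alpha>) *\<^sub>R w x))\<^sup>2" for x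
  proof -
    have "(cmod (w x))\<^sup>2 \<le> (\<delta> powr \<alpha> * cmod (norm x powr (- \<alpha>) *\<^sub>R w x))\<^sup>2"
      by (intro power_mono cmod_w_le) auto
    also have "\<dots> = \<delta> powr (2 * \<alpha>) * (cmod (norm x powr (- \<alpha>) *\<^sub>R w x))\<^sup>2"
      by (simp add: power_mult_distrib power2_eq_square[of "\<delta> powr _"] flip: powr_add)
    finally show ?thesis .
  qed
  show i: "integrable lborel (\<lambda>x. (cmod (w x))\<^sup>2)"
    by (rule Bochner_Integration.integrable_bound[OF integrable_mult_right[OF v_L2, of "\<delta> powr (2 * \<alpha>)"]])
      (use le in auto)
  have "(LINT x|lborel. (cmod (w x))\<^sup>2) \<le> (LINT x|lborel. \<delta> powr (2 * \<alpha>) * (cmod (norm x powr (- \<alpha>) *\<^sub>R w x))\<^sup>2)"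
    by (intro integral_mono i integrable_mult_right v_L2 le)
  also have "\<dots> \<le> \<delta> powr (2 * \<alpha>) * B"
    using v_L2_le by (simp add: mult_left_mono del: norm_scaleR)
  finally show "(LINT x|lborel. (cmod (w x))\<^sup>2) \<le> \<delta> powr (2 * \<alpha>) * B" .
qed

text \<open>With x = s y the increment becomes w(s y) - w(y). The Jacobian s^n, the factor
  s^(-2\<alpha>) of the weight and s^(2\<alpha>-n) from \<open>dil\<close> cancel exactly, so
  nothing is lost as s tends to 0, where q has its other singularity.\<close>

lemma dil_inverse:
  assumes s: "0 < s" "s < 1"
  shows "(\<integral>\<^sup>+x. ennreal (norm x powr (- 2 * \<alpha>) * (cmod (w x - w (x /\<^sub>R s)))\<^sup>2) \<partial>lborel)
     \<le> ennreal ((1 - s)\<^sup>2) * ennreal B"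
proof -
  define F where "F y = ennreal (norm (s *\<^sub>R y) powr (- 2 * \<alpha>) * (cmod (w (s *\<^sub>R y) - w y))\<^sup>2)" for y
  have "(\<integral>\<^sup>+x. ennreal (norm x powr (- 2 * \<alpha>) * (cmod (w x - w (x /\<^sub>R s)))\<^sup>2) \<partial>lborel)
      = (\<integral>\<^sup>+x. F (inverse s *\<^sub>R x) \<partial>lborel)"
    using s by (simp add: F_def)
  also have "\<dots> = ennreal (inverse s powr - real DIM('a)) * (\<integral>\<^sup>+x. F x \<partial>lborel)"
    using s by (intro nn_integral_dilation) (auto simp: F_def)
  also have "(\<integral>\<^sup>+x. F x \<partial>lborel) = (\<integral>\<^sup>+x. ennreal (s powr (- 2 * \<alpha>)) * ennreal (norm x powr (- 2 * \<alpha>) * (cmod (w x - w (s *\<^sub>R x)))\<^sup>2) \<partial>lborel)"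
    using s by (auto simp: F_def norm_minus_commute powr_mult mult.assoc ennreal_mult intro!: nn_integral_cong)
  also have "\<dots> = ennreal (s powr (- 2 * \<alpha>)) * (\<integral>\<^sup>+x. ennreal (norm x powr (- 2 * \<alpha>) * (cmod (w x - w (s *\<^sub>R x)))\<^sup>2) \<partial>lborel)"
    by (intro nn_integral_cmult) measurable
  also have "ennreal (inverse s powr - real DIM('a)) * \<dots> \<le> ennreal (inverse s powr - real DIM('a)) * (ennreal (s powr (- 2 * \<alpha>)) * (ennreal ((1 - s)\<^sup>2 * s powr (2 * \<alpha> - DIM('a))) * ennreal B))"
    by (intro mult_left_mono dil s) auto
  also have "\<dots> = ennreal ((inverse s powr - real DIM('a) * s powr (- 2 * \<alpha>) * s powr (2 * \<alpha> - DIM('a))) * (1 - s)\<^sup>2) * ennreal B"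
    using s by (simp add: mult_ac flip: ennreal_mult)
  also have "inverse s powr - real DIM('a) = s powr real DIM('a)"
    using s by (simp add: powr_minus inverse_powr)
  also have "s powr real DIM('a) * s powr (- 2 * \<alpha>) * s powr (2 * \<alpha> - DIM('a)) = 1"
    using s by (simp flip: powr_add)
  finally show ?thesis by simp
qed

text \<open>This serves the term in which the dilation acts on \<rho>, where |x|^(-\<alpha>) has
  been multiplied by the Hoelder factor |x|^\<kappa>. With x = s y, the bound |y| \<le> \<delta> on
  D leads back to the Hardy norm and leaves a positive power of s.\<close>

lemma nn_integral_weighted_inverse_dilation:
  assumes s: "0 < s" and "\<alpha> < \<kappa>"
  shows "(\<integral>\<^sup>+x. ennreal (norm x powr (2 * (\<kappa> - \<alpha>)) * (cmod (w (x /\<^sub>R s)))\<^sup>2) \<partial>lborel)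
     \<le> ennreal ((s powr (\<kappa> - \<alpha> + DIM('a) / 2))\<^sup>2) * ennreal (\<delta> powr (2 * \<kappa>) * B)"
proof -
  define F where "F y = ennreal (norm (s *\<^sub>R y) powr (2 * (\<kappa> - \<alpha>)) * (cmod (w y))\<^sup>2)" for y
  have "(\<integral>\<^sup>+x. ennreal (norm x powr (2 * (\<kappa> - \<alpha>)) * (cmod (w (x /\<^sub>R s)))\<^sup>2) \<partial>lborel)
      = (\<integral>\<^sup>+x. F (inverse s *\<^sub>R x) \<partial>lborel)"
    using s by (simp add: F_def)
  also have "\<dots> = ennreal (inverse s powr - real DIM('a)) * (\<integral>\<^sup>+x. F x \<partial>lborel)"
    using s by (intro nn_integral_dilation) (auto simp: F_def)
  also have "(\<integral>\<^sup>+x. F x \<partial>lborel) \<le> (\<integral>\<^sup>+x. ennreal (s powr (2 * (\<kappa> - \<alpha>)) * \<delta> powr (2 * \<kappa>)) * ennreal (norm x powr (- 2 * \<alpha>) * (cmod (w x))\<^sup>2) \<partial>lborel)"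
  proof (intro nn_integral_mono)
    fix x
    show "F x \<le> ennreal (s powr (2 * (\<kappa> - \<alpha>)) * \<delta> powr (2 * \<kappa>)) * ennreal (norm x powr (- 2 * \<alpha>) * (cmod (w x))\<^sup>2)"
    proof (cases "x \<in> D")
      case True
      have "norm x powr (2 * (\<kappa> - \<alpha>)) = norm x powr (2 * \<kappa>) * norm x powr (- 2 * \<alpha>)"
        by (simp add: algebra_simps flip: powr_add)
      also have "\<dots> \<le> \<delta> powr (2 * \<kappa>) * norm x powr (- 2 * \<alpha>)"
        using D_bdd[OF True] alpha assms by (intro mult_right_mono powr_mono2) auto
      finally have "(s powr (2 * (\<kappa> - \<alpha>)) * norm x powr (2 * (\<kappa> - \<alpha>))) * (cmod (w x))\<^sup>2
          \<le> (s powr (2 * (\<kappa> - \<alpha>)) * (\<delta> powr (2 * \<kappa>) * norm x powr (- 2 * \<alpha>))) * (cmod (w x))\<^sup>2"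
        by (intro mult_left_mono mult_right_mono) auto
      with s show ?thesis
        by (simp add: F_def powr_mult mult.assoc flip: ennreal_mult)
    qed (simp add: F_def w_out)
  qed
  also have "\<dots> = ennreal (s powr (2 * (\<kappa> - \<alpha>)) * \<delta> powr (2 * \<kappa>)) * (\<integral>\<^sup>+x. ennreal (norm x powr (- 2 * \<alpha>) * (cmod (w x))\<^sup>2) \<partial>lborel)"
    by (intro nn_integral_cmult) measurable
  also have "\<dots> \<le> ennreal (s powr (2 * (\<kappa> - \<alpha>)) * \<delta> powr (2 * \<kappa>)) * ennreal B"
    by (intro mult_left_mono hardy) auto
  also have "inverse s powr - real DIM('a) = s powr real DIM('a)"
    using s by (simp add: powr_minus inverse_powr)
  also have "ennreal (s powr real DIM('a)) * (ennreal (s powr (2 * (\<kappa> - \<alpha>)) * \<delta> powr (2 * \<kappa>)) * ennreal B)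
      = ennreal (s powr (real DIM('a) + 2 * (\<kappa> - \<alpha>))) * ennreal (\<delta> powr (2 * \<kappa>) * B)"
    using B_nonneg by (simp add: powr_add mult_ac flip: ennreal_mult)
  also have "s powr (real DIM('a) + 2 * (\<kappa> - \<alpha>)) = (s powr (\<kappa> - \<alpha> + DIM('a) / 2))\<^sup>2"
    by (simp add: power2_eq_square algebra_simps flip: powr_add)
  finally show ?thesis by (simp add: mult_left_mono)
qed

end

text \<open>Extended by zero, \<rho> may jump at the boundary, so \<open>holder\<close> is
  restricted to pairs of points of D. The premise \<open>subordinate\<close> is cut at \<tau> < 1
  because the full integral of k is infinite.\<close>

locale weighted_dilation_class = dilation_class D \<alpha> \<delta> B w
  for D :: "'a::euclidean_space set" and \<alpha> \<delta> B :: real and w :: "'a \<Rightarrow> complex" +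
  fixes \<rho> :: "'a \<Rightarrow> real" and R M \<kappa> :: real
  assumes kappa: "\<alpha> < \<kappa>"
    and rho_meas [measurable]: "\<rho> \<in> borel_measurable borel"
    and rho_out: "\<And>x. x \<notin> D \<Longrightarrow> \<rho> x = 0"
    and rho_nonneg: "\<And>x. \<rho> x \<ge> 0" and rho_le: "\<And>x. \<rho> x \<le> R"
    and holder: "\<And>x y. x \<in> D \<Longrightarrow> y \<in> D \<Longrightarrow> \<bar>\<rho> x - \<rho> y\<bar> \<le> M * dist x y powr \<kappa>"
    and M_nonneg: "M \<ge> 0"
    and subordinate: "\<And>x \<tau>. x \<in> D \<Longrightarrow> 0 < \<tau> \<Longrightarrow> \<tau> < 1 \<Longrightarrow>
      (\<integral>\<^sup>+s. ennreal (indicator {0<..<\<tau>} s * (right_kernel \<alpha> s * \<rho> (x /\<^sub>R s))) \<partial>lborel)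
      \<le> ennreal (\<rho> x) * ((\<integral>\<^sup>+s. ennreal (indicator {0<..<\<tau>} s * left_kernel DIM('a) \<alpha> s) \<partial>lborel)
          + ennreal (2 * (kip_const DIM('a) \<alpha> * Gamma (1 - \<alpha>) / \<alpha>)))"
begin

lemma R_nonneg: "R \<ge> 0"
  using rho_nonneg rho_le order_trans by blast

abbreviation f :: "'a \<Rightarrow> complex" where "f \<equiv> \<lambda>x. \<rho> x *\<^sub>R w x"

text \<open>A pointwise majorant for the right derivative and all its truncations, up to the factor
  c. Its square integrability justifies both the use of Fubini's theorem and the passage to the
  limit in the truncation.\<close>

definition G :: "'a \<Rightarrow> ennreal" where
  "G x = (\<integral>\<^sup>+s. ennreal (right_kernel \<alpha> s) * ennreal (indicator D x * (norm x powr (- \<alpha>) * cmod (f x - f (x /\<^sub>R s)))) \<partial>lborel)"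

lemma G_measurable [measurable]: "G \<in> borel_measurable borel"
  unfolding G_def by measurable

text \<open>The difference is split as \<rho>(x) (w(x) - w(x/s)) + (\<rho>(x) - \<rho>(x/s)) w(x/s),
  and Minkowski's inequality is applied to each term. The first gains 1 - s from the increment of w,
  the second ((1-s)/s)^\<kappa> from the Hoelder condition, with \<kappa> > \<alpha>; both integrals
  over s become Beta integrals.\<close>

lemma G_sq_finite: "(\<integral>\<^sup>+x. (G x)\<^sup>2 \<partial>lborel) < \<infinity>"
proof -
  let ?G1 = "\<lambda>x. \<integral>\<^sup>+s. ennreal (right_kernel \<alpha> s) * ennreal (norm x powr (- \<alpha>) * cmod (w x - w (x /\<^sub>R s))) \<partial>lborel"
  let ?a = "\<lambda>s. right_kernel \<alpha> s * ((1 - s) / s) powr \<kappa>"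
  let ?G2 = "\<lambda>x. \<integral>\<^sup>+s. ennreal (\<bar>?a s\<bar>) * ennreal (norm x powr (\<kappa> - \<alpha>) * cmod (w (x /\<^sub>R s))) \<partial>lborel"
  have "(\<integral>\<^sup>+x. (?G1 x)\<^sup>2 \<partial>lborel) \<le> (\<integral>\<^sup>+s. ennreal (right_kernel \<alpha> s * (1 - s)) \<partial>lborel)\<^sup>2 * ennreal B"
  proof (rule nn_integral_Minkowski_weight)
    fix s assume "right_kernel \<alpha> s \<noteq> 0"
    then have s: "0 < s" "s < 1" by (auto simp: right_kernel_def split: if_splits)
    then show "0 < 1 - s" by simp
    show "(\<integral>\<^sup>+x. (ennreal (norm x powr (- \<alpha>) * cmod (w x - w (x /\<^sub>R s))))\<^sup>2 \<partial>lborel)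
        \<le> ennreal ((1 - s)\<^sup>2) * ennreal B"
      using dil_inverse[OF s] by (simp only: sq_eq)
  qed (auto simp: kernels_nonneg lborel.sigma_finite_measure_axioms)
  also have "(\<lambda>s. ennreal (right_kernel \<alpha> s * (1 - s))) = (\<lambda>s. ennreal (indicator {0<..<1} s * ((1 - s) powr (- \<alpha>) * s powr (\<alpha> - 1))))"
    by (auto simp: right_kernel_def fun_eq_iff powr_diff intro!: arg_cong[where f=ennreal])
  also have "(\<integral>\<^sup>+s. ennreal (indicator {0<..<1} s * ((1 - s) powr (- \<alpha>) * s powr (\<alpha> - 1))) \<partial>lborel)\<^sup>2 * ennreal B < \<infinity>"
    using nn_integral_beta_kernel_finite[of "- \<alpha>" "\<alpha> - 1"] alpha by (simp add: ennreal_mult_less_top power2_eq_square)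
  finally have G1: "(\<integral>\<^sup>+x. (?G1 x)\<^sup>2 \<partial>lborel) < \<infinity>" .
  have "(\<integral>\<^sup>+x. (?G2 x)\<^sup>2 \<partial>lborel) \<le> (\<integral>\<^sup>+s. ennreal (\<bar>?a s\<bar> * s powr (\<kappa> - \<alpha> + DIM('a) / 2)) \<partial>lborel)\<^sup>2
      * ennreal (\<delta> powr (2 * \<kappa>) * B)"
  proof (rule nn_integral_Minkowski_weight)
    fix s assume "\<bar>?a s\<bar> \<noteq> 0"
    then have s: "0 < s" "s < 1" by (auto simp: right_kernel_def split: if_splits)
    then show "0 < s powr (\<kappa> - \<alpha> + DIM('a) / 2)" by simp
    have "(ennreal (norm x powr (\<kappa> - \<alpha>) * cmod (w (x /\<^sub>R s))))\<^sup>2 = ennreal (norm x powr (2 * (\<kappa> - \<alpha>)) * (cmod (w (x /\<^sub>R s)))\<^sup>2)" for x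
      by (simp add: ennreal_power power_mult_distrib power2_eq_square[of "norm x powr _"] flip: powr_add)
    then show "(\<integral>\<^sup>+x. (ennreal (norm x powr (\<kappa> - \<alpha>) * cmod (w (x /\<^sub>R s))))\<^sup>2 \<partial>lborel)
        \<le> ennreal ((s powr (\<kappa> - \<alpha> + DIM('a) / 2))\<^sup>2) * ennreal (\<delta> powr (2 * \<kappa>) * B)"
      using nn_integral_weighted_inverse_dilation[OF s(1) kappa] by simp
  qed (auto simp: lborel.sigma_finite_measure_axioms)
  also have "(\<lambda>s. ennreal (\<bar>?a s\<bar> * s powr (\<kappa> - \<alpha> + DIM('a) / 2)))
      = (\<lambda>s. ennreal (indicator {0<..<1} s * ((1 - s) powr (\<kappa> - \<alpha> - 1) * s powr (DIM('a) / 2 - 1))))"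
  proof (intro ext arg_cong[where f=ennreal])
    fix s :: real
    show "\<bar>?a s\<bar> * s powr (\<kappa> - \<alpha> + DIM('a) / 2) = indicator {0<..<1} s * ((1 - s) powr (\<kappa> - \<alpha> - 1) * s powr (DIM('a) / 2 - 1))"
    proof (cases "0 < s \<and> s < 1")
      case True
      then have "\<bar>?a s\<bar> * s powr (\<kappa> - \<alpha> + DIM('a) / 2)
          = ((1 - s) powr (- \<alpha> - 1) * (1 - s) powr \<kappa>) * (s powr (\<alpha> - 1) * s powr (- \<kappa>) * s powr (\<kappa> - \<alpha> + DIM('a) / 2))"
        by (simp add: right_kernel_def powr_divide powr_minus_divide[of _ \<kappa>])
      also have "(1 - s) powr (- \<alpha> - 1) * (1 - s) powr \<kappa> = (1 - s) powr (\<kappa> - \<alpha> - 1)"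
        by (simp add: algebra_simps flip: powr_add)
      also have "s powr (\<alpha> - 1) * s powr (- \<kappa>) * s powr (\<kappa> - \<alpha> + DIM('a) / 2) = s powr (DIM('a) / 2 - 1)"
        by (simp flip: powr_add)
      finally show ?thesis using True by simp
    qed (auto simp: right_kernel_def)
  qed
  also have "(\<integral>\<^sup>+s. ennreal (indicator {0<..<1} s * ((1 - s) powr (\<kappa> - \<alpha> - 1) * s powr (DIM('a) / 2 - 1))) \<partial>lborel)\<^sup>2 * ennreal (\<delta> powr (2 * \<kappa>) * B) < \<infinity>"
    using nn_integral_beta_kernel_finite[of "\<kappa> - \<alpha> - 1" "DIM('a) / 2 - 1"] kappa dim by (simp add: ennreal_mult_less_top power2_eq_square)
  finally have G2: "(\<integral>\<^sup>+x. (?G2 x)\<^sup>2 \<partial>lborel) < \<infinity>" .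
  have "G x \<le> ennreal R * ?G1 x + ennreal M * ?G2 x" for x
  proof -
    have "G x \<le> (\<integral>\<^sup>+s. ennreal R * (ennreal (right_kernel \<alpha> s) * ennreal (norm x powr (- \<alpha>) * cmod (w x - w (x /\<^sub>R s))))
      + ennreal M * (ennreal (\<bar>?a s\<bar>) * ennreal (norm x powr (\<kappa> - \<alpha>) * cmod (w (x /\<^sub>R s)))) \<partial>lborel)"
      unfolding G_def
    proof (intro nn_integral_mono)
      fix s
      have "right_kernel \<alpha> s * (indicator D x * (norm x powr (- \<alpha>) * cmod (f x - f (x /\<^sub>R s))))
        \<le> R * (right_kernel \<alpha> s * (norm x powr (- \<alpha>) * cmod (w x - w (x /\<^sub>R s))))
          + M * (\<bar>?a s\<bar> * (norm x powr (\<kappa> - \<alpha>) * cmod (w (x /\<^sub>R s))))"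
      proof (cases "x \<in> D \<and> 0 < s \<and> s < 1")
        case True
        then have s: "0 < s" "s < 1" and x: "x \<in> D" by auto
        have "cmod (f x - f (x /\<^sub>R s)) \<le> cmod (\<rho> x *\<^sub>R (w x - w (x /\<^sub>R s))) + cmod ((\<rho> x - \<rho> (x /\<^sub>R s)) *\<^sub>R w (x /\<^sub>R s))"
          using norm_triangle_ineq[of "\<rho> x *\<^sub>R (w x - w (x /\<^sub>R s))" "(\<rho> x - \<rho> (x /\<^sub>R s)) *\<^sub>R w (x /\<^sub>R s)"]
          by (simp only: algebra_simps) simp
        also have "cmod (\<rho> x *\<^sub>R (w x - w (x /\<^sub>R s))) \<le> R * cmod (w x - w (x /\<^sub>R s))"
          using rho_nonneg rho_le by (simp add: mult_right_mono)
        also have "cmod ((\<rho> x - \<rho> (x /\<^sub>R s)) *\<^sub>R w (x /\<^sub>R s)) \<le> M * (norm x powr \<kappa> * ((1 - s) / s) powr \<kappa>) * cmod (w (x /\<^sub>R s))"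
        proof (cases "x /\<^sub>R s \<in> D")
          case True
          have "x - x /\<^sub>R s = (1 - 1 / s) *\<^sub>R x" by (simp add: scaleR_left_diff_distrib inverse_eq_divide)
          then have "dist x (x /\<^sub>R s) = \<bar>1 - 1 / s\<bar> * norm x" by (simp only: dist_norm norm_scaleR)
          also have "\<bar>1 - 1 / s\<bar> = (1 - s) / s" using s by (simp add: abs_if field_simps)
          also have "(1 - s) / s * norm x = norm x * ((1 - s) / s)" by simp
          finally have "dist x (x /\<^sub>R s) = norm x * ((1 - s) / s)" .
          moreover have "(norm x * ((1 - s) / s)) powr \<kappa> = norm x powr \<kappa> * ((1 - s) / s) powr \<kappa>"
            by (rule powr_mult)
          ultimately have "\<bar>\<rho> x - \<rho> (x /\<^sub>R s)\<bar> \<le> M * (norm x powr \<kappa> * ((1 - s) / s) powr \<kappa>)"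
            using holder[OF x True] by (simp only:)
          then show ?thesis by (simp add: mult_right_mono)
        qed (simp add: w_out)
        finally have le: "cmod (f x - f (x /\<^sub>R s)) \<le> R * cmod (w x - w (x /\<^sub>R s)) + M * (norm x powr \<kappa> * ((1 - s) / s) powr \<kappa>) * cmod (w (x /\<^sub>R s))"
          by simp
        have "right_kernel \<alpha> s * (indicator D x * (norm x powr (- \<alpha>) * cmod (f x - f (x /\<^sub>R s))))
          \<le> right_kernel \<alpha> s * (norm x powr (- \<alpha>) * (R * cmod (w x - w (x /\<^sub>R s)) + M * (norm x powr \<kappa> * ((1 - s) / s) powr \<kappa>) * cmod (w (x /\<^sub>R s))))"
          using x by (simp only: indicator_simps mult_1) (intro mult_left_mono le; simp add: kernels_nonneg)
        also have "\<dots> = R * (right_kernel \<alpha> s * (norm x powr (- \<alpha>) * cmod (w x - w (x /\<^sub>R s))))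
          + M * (?a s * ((norm x powr (- \<alpha>) * norm x powr \<kappa>) * cmod (w (x /\<^sub>R s))))"
          by (simp add: algebra_simps)
        also have "norm x powr (- \<alpha>) * norm x powr \<kappa> = norm x powr (\<kappa> - \<alpha>)"
          by (simp flip: powr_add)
        also have "?a s = \<bar>?a s\<bar>" by (simp add: kernels_nonneg)
        finally show ?thesis .
      next
        case False
        then have "right_kernel \<alpha> s * (indicator D x * (norm x powr (- \<alpha>) * cmod (f x - f (x /\<^sub>R s)))) = 0"
          by (auto simp: right_kernel_def)
        also have "0 \<le> R * (right_kernel \<alpha> s * (norm x powr (- \<alpha>) * cmod (w x - w (x /\<^sub>R s))))
          + M * (\<bar>?a s\<bar> * (norm x powr (\<kappa> - \<alpha>) * cmod (w (x /\<^sub>R s))))"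
          using R_nonneg M_nonneg by (intro add_nonneg_nonneg mult_nonneg_nonneg) (auto simp: kernels_nonneg)
        finally show ?thesis .
      qed
      from ennreal_leI[OF this] show "ennreal (right_kernel \<alpha> s) * ennreal (indicator D x * (norm x powr (- \<alpha>) * cmod (f x - f (x /\<^sub>R s))))
        \<le> ennreal R * (ennreal (right_kernel \<alpha> s) * ennreal (norm x powr (- \<alpha>) * cmod (w x - w (x /\<^sub>R s))))
          + ennreal M * (ennreal (\<bar>?a s\<bar>) * ennreal (norm x powr (\<kappa> - \<alpha>) * cmod (w (x /\<^sub>R s))))"
        using R_nonneg M_nonneg by (simp add: kernels_nonneg flip: ennreal_mult ennreal_plus)
    qed
    also have "\<dots> = ennreal R * ?G1 x + ennreal M * ?G2 x"
      by (subst nn_integral_add) (auto simp: nn_integral_cmult)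
    finally show ?thesis .
  qed
  then have "(\<integral>\<^sup>+x. (G x)\<^sup>2 \<partial>lborel) \<le> (\<integral>\<^sup>+x. 2 * (ennreal R * ?G1 x)\<^sup>2 + 2 * (ennreal M * ?G2 x)\<^sup>2 \<partial>lborel)"
    by (intro nn_integral_mono order_trans[OF power_mono ennreal_sum_sq_le]) auto
  also have "\<dots> = 2 * (ennreal R)\<^sup>2 * (\<integral>\<^sup>+x. (?G1 x)\<^sup>2 \<partial>lborel) + 2 * (ennreal M)\<^sup>2 * (\<integral>\<^sup>+x. (?G2 x)\<^sup>2 \<partial>lborel)"
    by (simp only: power_mult_distrib mult.assoc[symmetric]) (simp add: nn_integral_add nn_integral_cmult)
  also have "\<dots> < \<infinity>"
    using G1 G2 by (simp add: ennreal_mult_less_top power2_eq_square ennreal_power)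
  finally show ?thesis .
qed

end

lemma integrable_pairI:
  fixes h :: "'a::euclidean_space \<Rightarrow> real \<Rightarrow> complex"
  assumes [measurable]: "case_prod h \<in> borel_measurable (lborel \<Otimes>\<^sub>M lborel)"
    and "(\<integral>\<^sup>+x. \<integral>\<^sup>+s. ennreal (cmod (h x s)) \<partial>lborel \<partial>lborel) < \<infinity>"
  shows "integrable (lborel \<Otimes>\<^sub>M lborel) (case_prod h)"
proof (rule integrableI_bounded)
  have "(\<integral>\<^sup>+p. ennreal (norm (case_prod h p)) \<partial>(lborel \<Otimes>\<^sub>M lborel)) = (\<integral>\<^sup>+x. \<integral>\<^sup>+s. ennreal (cmod (h x s)) \<partial>lborel \<partial>lborel)"
    by (subst lborel.nn_integral_fst[symmetric]) auto
  with assms(2) show "(\<integral>\<^sup>+p. ennreal (norm (case_prod h p)) \<partial>(lborel \<Otimes>\<^sub>M lborel)) < \<infinity>" by simp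
qed fact

lemma borel_measurable_cnj [measurable (raw)]:
  "f \<in> borel_measurable M \<Longrightarrow> (\<lambda>x. cnj (f x)) \<in> borel_measurable M"
  by (rule measurable_compose[OF _ borel_measurable_continuous_onI]) (auto intro: continuous_intros)

lemma ennreal_power2_less_topD: "(a::ennreal)\<^sup>2 < \<infinity> \<Longrightarrow> a < \<infinity>"
  by (cases a) (auto simp: power2_eq_square ennreal_mult_top)

section \<open>Adjointness of the two derivatives and positivity of the form\<close>

context weighted_dilation_class
begin

abbreviation c :: real where "c \<equiv> \<alpha> / Gamma (1 - \<alpha>)"

lemma c_pos: "c > 0"
  using alpha Gamma_pos by simp

lemma f_measurable [measurable]: "f \<in> borel_measurable borel"
  by measurable

lemma f_L2: "integrable lborel (\<lambda>x. (cmod (f x))\<^sup>2)"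
  and f_L2_le: "(LINT x|lborel. (cmod (f x))\<^sup>2) \<le> R\<^sup>2 * (\<delta> powr (2 * \<alpha>) * B)"
proof -
  have le: "(cmod (f x))\<^sup>2 \<le> R\<^sup>2 * (cmod (w x))\<^sup>2" for x
    using rho_nonneg[of x] rho_le[of x] by (simp add: power_mult_distrib mult_right_mono power_mono)
  show i: "integrable lborel (\<lambda>x. (cmod (f x))\<^sup>2)"
    by (rule Bochner_Integration.integrable_bound[OF integrable_mult_right[OF w_L2, of "R\<^sup>2"]])
      (use le in auto)
  have "(LINT x|lborel. (cmod (f x))\<^sup>2) \<le> (LINT x|lborel. R\<^sup>2 * (cmod (w x))\<^sup>2)"
    by (intro integral_mono i integrable_mult_right w_L2 le)
  also have "\<dots> \<le> R\<^sup>2 * (\<delta> powr (2 * \<alpha>) * B)"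
    using w_L2_le by (simp add: mult_left_mono)
  finally show "(LINT x|lborel. (cmod (f x))\<^sup>2) \<le> R\<^sup>2 * (\<delta> powr (2 * \<alpha>) * B)" .
qed

lemma v_weighted_L2: "integrable lborel (\<lambda>x. (cmod (norm x powr (- \<alpha>) *\<^sub>R f x))\<^sup>2)"
proof (rule Bochner_Integration.integrable_bound[OF integrable_mult_right[OF v_L2, of "R\<^sup>2"]])
  have "(norm x powr (- \<alpha>))\<^sup>2 * ((\<rho> x)\<^sup>2 * (cmod (w x))\<^sup>2) \<le> R\<^sup>2 * ((norm x powr (- \<alpha>))\<^sup>2 * (cmod (w x))\<^sup>2)" for x
    using power_mono[OF rho_le[of x] rho_nonneg[of x], of 2]
    by (metis mult.left_commute mult_right_mono zero_le_mult_iff zero_le_power2)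
  then show "AE x in lborel. norm ((cmod (norm x powr (- \<alpha>) *\<^sub>R f x))\<^sup>2) \<le> norm (R\<^sup>2 * (cmod (norm x powr (- \<alpha>) *\<^sub>R w x))\<^sup>2)"
    by (simp add: power_mult_distrib mult.assoc)
qed measurable

lemma frac_left_L2: "integrable lborel (\<lambda>x. (cmod (frac_left \<alpha> w x))\<^sup>2)"
  and frac_left_L2_le: "(LINT x|lborel. (cmod (frac_left \<alpha> w x))\<^sup>2) \<le> frac_const DIM('a) \<alpha> * B"
  using sq_integrable_bound[OF _ frac_left_sq_le] B_nonneg by auto

text \<open>The common quantity behind both forms: it is the conjugate of (\<rho> D u, u) and, by
  adjointness, equal to (D_-(\<rho> u), u).\<close>

definition pairing :: complex where
  "pairing = (LINT x|lborel. f x * cnj (frac_left \<alpha> w x))"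

lemma norm_pairing_le: "cmod pairing \<le> R * sqrt (\<delta> powr (2 * \<alpha>) * frac_const DIM('a) \<alpha>) * B"
proof -
  have "cmod pairing \<le> sqrt (LINT x|lborel. (cmod (f x))\<^sup>2) * sqrt (LINT x|lborel. (cmod (cnj (frac_left \<alpha> w x)))\<^sup>2)"
    unfolding pairing_def using f_L2 frac_left_L2
    by (intro Cauchy_Schwarz_integral(2)) auto
  also have "\<dots> \<le> sqrt (R\<^sup>2 * (\<delta> powr (2 * \<alpha>) * B)) * sqrt (frac_const DIM('a) \<alpha> * B)"
    using f_L2_le frac_left_L2_le by (intro mult_mono) (auto simp: B_nonneg)
  also have "\<dots> = sqrt (R\<^sup>2 * (\<delta> powr (2 * \<alpha>) * frac_const DIM('a) \<alpha>) * B\<^sup>2)"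
    by (simp add: power2_eq_square mult_ac flip: real_sqrt_mult)
  also have "\<dots> = R * sqrt (\<delta> powr (2 * \<alpha>) * frac_const DIM('a) \<alpha>) * B"
    using R_nonneg B_nonneg by (simp add: real_sqrt_mult mult_ac)
  finally show ?thesis .
qed

text \<open>\<open>H1\<close> and \<open>H2\<close> are the integrands in x and s of the right and
  left forms, without c and the zero-order term. \<open>Y\<close> and \<open>Z s\<close> below are
  the integrals to which integration over x reduces them.\<close>

definition H1 :: "'a \<Rightarrow> real \<Rightarrow> complex" where
  "H1 x s = (norm x powr (- \<alpha>) * right_kernel \<alpha> s) *\<^sub>R ((f x - f (x /\<^sub>R s)) * cnj (w x))"

definition H2 :: "'a \<Rightarrow> real \<Rightarrow> complex" where
  "H2 x s = (norm x powr (- \<alpha>) * left_kernel DIM('a) \<alpha> s) *\<^sub>R (f x * cnj (w x - w (s *\<^sub>R x)))"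

definition Y :: complex where
  "Y = (LINT x|lborel. norm x powr (- \<alpha>) *\<^sub>R (f x * cnj (w x)))"

definition Z :: "real \<Rightarrow> complex" where
  "Z s = (LINT x|lborel. norm x powr (- \<alpha>) *\<^sub>R (f x * cnj (w (s *\<^sub>R x))))"

lemma integrable_Z:
  assumes "s > 0"
  shows "integrable lborel (\<lambda>x. norm x powr (- \<alpha>) *\<^sub>R (f x * cnj (w (s *\<^sub>R x))))"
proof -
  have "integrable lborel (\<lambda>x. (norm x powr (- \<alpha>) *\<^sub>R f x) * cnj (w (s *\<^sub>R x)))"
    using v_weighted_L2 integrable_dilation[OF w_L2 assms]
    by (intro Cauchy_Schwarz_integral(1)) auto
  then show ?thesis by simp
qed

lemma integrable_Y: "integrable lborel (\<lambda>x. norm x powr (- \<alpha>) *\<^sub>R (f x * cnj (w x)))"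
  using integrable_Z[of 1] by simp

text \<open>Integrating |H1| over s gives |w| G, a product of two square integrable
  functions.\<close>

lemma integrable_H1: "integrable (lborel \<Otimes>\<^sub>M lborel) (case_prod H1)"
proof (rule integrable_pairI)
  show "case_prod H1 \<in> borel_measurable (lborel \<Otimes>\<^sub>M lborel)"
    unfolding H1_def by measurable
  have "(\<integral>\<^sup>+x. \<integral>\<^sup>+s. ennreal (cmod (H1 x s)) \<partial>lborel \<partial>lborel) = (\<integral>\<^sup>+x. ennreal (cmod (w x)) * G x \<partial>lborel)"
  proof (intro nn_integral_cong)
    fix x
    have "ennreal (cmod (H1 x s)) = ennreal (cmod (w x)) *
      (ennreal (right_kernel \<alpha> s) * ennreal (indicator D x * (norm x powr (- \<alpha>) * cmod (f x - f (x /\<^sub>R s)))))" for s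
      by (cases "x \<in> D") (auto simp: H1_def norm_mult w_out kernels_nonneg mult_ac simp flip: ennreal_mult)
    then show "(\<integral>\<^sup>+s. ennreal (cmod (H1 x s)) \<partial>lborel) = ennreal (cmod (w x)) * G x"
      by (simp add: G_def nn_integral_cmult)
  qed
  also have "\<dots> < \<infinity>"
  proof (rule ennreal_power2_less_topD)
    have "(\<integral>\<^sup>+x. ennreal (cmod (w x)) * G x \<partial>lborel)\<^sup>2
        \<le> (\<integral>\<^sup>+x. (ennreal (cmod (w x)))\<^sup>2 \<partial>lborel) * (\<integral>\<^sup>+x. (G x)\<^sup>2 \<partial>lborel)"
      by (intro nn_integral_Cauchy_Schwarz) auto
    also have "\<dots> < \<infinity>"
      using G_sq_finite w_L2 by (simp add: ennreal_power ennreal_mult_less_top nn_integral_eq_integral)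
    finally show "(\<integral>\<^sup>+x. ennreal (cmod (w x)) * G x \<partial>lborel)\<^sup>2 < \<infinity>" .
  qed
  finally show "(\<integral>\<^sup>+x. \<integral>\<^sup>+s. ennreal (cmod (H1 x s)) \<partial>lborel \<partial>lborel) < \<infinity>" .
qed

lemma integrable_H2: "integrable (lborel \<Otimes>\<^sub>M lborel) (case_prod H2)"
proof (rule integrable_pairI)
  show "case_prod H2 \<in> borel_measurable (lborel \<Otimes>\<^sub>M lborel)"
    unfolding H2_def by measurable
  let ?J = "\<lambda>x. \<integral>\<^sup>+s. ennreal (left_kernel DIM('a) \<alpha> s) * ennreal (norm x powr (- \<alpha>) * cmod (w x - w (s *\<^sub>R x))) \<partial>lborel"
  have "(\<integral>\<^sup>+x. \<integral>\<^sup>+s. ennreal (cmod (H2 x s)) \<partial>lborel \<partial>lborel) = (\<integral>\<^sup>+x. ennreal (cmod (f x)) * ?J x \<partial>lborel)"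
  proof (intro nn_integral_cong)
    fix x
    have "ennreal (cmod (H2 x s)) = ennreal (cmod (f x)) *
      (ennreal (left_kernel DIM('a) \<alpha> s) * ennreal (norm x powr (- \<alpha>) * cmod (w x - w (s *\<^sub>R x))))" for s
      unfolding H2_def norm_scaleR norm_mult complex_mod_cnj
      by (simp add: norm_mult kernels_nonneg mult_ac abs_mult flip: ennreal_mult)
    then show "(\<integral>\<^sup>+s. ennreal (cmod (H2 x s)) \<partial>lborel) = ennreal (cmod (f x)) * ?J x"
      by (simp add: nn_integral_cmult)
  qed
  also have "\<dots> < \<infinity>"
  proof (rule ennreal_power2_less_topD)
    have "(\<integral>\<^sup>+x. ennreal (cmod (f x)) * ?J x \<partial>lborel)\<^sup>2
        \<le> (\<integral>\<^sup>+x. (ennreal (cmod (f x)))\<^sup>2 \<partial>lborel) * (\<integral>\<^sup>+x. (?J x)\<^sup>2 \<partial>lborel)"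
      by (intro nn_integral_Cauchy_Schwarz) auto
    also have "\<dots> \<le> (\<integral>\<^sup>+x. (ennreal (cmod (f x)))\<^sup>2 \<partial>lborel) * ennreal ((left_const DIM('a) \<alpha>)\<^sup>2 * B)"
      by (intro mult_left_mono left_bound) auto
    also have "\<dots> < \<infinity>"
      using nn_integral_eq_integral[OF f_L2] by (simp add: ennreal_power ennreal_mult_less_top del: norm_scaleR)
    finally show "(\<integral>\<^sup>+x. ennreal (cmod (f x)) * ?J x \<partial>lborel)\<^sup>2 < \<infinity>" .
  qed
  finally show "(\<integral>\<^sup>+x. \<integral>\<^sup>+s. ennreal (cmod (H2 x s)) \<partial>lborel \<partial>lborel) < \<infinity>" .
qed

lemma pairing_eq: "pairing = c *\<^sub>R (LINT s|lborel. (LINT x|lborel. H2 x s)) + kip_const DIM('a) \<alpha> *\<^sub>R Y"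
proof -
  have i: "integrable lborel (\<lambda>x. LINT s|lborel. H2 x s)"
    using lborel_pair.integrable_fst'[OF integrable_H2] by simp
  have "f x * cnj (frac_left \<alpha> w x) = c *\<^sub>R (LINT s|lborel. H2 x s)
      + kip_const DIM('a) \<alpha> *\<^sub>R (norm x powr (- \<alpha>) *\<^sub>R (f x * cnj (w x)))" for x
  proof -
    define A where "A = (LINT s|lborel. left_kernel DIM('a) \<alpha> s *\<^sub>R (w x - w (s *\<^sub>R x)))"
    have "(LINT s|lborel. H2 x s) = norm x powr (- \<alpha>) *\<^sub>R (f x * cnj A)"
    proof -
      have "cnj A = (LINT s|lborel. cnj (left_kernel DIM('a) \<alpha> s *\<^sub>R (w x - w (s *\<^sub>R x))))"
        unfolding A_def by (rule Bochner_Integration.integral_cnj[symmetric])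
      then have "f x * cnj A = (LINT s|lborel. f x * cnj (left_kernel DIM('a) \<alpha> s *\<^sub>R (w x - w (s *\<^sub>R x))))"
        by (simp only: integral_mult_right_zero)
      then have "norm x powr (- \<alpha>) *\<^sub>R (f x * cnj A)
          = (LINT s|lborel. norm x powr (- \<alpha>) *\<^sub>R (f x * cnj (left_kernel DIM('a) \<alpha> s *\<^sub>R (w x - w (s *\<^sub>R x)))))"
        by (simp only: integral_scaleR_right)
      also have "\<dots> = (LINT s|lborel. H2 x s)"
        by (rule Bochner_Integration.integral_cong[OF refl]) (simp add: H2_def scaleR_conv_of_real mult_ac)
      finally show ?thesis by simp
    qed
    then show ?thesis
      unfolding frac_left_def A_def[symmetric] by (simp only:) (simp add: scaleR_conv_of_real algebra_simps)
  qed
  then have "pairing = (LINT x|lborel. c *\<^sub>R (LINT s|lborel. H2 x s)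
      + kip_const DIM('a) \<alpha> *\<^sub>R (norm x powr (- \<alpha>) *\<^sub>R (f x * cnj (w x))))"
    by (simp add: pairing_def)
  also have "\<dots> = c *\<^sub>R (LINT x|lborel. (LINT s|lborel. H2 x s)) + kip_const DIM('a) \<alpha> *\<^sub>R Y"
    unfolding Y_def
    by (simp only: Bochner_Integration.integral_add[OF integrable_scaleR_right[OF i] integrable_scaleR_right[OF integrable_Y]]
        integral_scaleR_right)
  also have "(LINT x|lborel. (LINT s|lborel. H2 x s)) = (LINT s|lborel. (LINT x|lborel. H2 x s))"
    by (rule lborel_pair.Fubini_integral[OF integrable_H2, symmetric])
  finally show ?thesis .
qed

lemma inner_H2: "(LINT x|lborel. H2 x s) = left_kernel DIM('a) \<alpha> s *\<^sub>R (Y - Z s)"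
proof (cases "s > 0")
  case True
  have "(LINT x|lborel. H2 x s) = (LINT x|lborel. left_kernel DIM('a) \<alpha> s *\<^sub>R
      (norm x powr (- \<alpha>) *\<^sub>R (f x * cnj (w x)) - norm x powr (- \<alpha>) *\<^sub>R (f x * cnj (w (s *\<^sub>R x)))))"
    by (simp add: H2_def scaleR_conv_of_real algebra_simps)
  also have "\<dots> = left_kernel DIM('a) \<alpha> s *\<^sub>R (Y - Z s)"
    unfolding Y_def Z_def integral_scaleR_right
    by (subst Bochner_Integration.integral_diff[OF integrable_Y integrable_Z[OF True]]) simp
  finally show ?thesis .
qed (simp add: H2_def left_kernel_def)

text \<open>Substituting x = s y in the dilated term gives s^(n-\<alpha>) Z(s), and this factor
  turns q into k. Compared with \<open>inner_H2\<close> only the kernel in front of Y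
  differs.\<close>

lemma inner_H1: "(LINT x|lborel. H1 x s) = right_kernel \<alpha> s *\<^sub>R Y - left_kernel DIM('a) \<alpha> s *\<^sub>R Z s"
proof (cases "s > 0")
  case True
  define F where "F y = norm (s *\<^sub>R y) powr (- \<alpha>) *\<^sub>R (f y * cnj (w (s *\<^sub>R y)))" for y
  have F: "F y = s powr (- \<alpha>) *\<^sub>R (norm y powr (- \<alpha>) *\<^sub>R (f y * cnj (w (s *\<^sub>R y))))" for y
    using True by (simp add: F_def powr_mult mult_ac)
  have Fi: "integrable lborel F"
    unfolding F by (intro integrable_scaleR_right integrable_Z True)
  have "(LINT x|lborel. F (inverse s *\<^sub>R x)) = (inverse s powr - real DIM('a)) *\<^sub>R (LINT x|lborel. F x)"
    using True Fi by (intro integral_dilation) auto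
  also have "(LINT x|lborel. F x) = s powr (- \<alpha>) *\<^sub>R Z s"
    unfolding F Z_def by (rule integral_scaleR_right)
  also have "inverse s powr - real DIM('a) = s powr real DIM('a)"
    using True by (simp add: powr_minus inverse_powr)
  finally have FZ: "(LINT x|lborel. F (inverse s *\<^sub>R x)) = (s powr (real DIM('a) - \<alpha>)) *\<^sub>R Z s"
    by (simp flip: powr_add)
  have "(LINT x|lborel. H1 x s) = (LINT x|lborel. right_kernel \<alpha> s *\<^sub>R
      (norm x powr (- \<alpha>) *\<^sub>R (f x * cnj (w x)) - F (inverse s *\<^sub>R x)))"
    using True by (simp add: H1_def F_def scaleR_conv_of_real algebra_simps)
  also have "\<dots> = right_kernel \<alpha> s *\<^sub>R (Y - (s powr (real DIM('a) - \<alpha>)) *\<^sub>R Z s)"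
    unfolding Y_def FZ[symmetric] integral_scaleR_right
    by (subst Bochner_Integration.integral_diff[OF integrable_Y integrable_dilation[OF Fi]]) (use True in auto)
  also have "\<dots> = right_kernel \<alpha> s *\<^sub>R Y - left_kernel DIM('a) \<alpha> s *\<^sub>R Z s"
    using dim by (simp add: left_kernel_eq algebra_simps)
  finally show ?thesis .
qed (simp add: H1_def left_kernel_def right_kernel_def)

lemma c_kernel_difference: "c * (kip_const DIM('a) \<alpha> * Gamma (1 - \<alpha>) / \<alpha>) = kip_const DIM('a) \<alpha>"
  using alpha less_imp_neq[OF Gamma_pos] by simp

text \<open>After Fubini's theorem the two forms differ by c times the integral of q - k, multiplied
  by Y. This equals C Y, which is precisely the zero-order term in the left derivative; the constant
  C of the definition is made for this.\<close>

lemma frac_right_pairing: "(LINT x|lborel. frac_right \<alpha> f x * cnj (w x)) = pairing"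
proof -
  have "frac_right \<alpha> f x * cnj (w x) = c *\<^sub>R (LINT s|lborel. H1 x s)" for x
  proof -
    define A where "A = (LINT s|lborel. right_kernel \<alpha> s *\<^sub>R (f x - f (x /\<^sub>R s)))"
    have "(LINT s|lborel. H1 x s) = norm x powr (- \<alpha>) *\<^sub>R (A * cnj (w x))"
      unfolding A_def integral_mult_left_zero[symmetric] integral_scaleR_right[symmetric]
      by (rule Bochner_Integration.integral_cong[OF refl]) (simp add: H1_def scaleR_conv_of_real mult_ac)
    then show ?thesis
      unfolding frac_right_def A_def[symmetric] by (simp only:) (simp add: scaleR_conv_of_real algebra_simps)
  qed
  then have "(LINT x|lborel. frac_right \<alpha> f x * cnj (w x)) = c *\<^sub>R (LINT x|lborel. (LINT s|lborel. H1 x s))"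
    by simp
  also have "(LINT x|lborel. (LINT s|lborel. H1 x s)) = (LINT s|lborel. (LINT x|lborel. H1 x s))"
    by (rule lborel_pair.Fubini_integral[OF integrable_H1, symmetric])
  also have "\<dots> = (LINT s|lborel. (LINT x|lborel. H2 x s) + (right_kernel \<alpha> s - left_kernel DIM('a) \<alpha> s) *\<^sub>R Y)"
    by (simp add: inner_H1 inner_H2 algebra_simps)
  also have "\<dots> = (LINT s|lborel. (LINT x|lborel. H2 x s)) + (kip_const DIM('a) \<alpha> * Gamma (1 - \<alpha>) / \<alpha>) *\<^sub>R Y"
    using has_bochner_integral_kernel_difference[OF alpha dim] lborel_pair.integrable_snd[OF integrable_H2]
    by (subst Bochner_Integration.integral_add) (auto simp: has_bochner_integral_iff)
  finally show ?thesis
    by (simp only: pairing_eq scaleR_right_distrib scaleR_scaleR c_kernel_difference)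
qed

text \<open>X is the weighted norm of w, and W(s) is the same norm with w dilated but \<rho> and the
  weight kept. The real part h(s) of the form at parameter s is at least k(s) (X - W(s)) / 2. If K
  is the mass of k on (0, \<tau>), then \<open>subordinate\<close> bounds the integral of k W over
  (0, \<tau>) by (K + 2 Q) X, so that h has integral at least (K X - (K + 2 Q) X) / 2 = - Q X. As c
  Q = C, the zero-order term C X makes up for this exactly, and K has disappeared before \<tau>
  tends to 1.\<close>

lemma Re_pairing_nonneg: "Re pairing \<ge> 0"
proof -
  define lk where "lk = left_kernel DIM('a) \<alpha>"
  have lk [measurable]: "lk \<in> borel_measurable borel" and lk0: "lk s \<ge> 0" for s
    by (auto simp: lk_def kernels_nonneg)
  define Q where "Q = kip_const DIM('a) \<alpha> * Gamma (1 - \<alpha>) / \<alpha>"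
  have Q: "Q \<ge> 0" "c * Q = kip_const DIM('a) \<alpha>"
    using kip_nonneg Gamma_pos alpha by (simp add: Q_def) (simp only: Q_def c_kernel_difference)
  define X where "X = (LINT x|lborel. norm x powr (- \<alpha>) * (\<rho> x * (cmod (w x))\<^sup>2))"
  define W where "W s = (LINT x|lborel. norm x powr (- \<alpha>) * (\<rho> x * (cmod (w (s *\<^sub>R x)))\<^sup>2))" for s
  have [measurable]: "W \<in> borel_measurable borel" unfolding W_def by measurable
  have sq: "f x * cnj (w x) = complex_of_real (\<rho> x * (cmod (w x))\<^sup>2)" for x
    using complex_norm_square[of "w x"] by (simp add: scaleR_conv_of_real mult.assoc)
  have iX: "integrable lborel (\<lambda>x. norm x powr (- \<alpha>) * (\<rho> x * (cmod (w x))\<^sup>2))"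
    using integrable_Re[OF integrable_Y] unfolding sq by simp
  have YX: "Y = complex_of_real X"
    unfolding Y_def X_def sq by (simp add: scaleR_conv_of_real flip: integral_complex_of_real)
  have X0: "X \<ge> 0" unfolding X_def by (intro integral_nonneg_AE) (auto simp: rho_nonneg)
  have W0: "W s \<ge> 0" for s unfolding W_def by (intro integral_nonneg_AE) (auto simp: rho_nonneg)
  \<comment> \<open>The majorant has R in place of \<rho> and dilates the function |y|^(-\<alpha>)
    |w(y)|^2, a product of two square integrable functions; the factor s^\<alpha> makes up for the
    dilated weight.\<close>
  have iW: "integrable lborel (\<lambda>x. norm x powr (- \<alpha>) * (\<rho> x * (cmod (w (s *\<^sub>R x)))\<^sup>2))" if s: "0 < s" for s
  proof -
    define F where "F y = norm y powr (- \<alpha>) * (R * (cmod (w y))\<^sup>2)" for y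
    have "integrable lborel (\<lambda>x. cmod (norm x powr (- \<alpha>) *\<^sub>R w x) * cmod (w x))"
      using integrable_norm[OF Cauchy_Schwarz_integral(1)[OF _ _ v_L2 w_L2]] by (simp add: norm_mult mult.assoc)
    then have "integrable lborel (\<lambda>x. R * (cmod (norm x powr (- \<alpha>) *\<^sub>R w x) * cmod (w x)))"
      by (rule integrable_mult_right)
    also have "(\<lambda>x. R * (cmod (norm x powr (- \<alpha>) *\<^sub>R w x) * cmod (w x))) = F"
      by (simp add: fun_eq_iff F_def power2_eq_square)
    finally have "integrable lborel F" .
    then have "integrable lborel (\<lambda>x. s powr \<alpha> * F (s *\<^sub>R x))"
      by (intro integrable_mult_right integrable_dilation s)
    then show ?thesis
    proof (rule Bochner_Integration.integrable_bound)
      have "norm x powr (- \<alpha>) * (\<rho> x * (cmod (w (s *\<^sub>R x)))\<^sup>2) \<le> s powr \<alpha> * F (s *\<^sub>R x)" for x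
      proof -
        have "s powr \<alpha> * F (s *\<^sub>R x) = (s powr \<alpha> * s powr (- \<alpha>)) * (norm x powr (- \<alpha>) * (R * (cmod (w (s *\<^sub>R x)))\<^sup>2))"
          using s by (simp add: F_def powr_mult)
        also have "s powr \<alpha> * s powr (- \<alpha>) = 1" using s by (simp flip: powr_add)
        finally show ?thesis by (simp add: mult_left_mono mult_right_mono rho_le)
      qed
      then show "AE x in lborel. norm (norm x powr (- \<alpha>) * (\<rho> x * (cmod (w (s *\<^sub>R x)))\<^sup>2)) \<le> norm (s powr \<alpha> * F (s *\<^sub>R x))"
        using R_nonneg by (simp add: rho_nonneg F_def)
    qed measurable
  qed
  define h where "h s = Re (LINT x|lborel. H2 x s)" for s
  have ih: "integrable lborel h"
    unfolding h_def using lborel_pair.integrable_snd[OF integrable_H2] by (intro integrable_Re) simp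
  have h_ge: "h s \<ge> lk s * (X - W s) / 2" for s
  proof (cases "s > 0")
    case True
    have "(X - W s) / 2 = (LINT x|lborel. (norm x powr (- \<alpha>) * (\<rho> x * (cmod (w x))\<^sup>2) - norm x powr (- \<alpha>) * (\<rho> x * (cmod (w (s *\<^sub>R x)))\<^sup>2)) / 2)"
      unfolding X_def W_def using iX iW[OF True] by simp
    also have "\<dots> \<le> (LINT x|lborel. Re (norm x powr (- \<alpha>) *\<^sub>R (f x * cnj (w x)) - norm x powr (- \<alpha>) *\<^sub>R (f x * cnj (w (s *\<^sub>R x)))))"
    proof (rule integral_mono)
      fix x
      have "((cmod (w x))\<^sup>2 - (cmod (w (s *\<^sub>R x)))\<^sup>2) / 2 \<le> Re (w x * cnj (w x) - w x * cnj (w (s *\<^sub>R x)))"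
        using zero_le_power2[of "cmod (w x - w (s *\<^sub>R x))"]
        unfolding cmod_power2 by (simp add: power2_eq_square field_simps)
      then have "norm x powr (- \<alpha>) * (\<rho> x * (((cmod (w x))\<^sup>2 - (cmod (w (s *\<^sub>R x)))\<^sup>2) / 2))
          \<le> norm x powr (- \<alpha>) * (\<rho> x * Re (w x * cnj (w x) - w x * cnj (w (s *\<^sub>R x))))"
        by (intro mult_left_mono) (auto simp: rho_nonneg)
      then show "(norm x powr (- \<alpha>) * (\<rho> x * (cmod (w x))\<^sup>2) - norm x powr (- \<alpha>) * (\<rho> x * (cmod (w (s *\<^sub>R x)))\<^sup>2)) / 2
          \<le> Re (norm x powr (- \<alpha>) *\<^sub>R (f x * cnj (w x)) - norm x powr (- \<alpha>) *\<^sub>R (f x * cnj (w (s *\<^sub>R x))))"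
        by (simp add: algebra_simps diff_divide_distrib)
    qed (intro integrable_Re Bochner_Integration.integrable_diff integrable_divide_zero integrable_Y integrable_Z[OF True] iX iW[OF True])+
    also have "\<dots> = Re (Y - Z s)"
      unfolding Y_def Z_def
      by (subst integral_Re) (use integrable_Y integrable_Z[OF True] in auto)
    finally show ?thesis
      using lk0[of s] unfolding h_def inner_H2 lk_def[symmetric]
      by (simp add: mult_left_mono flip: times_divide_eq_right)
  qed (simp add: h_def H2_def lk_def left_kernel_def)
  have step: "c * (LINT s|lborel. indicator {0<..<\<tau>} s * h s) + kip_const DIM('a) \<alpha> * X \<ge> 0"
    if \<tau>: "0 < \<tau>" "\<tau> < 1" for \<tau>
  proof -
    let ?\<kappa> = "\<integral>\<^sup>+s. ennreal (indicator {0<..<\<tau>} s * lk s) \<partial>lborel"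
    \<comment> \<open>Below \<tau> the singular factor is at most (1-\<tau>)^(-\<alpha>-1), so this
      mass is a real number and may later be subtracted.\<close>
    have "?\<kappa> \<le> (\<integral>\<^sup>+s. ennreal ((1 - \<tau>) powr (- \<alpha> - 1)) * indicator {0<..<\<tau>} s \<partial>lborel)"
    proof (intro nn_integral_mono)
      fix s
      show "ennreal (indicator {0<..<\<tau>} s * lk s) \<le> ennreal ((1 - \<tau>) powr (- \<alpha> - 1)) * indicator {0<..<\<tau>} s"
      proof (cases "0 < s \<and> s < \<tau>")
        case True
        then have "(1 - s) powr (- \<alpha> - 1) * s ^ (DIM('a) - 1) \<le> (1 - \<tau>) powr (- \<alpha> - 1) * 1"
          using \<tau> alpha by (intro mult_mono powr_mono2' power_le_one) auto
        then show ?thesis using True \<tau> by (simp add: lk_def left_kernel_def ennreal_leI)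
      qed (auto simp: indicator_def)
    qed
    also have "\<dots> < \<infinity>" using \<tau> by (simp add: nn_integral_cmult ennreal_mult_less_top)
    finally obtain k where k: "?\<kappa> = ennreal k" "k \<ge> 0" by (cases ?\<kappa>) auto
    have ik: "integrable lborel (\<lambda>s. indicator {0<..<\<tau>} s * lk s)" and k_eq: "(LINT s|lborel. indicator {0<..<\<tau>} s * lk s) = k"
      using k has_bochner_integral_nn_integral[of "\<lambda>s. indicator {0<..<\<tau>} s * lk s" lborel k]
      by (auto simp: has_bochner_integral_iff lk0)
    have "(\<integral>\<^sup>+s. ennreal (indicator {0<..<\<tau>} s * (lk s * W s)) \<partial>lborel)
        = (\<integral>\<^sup>+s. \<integral>\<^sup>+x. ennreal (indicator {0<..<\<tau>} s * right_kernel \<alpha> s * (norm x powr (- \<alpha>) * (\<rho> (x /\<^sub>R s) * (cmod (w x))\<^sup>2))) \<partial>lborel \<partial>lborel)"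
    proof (intro nn_integral_cong)
      fix s :: real
      show "ennreal (indicator {0<..<\<tau>} s * (lk s * W s)) =
        (\<integral>\<^sup>+x. ennreal (indicator {0<..<\<tau>} s * right_kernel \<alpha> s * (norm x powr (- \<alpha>) * (\<rho> (x /\<^sub>R s) * (cmod (w x))\<^sup>2))) \<partial>lborel)"
      proof (cases "0 < s \<and> s < \<tau>")
        case True
        then have s: "s > 0" "s < 1" using \<tau> by auto
        have "ennreal (W s) = (\<integral>\<^sup>+x. ennreal (norm x powr (- \<alpha>) * (\<rho> x * (cmod (w (s *\<^sub>R x)))\<^sup>2)) \<partial>lborel)"
          unfolding W_def by (rule nn_integral_eq_integral[symmetric, OF iW[OF s(1)]]) (simp add: rho_nonneg)
        also have "\<dots> = (\<integral>\<^sup>+x. ennreal (s powr \<alpha>) * ennreal (norm (s *\<^sub>R x) powr (- \<alpha>) * (\<rho> ((s *\<^sub>R x) /\<^sub>R s) * (cmod (w (s *\<^sub>R x)))\<^sup>2)) \<partial>lborel)"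
        proof (intro nn_integral_cong)
          fix x
          have "s powr \<alpha> * (norm (s *\<^sub>R x) powr (- \<alpha>) * (\<rho> ((s *\<^sub>R x) /\<^sub>R s) * (cmod (w (s *\<^sub>R x)))\<^sup>2))
            = (s powr \<alpha> * s powr (- \<alpha>)) * (norm x powr (- \<alpha>) * (\<rho> x * (cmod (w (s *\<^sub>R x)))\<^sup>2))"
            using s by (simp add: powr_mult)
          also have "s powr \<alpha> * s powr (- \<alpha>) = 1" using s by (simp flip: powr_add)
          finally show "ennreal (norm x powr (- \<alpha>) * (\<rho> x * (cmod (w (s *\<^sub>R x)))\<^sup>2)) =
            ennreal (s powr \<alpha>) * ennreal (norm (s *\<^sub>R x) powr (- \<alpha>) * (\<rho> ((s *\<^sub>R x) /\<^sub>R s) * (cmod (w (s *\<^sub>R x)))\<^sup>2))"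
            by (simp only: ennreal_mult'[symmetric] powr_ge_zero mult_1)
        qed
        also have "\<dots> = ennreal (s powr \<alpha>) * (\<integral>\<^sup>+x. ennreal (norm (s *\<^sub>R x) powr (- \<alpha>) * (\<rho> ((s *\<^sub>R x) /\<^sub>R s) * (cmod (w (s *\<^sub>R x)))\<^sup>2)) \<partial>lborel)"
          by (intro nn_integral_cmult) measurable
        also have "(\<integral>\<^sup>+x. ennreal (norm (s *\<^sub>R x) powr (- \<alpha>) * (\<rho> ((s *\<^sub>R x) /\<^sub>R s) * (cmod (w (s *\<^sub>R x)))\<^sup>2)) \<partial>lborel)
          = ennreal (s powr - real DIM('a)) * (\<integral>\<^sup>+x. ennreal (norm x powr (- \<alpha>) * (\<rho> (x /\<^sub>R s) * (cmod (w x))\<^sup>2)) \<partial>lborel)"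
          by (rule nn_integral_dilation[OF _ s(1), where F="\<lambda>x. ennreal (norm x powr (- \<alpha>) * (\<rho> (x /\<^sub>R s) * (cmod (w x))\<^sup>2))"]) measurable
        finally have "ennreal (lk s) * ennreal (W s) = ennreal (lk s * s powr \<alpha> * s powr - real DIM('a)) *
          (\<integral>\<^sup>+x. ennreal (norm x powr (- \<alpha>) * (\<rho> (x /\<^sub>R s) * (cmod (w x))\<^sup>2)) \<partial>lborel)"
          by (simp add: ennreal_mult lk0 mult.assoc)
        \<comment> \<open>Moving the dilation from w to \<rho> turns k into q, which is why the
          subordination of \<rho> is stated with q on the left and k on the right.\<close>
        also have "lk s * s powr \<alpha> * s powr - real DIM('a) = right_kernel \<alpha> s"
          using s dim by (simp add: lk_def left_kernel_eq mult.assoc flip: powr_add)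
        also have "ennreal (right_kernel \<alpha> s) * (\<integral>\<^sup>+x. ennreal (norm x powr (- \<alpha>) * (\<rho> (x /\<^sub>R s) * (cmod (w x))\<^sup>2)) \<partial>lborel)
          = (\<integral>\<^sup>+x. ennreal (right_kernel \<alpha> s * (norm x powr (- \<alpha>) * (\<rho> (x /\<^sub>R s) * (cmod (w x))\<^sup>2))) \<partial>lborel)"
          by (subst nn_integral_cmult[symmetric]) (auto simp: ennreal_mult' kernels_nonneg)
        finally show ?thesis using True by (simp add: ennreal_mult' lk0)
      qed (auto simp: indicator_def)
    qed
    also have "\<dots> = (\<integral>\<^sup>+x. \<integral>\<^sup>+s. ennreal (indicator {0<..<\<tau>} s * right_kernel \<alpha> s * (norm x powr (- \<alpha>) * (\<rho> (x /\<^sub>R s) * (cmod (w x))\<^sup>2))) \<partial>lborel \<partial>lborel)"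
      by (rule lborel_pair.Fubini') measurable
    also have "\<dots> \<le> (\<integral>\<^sup>+x. ennreal (norm x powr (- \<alpha>) * (\<rho> x * (cmod (w x))\<^sup>2)) * (?\<kappa> + ennreal (2 * Q)) \<partial>lborel)"
    proof (intro nn_integral_mono)
      fix x
      show "(\<integral>\<^sup>+s. ennreal (indicator {0<..<\<tau>} s * right_kernel \<alpha> s * (norm x powr (- \<alpha>) * (\<rho> (x /\<^sub>R s) * (cmod (w x))\<^sup>2))) \<partial>lborel)
        \<le> ennreal (norm x powr (- \<alpha>) * (\<rho> x * (cmod (w x))\<^sup>2)) * (?\<kappa> + ennreal (2 * Q))"
      proof (cases "x \<in> D")
        case True
        have "(\<integral>\<^sup>+s. ennreal (indicator {0<..<\<tau>} s * right_kernel \<alpha> s * (norm x powr (- \<alpha>) * (\<rho> (x /\<^sub>R s) * (cmod (w x))\<^sup>2))) \<partial>lborel)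
          = (\<integral>\<^sup>+s. ennreal (norm x powr (- \<alpha>) * (cmod (w x))\<^sup>2) * ennreal (indicator {0<..<\<tau>} s * (right_kernel \<alpha> s * \<rho> (x /\<^sub>R s))) \<partial>lborel)"
          by (intro nn_integral_cong) (simp add: mult_ac flip: ennreal_mult')
        also have "\<dots> = ennreal (norm x powr (- \<alpha>) * (cmod (w x))\<^sup>2) * (\<integral>\<^sup>+s. ennreal (indicator {0<..<\<tau>} s * (right_kernel \<alpha> s * \<rho> (x /\<^sub>R s))) \<partial>lborel)"
          by (intro nn_integral_cmult) measurable
        also have "\<dots> \<le> ennreal (norm x powr (- \<alpha>) * (cmod (w x))\<^sup>2) * (ennreal (\<rho> x) * (?\<kappa> + ennreal (2 * Q)))"
          using subordinate[OF True \<tau>] by (intro mult_left_mono) (auto simp: lk_def Q_def)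
        also have "\<dots> = ennreal (norm x powr (- \<alpha>) * (\<rho> x * (cmod (w x))\<^sup>2)) * (?\<kappa> + ennreal (2 * Q))"
          by (simp add: rho_nonneg mult_ac ennreal_mult')
        finally show ?thesis .
      qed (simp add: w_out)
    qed
    also have "\<dots> = ennreal X * (?\<kappa> + ennreal (2 * Q))"
      unfolding X_def by (subst nn_integral_multc) (auto simp: nn_integral_eq_integral[OF iX] rho_nonneg)
    also have "\<dots> = ennreal (X * (k + 2 * Q))"
    proof -
      have Q2: "2 * Q \<ge> 0" "k + 2 * Q \<ge> 0" using k Q by auto
      show ?thesis
        by (simp only: k(1) ennreal_plus[symmetric, OF k(2) Q2(1)] ennreal_mult[symmetric, OF X0 Q2(2)])
    qed
    finally have nW: "(\<integral>\<^sup>+s. ennreal (indicator {0<..<\<tau>} s * (lk s * W s)) \<partial>lborel) \<le> ennreal (X * (k + 2 * Q))" .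
    have iW': "integrable lborel (\<lambda>s. indicator {0<..<\<tau>} s * (lk s * W s))"
      using nW by (intro integrableI_nonneg) (auto simp: lk0 W0 intro: order_le_less_trans)
    have "ennreal (LINT s|lborel. indicator {0<..<\<tau>} s * (lk s * W s)) \<le> ennreal (X * (k + 2 * Q))"
      using nW by (subst nn_integral_eq_integral[symmetric, OF iW']) (auto simp: lk0 W0)
    then have leW: "(LINT s|lborel. indicator {0<..<\<tau>} s * (lk s * W s)) \<le> X * (k + 2 * Q)"
      using X0 k Q by (simp add: ennreal_le_iff)
    \<comment> \<open>Here the finite mass k of the cut kernel cancels, and only - Q X is
      left.\<close>
    have "(X * k - X * (k + 2 * Q)) / 2 \<le> (LINT s|lborel. (X * (indicator {0<..<\<tau>} s * lk s) - indicator {0<..<\<tau>} s * (lk s * W s)) / 2)"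
      using leW ik iW' k_eq by simp
    also have "\<dots> \<le> (LINT s|lborel. indicator {0<..<\<tau>} s * h s)"
    proof (rule integral_mono)
      show "integrable lborel (\<lambda>s. indicator {0<..<\<tau>} s * h s)"
        using integrable_mult_indicator[OF _ ih, of "{0<..<\<tau>}"] by simp
      show "integrable lborel (\<lambda>s. (X * (indicator {0<..<\<tau>} s * lk s) - indicator {0<..<\<tau>} s * (lk s * W s)) / 2)"
        using ik iW' by simp
      fix s
      show "(X * (indicator {0<..<\<tau>} s * lk s) - indicator {0<..<\<tau>} s * (lk s * W s)) / 2 \<le> indicator {0<..<\<tau>} s * h s"
        using h_ge[of s] by (auto simp: indicator_def algebra_simps)
    qed
    finally have "- (Q * X) \<le> (LINT s|lborel. indicator {0<..<\<tau>} s * h s)"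
      by (simp add: algebra_simps)
    then have "c * - (Q * X) \<le> c * (LINT s|lborel. indicator {0<..<\<tau>} s * h s)"
      using c_pos by (intro mult_left_mono) auto
    moreover have "c * - (Q * X) = - (c * Q * X)" by simp
    ultimately show ?thesis unfolding Q(2) by linarith
  qed
  \<comment> \<open>The shift by 2 keeps the cut strictly between 0 and 1 for every n, starting from
    1/2.\<close>
  define \<tau> where "\<tau> n = 1 - 1 / (real n + 2)" for n
  have "(\<lambda>n. LINT s|lborel. indicator {0<..<\<tau> n} s * h s) \<longlonglongrightarrow> (LINT s|lborel. h s)"
  proof (rule integral_dominated_convergence[where w="\<lambda>s. norm (h s)"])
    have tau: "\<tau> \<longlonglongrightarrow> 1" unfolding \<tau>_def by real_asymp
    show "AE s in lborel. (\<lambda>n. indicator {0<..<\<tau> n} s * h s) \<longlonglongrightarrow> h s"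
    proof (intro AE_I2)
      fix s
      show "(\<lambda>n. indicator {0<..<\<tau> n} s * h s) \<longlonglongrightarrow> h s"
      proof (cases "0 < s \<and> s < 1")
        case True
        then have "\<forall>\<^sub>F n in sequentially. s < \<tau> n" using order_tendstoD(1)[OF tau] by auto
        then have "\<forall>\<^sub>F n in sequentially. indicator {0<..<\<tau> n} s * h s = h s"
          by eventually_elim (use True in auto)
        then show ?thesis by (rule tendsto_eventually)
      next
        case False
        then have "h s = 0" by (auto simp: h_def inner_H2 left_kernel_def)
        then show ?thesis by simp
      qed
    qed
  qed (use ih in \<open>auto simp: indicator_def\<close>)
  then have "(\<lambda>n. c * (LINT s|lborel. indicator {0<..<\<tau> n} s * h s) + kip_const DIM('a) \<alpha> * X)
      \<longlonglongrightarrow> c * (LINT s|lborel. h s) + kip_const DIM('a) \<alpha> * X"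
    by (intro tendsto_intros)
  then have "c * (LINT s|lborel. h s) + kip_const DIM('a) \<alpha> * X \<ge> 0"
  proof (rule LIMSEQ_le_const, intro exI allI impI)
    fix n
    show "0 \<le> c * (LINT s|lborel. indicator {0<..<\<tau> n} s * h s) + kip_const DIM('a) \<alpha> * X"
      by (rule step) (auto simp: \<tau>_def field_simps)
  qed
  also have "c * (LINT s|lborel. h s) + kip_const DIM('a) \<alpha> * X = Re pairing"
    unfolding pairing_eq YX h_def using lborel_pair.integrable_snd[OF integrable_H2]
    by (subst integral_Re) auto
  finally show ?thesis .
qed

end

subsection \<open>Passage to the domain\<close>

lemma segment_to_closure_in_open_convex:
  fixes \<Omega> :: "(real^'n) set"
  assumes \<Omega>: "open \<Omega>" "convex \<Omega>" and P: "P \<in> closure \<Omega>" and x: "P + x \<in> \<Omega>" and s: "0 < s" "s \<le> 1"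
  shows "P + s *\<^sub>R x \<in> \<Omega>"
proof -
  have "(P + x) - (1 - s) *\<^sub>R ((P + x) - P) \<in> interior \<Omega>"
  proof (cases "s = 1")
    case False
    then show ?thesis using mem_interior_closure_convex_shrink[OF \<Omega>(2) _ P, of "P + x" s] s x \<Omega>(1)
      by (simp add: interior_open algebra_simps)
  qed (use x \<Omega> in \<open>simp add: interior_open\<close>)
  then show ?thesis using \<Omega>(1) by (simp add: interior_open algebra_simps)
qed

text \<open>The parameters at which the ray lies in \<Omega> form a set that is downward closed,
  since \<Omega> is convex and P is in its closure, and open, since \<Omega> is open. This set is
  therefore the interval from 0 to d without its end points, and the strict inequalities
  follow.\<close>

lemma ray_length:
  fixes \<Omega> :: "(real^'n) set"
  assumes \<Omega>: "open \<Omega>" "convex \<Omega>" "bounded \<Omega>" and P: "P \<in> frontier \<Omega>" and Q: "Q \<in> \<Omega>"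
  defines "d \<equiv> ray_length \<Omega> P (direction P Q)"
  shows "0 < dist P Q" "dist P Q < d" "d \<le> diameter \<Omega>"
    "t > 0 \<Longrightarrow> P + t *\<^sub>R direction P Q \<in> \<Omega> \<longleftrightarrow> t < d"
proof -
  let ?e = "direction P Q"
  define S where "S = {t. 0 < t \<and> P + t *\<^sub>R ?e \<in> \<Omega>}"
  have Pc: "P \<in> closure \<Omega>" and Pn: "P \<notin> \<Omega>" using P \<Omega>(1) by (auto simp: frontier_def interior_open)
  have PQ: "P \<noteq> Q" using Pn Q by auto
  then show r0: "0 < dist P Q" by simp
  have e1: "norm ?e = 1" using PQ by (simp add: direction_def dist_norm norm_minus_commute)
  have re: "P + dist P Q *\<^sub>R ?e = Q" using PQ by (simp add: direction_def)
  have dS: "t \<le> diameter \<Omega>" if "t \<in> S" for t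
  proof -
    have "dist P (P + t *\<^sub>R ?e) \<le> diameter (closure \<Omega>)"
      using that Pc closure_subset[of \<Omega>] \<Omega>(3) by (intro diameter_bounded_bound) (auto simp: S_def)
    then show ?thesis using that e1 \<Omega>(3) by (simp add: S_def dist_norm diameter_closure)
  qed
  then have bdd: "bdd_above S" by (auto simp: bdd_above_def)
  have rS: "dist P Q \<in> S" using r0 re Q by (simp add: S_def)
  have down: "s \<in> S" if "t \<in> S" "0 < s" "s \<le> t" for s t
  proof -
    have "P + t *\<^sub>R ?e \<in> \<Omega>" "0 < s / t" "s / t \<le> 1" using that by (auto simp: S_def)
    then have "P + (s / t) *\<^sub>R (t *\<^sub>R ?e) \<in> \<Omega>" by (rule segment_to_closure_in_open_convex[OF \<Omega>(1,2) Pc])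
    then show ?thesis using that by (simp add: S_def)
  qed
  have up: "\<exists>u\<in>S. t < u" if "t \<in> S" for t
  proof -
    have "continuous_on UNIV (\<lambda>u. P + u *\<^sub>R ?e)" by (intro continuous_intros)
    then have "open ((\<lambda>u. P + u *\<^sub>R ?e) -` \<Omega>)" using \<Omega>(1) by (rule open_vimage[rotated])
    moreover have "t \<in> (\<lambda>u. P + u *\<^sub>R ?e) -` \<Omega>" using that by (simp add: S_def)
    ultimately obtain \<epsilon> where \<epsilon>: "\<epsilon> > 0" "ball t \<epsilon> \<subseteq> (\<lambda>u. P + u *\<^sub>R ?e) -` \<Omega>"
      unfolding open_contains_ball by blast
    have "t + \<epsilon> / 2 \<in> ball t \<epsilon>" using \<epsilon> by (simp add: dist_real_def)
    then have "t + \<epsilon> / 2 \<in> S" using \<epsilon> that by (auto simp: S_def)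
    then show ?thesis using \<epsilon> by (intro bexI[of _ "t + \<epsilon> / 2"]) auto
  qed
  have d: "d = Sup S" by (simp add: d_def ray_length_def S_def)
  have iff: "t \<in> S \<longleftrightarrow> t < d" if "t > 0" for t
  proof
    assume "t \<in> S"
    with up obtain u where "u \<in> S" "t < u" by blast
    with cSup_upper[OF _ bdd] show "t < d" unfolding d by fastforce
  next
    assume "t < d"
    then obtain u where "u \<in> S" "t < u" unfolding d using less_cSup_iff[OF _ bdd] rS by blast
    then show "t \<in> S" using down that by auto
  qed
  show "dist P Q < d" using iff[OF r0] rS by simp
  show "d \<le> diameter \<Omega>" unfolding d using rS dS by (intro cSup_least) auto
  show "t > 0 \<Longrightarrow> P + t *\<^sub>R direction P Q \<in> \<Omega> \<longleftrightarrow> t < d" using iff[of t] by (simp add: S_def)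
qed

text \<open>Dilations and product measures are handled for Borel functions, whereas an element of
  the space is only Lebesgue measurable on \<Omega>. Real and imaginary parts are replaced
  separately, moved so that P is the origin and set to 0 outside.\<close>

lemma ex_borel_representative:
  fixes u :: "real^'n \<Rightarrow> complex"
  assumes \<Omega>: "open \<Omega>" and u: "u \<in> borel_measurable (lebesgue_on \<Omega>)"
  obtains w where "w \<in> borel_measurable borel" "\<And>x. P + x \<notin> \<Omega> \<Longrightarrow> w x = 0"
    "AE x in lborel. P + x \<in> \<Omega> \<longrightarrow> u (P + x) = w x"
proof -
  have [measurable]: "\<Omega> \<in> sets borel" using \<Omega> by simp
  have "\<Omega> \<in> sets lebesgue" by simp
  then have m: "(\<lambda>x. if x \<in> \<Omega> then u x else 0) \<in> borel_measurable lebesgue"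
    using u by (simp add: borel_measurable_if)
  have "(\<lambda>x. Re (if x \<in> \<Omega> then u x else 0)) \<in> borel_measurable lebesgue"
    "(\<lambda>x. Im (if x \<in> \<Omega> then u x else 0)) \<in> borel_measurable lebesgue"
    by (rule measurable_compose[OF m]; measurable)+
  from this[THEN completion_ex_borel_measurable_real] obtain a b where
    ab[measurable]: "a \<in> borel_measurable lborel" "b \<in> borel_measurable lborel"
    and ae: "AE x in lborel. Re (if x \<in> \<Omega> then u x else 0) = a x" "AE x in lborel. Im (if x \<in> \<Omega> then u x else 0) = b x"
    by blast
  define w where "w x = (if P + x \<in> \<Omega> then of_real (a (P + x)) + \<i> * of_real (b (P + x)) else 0)" for x
  have [measurable]: "w \<in> borel_measurable borel" unfolding w_def by measurable
  have "AE x in lborel. x \<in> \<Omega> \<longrightarrow> u x = of_real (a x) + \<i> * of_real (b x)"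
    using ae by eventually_elim (auto simp: complex_eq_iff)
  then have "AE x in distr lborel borel ((+) P). x \<in> \<Omega> \<longrightarrow> u x = of_real (a x) + \<i> * of_real (b x)"
    by (simp only: lborel_distr_plus)
  then have "AE x in lborel. P + x \<in> \<Omega> \<longrightarrow> u (P + x) = of_real (a (P + x)) + \<i> * of_real (b (P + x))"
    by (rule AE_distrD[rotated]) simp
  then have "AE x in lborel. P + x \<in> \<Omega> \<longrightarrow> u (P + x) = w x"
    by eventually_elim (simp add: w_def)
  then show ?thesis by (intro that[of w]) (auto simp: w_def)
qed

text \<open>The bridge between Lebesgue measure on \<Omega>, in which the operators are defined, and
  integrals centred at P, in which the estimates are proved: a translation combined with extension
  by zero and completion of the measure.\<close>

lemma transfer_to_borel:
  fixes F :: "real^'n \<Rightarrow> 'b::euclidean_space" and F' :: "real^'n \<Rightarrow> 'b"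
  assumes \<Omega>: "open \<Omega>" and F'[measurable]: "F' \<in> borel_measurable borel" and out: "\<And>x. P + x \<notin> \<Omega> \<Longrightarrow> F' x = 0"
    and ae: "AE x in lborel. P + x \<in> \<Omega> \<longrightarrow> F (P + x) = F' x"
  shows "F \<in> borel_measurable (lebesgue_on \<Omega>)"
    "integrable (lebesgue_on \<Omega>) F \<longleftrightarrow> integrable lborel F'"
    "(LINT x|lebesgue_on \<Omega>. F x) = (LINT x|lborel. F' x)"
proof -
  have [measurable]: "\<Omega> \<in> sets borel" using \<Omega> by simp
  have [simp]: "\<Omega> \<in> sets lebesgue" by simp
  define H where "H y = F' (y - P)" for y
  have [measurable]: "H \<in> borel_measurable borel" unfolding H_def by measurable
  have "AE y in distr lborel borel ((+) (- P)). P + y \<in> \<Omega> \<longrightarrow> F (P + y) = F' y"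
    using ae by (simp only: lborel_distr_plus)
  then have "AE y in lborel. P + (- P + y) \<in> \<Omega> \<longrightarrow> F (P + (- P + y)) = F' (- P + y)"
    by (rule AE_distrD[rotated]) simp
  then have "AE y in lborel. H y = indicator \<Omega> y *\<^sub>R F y"
    by eventually_elim (use out in \<open>auto simp: H_def indicator_def algebra_simps\<close>)
  then have ae': "AE y in lebesgue. H y = indicator \<Omega> y *\<^sub>R F y" by (rule AE_completion)
  have Hm: "H \<in> borel_measurable lebesgue" by (simp add: measurable_completion)
  have m: "(\<lambda>y. indicator \<Omega> y *\<^sub>R F y) \<in> borel_measurable lebesgue"
    by (rule borel_measurable_AE[OF Hm ae'])
  then show "F \<in> borel_measurable (lebesgue_on \<Omega>)"
    by (subst borel_measurable_restrict_space_iff) auto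
  have HF: "integrable lborel H \<longleftrightarrow> integrable lborel F'" "(LINT y|lborel. H y) = (LINT x|lborel. F' x)"
  proof -
    have "integrable (distr lborel borel ((+) P)) H \<longleftrightarrow> integrable lborel (\<lambda>x. H (P + x))"
      by (intro integrable_distr_eq) auto
    then show "integrable lborel H \<longleftrightarrow> integrable lborel F'" by (simp add: lborel_distr_plus H_def)
    have "(LINT y|distr lborel borel ((+) P). H y) = (LINT x|lborel. H (P + x))"
      by (intro integral_distr) auto
    then show "(LINT y|lborel. H y) = (LINT x|lborel. F' x)" by (simp add: lborel_distr_plus H_def)
  qed
  have "integrable (lebesgue_on \<Omega>) F \<longleftrightarrow> integrable lebesgue (\<lambda>y. indicator \<Omega> y *\<^sub>R F y)"
    by (simp add: integrable_restrict_space)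
  also have "\<dots> \<longleftrightarrow> integrable lebesgue H"
    using ae' by (intro integrable_cong_AE m Hm) (auto simp: eq_commute)
  also have "\<dots> \<longleftrightarrow> integrable lborel H" by (simp add: integrable_completion)
  finally show "integrable (lebesgue_on \<Omega>) F \<longleftrightarrow> integrable lborel F'" using HF by simp
  have "(LINT x|lebesgue_on \<Omega>. F x) = (LINT y|lebesgue. indicator \<Omega> y *\<^sub>R F y)"
    by (simp add: integral_restrict_space)
  also have "\<dots> = (LINT y|lebesgue. H y)"
    using ae' by (intro integral_cong_AE m Hm) (auto simp: eq_commute)
  also have "\<dots> = (LINT y|lborel. H y)" by (simp add: integral_completion)
  finally show "(LINT x|lebesgue_on \<Omega>. F x) = (LINT x|lborel. F' x)" using HF by simp
qed

text \<open>The fundamental theorem of calculus along the ray from P, followed by Cauchy-Schwarz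
  twice: over the coordinates, which separates |x| from the gradient, and over t, which yields the
  factor 1 - s.\<close>

lemma C1_increment:
  fixes \<phi> :: "real^'n \<Rightarrow> complex"
  assumes \<phi>: "C_k 1 \<phi>" and s: "0 < s" "s < 1"
  shows "ennreal ((cmod (\<phi> (P + x) - \<phi> (P + s *\<^sub>R x)))\<^sup>2)
    \<le> ennreal (1 - s) * (\<integral>\<^sup>+t. ennreal (indicator {s..1} t *
        ((norm x)\<^sup>2 * (\<Sum>i\<in>UNIV. (cmod (partial i \<phi> (P + t *\<^sub>R x)))\<^sup>2))) \<partial>lborel)"
proof -
  have dif: "\<phi> differentiable at y" and con: "continuous_on UNIV (partial i \<phi>)" for y i using \<phi> by auto
  define F' where "F' t = (\<Sum>i\<in>UNIV. (x $ i) *\<^sub>R partial i \<phi> (P + t *\<^sub>R x))" for t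
  have F': "((\<lambda>t. \<phi> (P + t *\<^sub>R x)) has_vector_derivative F' t) (at t within {s..1})" for t
  proof -
    have "((\<lambda>t. P + t *\<^sub>R x) has_derivative (\<lambda>h. h *\<^sub>R x)) (at t within {s..1})"
      by (auto intro!: derivative_eq_intros)
    from has_derivative_compose[OF this differentiable_has_derivative[OF dif]]
    show ?thesis
      unfolding has_vector_derivative_def F'_def
      by (simp add: frechet_derivative_partial[OF dif] scaleR_sum_right)
  qed
  have cF': "continuous_on {s..1} F'"
    unfolding F'_def by (intro continuous_intros continuous_on_compose2[OF con]) auto
  have cF'': "continuous_on UNIV F'"
    unfolding F'_def by (intro continuous_intros continuous_on_compose2[OF con]) auto
  then have [measurable]: "F' \<in> borel_measurable borel" by (rule borel_measurable_continuous_onI)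
  have hb: "has_bochner_integral lborel (\<lambda>t. indicator {s..1} t *\<^sub>R F' t) (\<phi> (P + 1 *\<^sub>R x) - \<phi> (P + s *\<^sub>R x))"
    using s by (intro has_bochner_integral_FTC_Icc F' cF') auto
  have F'le: "(cmod (F' t))\<^sup>2 \<le> (norm x)\<^sup>2 * (\<Sum>i\<in>UNIV. (cmod (partial i \<phi> (P + t *\<^sub>R x)))\<^sup>2)" for t
  proof -
    have "cmod (F' t) \<le> (\<Sum>i\<in>UNIV. \<bar>x $ i\<bar> * cmod (partial i \<phi> (P + t *\<^sub>R x)))"
      unfolding F'_def by (rule order_trans[OF norm_sum]) simp
    also have "\<dots> \<le> L2_set (\<lambda>i. x $ i) UNIV * L2_set (\<lambda>i. cmod (partial i \<phi> (P + t *\<^sub>R x))) UNIV"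
      using L2_set_mult_ineq[of "\<lambda>i. x $ i" "\<lambda>i. cmod (partial i \<phi> (P + t *\<^sub>R x))" UNIV] by simp
    finally have "(cmod (F' t))\<^sup>2 \<le> (L2_set (\<lambda>i. x $ i) UNIV * L2_set (\<lambda>i. cmod (partial i \<phi> (P + t *\<^sub>R x))) UNIV)\<^sup>2"
      by (intro power_mono) auto
    also have "\<dots> = (norm x)\<^sup>2 * (\<Sum>i\<in>UNIV. (cmod (partial i \<phi> (P + t *\<^sub>R x)))\<^sup>2)"
      by (simp add: power_mult_distrib norm_vec_def L2_set_def sum_nonneg)
    finally show ?thesis .
  qed
  have "ennreal ((cmod (\<phi> (P + x) - \<phi> (P + s *\<^sub>R x)))\<^sup>2) = (ennreal (cmod (LINT t|lborel. indicator {s..1} t *\<^sub>R F' t)))\<^sup>2"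
    using hb by (simp add: has_bochner_integral_iff ennreal_power)
  also have "\<dots> \<le> (\<integral>\<^sup>+t. ennreal (cmod (indicator {s..1} t *\<^sub>R F' t)) \<partial>lborel)\<^sup>2"
    using hb by (intro power_mono integral_norm_bound_ennreal) (auto simp: has_bochner_integral_iff)
  \<comment> \<open>The indicator is duplicated so that Cauchy-Schwarz can use one copy as a factor;
    the integral of its square is 1 - s.\<close>
  also have "(\<lambda>t. ennreal (cmod (indicator {s..1} t *\<^sub>R F' t))) = (\<lambda>t. indicator {s..1} t * ennreal (indicator {s..1} t * cmod (F' t)))"
    by (auto simp: indicator_def fun_eq_iff)
  also have "(\<integral>\<^sup>+t. indicator {s..1} t * ennreal (indicator {s..1} t * cmod (F' t)) \<partial>lborel)\<^sup>2
      \<le> (\<integral>\<^sup>+t. (indicator {s..1} t)\<^sup>2 \<partial>lborel) * (\<integral>\<^sup>+t. (ennreal (indicator {s..1} t * cmod (F' t)))\<^sup>2 \<partial>lborel)"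
    by (intro nn_integral_Cauchy_Schwarz) auto
  also have "(\<integral>\<^sup>+t. (indicator {s..1} t)\<^sup>2 \<partial>lborel) = ennreal (1 - s)"
  proof -
    have "(\<lambda>t. (indicator {s..1} t)\<^sup>2) = (indicator {s..1} :: real \<Rightarrow> ennreal)" by (auto simp: indicator_def fun_eq_iff)
    then show ?thesis using s by simp
  qed
  also have "(\<integral>\<^sup>+t. (ennreal (indicator {s..1} t * cmod (F' t)))\<^sup>2 \<partial>lborel) \<le>
    (\<integral>\<^sup>+t. ennreal (indicator {s..1} t * ((norm x)\<^sup>2 * (\<Sum>i\<in>UNIV. (cmod (partial i \<phi> (P + t *\<^sub>R x)))\<^sup>2))) \<partial>lborel)"
    by (intro nn_integral_mono) (auto simp: indicator_def ennreal_power intro!: ennreal_leI F'le)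
  finally show ?thesis by (simp add: mult_left_mono)
qed

lemma dist_le_diameter:
  fixes \<Omega> :: "(real^'n) set"
  assumes "bounded \<Omega>" "P \<in> closure \<Omega>" "P + x \<in> \<Omega>"
  shows "norm x \<le> diameter \<Omega>"
proof -
  have "dist P (P + x) \<le> diameter (closure \<Omega>)"
    using assms closure_subset[of \<Omega>] by (intro diameter_bounded_bound) auto
  then show ?thesis using assms by (simp add: dist_norm diameter_closure)
qed

text \<open>The support is a compact subset of \<Omega>, which does not contain P, so \<phi>
  vanishes in a ball about P. There the singular weight is harmless, and the weighted norm is
  finite.\<close>

lemma test_function_dilation_estimate:
  fixes \<phi> :: "real^'n \<Rightarrow> complex"
  assumes n: "CARD('n) \<ge> 2" and \<alpha>: "0 < \<alpha>" "\<alpha> < 1"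
    and \<Omega>: "open \<Omega>" "bounded \<Omega>" and P: "P \<in> frontier \<Omega>" and \<phi>: "test_function \<Omega> \<phi>"
  shows "dilation_estimate (\<lambda>x. \<phi> (P + x)) (\<lambda>x. \<Sum>i\<in>UNIV. (cmod (partial i \<phi> (P + x)))\<^sup>2) \<alpha> (diameter \<Omega>)
    (\<Sum>i\<in>UNIV. (l2_norm \<Omega> (partial i \<phi>))\<^sup>2)"
proof -
  have Pc: "P \<in> closure \<Omega>" and Pn: "P \<notin> \<Omega>" using P \<Omega>(1) by (auto simp: frontier_def interior_open)
  define K where "K = closure {x. \<phi> x \<noteq> 0}"
  have K: "compact K" "K \<subseteq> \<Omega>" and \<phi>C: "C_k k \<phi>" for k
    using \<phi> by (auto simp: test_function_def K_def)
  have oK: "open (- K)" by (simp add: K_def open_Compl)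
  have \<phi>0: "\<phi> x = 0" if "x \<notin> K" for x using that closure_subset by (force simp: K_def)
  have p0: "partial i \<phi> x = 0" if "x \<notin> K" for x i
    using that oK \<phi>0 by (intro partial_eq_0(2)[of "- K"]) auto
  have \<phi>c: "continuous_on UNIV \<phi>" using \<phi>C by (rule C_k_continuous)
  have pc: "continuous_on UNIV (partial i \<phi>)" for i using \<phi>C[of 1] by simp
  have [measurable]: "\<phi> \<in> borel_measurable borel" "partial i \<phi> \<in> borel_measurable borel" for i
    using \<phi>c pc by (auto intro: borel_measurable_continuous_onI)
  have delta: "norm x \<le> diameter \<Omega>" if "P + x \<in> K" for x
    using that K dist_le_diameter[OF \<Omega>(2) Pc] by blast
  have inK: "P + x \<notin> K" if "norm x > diameter \<Omega>" for x using delta that by force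
  obtain a b where ab: "K \<subseteq> cbox a b" using bounded_subset_cbox_symmetric[OF compact_imp_bounded[OF K(1)]] by blast
  show ?thesis
  proof
    show "2 \<le> DIM(real^'n)" using n by simp
    show "(\<Sum>i\<in>UNIV. (cmod (partial i \<phi> (P + x)))\<^sup>2) = 0" if "diameter \<Omega> < norm x" for x
      using inK[OF that] by (simp add: p0)
    show "ennreal ((cmod (\<phi> (P + x) - \<phi> (P + s *\<^sub>R x)))\<^sup>2)
      \<le> ennreal (1 - s) * (\<integral>\<^sup>+t. ennreal (indicator {s..1} t * ((norm x)\<^sup>2 * (\<Sum>i\<in>UNIV. (cmod (partial i \<phi> (P + t *\<^sub>R x)))\<^sup>2))) \<partial>lborel)"
      if "0 < s" "s < 1" for s x
      using C1_increment[OF \<phi>C that] .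
    show "(\<integral>\<^sup>+x. ennreal (\<Sum>i\<in>UNIV. (cmod (partial i \<phi> (P + x)))\<^sup>2) \<partial>lborel) \<le> ennreal (\<Sum>i\<in>UNIV. (l2_norm \<Omega> (partial i \<phi>))\<^sup>2)"
    proof -
      have "(\<integral>\<^sup>+x. ennreal ((cmod (partial i \<phi> (P + x)))\<^sup>2) \<partial>lborel) = ennreal ((l2_norm \<Omega> (partial i \<phi>))\<^sup>2)" for i
      proof -
        have "continuous_on UNIV (\<lambda>x. complex_of_real ((cmod (partial i \<phi> x))\<^sup>2))"
          by (intro continuous_intros pc)
        then have "integrable lborel (\<lambda>x. complex_of_real ((cmod (partial i \<phi> x))\<^sup>2))"
          using p0 ab by (intro integrable_continuous_cbox_support(1)[of _ a b]) auto
        from integrable_Re[OF this] have i0: "integrable lborel (\<lambda>x. (cmod (partial i \<phi> x))\<^sup>2)" by simp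
        have "integrable (distr lborel borel ((+) P)) (\<lambda>x. (cmod (partial i \<phi> x))\<^sup>2)"
          using i0 by (simp only: lborel_distr_plus)
        then have i1: "integrable lborel (\<lambda>x. (cmod (partial i \<phi> (P + x)))\<^sup>2)"
          by (subst (asm) integrable_distr_eq) auto
        have "(LINT x|lebesgue_on \<Omega>. (cmod (partial i \<phi> x))\<^sup>2) = (LINT x|lborel. (cmod (partial i \<phi> (P + x)))\<^sup>2)"
          using p0 K(2) by (intro transfer_to_borel(3)[OF \<Omega>(1), of _ P]) auto
        moreover have "(LINT x|lebesgue_on \<Omega>. (cmod (partial i \<phi> x))\<^sup>2) = (l2_norm \<Omega> (partial i \<phi>))\<^sup>2"
          by (simp add: l2_norm_def integral_nonneg_AE)
        ultimately show ?thesis using nn_integral_eq_integral[OF i1] by simp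
      qed
      then have "(\<integral>\<^sup>+x. (\<Sum>i\<in>UNIV. ennreal ((cmod (partial i \<phi> (P + x)))\<^sup>2)) \<partial>lborel) = ennreal (\<Sum>i\<in>UNIV. (l2_norm \<Omega> (partial i \<phi>))\<^sup>2)"
        by (subst nn_integral_sum) auto
      then show ?thesis by simp
    qed
    show "(\<integral>\<^sup>+x. ennreal (norm x powr (- 2 * \<alpha>) * (cmod (\<phi> (P + x)))\<^sup>2) \<partial>lborel) < \<infinity>"
    proof -
      have "P \<in> - K" using Pn K by blast
      then obtain r where r: "r > 0" "ball P r \<subseteq> - K" using oK open_contains_ball by blast
      obtain C where C: "\<And>x. x \<in> K \<Longrightarrow> cmod (\<phi> x) \<le> C"
        using compact_imp_bounded[OF compact_continuous_image[OF continuous_on_subset[OF \<phi>c] K(1)]]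
        by (auto simp: bounded_iff)
      have "(\<integral>\<^sup>+x. ennreal (norm x powr (- 2 * \<alpha>) * (cmod (\<phi> (P + x)))\<^sup>2) \<partial>lborel)
        \<le> (\<integral>\<^sup>+x. ennreal (r powr (- 2 * \<alpha>) * C\<^sup>2) * indicator (cball (0::real^'n) (diameter \<Omega>)) x \<partial>lborel)"
      proof (intro nn_integral_mono)
        fix x :: "real^'n"
        show "ennreal (norm x powr (- 2 * \<alpha>) * (cmod (\<phi> (P + x)))\<^sup>2) \<le> ennreal (r powr (- 2 * \<alpha>) * C\<^sup>2) * indicator (cball 0 (diameter \<Omega>)) x"
        proof (cases "P + x \<in> K")
          case True
          then have "P + x \<notin> ball P r" using r by blast
          then have "norm x \<ge> r" by (simp add: dist_norm)
          then have "norm x powr (- 2 * \<alpha>) \<le> r powr (- 2 * \<alpha>)" using r \<alpha> by (intro powr_mono2') auto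
          moreover have "(cmod (\<phi> (P + x)))\<^sup>2 \<le> C\<^sup>2" using C[OF True] by (intro power_mono) auto
          ultimately have "norm x powr (- 2 * \<alpha>) * (cmod (\<phi> (P + x)))\<^sup>2 \<le> r powr (- 2 * \<alpha>) * C\<^sup>2"
            by (intro mult_mono) auto
          then show ?thesis using delta[OF True] by (simp add: ennreal_leI)
        qed (simp add: \<phi>0)
      qed
      also have "\<dots> < \<infinity>"
        using emeasure_bounded_finite[OF bounded_cball, of 0 "diameter \<Omega>"] by (subst nn_integral_cmult_indicator) (auto simp: ennreal_mult_less_top)
      finally show ?thesis .
    qed
  qed (use \<alpha> in \<open>auto intro: sum_nonneg\<close>)
qed

subsection \<open>Square integrable functions\<close>

lemma L2_D:
  assumes "f \<in> L2 \<Omega>"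
  shows "f \<in> borel_measurable (lebesgue_on \<Omega>)" "integrable (lebesgue_on \<Omega>) (\<lambda>x. (cmod (f x))\<^sup>2)"
  using assms by (auto simp: L2_def)

lemma l2_norm_sq: "(l2_norm \<Omega> f)\<^sup>2 = (LINT x|lebesgue_on \<Omega>. (cmod (f x))\<^sup>2)"
  by (simp add: l2_norm_def integral_nonneg_AE)

lemma l2_norm_nonneg: "l2_norm \<Omega> f \<ge> 0"
  by (simp add: l2_norm_def integral_nonneg_AE)

lemma L2_add:
  assumes f: "f \<in> L2 \<Omega>" and g: "g \<in> L2 \<Omega>"
  shows "(\<lambda>x. f x + g x) \<in> L2 \<Omega>"
proof -
  note [measurable] = L2_D(1)[OF f] L2_D(1)[OF g]
  have "integrable (lebesgue_on \<Omega>) (\<lambda>x. (cmod (f x + g x))\<^sup>2)"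
  proof (rule Bochner_Integration.integrable_bound)
    show "integrable (lebesgue_on \<Omega>) (\<lambda>x. 2 * (cmod (f x))\<^sup>2 + 2 * (cmod (g x))\<^sup>2)"
      using f g by (auto simp: L2_def)
    have "(cmod (f x + g x))\<^sup>2 \<le> 2 * (cmod (f x))\<^sup>2 + 2 * (cmod (g x))\<^sup>2" for x
    proof -
      have "(cmod (f x + g x))\<^sup>2 \<le> (cmod (f x) + cmod (g x))\<^sup>2"
        by (intro power_mono norm_triangle_ineq) auto
      also have "\<dots> \<le> 2 * (cmod (f x))\<^sup>2 + 2 * (cmod (g x))\<^sup>2"
        using zero_le_power2[of "cmod (f x) - cmod (g x)"] by (simp add: power2_diff power2_sum)
      finally show ?thesis .
    qed
    then show "AE x in lebesgue_on \<Omega>. norm ((cmod (f x + g x))\<^sup>2) \<le> norm (2 * (cmod (f x))\<^sup>2 + 2 * (cmod (g x))\<^sup>2)"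
      by simp
  qed measurable
  then show ?thesis by (simp add: L2_def)
qed

lemma L2_uminus: "f \<in> L2 \<Omega> \<Longrightarrow> (\<lambda>x. - f x) \<in> L2 \<Omega>"
  by (auto simp: L2_def)

lemma L2_diff: "f \<in> L2 \<Omega> \<Longrightarrow> g \<in> L2 \<Omega> \<Longrightarrow> (\<lambda>x. f x - g x) \<in> L2 \<Omega>"
  using L2_add[of f \<Omega> "\<lambda>x. - g x"] L2_uminus[of g \<Omega>] by simp

lemma L2_bounded_mult:
  fixes a :: "real^'n \<Rightarrow> real"
  assumes \<Omega>: "open \<Omega>" and f: "f \<in> L2 \<Omega>" and a: "continuous_on \<Omega> a" "\<And>x. x \<in> \<Omega> \<Longrightarrow> \<bar>a x\<bar> \<le> c"
  shows "(\<lambda>x. a x *\<^sub>R f x) \<in> L2 \<Omega>"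
proof -
  have am: "a \<in> borel_measurable (lebesgue_on \<Omega>)"
    using a(1) \<Omega> by (intro continuous_imp_measurable_on_sets_lebesgue) auto
  note [measurable] = L2_D(1)[OF f] am
  have "integrable (lebesgue_on \<Omega>) (\<lambda>x. (cmod (a x *\<^sub>R f x))\<^sup>2)"
  proof (rule Bochner_Integration.integrable_bound)
    show "integrable (lebesgue_on \<Omega>) (\<lambda>x. c\<^sup>2 * (cmod (f x))\<^sup>2)"
      using f by (auto simp: L2_def)
    have "(a x)\<^sup>2 * (cmod (f x))\<^sup>2 \<le> c\<^sup>2 * (cmod (f x))\<^sup>2" if "x \<in> \<Omega>" for x
      using power_mono[OF a(2)[OF that], of 2] by (intro mult_right_mono) auto
    then show "AE x in lebesgue_on \<Omega>. norm ((cmod (a x *\<^sub>R f x))\<^sup>2) \<le> norm (c\<^sup>2 * (cmod (f x))\<^sup>2)"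
      by (intro AE_I2) (auto simp: power_mult_distrib space_restrict_space)
  qed measurable
  then show ?thesis by (simp add: L2_def)
qed

lemma L2_cnj_mult:
  assumes "f \<in> L2 \<Omega>" "g \<in> L2 \<Omega>"
  shows "integrable (lebesgue_on \<Omega>) (\<lambda>x. f x * cnj (g x))"
    "cmod (l2_inner \<Omega> f g) \<le> l2_norm \<Omega> f * l2_norm \<Omega> g"
  using Cauchy_Schwarz_integral[of f "lebesgue_on \<Omega>" "\<lambda>x. cnj (g x)"] assms[THEN L2_D(1)] assms[THEN L2_D(2)]
  by (auto simp: l2_inner_def l2_norm_def)

lemma l2_inner_diff:
  assumes "f \<in> L2 \<Omega>" "f' \<in> L2 \<Omega>" "g \<in> L2 \<Omega>"
  shows "l2_inner \<Omega> (\<lambda>x. f x - f' x) g = l2_inner \<Omega> f g - l2_inner \<Omega> f' g"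
    "l2_inner \<Omega> g (\<lambda>x. f x - f' x) = l2_inner \<Omega> g f - l2_inner \<Omega> g f'"
  using L2_cnj_mult(1)[OF assms(1,3)] L2_cnj_mult(1)[OF assms(2,3)] L2_cnj_mult(1)[OF assms(3,1)] L2_cnj_mult(1)[OF assms(3,2)]
  by (simp_all add: l2_inner_def left_diff_distrib right_diff_distrib)

lemma l2_norm_triangle:
  assumes f: "f \<in> L2 \<Omega>" and g: "g \<in> L2 \<Omega>"
  shows "l2_norm \<Omega> (\<lambda>x. f x + g x) \<le> l2_norm \<Omega> f + l2_norm \<Omega> g"
proof (rule power2_le_imp_le)
  define h where "h x = Re (f x * cnj (g x))" for x
  have h: "integrable (lebesgue_on \<Omega>) h" "(LINT x|lebesgue_on \<Omega>. h x) = Re (l2_inner \<Omega> f g)"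
    unfolding h_def l2_inner_def using L2_cnj_mult(1)[OF f g] by (auto intro: integrable_Re integral_Re simp del: times_complex.simps)
  have "(l2_norm \<Omega> (\<lambda>x. f x + g x))\<^sup>2 = (LINT x|lebesgue_on \<Omega>. (cmod (f x))\<^sup>2 + (cmod (g x))\<^sup>2 + 2 * h x)"
    unfolding l2_norm_sq
    by (intro Bochner_Integration.integral_cong refl) (simp add: h_def cmod_power2 power2_sum algebra_simps)
  also have "\<dots> = (l2_norm \<Omega> f)\<^sup>2 + (l2_norm \<Omega> g)\<^sup>2 + 2 * Re (l2_inner \<Omega> f g)"
    using L2_D(2)[OF f] L2_D(2)[OF g] h by (simp add: l2_norm_sq)
  also have "\<dots> \<le> (l2_norm \<Omega> f)\<^sup>2 + (l2_norm \<Omega> g)\<^sup>2 + 2 * (l2_norm \<Omega> f * l2_norm \<Omega> g)"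
    using L2_cnj_mult(2)[OF f g] complex_Re_le_cmod[of "l2_inner \<Omega> f g"] by linarith
  also have "\<dots> = (l2_norm \<Omega> f + l2_norm \<Omega> g)\<^sup>2" by (simp add: power2_sum)
  finally show "(l2_norm \<Omega> (\<lambda>x. f x + g x))\<^sup>2 \<le> (l2_norm \<Omega> f + l2_norm \<Omega> g)\<^sup>2" .
qed (simp add: l2_norm_nonneg)

lemma l2_norm_minus_commute: "l2_norm \<Omega> (\<lambda>x. f x - g x) = l2_norm \<Omega> (\<lambda>x. g x - f x)"
  by (simp add: l2_norm_def norm_minus_commute)

lemma l2_norm_diff_le:
  assumes f: "f \<in> L2 \<Omega>" and g: "g \<in> L2 \<Omega>"
  shows "\<bar>l2_norm \<Omega> f - l2_norm \<Omega> g\<bar> \<le> l2_norm \<Omega> (\<lambda>x. f x - g x)"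
  using l2_norm_triangle[OF L2_diff[OF f g] g] l2_norm_triangle[OF L2_diff[OF g f] f] l2_norm_minus_commute[of \<Omega> f g]
  by simp

lemma l2_tendsto_norm:
  assumes "l2_tendsto \<Omega> f g F"
  shows "((\<lambda>k. l2_norm \<Omega> (f k)) \<longlongrightarrow> l2_norm \<Omega> g) F"
proof -
  have g: "g \<in> L2 \<Omega>" and f: "\<forall>\<^sub>F k in F. f k \<in> L2 \<Omega>" and l: "((\<lambda>k. l2_norm \<Omega> (\<lambda>x. f k x - g x)) \<longlongrightarrow> 0) F"
    using assms by (auto simp: l2_tendsto_def)
  have "\<forall>\<^sub>F k in F. norm (l2_norm \<Omega> (f k) - l2_norm \<Omega> g) \<le> l2_norm \<Omega> (\<lambda>x. f k x - g x)"
    using f by eventually_elim (simp add: l2_norm_diff_le g)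
  then have "((\<lambda>k. l2_norm \<Omega> (f k) - l2_norm \<Omega> g) \<longlongrightarrow> 0) F" using l by (rule Lim_null_comparison)
  then show ?thesis by (rule LIM_zero_cancel)
qed

lemma l2_tendsto_inner:
  assumes "l2_tendsto \<Omega> f g F" "l2_tendsto \<Omega> f' g' F"
  shows "((\<lambda>k. l2_inner \<Omega> (f k) (f' k)) \<longlongrightarrow> l2_inner \<Omega> g g') F"
proof -
  have g: "g \<in> L2 \<Omega>" "g' \<in> L2 \<Omega>" and f: "\<forall>\<^sub>F k in F. f k \<in> L2 \<Omega>" "\<forall>\<^sub>F k in F. f' k \<in> L2 \<Omega>"
    and l: "((\<lambda>k. l2_norm \<Omega> (\<lambda>x. f k x - g x)) \<longlongrightarrow> 0) F" "((\<lambda>k. l2_norm \<Omega> (\<lambda>x. f' k x - g' x)) \<longlongrightarrow> 0) F"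
    using assms by (auto simp: l2_tendsto_def)
  have "\<forall>\<^sub>F k in F. norm (l2_inner \<Omega> (f k) (f' k) - l2_inner \<Omega> g g')
      \<le> l2_norm \<Omega> (\<lambda>x. f k x - g x) * l2_norm \<Omega> (f' k) + l2_norm \<Omega> g * l2_norm \<Omega> (\<lambda>x. f' k x - g' x)"
    using f
  proof eventually_elim
    case (elim k)
    have "l2_inner \<Omega> (f k) (f' k) - l2_inner \<Omega> g g' = l2_inner \<Omega> (\<lambda>x. f k x - g x) (f' k) + l2_inner \<Omega> g (\<lambda>x. f' k x - g' x)"
      using elim g by (simp add: l2_inner_diff)
    then show ?case
      using L2_cnj_mult(2)[OF L2_diff[OF elim(1) g(1)] elim(2)] L2_cnj_mult(2)[OF g(1) L2_diff[OF elim(2) g(2)]]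
        norm_triangle_ineq[of "l2_inner \<Omega> (\<lambda>x. f k x - g x) (f' k)" "l2_inner \<Omega> g (\<lambda>x. f' k x - g' x)"]
      by simp
  qed
  moreover have "((\<lambda>k. l2_norm \<Omega> (\<lambda>x. f k x - g x) * l2_norm \<Omega> (f' k) + l2_norm \<Omega> g * l2_norm \<Omega> (\<lambda>x. f' k x - g' x)) \<longlongrightarrow>
      0 * l2_norm \<Omega> g' + l2_norm \<Omega> g * 0) F"
    by (intro tendsto_intros l l2_tendsto_norm[OF assms(2)])
  ultimately have "((\<lambda>k. l2_inner \<Omega> (f k) (f' k) - l2_inner \<Omega> g g') \<longlongrightarrow> 0) F"
    by (auto intro: Lim_null_comparison)
  then show ?thesis by (rule LIM_zero_cancel)
qed

lemma l2_tendsto_const: "f \<in> L2 \<Omega> \<Longrightarrow> l2_tendsto \<Omega> (\<lambda>_. f) f F"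
  by (simp add: l2_tendsto_def l2_norm_def)

lemma l2_tendsto_unique:
  assumes F: "F \<noteq> bot" and g: "l2_tendsto \<Omega> f g F" and g': "l2_tendsto \<Omega> f g' F"
  shows "AE x in lebesgue_on \<Omega>. g x = g' x"
proof -
  have gL: "g \<in> L2 \<Omega>" "g' \<in> L2 \<Omega>" and f: "\<forall>\<^sub>F k in F. f k \<in> L2 \<Omega>"
    and l: "((\<lambda>k. l2_norm \<Omega> (\<lambda>x. f k x - g x)) \<longlongrightarrow> 0) F" "((\<lambda>k. l2_norm \<Omega> (\<lambda>x. f k x - g' x)) \<longlongrightarrow> 0) F"
    using g g' by (auto simp: l2_tendsto_def)
  have "\<forall>\<^sub>F k in F. l2_norm \<Omega> (\<lambda>x. g x - g' x) \<le> l2_norm \<Omega> (\<lambda>x. f k x - g x) + l2_norm \<Omega> (\<lambda>x. f k x - g' x)"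
    using f
  proof eventually_elim
    case (elim k)
    then show ?case
      using l2_norm_triangle[OF L2_diff[OF gL(1) elim] L2_diff[OF elim gL(2)]] l2_norm_minus_commute[of \<Omega> g "f k"] by simp
  qed
  moreover have "((\<lambda>k. l2_norm \<Omega> (\<lambda>x. f k x - g x) + l2_norm \<Omega> (\<lambda>x. f k x - g' x)) \<longlongrightarrow> 0 + 0) F"
    by (intro tendsto_intros l)
  ultimately have "l2_norm \<Omega> (\<lambda>x. g x - g' x) \<le> 0 + 0"
    using F by (intro tendsto_le[OF F _ tendsto_const]) auto
  then have "l2_norm \<Omega> (\<lambda>x. g x - g' x) = 0" using l2_norm_nonneg[of \<Omega> "\<lambda>x. g x - g' x"] by simp
  then have "(LINT x|lebesgue_on \<Omega>. (cmod (g x - g' x))\<^sup>2) = 0" using l2_norm_sq[of \<Omega> "\<lambda>x. g x - g' x"] by simp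
  then have "AE x in lebesgue_on \<Omega>. (cmod (g x - g' x))\<^sup>2 = 0"
    using integral_nonneg_eq_0_iff_AE[OF L2_D(2)[OF L2_diff[OF gL]]] by simp
  then show ?thesis by simp
qed

lemma l2_inner_cong_AE:
  assumes "f \<in> borel_measurable (lebesgue_on \<Omega>)" "f' \<in> borel_measurable (lebesgue_on \<Omega>)" "g \<in> borel_measurable (lebesgue_on \<Omega>)"
    and "AE x in lebesgue_on \<Omega>. f x = f' x"
  shows "l2_inner \<Omega> f g = l2_inner \<Omega> f' g"
  unfolding l2_inner_def
  by (rule integral_cong_AE) (use assms in auto)

lemma AE_lebesgue_on_iff:
  fixes \<Omega> :: "(real^'n) set"
  assumes "open \<Omega>"
  shows "(AE x in lebesgue_on \<Omega>. Q x) \<longleftrightarrow> (AE x in lborel. P + x \<in> \<Omega> \<longrightarrow> Q (P + x))"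
proof -
  have "(AE x in lebesgue_on \<Omega>. Q x) \<longleftrightarrow> (AE x in lebesgue. x \<in> \<Omega> \<longrightarrow> Q x)"
    using assms by (subst AE_restrict_space_iff) auto
  also have "\<dots> \<longleftrightarrow> (AE x in lborel. x \<in> \<Omega> \<longrightarrow> Q x)" by (rule AE_completion_iff)
  also have "\<dots> \<longleftrightarrow> (AE x in lborel. P + x \<in> \<Omega> \<longrightarrow> Q (P + x))"
  proof
    assume "AE x in lborel. x \<in> \<Omega> \<longrightarrow> Q x"
    then have "AE x in distr lborel borel ((+) P). x \<in> \<Omega> \<longrightarrow> Q x" by (simp only: lborel_distr_plus)
    then show "AE x in lborel. P + x \<in> \<Omega> \<longrightarrow> Q (P + x)" by (rule AE_distrD[rotated]) simp
  next
    assume "AE x in lborel. P + x \<in> \<Omega> \<longrightarrow> Q (P + x)"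
    then have "AE x in distr lborel borel ((+) (- P)). P + x \<in> \<Omega> \<longrightarrow> Q (P + x)" by (simp only: lborel_distr_plus)
    then have "AE x in lborel. P + (- P + x) \<in> \<Omega> \<longrightarrow> Q (P + (- P + x))" by (rule AE_distrD[rotated]) simp
    then show "AE x in lborel. x \<in> \<Omega> \<longrightarrow> Q x" by simp
  qed
  finally show ?thesis .
qed

text \<open>The test functions that approximate u satisfy the estimates with their own Dirichlet
  integrals. A subsequence converges almost everywhere, the Dirichlet integrals converge to that of
  u, and Fatou's lemma passes to the limit.\<close>

lemma sobolev10_dilation_class:
  fixes u :: "real^'n \<Rightarrow> complex"
  assumes n: "CARD('n) \<ge> 2" and \<alpha>: "0 < \<alpha>" "\<alpha> < 1"
    and \<Omega>: "open \<Omega>" "convex \<Omega>" "bounded \<Omega>" and P: "P \<in> frontier \<Omega>" and u: "u \<in> sobolev10 \<Omega>"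
  obtains w where "AE x in lborel. P + x \<in> \<Omega> \<longrightarrow> u (P + x) = w x"
    "dilation_class {x. P + x \<in> \<Omega>} \<alpha> (diameter \<Omega>)
      (class_const CARD('n) \<alpha> (diameter \<Omega>) * (\<Sum>i\<in>UNIV. (l2_norm \<Omega> (weak_partial \<Omega> i u))\<^sup>2)) w"
proof -
  let ?E = "\<Sum>i\<in>UNIV. (l2_norm \<Omega> (weak_partial \<Omega> i u))\<^sup>2"
  let ?K = "class_const CARD('n) \<alpha> (diameter \<Omega>)"
  have Pc: "P \<in> closure \<Omega>" and Pn: "P \<notin> \<Omega>" using P \<Omega>(1) by (auto simp: frontier_def interior_open)
  obtain \<phi> where \<phi>: "\<And>k::nat. test_function \<Omega> (\<phi> k)" "l2_tendsto \<Omega> \<phi> u sequentially"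
    "\<And>i. l2_tendsto \<Omega> (\<lambda>k. partial i (\<phi> k)) (weak_partial \<Omega> i u) sequentially"
    using u by (auto simp: sobolev10_def)
  have uL: "u \<in> L2 \<Omega>" and "\<forall>\<^sub>F k in sequentially. \<phi> k \<in> L2 \<Omega>"
    and lim: "(\<lambda>k. l2_norm \<Omega> (\<lambda>x. \<phi> k x - u x)) \<longlonglongrightarrow> 0"
    using \<phi>(2) by (auto simp: l2_tendsto_def)
  \<comment> \<open>Convergence in the sense of \<open>l2_tendsto\<close> gives square integrability
    only from some index on, so the sequence is shifted by N0.\<close>
  then obtain N0 where N0: "\<And>k. k \<ge> N0 \<Longrightarrow> \<phi> k \<in> L2 \<Omega>" by (auto simp: eventually_sequentially)
  obtain w where w[measurable]: "w \<in> borel_measurable borel" and w_out: "\<And>x. P + x \<notin> \<Omega> \<Longrightarrow> w x = 0"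
    and uw: "AE x in lborel. P + x \<in> \<Omega> \<longrightarrow> u (P + x) = w x"
    using ex_borel_representative[OF \<Omega>(1) L2_D(1)[OF uL], of P] by blast
  have "\<exists>r::nat\<Rightarrow>nat. strict_mono r \<and> (AE x in lebesgue_on \<Omega>. (\<lambda>k. (cmod (\<phi> (r k + N0) x - u x))\<^sup>2) \<longlonglongrightarrow> 0)"
  proof (rule tendsto_L1_AE_subseq)
    show "integrable (lebesgue_on \<Omega>) (\<lambda>x. (cmod (\<phi> (k + N0) x - u x))\<^sup>2)" for k
      using L2_D(2)[OF L2_diff[OF N0 uL]] by simp
    have "(\<lambda>k. (l2_norm \<Omega> (\<lambda>x. \<phi> k x - u x))\<^sup>2) \<longlonglongrightarrow> 0\<^sup>2" by (intro tendsto_intros lim)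
    then have "(\<lambda>k. LINT x|lebesgue_on \<Omega>. (cmod (\<phi> k x - u x))\<^sup>2) \<longlonglongrightarrow> 0" by (simp add: l2_norm_sq)
    from LIMSEQ_ignore_initial_segment[OF this, of N0]
    show "(\<lambda>k. LINT x|lebesgue_on \<Omega>. norm ((cmod (\<phi> (k + N0) x - u x))\<^sup>2)) \<longlonglongrightarrow> 0" by simp
  qed
  then obtain r :: "nat \<Rightarrow> nat" where r: "strict_mono r"
    and ae: "AE x in lebesgue_on \<Omega>. (\<lambda>k. (cmod (\<phi> (r k + N0) x - u x))\<^sup>2) \<longlonglongrightarrow> 0" by blast
  define \<psi> where "\<psi> k x = \<phi> (r k + N0) (P + x)" for k x
  have \<psi>m[measurable]: "\<psi> k \<in> borel_measurable borel" for k
  proof -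
    have "continuous_on UNIV (\<phi> (r k + N0))" using \<phi>(1) by (auto simp: test_function_def intro: C_k_continuous)
    then have "\<phi> (r k + N0) \<in> borel_measurable borel" by (rule borel_measurable_continuous_onI)
    then show ?thesis unfolding \<psi>_def by (rule measurable_compose[rotated]) measurable
  qed
  have \<psi>_out: "\<psi> k x = 0" if "P + x \<notin> \<Omega>" for k x
  proof -
    have "closure {x. \<phi> (r k + N0) x \<noteq> 0} \<subseteq> \<Omega>" using \<phi>(1) by (auto simp: test_function_def)
    then have "P + x \<notin> closure {x. \<phi> (r k + N0) x \<noteq> 0}" using that by (rule contra_subsetD)
    then have "P + x \<notin> {x. \<phi> (r k + N0) x \<noteq> 0}" by (rule contra_subsetD[OF closure_subset])
    then show ?thesis by (simp add: \<psi>_def)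
  qed
  have "AE x in lborel. P + x \<in> \<Omega> \<longrightarrow> (\<lambda>k. (cmod (\<psi> k x - u (P + x)))\<^sup>2) \<longlonglongrightarrow> 0"
    using ae unfolding AE_lebesgue_on_iff[OF \<Omega>(1), of _ P] \<psi>_def .
  then have \<psi>w: "AE x in lborel. (\<lambda>k. \<psi> k x) \<longlonglongrightarrow> w x"
    using uw
  proof eventually_elim
    case (elim x)
    show ?case
    proof (cases "P + x \<in> \<Omega>")
      case True
      then have "(\<lambda>k. (cmod (\<psi> k x - w x))\<^sup>2) \<longlonglongrightarrow> 0" using elim by simp
      from tendsto_real_sqrt[OF this] have "(\<lambda>k. cmod (\<psi> k x - w x)) \<longlonglongrightarrow> 0" by simp
      then have "(\<lambda>k. \<psi> k x - w x) \<longlonglongrightarrow> 0" by (rule tendsto_norm_zero_cancel)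
      then show ?thesis by (rule LIM_zero_cancel)
    qed (simp add: \<psi>_out w_out)
  qed
  define A where "A k = (\<Sum>i\<in>UNIV. (l2_norm \<Omega> (partial i (\<phi> (r k + N0))))\<^sup>2)" for k
  have "(\<lambda>k. \<Sum>i\<in>UNIV. (l2_norm \<Omega> (partial i (\<phi> k)))\<^sup>2) \<longlonglongrightarrow> ?E"
    by (intro tendsto_intros l2_tendsto_norm \<phi>(3))
  moreover have "filterlim (\<lambda>k. r k + N0) at_top sequentially"
    using r by (intro filterlim_subseq) (auto simp: strict_mono_def)
  ultimately have A: "A \<longlonglongrightarrow> ?E" unfolding A_def by (rule filterlim_compose)
  interpret dilation_estimate "\<psi> k" "\<lambda>x. \<Sum>i\<in>UNIV. (cmod (partial i (\<phi> (r k + N0)) (P + x)))\<^sup>2" \<alpha> "diameter \<Omega>" "A k" for k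
    unfolding \<psi>_def A_def by (rule test_function_dilation_estimate[OF n \<alpha> \<Omega>(1,3) P \<phi>(1)])
  have K0: "?K \<ge> 0"
    using dil_const_nonneg[of "CARD('n)" \<alpha> "diameter \<Omega>"] hardy_const_nonneg[OF \<alpha>(2) n, of "diameter \<Omega>"]
    by (simp add: class_const_def)
  have KA: "(\<lambda>k. ?K * A k) \<longlonglongrightarrow> ?K * ?E" by (intro tendsto_intros A)
  have "dilation_class {x. P + x \<in> \<Omega>} \<alpha> (diameter \<Omega>) (?K * ?E) w"
  proof
    have "open {x. P + x \<in> \<Omega>}"
      using open_vimage[OF \<Omega>(1), of "\<lambda>x. P + x"] by (simp add: vimage_def continuous_intros)
    then show "{x. P + x \<in> \<Omega>} \<in> sets borel" by simp
    show "s *\<^sub>R x \<in> {x. P + x \<in> \<Omega>}" if "x \<in> {x. P + x \<in> \<Omega>}" "0 < s" "s \<le> 1" for x s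
      using segment_to_closure_in_open_convex[OF \<Omega>(1,2) Pc] that by simp
    show "norm x \<le> diameter \<Omega>" if "x \<in> {x. P + x \<in> \<Omega>}" for x
      using dist_le_diameter[OF \<Omega>(3) Pc] that by simp
    show "0 \<le> ?K * ?E" using K0 by (intro mult_nonneg_nonneg sum_nonneg) auto
    have "(\<integral>\<^sup>+x. ennreal (norm x powr (- 2 * \<alpha>) * (cmod (w x))\<^sup>2) \<partial>lborel) \<le> 1 * ennreal (?K * ?E)"
      by (rule nn_integral_le_limit[OF _ _ \<psi>w _ KA]) (use dilation_class_estimates(1) in auto)
    then show "(\<integral>\<^sup>+x. ennreal (norm x powr (- 2 * \<alpha>) * (cmod (w x))\<^sup>2) \<partial>lborel) \<le> ennreal (?K * ?E)" by simp
    fix s :: real assume s: "0 < s" "s < 1"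
    \<comment> \<open>Dilation by s preserves null sets, so convergence holds at x and at s x
      simultaneously for almost every x.\<close>
    have \<psi>w': "AE x in lborel. (\<lambda>k. \<psi> k x - \<psi> k (s *\<^sub>R x)) \<longlonglongrightarrow> w x - w (s *\<^sub>R x)"
      using \<psi>w AE_dilation1[OF \<psi>w s(1)] by eventually_elim (intro tendsto_intros)
    have "(\<integral>\<^sup>+x. ennreal (norm x powr (- 2 * \<alpha>) * (cmod (w x - w (s *\<^sub>R x)))\<^sup>2) \<partial>lborel)
        \<le> ennreal ((1 - s)\<^sup>2 * s powr (2 * \<alpha> - DIM(real^'n))) * ennreal (?K * ?E)"
      by (rule nn_integral_le_limit[OF _ _ \<psi>w' _ KA]) (use dilation_class_estimates(2)[OF s] in auto)
    then show "(\<integral>\<^sup>+x. ennreal (norm x powr (- 2 * \<alpha>) * (cmod (w x - w (s *\<^sub>R x)))\<^sup>2) \<partial>lborel)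
        \<le> ennreal ((1 - s)\<^sup>2 * s powr (2 * \<alpha> - DIM(real^'n))) * ennreal (?K * ?E)" .
  qed (use \<alpha> n Pn w_out in auto)
  then show ?thesis using uw that by blast
qed

section \<open>Substitutions in the integrals along rays\<close>

lemma lebesgue_on_integral_borel:
  fixes F F' :: "'a::euclidean_space \<Rightarrow> 'b::euclidean_space"
  assumes S: "S \<in> sets borel" and F': "F' \<in> borel_measurable borel" and ae: "AE x in lborel. F' x = indicator S x *\<^sub>R F x"
  shows "(LINT x|lebesgue_on S. F x) = (LINT x|lborel. F' x)"
proof -
  have [simp]: "S \<in> sets lebesgue" using S by simp
  have ae': "AE x in lebesgue. F' x = indicator S x *\<^sub>R F x" using ae by (rule AE_completion)
  have Fm: "F' \<in> borel_measurable lebesgue" using F' by (simp add: measurable_completion)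
  have "(LINT x|lebesgue_on S. F x) = (LINT x|lebesgue. indicator S x *\<^sub>R F x)"
    by (simp add: integral_restrict_space)
  also have "\<dots> = (LINT x|lebesgue. F' x)"
    using ae' by (intro integral_cong_AE Fm borel_measurable_AE[OF Fm ae']) (auto simp: eq_commute)
  also have "\<dots> = (LINT x|lborel. F' x)" using F' by (simp add: integral_completion)
  finally show ?thesis .
qed

lemma integral_lborel_scale:
  fixes H :: "real \<Rightarrow> complex"
  assumes "r > 0"
  shows "(LINT t|lborel. H t) = (LINT s|lborel. r *\<^sub>R H (r * s))"
  using lborel_integral_real_affine[of r H 0] assms by simp

lemma kipriyanov_integral_substitution:
  fixes f w :: "real \<Rightarrow> complex"
  assumes r: "r > 0" and n: "n \<ge> 2" and w[measurable]: "w \<in> borel_measurable borel"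
    and ae: "AE s in lborel. 0 < s \<longrightarrow> s < 1 \<longrightarrow> f (r * s) = w s"
  shows "(LINT t|lebesgue_on {0..r}. ((t / r) ^ (n - 1) / (r - t) powr (\<alpha> + 1)) *\<^sub>R (z - f t))
    = r powr (- \<alpha>) *\<^sub>R (LINT s|lborel. left_kernel n \<alpha> s *\<^sub>R (z - w s))"
proof -
  define H where "H t = indicator {0..r} t *\<^sub>R (((t / r) ^ (n - 1) / (r - t) powr (\<alpha> + 1)) *\<^sub>R (z - w (t / r)))" for t
  have [measurable]: "H \<in> borel_measurable borel" unfolding H_def by measurable
  have "AE t in lborel. 0 < (1 / r) *\<^sub>R t \<longrightarrow> (1 / r) *\<^sub>R t < 1 \<longrightarrow> f (r * ((1 / r) *\<^sub>R t)) = w ((1 / r) *\<^sub>R t)"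
    using r by (intro AE_dilation1[OF ae]) auto
  moreover have "AE t in lborel. t \<noteq> 0 \<and> t \<noteq> r"
    using AE_lborel_singleton[of 0] AE_lborel_singleton[of r] by eventually_elim auto
  ultimately have "AE t in lborel. H t = indicator {0..r} t *\<^sub>R (((t / r) ^ (n - 1) / (r - t) powr (\<alpha> + 1)) *\<^sub>R (z - f t))"
    by eventually_elim (use r in \<open>auto simp: H_def indicator_def field_simps\<close>)
  then have "(LINT t|lebesgue_on {0..r}. ((t / r) ^ (n - 1) / (r - t) powr (\<alpha> + 1)) *\<^sub>R (z - f t)) = (LINT t|lborel. H t)"
    by (intro lebesgue_on_integral_borel) auto
  also have "\<dots> = (LINT s|lborel. r *\<^sub>R H (r * s))" by (rule integral_lborel_scale[OF r])
  also have "\<dots> = (LINT s|lborel. r powr (- \<alpha>) *\<^sub>R (left_kernel n \<alpha> s *\<^sub>R (z - w s)))"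
  proof (rule Bochner_Integration.integral_cong[OF refl])
    fix s
    show "r *\<^sub>R H (r * s) = r powr (- \<alpha>) *\<^sub>R (left_kernel n \<alpha> s *\<^sub>R (z - w s))"
    proof (cases "0 < s \<and> s < 1")
      case True
      then have "(r - r * s) powr (\<alpha> + 1) = r powr (\<alpha> + 1) * (1 - s) powr (\<alpha> + 1)"
        using r by (simp add: right_diff_distrib[symmetric, of r 1 s, simplified] powr_mult)
      moreover have "r / r powr (\<alpha> + 1) = r powr (- \<alpha>)" using r by (simp add: powr_add powr_minus field_simps)
      moreover have "1 / (1 - s) powr (\<alpha> + 1) = (1 - s) powr (- \<alpha> - 1)"
        using powr_minus_divide[of "1 - s" "\<alpha> + 1"] by (simp only: minus_add_distrib diff_conv_add_uminus)
      ultimately have "r * (s ^ (n - 1) / (r - r * s) powr (\<alpha> + 1)) = r powr (- \<alpha>) * ((1 - s) powr (- \<alpha> - 1) * s ^ (n - 1))"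
        by (metis (no_types, lifting) divide_divide_eq_left' mult.commute times_divide_eq_left times_divide_eq_right mult_1)
      moreover have "0 \<le> r * s \<and> r * s \<le> r" using True r by simp
      ultimately show ?thesis using True r by (simp add: H_def left_kernel_def)
    next
      case False
      have "H (r * s) = 0"
      \<comment> \<open>At s = 0 the factor s^(n-1) is 0 because n \<ge> 2, and at s = 1 the
        quotient is a division by zero, whose value is 0; both agree with the kernel.\<close>
      proof (cases "s = 0 \<or> s = 1")
        case True
        then show ?thesis using n by (auto simp: H_def)
      next
        case s: False
        then have "r * s \<notin> {0..r}" using False r by (auto simp: mult_le_cancel_left1 zero_le_mult_iff)
        then show ?thesis by (simp add: H_def)
      qed
      then show ?thesis using False by (auto simp: left_kernel_def)
    qed
  qed
  also have "\<dots> = r powr (- \<alpha>) *\<^sub>R (LINT s|lborel. left_kernel n \<alpha> s *\<^sub>R (z - w s))"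
    by (rule integral_scaleR_right)
  finally show ?thesis .
qed

text \<open>The substitution s = 1/t. Integrability is assumed on the side where the kernel q will
  appear, because there it is known from the finiteness of \<open>G\<close>, and it is transported
  to the other side.\<close>

lemma integral_inversion_real:
  fixes F :: "real \<Rightarrow> real"
  assumes ab: "0 < a" "a \<le> b" and [measurable]: "F \<in> borel_measurable borel"
    and int: "integrable lborel (\<lambda>s. indicator {1 / b..1 / a} s * (1 / s\<^sup>2 * F (1 / s)))"
  shows "integrable lborel (\<lambda>s. indicator {a..b} s * F s)"
    "(LINT s|lborel. indicator {a..b} s * F s) = (LINT s|lborel. indicator {1 / b..1 / a} s * (1 / s\<^sup>2 * F (1 / s)))"
proof -
  let ?S = "{1 / b..1 / a}"
  have img: "(\<lambda>s. 1 / s) ` ?S = {a..b}"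
  proof
    show "{a..b} \<subseteq> (\<lambda>s. 1 / s) ` ?S"
    proof
      fix t assume "t \<in> {a..b}"
      then have "1 / t \<in> ?S" "t = 1 / (1 / t)" using ab by (auto simp: field_simps)
      then show "t \<in> (\<lambda>s. 1 / s) ` ?S" by (rule rev_image_eqI)
    qed
    show "(\<lambda>s. 1 / s) ` ?S \<subseteq> {a..b}"
    proof
      fix t assume "t \<in> (\<lambda>s. 1 / s) ` ?S"
      then obtain s where s: "1 / b \<le> s" "s \<le> 1 / a" "t = 1 / s" by auto
      have "s > 0" by (rule less_le_trans[OF _ s(1)]) (use ab in auto)
      have "1 / (1 / a) \<le> 1 / s" by (rule divide_left_mono) (use s ab \<open>s > 0\<close> in auto)
      moreover have "1 / s \<le> 1 / (1 / b)" by (rule divide_left_mono) (use s ab \<open>s > 0\<close> in auto)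
      ultimately show "t \<in> {a..b}" using s by simp
    qed
  qed
  have pos: "s > 0" if "s \<in> ?S" for s by (rule less_le_trans[of 0 "1 / b"]) (use that ab in auto)
  have i1: "integrable lebesgue (\<lambda>s. indicator ?S s *\<^sub>R (\<bar>- (1 / s\<^sup>2)\<bar> * F (1 / s)))"
    using int by (simp add: integrable_completion)
  then have si: "(\<lambda>s. \<bar>- (1 / s\<^sup>2)\<bar> * F (1 / s)) absolutely_integrable_on ?S"
    by (simp add: set_integrable_def)
  have cov: "(\<lambda>s. \<bar>- (1 / s\<^sup>2)\<bar> * F (1 / s)) absolutely_integrable_on ?S \<and> integral ?S (\<lambda>s. \<bar>- (1 / s\<^sup>2)\<bar> * F (1 / s)) = I
    \<longleftrightarrow> F absolutely_integrable_on ((\<lambda>s. 1 / s) ` ?S) \<and> integral ((\<lambda>s. 1 / s) ` ?S) F = I" for I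
  proof (rule has_absolute_integral_change_of_variables_1')
    show "((\<lambda>s. 1 / s) has_field_derivative - (1 / s\<^sup>2)) (at s within ?S)" if "s \<in> ?S" for s
      using pos[OF that] by (auto intro!: derivative_eq_intros simp: power2_eq_square)
  qed (auto simp: inj_on_def)
  with si have F: "F absolutely_integrable_on {a..b}" "integral {a..b} F = integral ?S (\<lambda>s. \<bar>- (1 / s\<^sup>2)\<bar> * F (1 / s))"
    unfolding img by blast+
  show "integrable lborel (\<lambda>s. indicator {a..b} s * F s)"
    using F(1) by (simp add: set_integrable_def integrable_completion)
  have "(LINT s|lborel. indicator {a..b} s * F s) = (LINT s|lebesgue. indicator {a..b} s *\<^sub>R F s)"
    by (simp add: integral_completion)
  also have "\<dots> = integral {a..b} F"
    using set_lebesgue_integral_eq_integral(2)[OF F(1)] by (simp add: set_lebesgue_integral_def)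
  also have "\<dots> = (LINT s|lebesgue. indicator ?S s *\<^sub>R (\<bar>- (1 / s\<^sup>2)\<bar> * F (1 / s)))"
    using set_lebesgue_integral_eq_integral(2)[OF si] F(2) by (simp add: set_lebesgue_integral_def)
  also have "\<dots> = (LINT s|lborel. indicator ?S s * (1 / s\<^sup>2 * F (1 / s)))"
    by (simp add: integral_completion)
  finally show "(LINT s|lborel. indicator {a..b} s * F s) = (LINT s|lborel. indicator {1 / b..1 / a} s * (1 / s\<^sup>2 * F (1 / s)))" .
qed

lemma integral_inversion:
  fixes F :: "real \<Rightarrow> complex"
  assumes ab: "0 < a" "a \<le> b" and [measurable]: "F \<in> borel_measurable borel"
    and int: "integrable lborel (\<lambda>s. indicator {1 / b..1 / a} s *\<^sub>R ((1 / s\<^sup>2) *\<^sub>R F (1 / s)))"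
  shows "(LINT s|lborel. indicator {a..b} s *\<^sub>R F s) = (LINT s|lborel. indicator {1 / b..1 / a} s *\<^sub>R ((1 / s\<^sup>2) *\<^sub>R F (1 / s)))"
proof -
  have R: "integrable lborel (\<lambda>s. indicator {a..b} s * Re (F s))"
    "(LINT s|lborel. indicator {a..b} s * Re (F s)) = (LINT s|lborel. indicator {1 / b..1 / a} s * (1 / s\<^sup>2 * Re (F (1 / s))))"
    by (rule integral_inversion_real[OF ab]; use integrable_Re[OF int] in auto)+
  have I: "integrable lborel (\<lambda>s. indicator {a..b} s * Im (F s))"
    "(LINT s|lborel. indicator {a..b} s * Im (F s)) = (LINT s|lborel. indicator {1 / b..1 / a} s * (1 / s\<^sup>2 * Im (F (1 / s))))"
    by (rule integral_inversion_real[OF ab]; use integrable_Im[OF int] in auto)+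
  have "integrable lborel (\<lambda>s. complex_of_real (indicator {a..b} s * Re (F s)) + \<i> * complex_of_real (indicator {a..b} s * Im (F s)))"
    by (intro Bochner_Integration.integrable_add integrable_mult_right integrable_of_real R I)
  also have "(\<lambda>s. complex_of_real (indicator {a..b} s * Re (F s)) + \<i> * complex_of_real (indicator {a..b} s * Im (F s)))
      = (\<lambda>s. indicator {a..b} s *\<^sub>R F s)"
    by (auto simp: fun_eq_iff complex_eq_iff)
  finally have iF: "integrable lborel (\<lambda>s. indicator {a..b} s *\<^sub>R F s)" .
  show ?thesis
  proof (rule complex_eqI)
    show "Re (LINT s|lborel. indicator {a..b} s *\<^sub>R F s) = Re (LINT s|lborel. indicator {1 / b..1 / a} s *\<^sub>R ((1 / s\<^sup>2) *\<^sub>R F (1 / s)))"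
      using integral_Re[OF iF] integral_Re[OF int] R(2) by simp
    show "Im (LINT s|lborel. indicator {a..b} s *\<^sub>R F s) = Im (LINT s|lborel. indicator {1 / b..1 / a} s *\<^sub>R ((1 / s\<^sup>2) *\<^sub>R F (1 / s)))"
      using integral_Im[OF iF] integral_Im[OF int] I(2) by simp
  qed
qed

text \<open>Two substitutions in succession, t = r s and then the inversion of s. They send the
  limits d and r + \<epsilon> to r/d and r/(r + \<epsilon>), so that truncation near t = r becomes
  truncation near s = 1.\<close>

lemma psi_integral_substitution:
  fixes f w :: "real \<Rightarrow> complex"
  assumes r: "r > 0" and e: "\<epsilon> > 0" "r + \<epsilon> \<le> d" and w[measurable]: "w \<in> borel_measurable borel"
    and ae: "AE s in lborel. 0 < s \<longrightarrow> s < d / r \<longrightarrow> f (r * s) = w s"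
    and int: "integrable lborel (\<lambda>s. right_kernel \<alpha> s *\<^sub>R (z - w (1 / s)))"
  shows "(LINT t|lebesgue_on {r + \<epsilon>..d}. (1 / (t - r) powr (\<alpha> + 1)) *\<^sub>R (z - f t))
    = r powr (- \<alpha>) *\<^sub>R (LINT s|lborel. indicator {r / d..r / (r + \<epsilon>)} s *\<^sub>R (right_kernel \<alpha> s *\<^sub>R (z - w (1 / s))))"
proof -
  define H where "H t = indicator {r + \<epsilon>..d} t *\<^sub>R ((1 / (t - r) powr (\<alpha> + 1)) *\<^sub>R (z - w (t / r)))" for t
  have [measurable]: "H \<in> borel_measurable borel" unfolding H_def by measurable
  have d: "d > 0" "r < d" using r e by auto
  have "AE t in lborel. 0 < (1 / r) *\<^sub>R t \<longrightarrow> (1 / r) *\<^sub>R t < d / r \<longrightarrow> f (r * ((1 / r) *\<^sub>R t)) = w ((1 / r) *\<^sub>R t)"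
    using r by (intro AE_dilation1[OF ae]) auto
  moreover have "AE t in lborel. t \<noteq> d" by (rule AE_lborel_singleton)
  ultimately have "AE t in lborel. H t = indicator {r + \<epsilon>..d} t *\<^sub>R ((1 / (t - r) powr (\<alpha> + 1)) *\<^sub>R (z - f t))"
    by eventually_elim (use r e in \<open>auto simp: H_def indicator_def field_simps\<close>)
  then have "(LINT t|lebesgue_on {r + \<epsilon>..d}. (1 / (t - r) powr (\<alpha> + 1)) *\<^sub>R (z - f t)) = (LINT t|lborel. H t)"
    by (intro lebesgue_on_integral_borel) auto
  also have "\<dots> = (LINT s|lborel. r *\<^sub>R H (r * s))" by (rule integral_lborel_scale[OF r])
  also have "\<dots> = (LINT s|lborel. indicator {(r + \<epsilon>) / r..d / r} s *\<^sub>R (r powr (- \<alpha>) *\<^sub>R ((s - 1) powr (- \<alpha> - 1) *\<^sub>R (z - w s))))"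
  proof (rule Bochner_Integration.integral_cong[OF refl])
    fix s
    have iff: "r * s \<in> {r + \<epsilon>..d} \<longleftrightarrow> s \<in> {(r + \<epsilon>) / r..d / r}" using r by (auto simp: field_simps)
    show "r *\<^sub>R H (r * s) = indicator {(r + \<epsilon>) / r..d / r} s *\<^sub>R (r powr (- \<alpha>) *\<^sub>R ((s - 1) powr (- \<alpha> - 1) *\<^sub>R (z - w s)))"
    proof (cases "r * s \<in> {r + \<epsilon>..d}")
      case True
      then have "r * 1 < r * s" using e by simp
      then have s: "s > 1" using r by (simp only: mult_less_cancel_left_pos)
      have "(r * s - r) powr (\<alpha> + 1) = (r * (s - 1)) powr (\<alpha> + 1)" by (simp add: algebra_simps)
      also have "\<dots> = r powr (\<alpha> + 1) * (s - 1) powr (\<alpha> + 1)" by (rule powr_mult)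
      finally have "r * (1 / (r * s - r) powr (\<alpha> + 1)) = (r / r powr (\<alpha> + 1)) * (1 / (s - 1) powr (\<alpha> + 1))" by simp
      also have "r / r powr (\<alpha> + 1) = r powr (- \<alpha>)" using r by (simp add: powr_add powr_minus field_simps)
      also have "1 / (s - 1) powr (\<alpha> + 1) = (s - 1) powr (- \<alpha> - 1)"
        using powr_minus_divide[of "s - 1" "\<alpha> + 1"] by (simp only: minus_add_distrib diff_conv_add_uminus)
      finally show ?thesis using True iff r by (simp add: H_def)
    qed (use iff in \<open>simp add: H_def indicator_def del: atLeastAtMost_iff\<close>)
  qed
  also have "\<dots> = (LINT s|lborel. r powr (- \<alpha>) *\<^sub>R (indicator {r / d..r / (r + \<epsilon>)} s *\<^sub>R (right_kernel \<alpha> s *\<^sub>R (z - w (1 / s)))))"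
  proof -
    have eq: "indicator {1 / (d / r)..1 / ((r + \<epsilon>) / r)} s *\<^sub>R
      ((1 / s\<^sup>2) *\<^sub>R (r powr (- \<alpha>) *\<^sub>R ((1 / s - 1) powr (- \<alpha> - 1) *\<^sub>R (z - w (1 / s)))))
      = r powr (- \<alpha>) *\<^sub>R (indicator {r / d..r / (r + \<epsilon>)} s *\<^sub>R (right_kernel \<alpha> s *\<^sub>R (z - w (1 / s))))" for s
    proof (cases "s \<in> {r / d..r / (r + \<epsilon>)}")
      case True
      have "r / (r + \<epsilon>) < 1" "0 < r / d" using r e d by auto
      moreover have "r / d \<le> s" "s \<le> r / (r + \<epsilon>)" using True by auto
      ultimately have s: "0 < s" "s < 1" by linarith+
      have "(1 / s\<^sup>2) * (1 / s - 1) powr (- \<alpha> - 1) = right_kernel \<alpha> s"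
      proof -
        have "1 / s - 1 = (1 - s) / s" using s by (simp add: field_simps)
        then have "(1 / s\<^sup>2) * (1 / s - 1) powr (- \<alpha> - 1) = s powr (- 2) * ((1 - s) powr (- \<alpha> - 1) / s powr (- \<alpha> - 1))"
          using s by (simp add: powr_divide powr_minus_divide[of _ 2])
        also have "\<dots> = (1 - s) powr (- \<alpha> - 1) * (s powr (- 2) / s powr (- \<alpha> - 1))" by simp
        also have "s powr (- 2) / s powr (- \<alpha> - 1) = s powr (\<alpha> - 1)" by (simp flip: powr_diff)
        finally show ?thesis using s by (simp add: right_kernel_def)
      qed
      then have "(1 / s\<^sup>2) *\<^sub>R (r powr (- \<alpha>) *\<^sub>R ((1 / s - 1) powr (- \<alpha> - 1) *\<^sub>R (z - w (1 / s))))
          = r powr (- \<alpha>) *\<^sub>R (right_kernel \<alpha> s *\<^sub>R (z - w (1 / s)))"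
        by (simp only: scaleR_scaleR) (simp add: mult_ac)
      then show ?thesis using True by simp
    qed simp
    have "integrable lborel (\<lambda>s. r powr (- \<alpha>) *\<^sub>R (indicator {r / d..r / (r + \<epsilon>)} s *\<^sub>R (right_kernel \<alpha> s *\<^sub>R (z - w (1 / s)))))"
      by (intro integrable_scaleR_right integrable_mult_indicator int) auto
    then show ?thesis
      using r e d unfolding eq[symmetric] by (intro integral_inversion) (auto simp: divide_right_mono)
  qed
  also have "(LINT s|lborel. r powr (- \<alpha>) *\<^sub>R (indicator {r / d..r / (r + \<epsilon>)} s *\<^sub>R (right_kernel \<alpha> s *\<^sub>R (z - w (1 / s)))))
      = r powr (- \<alpha>) *\<^sub>R (LINT s|lborel. indicator {r / d..r / (r + \<epsilon>)} s *\<^sub>R (right_kernel \<alpha> s *\<^sub>R (z - w (1 / s))))"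
    by (rule integral_scaleR_right)
  finally show ?thesis .
qed

subsection \<open>The fractional derivatives in the domain\<close>

locale kipriyanov_setting =
  fixes \<Omega> :: "(real^'n) set" and P :: "real^'n" and \<rho> :: "real^'n \<Rightarrow> real" and \<alpha> \<kappa> M :: real
  assumes card_ge_2: "CARD('n) \<ge> 2" and alpha: "0 < \<alpha>" "\<alpha> < 1"
    and \<Omega>: "open \<Omega>" "convex \<Omega>" "bounded \<Omega>" and P: "P \<in> frontier \<Omega>"
    and rho_pos: "\<And>Q. Q \<in> \<Omega> \<Longrightarrow> \<rho> Q > 0" and kappa: "\<alpha> < \<kappa>"
    and holder: "\<And>Q1 Q2. Q1 \<in> closure \<Omega> \<Longrightarrow> Q2 \<in> closure \<Omega> \<Longrightarrow> \<bar>\<rho> Q1 - \<rho> Q2\<bar> \<le> M * dist Q1 Q2 powr \<kappa>"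
    and mu_pos: "(INF Q\<in>\<Omega>. \<rho> Q) > 0 \<and> mu_general CARD('n) \<alpha> \<kappa> M (INF Q\<in>\<Omega>. \<rho> Q) (diameter \<Omega>) > 0
         \<or> nonincreasing_on_rays \<Omega> P \<rho>"
begin

lemma P_closure: "P \<in> closure \<Omega>" and P_notin: "P \<notin> \<Omega>"
  using P \<Omega>(1) by (auto simp: frontier_def interior_open)

lemma obtain_point: obtains Q0 where "Q0 \<in> \<Omega>"
  using P_closure by force

lemma in_closureI: "x \<in> \<Omega> \<Longrightarrow> x \<in> closure \<Omega>"
  using closure_subset by blast

lemma M_nonneg: "M \<ge> 0"
proof -
  obtain Q where Q: "Q \<in> \<Omega>" by (rule obtain_point)
  then have "dist P Q > 0" using P_notin by auto
  moreover have "0 \<le> M * dist P Q powr \<kappa>" using holder[OF P_closure in_closureI[OF Q]] by linarith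
  ultimately show ?thesis by (simp add: zero_le_mult_iff)
qed

lemma rho_continuous: "continuous_on \<Omega> \<rho>"
  unfolding continuous_on_def
proof
  fix x assume x: "x \<in> \<Omega>"
  have "continuous (at x within \<Omega>) (\<lambda>y. M * dist y x powr \<kappa>)"
  proof -
    have "continuous_on \<Omega> (\<lambda>y. M * dist y x powr \<kappa>)"
      using kappa alpha by (intro continuous_on_mult continuous_on_powr' continuous_intros) auto
    then show ?thesis using x by (simp add: continuous_on_eq_continuous_within)
  qed
  then have "((\<lambda>y. M * dist y x powr \<kappa>) \<longlongrightarrow> 0) (at x within \<Omega>)"
    by (simp add: continuous_within)
  moreover have "\<forall>\<^sub>F y in at x within \<Omega>. norm (\<rho> y - \<rho> x) \<le> M * dist y x powr \<kappa>"
    unfolding eventually_at_filter using x by (auto intro!: always_eventually holder in_closureI)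
  ultimately have "((\<lambda>y. \<rho> y - \<rho> x) \<longlongrightarrow> 0) (at x within \<Omega>)" by (rule Lim_null_comparison[rotated])
  then show "(\<rho> \<longlongrightarrow> \<rho> x) (at x within \<Omega>)" by (rule LIM_zero_cancel)
qed

definition rho :: "real^'n \<Rightarrow> real" where
  "rho x = (if P + x \<in> \<Omega> then \<rho> (P + x) else 0)"

text \<open>The Hoelder condition on the closure compares every value of \<rho> with the value at
  the boundary point P, which gives an upper bound without further assumptions on \<rho>.\<close>

definition R :: real where "R = \<rho> P + M * diameter \<Omega> powr \<kappa>"

lemma rho_le_R: "Q \<in> \<Omega> \<Longrightarrow> \<rho> Q \<le> R"
proof -
  assume Q: "Q \<in> \<Omega>"
  have "dist Q P \<le> diameter \<Omega>"
    using dist_le_diameter[OF \<Omega>(3) P_closure, of "Q - P"] Q by (simp add: dist_norm)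
  then have "M * dist Q P powr \<kappa> \<le> M * diameter \<Omega> powr \<kappa>"
    using M_nonneg kappa alpha by (intro mult_left_mono powr_mono2) auto
  with holder[OF in_closureI[OF Q] P_closure] show ?thesis by (simp add: R_def)
qed

lemma R_pos: "R > 0"
  using obtain_point rho_le_R rho_pos by (metis less_le_trans)

text \<open>With s0 = r/d the point x/s lies in the domain exactly for s > s0. If \<rho> decreases
  along rays, \<rho>(x/s) \<le> \<rho>(x); otherwise the Hoelder condition adds M r^\<kappa>
  ((1-s)/s)^\<kappa>, since x and x/s are at distance r (1-s)/s. The premise \<open>cond\<close> of
  \<open>kernel_subordinate\<close> is derived from \<mu> > 0.\<close>

lemma subordinate:
  assumes x: "P + x \<in> \<Omega>" and \<tau>: "0 < \<tau>" "\<tau> < 1"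
  shows "(\<integral>\<^sup>+s. ennreal (indicator {0<..<\<tau>} s * (right_kernel \<alpha> s * rho (x /\<^sub>R s))) \<partial>lborel)
      \<le> ennreal (rho x) * ((\<integral>\<^sup>+s. ennreal (indicator {0<..<\<tau>} s * left_kernel CARD('n) \<alpha> s) \<partial>lborel)
          + ennreal (2 * (kip_const CARD('n) \<alpha> * Gamma (1 - \<alpha>) / \<alpha>)))"
proof -
  let ?e = "direction P (P + x)" and ?\<delta> = "diameter \<Omega>"
  define r where "r = norm x"
  define d where "d = ray_length \<Omega> P ?e"
  define s0 where "s0 = r / d"
  define Q where "Q = kip_const CARD('n) \<alpha> * Gamma (1 - \<alpha>) / \<alpha>"
  have "r = dist P (P + x)" by (simp add: r_def dist_norm)
  then have r: "0 < r" "r < d" "d \<le> ?\<delta>" and ray: "\<And>t. t > 0 \<Longrightarrow> P + t *\<^sub>R ?e \<in> \<Omega> \<longleftrightarrow> t < d"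
    unfolding d_def using ray_length[OF \<Omega> P x] by simp_all
  have e: "?e = x /\<^sub>R r" by (simp add: direction_def r_def dist_norm)
  have s0: "0 < s0" "s0 < 1" using r by (auto simp: s0_def)
  have inD: "P + x /\<^sub>R s \<in> \<Omega> \<longleftrightarrow> s0 < s" if "s > 0" for s
  proof -
    have "x /\<^sub>R s = (r / s) *\<^sub>R ?e" unfolding e using r that by (simp add: field_simps)
    then have "P + x /\<^sub>R s \<in> \<Omega> \<longleftrightarrow> r / s < d" using ray[of "r / s"] r that by simp
    also have "\<dots> \<longleftrightarrow> s0 < s" using r that by (simp add: s0_def field_simps)
    finally show ?thesis .
  qed
  have rx: "rho x = \<rho> (P + x)" using x by (simp add: rho_def)
  have Q0: "Q \<ge> 0"
    using alpha card_ge_2 unfolding Q_def kip_const_def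
    by (auto intro!: divide_nonneg_nonneg mult_nonneg_nonneg Gamma_real_nonneg)
  have rx0: "rho x \<ge> 0" using rho_pos[OF x] by (simp add: rx)
  show ?thesis
  proof (cases "nonincreasing_on_rays \<Omega> P \<rho>")
    case True
    show ?thesis
    \<comment> \<open>Without a Hoelder term the premise \<open>cond\<close> says that 0 is at most
      a nonnegative number.\<close>
    proof (rule kernel_subordinate[OF alpha card_ge_2 kappa s0 \<tau> rx0, where A=0])
      show "rho (x /\<^sub>R s) = 0" if "0 < s" "s \<le> s0" for s using inD[of s] that by (simp add: rho_def)
      show "rho (x /\<^sub>R s) \<le> rho x + 0 * ((1 - s) / s) powr \<kappa>" if s: "s0 < s" "s < 1" for s
      proof -
        have s': "s > 0" using s s0 by simp
        have "x /\<^sub>R s = (r / s) *\<^sub>R ?e" "x = r *\<^sub>R ?e" unfolding e using r s' by (simp_all add: field_simps)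
        moreover have "norm ?e = 1" unfolding e using r by (simp add: r_def)
        moreover have "r \<le> r / s" using s s' r by (simp add: field_simps)
        ultimately have "\<rho> (P + x /\<^sub>R s) \<le> \<rho> (P + x)"
          using True[unfolded nonincreasing_on_rays_def, rule_format, of ?e r "r / s"] r x inD[OF s'] s by simp
        then show ?thesis using inD[OF s'] s x by (simp add: rho_def)
      qed
    qed (use rx0 Q0 alpha s0 in \<open>auto simp: Q_def[symmetric] intro!: mult_nonneg_nonneg add_nonneg_nonneg\<close>)
  next
    case False
    define m where "m = (INF Q\<in>\<Omega>. \<rho> Q)"
    have m: "m > 0" and mu: "mu_general CARD('n) \<alpha> \<kappa> M m ?\<delta> > 0" using mu_pos False by (auto simp: m_def)
    have "bdd_below (\<rho> ` \<Omega>)" using rho_pos by (intro bdd_belowI[of _ 0]) (auto intro: less_imp_le)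
    then have m_le: "m \<le> rho x" unfolding rx m_def using x by (rule cINF_lower)
    show ?thesis
    proof (rule kernel_subordinate[OF alpha card_ge_2 kappa s0 \<tau> rx0, where A="M * r powr \<kappa>"])
      show "0 \<le> M * r powr \<kappa>" using M_nonneg by simp
      show "rho (x /\<^sub>R s) = 0" if "0 < s" "s \<le> s0" for s using inD[of s] that by (simp add: rho_def)
      show "rho (x /\<^sub>R s) \<le> rho x + M * r powr \<kappa> * ((1 - s) / s) powr \<kappa>" if s: "s0 < s" "s < 1" for s
      proof -
        have s': "s > 0" using s s0 by simp
        have xs: "P + x /\<^sub>R s \<in> \<Omega>" using inD[OF s'] s by simp
        have "x /\<^sub>R s - x = (1 / s - 1) *\<^sub>R x" by (simp add: scaleR_left_diff_distrib inverse_eq_divide)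
        then have "norm (x /\<^sub>R s - x) = \<bar>1 / s - 1\<bar> * r" by (simp only: norm_scaleR r_def)
        also have "\<bar>1 / s - 1\<bar> = (1 - s) / s" using s s' by (simp add: abs_if field_simps)
        finally have "dist (P + x /\<^sub>R s) (P + x) = r * ((1 - s) / s)" by (simp add: dist_norm mult.commute)
        moreover have "(r * ((1 - s) / s)) powr \<kappa> = r powr \<kappa> * ((1 - s) / s) powr \<kappa>" by (rule powr_mult)
        ultimately have "\<bar>\<rho> (P + x /\<^sub>R s) - \<rho> (P + x)\<bar> \<le> M * (r powr \<kappa> * ((1 - s) / s) powr \<kappa>)"
          using holder[OF in_closureI[OF xs] in_closureI[OF x]] by (simp only:)
        then show ?thesis using xs x by (simp add: rho_def)
      qed
      have G: "Gamma (1 - \<alpha>) > 0" using alpha by (intro Gamma_real_pos) auto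
      have dpos: "?\<delta> > 0" using r by linarith
      \<comment> \<open>This is positivity of \<mu> multiplied by 2 \<Gamma>(1-\<alpha>) m /
        \<alpha>, which rewrites C in terms of Q.\<close>
      have key: "M * ?\<delta> powr (\<kappa> - \<alpha>) / (\<kappa> - \<alpha>) \<le> m * ?\<delta> powr (- \<alpha>) * (1 / \<alpha> + Q)"
      proof -
        have "0 \<le> mu_general CARD('n) \<alpha> \<kappa> M m ?\<delta> * (2 * Gamma (1 - \<alpha>) * m / \<alpha>)"
          using mu G m alpha by (intro mult_nonneg_nonneg) auto
        also have "\<dots> = m * ?\<delta> powr (- \<alpha>) * (1 / \<alpha> + Q) - M * ?\<delta> powr (\<kappa> - \<alpha>) / (\<kappa> - \<alpha>)"
        proof -
          have "(1/2 * D * (1 / g + C) - a * L * E / (2 * g * k * m)) * (2 * g * m / a)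
              = m * D * (1 / a + C * g / a) - L * E / k"
            if "g > 0" "m > 0" "a > 0" "k > 0" for D g C m a k L E :: real
            using that by (simp add: field_simps)
          then show ?thesis unfolding mu_general_def Q_def using G m alpha kappa by simp
        qed
        finally show ?thesis by simp
      qed
      have "M * r powr \<kappa> * (((1 - s0) / s0) powr (\<kappa> - \<alpha>) / (\<kappa> - \<alpha>)) = r powr \<alpha> * (M * (d - r) powr (\<kappa> - \<alpha>) / (\<kappa> - \<alpha>))"
      proof -
        have "(1 - s0) / s0 = (d - r) / r" using r by (simp add: s0_def field_simps)
        then have "r powr \<kappa> * ((1 - s0) / s0) powr (\<kappa> - \<alpha>) = r powr \<kappa> / r powr (\<kappa> - \<alpha>) * (d - r) powr (\<kappa> - \<alpha>)"
          using r by (simp add: powr_divide)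
        also have "r powr \<kappa> / r powr (\<kappa> - \<alpha>) = r powr \<alpha>" by (simp flip: powr_diff)
        finally show ?thesis by (simp add: mult.assoc mult.left_commute)
      qed
      also have "\<dots> \<le> r powr \<alpha> * (M * ?\<delta> powr (\<kappa> - \<alpha>) / (\<kappa> - \<alpha>))"
        using r kappa M_nonneg by (intro mult_left_mono divide_right_mono powr_mono2) auto
      also have "\<dots> \<le> r powr \<alpha> * (rho x * ?\<delta> powr (- \<alpha>) * (1 / \<alpha> + Q))"
      proof (intro mult_left_mono order_trans[OF key] mult_right_mono m_le)
      qed (use Q0 alpha in auto)
      also have "\<dots> = rho x * ((r / ?\<delta>) powr \<alpha> / \<alpha> + (r / ?\<delta>) powr \<alpha> * Q)"
        using r dpos by (simp add: powr_divide powr_minus field_simps)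
      \<comment> \<open>The same factor (r/\<delta>)^\<alpha> is bounded differently in the two
        terms: in the first by (r/(d-r))^\<alpha>, as d - r \<le> \<delta>, and in the second by 1,
        as r \<le> \<delta>.\<close>
      also have "\<dots> \<le> rho x * ((s0 / (1 - s0)) powr \<alpha> / \<alpha> + 1 * Q)"
      proof (intro mult_left_mono add_mono divide_right_mono mult_right_mono)
        have "s0 / (1 - s0) = r / (d - r)" using r by (simp add: s0_def field_simps)
        moreover have "r / ?\<delta> \<le> r / (d - r)" using r by (intro divide_left_mono) auto
        ultimately show "(r / ?\<delta>) powr \<alpha> \<le> (s0 / (1 - s0)) powr \<alpha>"
          using r dpos alpha by (intro powr_mono2) auto
        show "(r / ?\<delta>) powr \<alpha> \<le> 1" using r dpos alpha by (intro powr_le1) auto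
      qed (use rx0 Q0 alpha in auto)
      finally show "M * r powr \<kappa> * (((1 - s0) / s0) powr (\<kappa> - \<alpha>) / (\<kappa> - \<alpha>))
        \<le> rho x * ((s0 / (1 - s0)) powr \<alpha> / \<alpha> + kip_const CARD('n) \<alpha> * Gamma (1 - \<alpha>) / \<alpha>)"
        by (simp add: Q_def)
    qed
  qed
qed

lemma weighted_class:
  assumes "dilation_class {x. P + x \<in> \<Omega>} \<alpha> (diameter \<Omega>) B w"
  shows "weighted_dilation_class {x. P + x \<in> \<Omega>} \<alpha> (diameter \<Omega>) B w rho R M \<kappa>"
proof -
  interpret dilation_class "{x. P + x \<in> \<Omega>}" \<alpha> "diameter \<Omega>" B w by fact
  show ?thesis
  proof
    have "(\<lambda>x. indicator \<Omega> x *\<^sub>R \<rho> x) \<in> borel_measurable borel"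
      using \<Omega>(1) rho_continuous by (intro borel_measurable_continuous_on_indicator) auto
    then have "(\<lambda>x. indicator \<Omega> (P + x) *\<^sub>R \<rho> (P + x)) \<in> borel_measurable borel"
      by (rule measurable_compose[rotated]) measurable
    moreover have "(\<lambda>x. indicator \<Omega> (P + x) *\<^sub>R \<rho> (P + x)) = rho" by (auto simp: rho_def fun_eq_iff)
    ultimately show "rho \<in> borel_measurable borel" by simp
    show "rho x \<ge> 0" for x using rho_pos[of "P + x"] by (auto simp: rho_def)
    show "rho x \<le> R" for x using rho_le_R[of "P + x"] R_pos by (auto simp: rho_def)
    show "\<bar>rho x - rho y\<bar> \<le> M * dist x y powr \<kappa>" if "x \<in> {x. P + x \<in> \<Omega>}" "y \<in> {x. P + x \<in> \<Omega>}" for x y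
      using that holder[of "P + x" "P + y"] by (auto simp: rho_def in_closureI)
    show "(\<integral>\<^sup>+s. ennreal (indicator {0<..<\<tau>} s * (right_kernel \<alpha> s * rho (x /\<^sub>R s))) \<partial>lborel)
      \<le> ennreal (rho x) * ((\<integral>\<^sup>+s. ennreal (indicator {0<..<\<tau>} s * left_kernel DIM(real^'n) \<alpha> s) \<partial>lborel)
          + ennreal (2 * (kip_const DIM(real^'n) \<alpha> * Gamma (1 - \<alpha>) / \<alpha>)))"
      if "x \<in> {x. P + x \<in> \<Omega>}" "0 < \<tau>" "\<tau> < 1" for x \<tau>
      using subordinate that by simp
  qed (use kappa M_nonneg in \<open>auto simp: rho_def\<close>)
qed

text \<open>A fractional derivative of u at a point depends on u along a whole ray. For almost every
  x, the representative w agrees with u at x and almost everywhere on the ray through x, so u may be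
  replaced by w under the integral.\<close>

lemma AE_along_rays:
  assumes "AE x in lborel. P + x \<in> \<Omega> \<longrightarrow> u (P + x) = w x"
  shows "AE x in lborel. (P + x \<in> \<Omega> \<longrightarrow> u (P + x) = w x) \<and>
    (AE s in lborel. 0 < s \<longrightarrow> P + s *\<^sub>R x \<in> \<Omega> \<longrightarrow> u (P + s *\<^sub>R x) = w (s *\<^sub>R x))"
proof -
  from assms obtain N where N: "N \<in> null_sets lborel" "{x. \<not> (P + x \<in> \<Omega> \<longrightarrow> u (P + x) = w x)} \<subseteq> N"
    by (auto simp: eventually_ae_filter)
  from AE_dilation[OF N(1)] assms show ?thesis
  proof eventually_elim
    case (elim x)
    from elim(1) have "AE s in lborel. 0 < s \<longrightarrow> P + s *\<^sub>R x \<in> \<Omega> \<longrightarrow> u (P + s *\<^sub>R x) = w (s *\<^sub>R x)"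
      by eventually_elim (use N(2) in auto)
    with elim(2) show ?case by blast
  qed
qed

lemma ray_point:
  assumes x: "P + x \<in> \<Omega>"
  shows "dist P (P + x) = norm x" "norm x > 0" "P + (norm x * s) *\<^sub>R direction P (P + x) = P + s *\<^sub>R x"
    "norm x < ray_length \<Omega> P (direction P (P + x))"
    "s > 0 \<Longrightarrow> P + s *\<^sub>R x \<in> \<Omega> \<longleftrightarrow> s < ray_length \<Omega> P (direction P (P + x)) / norm x"
proof -
  show d: "dist P (P + x) = norm x" by (simp add: dist_norm)
  show n0: "norm x > 0" using ray_length(1)[OF \<Omega> P x] d by simp
  show e: "P + (norm x * s) *\<^sub>R direction P (P + x) = P + s *\<^sub>R x" for s
    using n0 by (simp add: direction_def d)
  show "norm x < ray_length \<Omega> P (direction P (P + x))" using ray_length(2)[OF \<Omega> P x] d by simp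
  show "P + s *\<^sub>R x \<in> \<Omega> \<longleftrightarrow> s < ray_length \<Omega> P (direction P (P + x)) / norm x" if "s > 0"
    using ray_length(4)[OF \<Omega> P x, of "norm x * s"] n0 that unfolding e by (simp add: field_simps)
qed

lemma kipriyanov_eq_frac_left:
  assumes [measurable]: "w \<in> borel_measurable borel" and ae: "AE x in lborel. P + x \<in> \<Omega> \<longrightarrow> u (P + x) = w x"
  shows "AE x in lborel. P + x \<in> \<Omega> \<longrightarrow> kipriyanov \<alpha> P u (P + x) = frac_left \<alpha> w x"
  using AE_along_rays[OF ae]
proof eventually_elim
  case (elim x)
  show ?case
  proof
    assume x: "P + x \<in> \<Omega>"
    let ?e = "direction P (P + x)"
    have "(LINT t|lebesgue_on {0..norm x}. ((t / norm x) ^ (CARD('n) - 1) / (norm x - t) powr (\<alpha> + 1)) *\<^sub>R (u (P + x) - u (P + t *\<^sub>R ?e)))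
      = norm x powr (- \<alpha>) *\<^sub>R (LINT s|lborel. left_kernel CARD('n) \<alpha> s *\<^sub>R (u (P + x) - w (s *\<^sub>R x)))"
    proof (rule kipriyanov_integral_substitution[OF ray_point(2)[OF x] card_ge_2])
      have "AE s in lborel. 0 < s \<longrightarrow> P + s *\<^sub>R x \<in> \<Omega> \<longrightarrow> u (P + s *\<^sub>R x) = w (s *\<^sub>R x)" using elim by blast
      then show "AE s in lborel. 0 < s \<longrightarrow> s < 1 \<longrightarrow> u (P + (norm x * s) *\<^sub>R ?e) = w (s *\<^sub>R x)"
      proof eventually_elim
        case (elim s)
        then show ?case using segment_to_closure_in_open_convex[OF \<Omega>(1,2) P_closure x, of s] by (auto simp: ray_point(3)[OF x])
      qed
    qed measurable
    moreover have "u (P + x) = w x" using elim x by blast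
    ultimately show "kipriyanov \<alpha> P u (P + x) = frac_left \<alpha> w x"
      unfolding kipriyanov_def Let_def ray_point(1)[OF x] frac_left_def
      by (simp add: scaleR_add_right mult.commute)
  qed
qed

text \<open>Both branches of \<open>psi_minus\<close> amount to cutting the average at s = r/(r +
  \<epsilon>). If this is at least r/d, the part over (0, r/d) is the boundary term and the rest is
  the integral over t. Otherwise x/s is outside the domain on the whole range, and the explicit
  integral of q gives \<epsilon>^(-\<alpha>), which is what the value prescribed near the boundary
  and the boundary term add up to.\<close>

lemma right_frac_deriv_eps_eq:
  fixes u w :: "real^'n \<Rightarrow> complex"
  defines "f \<equiv> \<lambda>y. \<rho> y *\<^sub>R u y" and "g \<equiv> \<lambda>x. rho x *\<^sub>R w x"
  assumes w[measurable]: "w \<in> borel_measurable borel" and rho[measurable]: "rho \<in> borel_measurable borel"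
    and x: "P + x \<in> \<Omega>" and ux: "u (P + x) = w x"
    and ae: "AE s in lborel. 0 < s \<longrightarrow> P + s *\<^sub>R x \<in> \<Omega> \<longrightarrow> u (P + s *\<^sub>R x) = w (s *\<^sub>R x)"
    and int: "integrable lborel (\<lambda>s. right_kernel \<alpha> s *\<^sub>R (g x - g (x /\<^sub>R s)))" and \<epsilon>: "\<epsilon> > 0"
  shows "right_frac_deriv_eps \<alpha> \<Omega> P \<epsilon> f (P + x) = norm x powr (- \<alpha>) *\<^sub>R ((\<alpha> / Gamma (1 - \<alpha>)) *\<^sub>R
    (LINT s|lborel. indicator {0<..<norm x / (norm x + \<epsilon>)} s *\<^sub>R (right_kernel \<alpha> s *\<^sub>R (g x - g (x /\<^sub>R s)))))"
proof -
  let ?e = "direction P (P + x)"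
  define r where "r = norm x"
  define d where "d = ray_length \<Omega> P ?e"
  define h where "h s = right_kernel \<alpha> s *\<^sub>R (g x - g (x /\<^sub>R s))" for s
  have r: "r > 0" "r < d" and rd: "dist P (P + x) = r"
    using ray_point[OF x] by (simp_all add: r_def d_def)
  have inD: "P + s *\<^sub>R x \<in> \<Omega> \<longleftrightarrow> s < d / r" if "s > 0" for s
    using ray_point(5)[OF x that] by (simp add: r_def d_def)
  have ih: "integrable lborel h" using int by (simp add: h_def[abs_def])
  have fx: "f (P + x) = g x" using ux x by (simp add: f_def g_def rho_def)
  have G: "Gamma (1 - \<alpha>) > 0" using alpha by (intro Gamma_real_pos) auto
  \<comment> \<open>For s < r/d the point x/s has left the domain, so g(x/s) = 0 and the integrand
    is q(s) g(x), whose integral is explicit.\<close>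
  have near: "(LINT s|lborel. indicator {0<..<b} s *\<^sub>R h s) = ((b / (1 - b)) powr \<alpha> / \<alpha>) *\<^sub>R g x"
    if b: "0 \<le> b" "b \<le> r / d" for b
  proof -
    have b1: "b < 1" using b r by (auto intro: le_less_trans)
    have "has_bochner_integral lborel (\<lambda>s. indicator {0<..<b} s * right_kernel \<alpha> s) ((b / (1 - b)) powr \<alpha> / \<alpha>)"
      using nn_integral_right_kernel[of \<alpha> 0 b] alpha b b1
      by (intro has_bochner_integral_nn_integral) (auto simp: kernels_nonneg)
    then have "(LINT s|lborel. (indicator {0<..<b} s * right_kernel \<alpha> s) *\<^sub>R g x) = ((b / (1 - b)) powr \<alpha> / \<alpha>) *\<^sub>R g x"
      using has_bochner_integral_integral_eq has_bochner_integral_scaleR_left by blast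
    moreover have "(indicator {0<..<b} s * right_kernel \<alpha> s) *\<^sub>R g x = indicator {0<..<b} s *\<^sub>R h s" for s
    proof (cases "0 < s \<and> s < b")
      case True
      then have "s < r / d" using b by simp
      then have "\<not> inverse s < d / r" using True r by (simp add: field_simps)
      then have "P + x /\<^sub>R s \<notin> \<Omega>" using inD[of "inverse s"] True by simp
      then have "g (x /\<^sub>R s) = 0" by (simp add: g_def rho_def)
      then show ?thesis by (simp add: h_def)
    qed auto
    ultimately show ?thesis by simp
  qed
  have "right_frac_deriv_eps \<alpha> \<Omega> P \<epsilon> f (P + x) = r powr (- \<alpha>) *\<^sub>R ((\<alpha> / Gamma (1 - \<alpha>)) *\<^sub>R
    (LINT s|lborel. indicator {0<..<r / (r + \<epsilon>)} s *\<^sub>R h s))"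
  proof (cases "r \<le> d - \<epsilon>")
    case True
    have rde: "r / d \<le> r / (r + \<epsilon>)" using True r \<epsilon> by (intro divide_left_mono) auto
    have "(LINT t|lebesgue_on {r + \<epsilon>..d}. (1 / (t - r) powr (\<alpha> + 1)) *\<^sub>R (g x - f (P + t *\<^sub>R ?e)))
      = r powr (- \<alpha>) *\<^sub>R (LINT s|lborel. indicator {r / d..r / (r + \<epsilon>)} s *\<^sub>R (right_kernel \<alpha> s *\<^sub>R (g x - g ((1 / s) *\<^sub>R x))))"
    proof (rule psi_integral_substitution[OF r(1) \<epsilon>])
      show "AE s in lborel. 0 < s \<longrightarrow> s < d / r \<longrightarrow> f (P + (r * s) *\<^sub>R ?e) = g (s *\<^sub>R x)"
        using ae
      proof eventually_elim
        case (elim s)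
        then show ?case
          using inD[of s] ray_point(3)[OF x, of s] by (auto simp: f_def g_def rho_def r_def)
      qed
      show "integrable lborel (\<lambda>s. right_kernel \<alpha> s *\<^sub>R (g x - g ((1 / s) *\<^sub>R x)))"
        using int by (simp add: inverse_eq_divide)
    qed (use True in \<open>auto simp: g_def\<close>)
    then have psi: "psi_minus \<alpha> \<Omega> P \<epsilon> f (P + x) = r powr (- \<alpha>) *\<^sub>R (LINT s|lborel. indicator {r / d..r / (r + \<epsilon>)} s *\<^sub>R h s)"
      unfolding psi_minus_def Let_def rd using True by (simp add: d_def[symmetric] fx h_def inverse_eq_divide)
    have "(LINT s|lborel. indicator {0<..<r / (r + \<epsilon>)} s *\<^sub>R h s)
        = (LINT s|lborel. indicator {0<..<r / d} s *\<^sub>R h s + indicator {r / d..r / (r + \<epsilon>)} s *\<^sub>R h s)"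
    proof (rule integral_cong_AE)
      have "AE s in lborel. s \<noteq> r / (r + \<epsilon>)" by (rule AE_lborel_singleton)
      then show "AE s in lborel. indicator {0<..<r / (r + \<epsilon>)} s *\<^sub>R h s
          = indicator {0<..<r / d} s *\<^sub>R h s + indicator {r / d..r / (r + \<epsilon>)} s *\<^sub>R h s"
      proof eventually_elim
        case (elim s)
        have "r / d > 0" using r by simp
        then show ?case using elim rde by (auto simp: indicator_def)
      qed
    qed (use ih in auto)
    also have "\<dots> = (LINT s|lborel. indicator {0<..<r / d} s *\<^sub>R h s) + (LINT s|lborel. indicator {r / d..r / (r + \<epsilon>)} s *\<^sub>R h s)"
      by (intro Bochner_Integration.integral_add integrable_mult_indicator ih) auto
    also have "(LINT s|lborel. indicator {0<..<r / d} s *\<^sub>R h s) = ((r / (d - r)) powr \<alpha> / \<alpha>) *\<^sub>R g x"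
    proof -
      have "(r / d) / (1 - r / d) = r / (d - r)" using r by (simp add: field_simps)
      then show ?thesis using near[of "r / d"] r by simp
    qed
    finally have eq: "(LINT s|lborel. indicator {0<..<r / (r + \<epsilon>)} s *\<^sub>R h s)
      = ((r / (d - r)) powr \<alpha> / \<alpha>) *\<^sub>R g x + (LINT s|lborel. indicator {r / d..r / (r + \<epsilon>)} s *\<^sub>R h s)" .
    have c: "r powr (- \<alpha>) * (\<alpha> / Gamma (1 - \<alpha>)) * ((r / (d - r)) powr \<alpha> / \<alpha>) = (d - r) powr (- \<alpha>) / Gamma (1 - \<alpha>)"
      using r alpha by (simp add: powr_divide powr_minus field_simps)
    show ?thesis
      unfolding right_frac_deriv_eps_def Let_def rd psi eq fx d_def[symmetric] c[symmetric]
      by (simp add: scaleR_add_right mult_ac)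
  next
    case False
    have "r / (r + \<epsilon>) \<le> r / d" using False r \<epsilon> by (intro divide_left_mono) auto
    moreover have "r / (r + \<epsilon>) / (1 - r / (r + \<epsilon>)) = r / \<epsilon>"
    proof -
      have "1 - r / (r + \<epsilon>) = \<epsilon> / (r + \<epsilon>)" using r \<epsilon> by (simp add: field_simps)
      then show ?thesis using r \<epsilon> by simp
    qed
    ultimately have "(LINT s|lborel. indicator {0<..<r / (r + \<epsilon>)} s *\<^sub>R h s) = ((r / \<epsilon>) powr \<alpha> / \<alpha>) *\<^sub>R g x"
      using near[of "r / (r + \<epsilon>)"] r \<epsilon> by simp
    moreover have "r powr (- \<alpha>) * (\<alpha> / Gamma (1 - \<alpha>)) * ((r / \<epsilon>) powr \<alpha> / \<alpha>) = \<epsilon> powr (- \<alpha>) / Gamma (1 - \<alpha>)"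
      using r alpha \<epsilon> by (simp add: powr_divide powr_minus field_simps)
    moreover have "psi_minus \<alpha> \<Omega> P \<epsilon> f (P + x) = ((\<epsilon> powr (- \<alpha>) - (d - r) powr (- \<alpha>)) / \<alpha>) *\<^sub>R g x"
      unfolding psi_minus_def Let_def rd using False by (simp add: d_def[symmetric] fx)
    moreover have "(d - r) powr (- \<alpha>) / Gamma (1 - \<alpha>) + \<alpha> / Gamma (1 - \<alpha>) * ((\<epsilon> powr (- \<alpha>) - (d - r) powr (- \<alpha>)) / \<alpha>)
        = \<epsilon> powr (- \<alpha>) / Gamma (1 - \<alpha>)"
      using alpha by (simp add: diff_divide_distrib right_diff_distrib)
    ultimately show ?thesis
      unfolding right_frac_deriv_eps_def Let_def rd fx d_def[symmetric]
      by (simp only: scaleR_scaleR mult.assoc scaleR_add_left[symmetric])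
  qed
  then show ?thesis by (simp add: r_def h_def)
qed

text \<open>Dominated convergence is used twice: in s for fixed x, where finiteness of G(x) makes
  the full integrand integrable, and then in x, where every truncation \<open>T \<epsilon>\<close>
  and the limit \<open>T0\<close> are bounded by c G.\<close>

lemma right_frac_deriv_limit:
  fixes u w :: "real^'n \<Rightarrow> complex"
  defines "f \<equiv> \<lambda>y. \<rho> y *\<^sub>R u y"
  assumes ae: "AE x in lborel. P + x \<in> \<Omega> \<longrightarrow> u (P + x) = w x"
    and cl: "dilation_class {x. P + x \<in> \<Omega>} \<alpha> (diameter \<Omega>) B w"
  shows "l2_tendsto \<Omega> (\<lambda>\<epsilon>. right_frac_deriv_eps \<alpha> \<Omega> P \<epsilon> f)
    (\<lambda>Q. indicator \<Omega> Q *\<^sub>R frac_right \<alpha> (\<lambda>x. rho x *\<^sub>R w x) (Q - P)) (at_right 0)"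
proof -
  let ?D = "{x. P + x \<in> \<Omega>}"
  interpret W: weighted_dilation_class ?D \<alpha> "diameter \<Omega>" B w rho R M \<kappa> by (rule weighted_class[OF cl])
  let ?g = "\<lambda>x. rho x *\<^sub>R w x" and ?c = "\<alpha> / Gamma (1 - \<alpha>)"
  have [measurable]: "\<Omega> \<in> sets borel" using \<Omega>(1) by simp
  define T where "T \<epsilon> x = indicator ?D x *\<^sub>R (norm x powr (- \<alpha>) *\<^sub>R (?c *\<^sub>R
    (LINT s|lborel. indicator {0<..<norm x / (norm x + \<epsilon>)} s *\<^sub>R (right_kernel \<alpha> s *\<^sub>R (?g x - ?g (x /\<^sub>R s))))))" for \<epsilon> x
  define T0 where "T0 x = indicator ?D x *\<^sub>R frac_right \<alpha> ?g x" for x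
  have Tm[measurable]: "T \<epsilon> \<in> borel_measurable borel" for \<epsilon>
  proof -
    have "(\<lambda>p. indicator {0<..<norm (fst p) / (norm (fst p) + \<epsilon>)} (snd p) :: real) \<in> borel_measurable ((borel :: (real^'n) measure) \<Otimes>\<^sub>M (lborel :: real measure))"
    proof -
      have "(\<lambda>p. indicator {0<..<norm (fst p) / (norm (fst p) + \<epsilon>)} (snd p) :: real)
          = (\<lambda>p :: (real^'n) \<times> real. if 0 < snd p \<and> snd p < norm (fst p) / (norm (fst p) + \<epsilon>) then 1 else 0)"
        by (auto simp: indicator_def fun_eq_iff)
      also have "\<dots> \<in> borel_measurable ((borel :: (real^'n) measure) \<Otimes>\<^sub>M (lborel :: real measure))" by measurable
      finally show ?thesis .
    qed
    then have [measurable]: "(\<lambda>(x, s). indicator {0<..<norm x / (norm x + \<epsilon>)} s :: real)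
        \<in> borel_measurable ((borel :: (real^'n) measure) \<Otimes>\<^sub>M (lborel :: real measure))"
      by (simp add: split_beta')
    show ?thesis unfolding T_def by measurable
  qed
  have T0m[measurable]: "T0 \<in> borel_measurable borel"
    unfolding T0_def frac_right_def by measurable
  have c0: "?c \<ge> 0" using W.c_pos by simp
  have Gfin: "AE x in lborel. W.G x < \<infinity>"
  proof -
    have "AE x in lborel. (W.G x)\<^sup>2 \<noteq> \<infinity>"
      using W.G_sq_finite by (intro nn_integral_PInf_AE) auto
    then show ?thesis by eventually_elim (rule ennreal_power2_less_topD, simp add: less_top)
  qed
  have good: "integrable lborel (\<lambda>s. right_kernel \<alpha> s *\<^sub>R (?g x - ?g (x /\<^sub>R s)))"
    "norm x powr (- \<alpha>) * (LINT s|lborel. norm (right_kernel \<alpha> s *\<^sub>R (?g x - ?g (x /\<^sub>R s)))) = enn2real (W.G x)"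
    if fin: "W.G x < \<infinity>" and x: "P + x \<in> \<Omega>" for x
  proof -
    have n0: "norm x powr (- \<alpha>) > 0" using ray_point(2)[OF x] by simp
    have GG: "W.G x = ennreal (norm x powr (- \<alpha>)) * (\<integral>\<^sup>+s. ennreal (norm (right_kernel \<alpha> s *\<^sub>R (?g x - ?g (x /\<^sub>R s)))) \<partial>lborel)"
      unfolding W.G_def using x
      by (subst nn_integral_cmult[symmetric])
        (auto simp: kernels_nonneg mult_ac intro!: nn_integral_cong simp flip: ennreal_mult)
    then have "(\<integral>\<^sup>+s. ennreal (norm (right_kernel \<alpha> s *\<^sub>R (?g x - ?g (x /\<^sub>R s)))) \<partial>lborel) < \<infinity>"
      using fin n0 by (auto simp: ennreal_mult_less_top)
    then show i: "integrable lborel (\<lambda>s. right_kernel \<alpha> s *\<^sub>R (?g x - ?g (x /\<^sub>R s)))"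
      by (intro integrableI_bounded) auto
    show "norm x powr (- \<alpha>) * (LINT s|lborel. norm (right_kernel \<alpha> s *\<^sub>R (?g x - ?g (x /\<^sub>R s)))) = enn2real (W.G x)"
      unfolding GG nn_integral_eq_integral[OF integrable_norm[OF i] AE_I2[OF norm_ge_zero]]
      by (simp add: integral_nonneg_AE flip: ennreal_mult del: norm_scaleR)
  qed
  have bound: "norm x powr (- \<alpha>) * (?c * cmod (LINT s|lborel. indicator A s *\<^sub>R (right_kernel \<alpha> s *\<^sub>R (?g x - ?g (x /\<^sub>R s))))) \<le> ?c * enn2real (W.G x)"
    if fin: "W.G x < \<infinity>" and x: "P + x \<in> \<Omega>" and A: "A \<in> sets borel" for x and A :: "real set"
  proof -
    have "cmod (LINT s|lborel. indicator A s *\<^sub>R (right_kernel \<alpha> s *\<^sub>R (?g x - ?g (x /\<^sub>R s))))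
        \<le> (LINT s|lborel. norm (right_kernel \<alpha> s *\<^sub>R (?g x - ?g (x /\<^sub>R s))))"
      using A by (intro Bochner_Integration.integral_norm_bound_integral integrable_mult_indicator integrable_norm good(1)[OF fin x])
        (auto simp: indicator_def)
    then have "?c * (norm x powr (- \<alpha>) * cmod (LINT s|lborel. indicator A s *\<^sub>R (right_kernel \<alpha> s *\<^sub>R (?g x - ?g (x /\<^sub>R s)))))
        \<le> ?c * (norm x powr (- \<alpha>) * (LINT s|lborel. norm (right_kernel \<alpha> s *\<^sub>R (?g x - ?g (x /\<^sub>R s)))))"
      using c0 by (intro mult_left_mono) auto
    then show ?thesis unfolding good(2)[OF fin x] by (simp add: mult.left_commute)
  qed
  have nrm: "cmod (norm x powr (- \<alpha>) *\<^sub>R (?c *\<^sub>R I)) = norm x powr (- \<alpha>) * (?c * cmod I)" for x :: "real^'n" and I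
    by (simp only: norm_scaleR abs_of_nonneg[OF c0] abs_of_nonneg[OF powr_ge_zero])
  have T_le: "cmod (T \<epsilon> x) \<le> ?c * enn2real (W.G x)" and T0_le: "cmod (T0 x) \<le> ?c * enn2real (W.G x)"
    if fin: "W.G x < \<infinity>" for \<epsilon> x
  proof -
    show "cmod (T \<epsilon> x) \<le> ?c * enn2real (W.G x)"
    proof (cases "P + x \<in> \<Omega>")
      case True
      then have "T \<epsilon> x = norm x powr (- \<alpha>) *\<^sub>R (?c *\<^sub>R
        (LINT s|lborel. indicator {0<..<norm x / (norm x + \<epsilon>)} s *\<^sub>R (right_kernel \<alpha> s *\<^sub>R (?g x - ?g (x /\<^sub>R s)))))"
        unfolding T_def by (simp only: indicator_simps mem_Collect_eq scaleR_one)
      with bound[OF fin True, of "{0<..<norm x / (norm x + \<epsilon>)}"] show ?thesis by (simp only: nrm borel_open open_greaterThanLessThan)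
    next
      case False
      then have "T \<epsilon> x = 0" by (simp add: T_def)
      then show ?thesis using mult_nonneg_nonneg[OF c0 enn2real_nonneg] by (simp only: norm_zero)
    qed
    show "cmod (T0 x) \<le> ?c * enn2real (W.G x)"
    proof (cases "P + x \<in> \<Omega>")
      case True
      then have "T0 x = norm x powr (- \<alpha>) *\<^sub>R (?c *\<^sub>R
        (LINT s|lborel. indicator UNIV s *\<^sub>R (right_kernel \<alpha> s *\<^sub>R (?g x - ?g (x /\<^sub>R s)))))"
        unfolding T0_def frac_right_def by (simp only: indicator_simps mem_Collect_eq scaleR_one UNIV_I)
      with bound[OF fin True, of UNIV] show ?thesis by (simp only: nrm borel_open open_UNIV)
    next
      case False
      then have "T0 x = 0" by (simp add: T0_def)
      then show ?thesis using mult_nonneg_nonneg[OF c0 enn2real_nonneg] by (simp only: norm_zero)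
    qed
  qed
  have iG: "integrable lborel (\<lambda>x. (?c * enn2real (W.G x))\<^sup>2)"
  proof -
    have "(\<integral>\<^sup>+x. ennreal ((enn2real (W.G x))\<^sup>2) \<partial>lborel) = (\<integral>\<^sup>+x. (W.G x)\<^sup>2 \<partial>lborel)"
      by (intro nn_integral_cong_AE, use Gfin in eventually_elim) (auto simp: ennreal_power[symmetric])
    then have "integrable lborel (\<lambda>x. (enn2real (W.G x))\<^sup>2)"
      using W.G_sq_finite by (intro integrableI_nonneg) auto
    then show ?thesis unfolding power_mult_distrib by (rule integrable_mult_right)
  qed
  have T_sq: "integrable lborel (\<lambda>x. (cmod (T \<epsilon> x))\<^sup>2)" "integrable lborel (\<lambda>x. (cmod (T0 x))\<^sup>2)" for \<epsilon>
  proof -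
    show "integrable lborel (\<lambda>x. (cmod (T \<epsilon> x))\<^sup>2)"
    proof (rule Bochner_Integration.integrable_bound[OF iG])
      show "AE x in lborel. norm ((cmod (T \<epsilon> x))\<^sup>2) \<le> norm ((?c * enn2real (W.G x))\<^sup>2)"
        using Gfin by eventually_elim (use T_le in \<open>auto intro!: power_mono\<close>)
    qed measurable
    show "integrable lborel (\<lambda>x. (cmod (T0 x))\<^sup>2)"
    proof (rule Bochner_Integration.integrable_bound[OF iG])
      show "AE x in lborel. norm ((cmod (T0 x))\<^sup>2) \<le> norm ((?c * enn2real (W.G x))\<^sup>2)"
        using Gfin by eventually_elim (use T0_le in \<open>auto intro!: power_mono\<close>)
    qed measurable
  qed
  have eps: "AE x in lborel. P + x \<in> \<Omega> \<longrightarrow> right_frac_deriv_eps \<alpha> \<Omega> P \<epsilon> f (P + x) = T \<epsilon> x" if "\<epsilon> > 0" for \<epsilon>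
    using AE_along_rays[OF ae] Gfin
  proof eventually_elim
    case (elim x)
    show ?case
    proof
      assume x: "P + x \<in> \<Omega>"
      show "right_frac_deriv_eps \<alpha> \<Omega> P \<epsilon> f (P + x) = T \<epsilon> x"
        unfolding f_def T_def using elim x that
        by (subst right_frac_deriv_eps_eq[OF W.w_meas W.rho_meas x]) (auto intro: good(1))
    qed
  qed
  let ?lim = "\<lambda>Q. indicator \<Omega> Q *\<^sub>R frac_right \<alpha> ?g (Q - P)"
  have g0: "?lim (P + x) = T0 x" for x by (simp add: T0_def indicator_def)
  have T_out: "T \<epsilon> x = 0" "T0 x = 0" if "P + x \<notin> \<Omega>" for \<epsilon> x using that by (auto simp: T_def T0_def)
  have fL2: "right_frac_deriv_eps \<alpha> \<Omega> P \<epsilon> f \<in> L2 \<Omega>" if e: "\<epsilon> > 0" for \<epsilon>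
  proof -
    have "(\<lambda>Q. (cmod (right_frac_deriv_eps \<alpha> \<Omega> P \<epsilon> f Q))\<^sup>2) \<in> borel_measurable (lebesgue_on \<Omega>)
      \<and> integrable (lebesgue_on \<Omega>) (\<lambda>Q. (cmod (right_frac_deriv_eps \<alpha> \<Omega> P \<epsilon> f Q))\<^sup>2)"
    proof -
      have m: "(\<lambda>x. (cmod (T \<epsilon> x))\<^sup>2) \<in> borel_measurable borel" by measurable
      have o: "(cmod (T \<epsilon> x))\<^sup>2 = 0" if "P + x \<notin> \<Omega>" for x using that T_out by simp
      have a: "AE x in lborel. P + x \<in> \<Omega> \<longrightarrow> (cmod (right_frac_deriv_eps \<alpha> \<Omega> P \<epsilon> f (P + x)))\<^sup>2 = (cmod (T \<epsilon> x))\<^sup>2"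
        using eps[OF e] by eventually_elim auto
      show ?thesis
        using transfer_to_borel(1,2)[OF \<Omega>(1) m o a] T_sq(1)[of \<epsilon>] by blast
    qed
    moreover have "right_frac_deriv_eps \<alpha> \<Omega> P \<epsilon> f \<in> borel_measurable (lebesgue_on \<Omega>)"
      by (rule transfer_to_borel(1)[OF \<Omega>(1) Tm T_out(1) eps[OF e]])
    ultimately show ?thesis by (simp add: L2_def)
  qed
  have g0L2: "?lim \<in> L2 \<Omega>"
  proof -
    have "?lim \<in> borel_measurable (lebesgue_on \<Omega>)"
      by (rule transfer_to_borel(1)[where P=P, OF \<Omega>(1) T0m T_out(2) AE_I2[OF impI[OF g0]]])
    moreover have "integrable (lebesgue_on \<Omega>) (\<lambda>Q. (cmod (?lim Q))\<^sup>2) \<longleftrightarrow> integrable lborel (\<lambda>x. (cmod (T0 x))\<^sup>2)"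
    proof (rule transfer_to_borel(2)[OF \<Omega>(1), of _ P])
      show "(\<lambda>x. (cmod (T0 x))\<^sup>2) \<in> borel_measurable borel" by measurable
      show "AE x in lborel. P + x \<in> \<Omega> \<longrightarrow> (cmod (?lim (P + x)))\<^sup>2 = (cmod (T0 x))\<^sup>2"
        unfolding g0 by simp
    qed (simp add: T_out)
    ultimately show ?thesis using T_sq(2) by (simp add: L2_def)
  qed
  have norm_eq: "l2_norm \<Omega> (\<lambda>Q. right_frac_deriv_eps \<alpha> \<Omega> P \<epsilon> f Q - ?lim Q) = sqrt (LINT x|lborel. (cmod (T \<epsilon> x - T0 x))\<^sup>2)"
    if e: "\<epsilon> > 0" for \<epsilon>
  proof -
    have m: "(\<lambda>x. (cmod (T \<epsilon> x - T0 x))\<^sup>2) \<in> borel_measurable borel" by measurable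
    have o: "(cmod (T \<epsilon> x - T0 x))\<^sup>2 = 0" if "P + x \<notin> \<Omega>" for x using that T_out by simp
    have a: "AE x in lborel. P + x \<in> \<Omega> \<longrightarrow> (cmod (right_frac_deriv_eps \<alpha> \<Omega> P \<epsilon> f (P + x) - ?lim (P + x)))\<^sup>2 = (cmod (T \<epsilon> x - T0 x))\<^sup>2"
      unfolding g0 using eps[OF e] by eventually_elim auto
    show ?thesis unfolding l2_norm_def using transfer_to_borel(3)[OF \<Omega>(1) m o a] by simp
  qed
  have "((\<lambda>\<epsilon>. l2_norm \<Omega> (\<lambda>Q. right_frac_deriv_eps \<alpha> \<Omega> P \<epsilon> f Q - ?lim Q)) \<longlongrightarrow> 0) (at_right 0)"
  proof (rule tendsto_at_right_sequentially[where b=1])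
    fix S :: "nat \<Rightarrow> real"
    assume S: "\<And>n. 0 < S n" "S \<longlonglongrightarrow> 0"
    have ptw: "(\<lambda>n. T (S n) x) \<longlonglongrightarrow> T0 x" if fin: "W.G x < \<infinity>" for x
    proof (cases "P + x \<in> \<Omega>")
      case True
      have "(\<lambda>n. LINT s|lborel. indicator {0<..<norm x / (norm x + S n)} s *\<^sub>R (right_kernel \<alpha> s *\<^sub>R (?g x - ?g (x /\<^sub>R s))))
          \<longlonglongrightarrow> (LINT s|lborel. right_kernel \<alpha> s *\<^sub>R (?g x - ?g (x /\<^sub>R s)))"
      proof (rule integral_dominated_convergence[where w="\<lambda>s. norm (right_kernel \<alpha> s *\<^sub>R (?g x - ?g (x /\<^sub>R s)))"])
        have n0: "norm x > 0" using ray_point(2)[OF True] .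
        have "(\<lambda>n. norm x / (norm x + S n)) \<longlonglongrightarrow> norm x / (norm x + 0)"
          using n0 by (intro tendsto_intros S) auto
        then have lim: "(\<lambda>n. norm x / (norm x + S n)) \<longlonglongrightarrow> 1" using n0 by simp
        show "AE s in lborel. (\<lambda>n. indicator {0<..<norm x / (norm x + S n)} s *\<^sub>R (right_kernel \<alpha> s *\<^sub>R (?g x - ?g (x /\<^sub>R s))))
          \<longlonglongrightarrow> right_kernel \<alpha> s *\<^sub>R (?g x - ?g (x /\<^sub>R s))"
        proof (intro AE_I2)
          fix s
          show "(\<lambda>n. indicator {0<..<norm x / (norm x + S n)} s *\<^sub>R (right_kernel \<alpha> s *\<^sub>R (?g x - ?g (x /\<^sub>R s))))
            \<longlonglongrightarrow> right_kernel \<alpha> s *\<^sub>R (?g x - ?g (x /\<^sub>R s))"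
          proof (cases "0 < s \<and> s < 1")
            case True
            then have "\<forall>\<^sub>F n in sequentially. s < norm x / (norm x + S n)" using order_tendstoD(1)[OF lim] by blast
            then have "\<forall>\<^sub>F n in sequentially. indicator {0<..<norm x / (norm x + S n)} s *\<^sub>R (right_kernel \<alpha> s *\<^sub>R (?g x - ?g (x /\<^sub>R s)))
              = right_kernel \<alpha> s *\<^sub>R (?g x - ?g (x /\<^sub>R s))"
              by eventually_elim (use True in auto)
            then show ?thesis by (rule tendsto_eventually)
          next
            case False
            then have "right_kernel \<alpha> s = 0" by (auto simp: right_kernel_def)
            then show ?thesis by simp
          qed
        qed
      qed (use good(1)[OF fin True] in \<open>auto simp: indicator_def simp del: norm_scaleR\<close>)
      then have "(\<lambda>n. norm x powr (- \<alpha>) *\<^sub>R (?c *\<^sub>R (LINT s|lborel. indicator {0<..<norm x / (norm x + S n)} s *\<^sub>R (right_kernel \<alpha> s *\<^sub>R (?g x - ?g (x /\<^sub>R s))))))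
          \<longlonglongrightarrow> norm x powr (- \<alpha>) *\<^sub>R (?c *\<^sub>R (LINT s|lborel. right_kernel \<alpha> s *\<^sub>R (?g x - ?g (x /\<^sub>R s))))"
        by (intro tendsto_scaleR tendsto_const)
      then show ?thesis using True by (simp add: T_def T0_def frac_right_def)
    qed (simp add: T_out)
    have "(\<lambda>n. LINT x|lborel. (cmod (T (S n) x - T0 x))\<^sup>2) \<longlonglongrightarrow> (LINT x|(lborel :: (real^'n) measure). 0)"
    \<comment> \<open>Each of the two functions is at most c G in modulus, so the square of their
      difference is at most 4 (c G)^2.\<close>
    proof (rule integral_dominated_convergence[where w="\<lambda>x. 4 * (?c * enn2real (W.G x))\<^sup>2"])
      show "AE x in lborel. (\<lambda>n. (cmod (T (S n) x - T0 x))\<^sup>2) \<longlonglongrightarrow> 0"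
        using Gfin
      proof eventually_elim
        case (elim x)
        have "(\<lambda>n. (cmod (T (S n) x - T0 x))\<^sup>2) \<longlonglongrightarrow> (cmod (T0 x - T0 x))\<^sup>2"
          by (intro tendsto_intros ptw[OF elim])
        then show ?case by simp
      qed
      show "AE x in lborel. norm ((cmod (T (S n) x - T0 x))\<^sup>2) \<le> 4 * (?c * enn2real (W.G x))\<^sup>2" for n
        using Gfin
      proof eventually_elim
        case (elim x)
        have "cmod (T (S n) x - T0 x) \<le> 2 * (?c * enn2real (W.G x))"
          using norm_triangle_ineq4[of "T (S n) x" "T0 x"] T_le[OF elim, of "S n"] T0_le[OF elim] by linarith
        then have "(cmod (T (S n) x - T0 x))\<^sup>2 \<le> (2 * (?c * enn2real (W.G x)))\<^sup>2" by (intro power_mono) auto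
        also have "(2 * y)\<^sup>2 = 4 * y\<^sup>2" for y :: real by (simp add: power_mult_distrib)
        finally show ?case by (simp only: real_norm_def abs_power2)
      qed
    qed (use iG in auto)
    then have "(\<lambda>n. sqrt (LINT x|lborel. (cmod (T (S n) x - T0 x))\<^sup>2)) \<longlonglongrightarrow> sqrt 0"
      by (intro tendsto_real_sqrt) simp
    then show "(\<lambda>n. l2_norm \<Omega> (\<lambda>Q. right_frac_deriv_eps \<alpha> \<Omega> P (S n) f Q - ?lim Q)) \<longlonglongrightarrow> 0"
      by (simp add: norm_eq[OF S(1)])
  qed simp
  moreover have "\<forall>\<^sub>F \<epsilon> in at_right 0. right_frac_deriv_eps \<alpha> \<Omega> P \<epsilon> f \<in> L2 \<Omega>"
    using eventually_at_right_less[of 0] by eventually_elim (rule fL2)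
  ultimately show ?thesis using g0L2 by (simp add: l2_tendsto_def)
qed

end

subsection \<open>The quadratic forms\<close>

definition energy :: "(real^'n) set \<Rightarrow> (real^'n \<Rightarrow> complex) \<Rightarrow> real" where
  "energy \<Omega> u = (\<Sum>i\<in>UNIV. (l2_norm \<Omega> (weak_partial \<Omega> i u))\<^sup>2)"

lemma energy_nonneg: "energy \<Omega> u \<ge> 0"
  by (simp add: energy_def sum_nonneg)

context kipriyanov_setting
begin

definition pairing_bound :: real where
  "pairing_bound = R * sqrt (diameter \<Omega> powr (2 * \<alpha>) * frac_const CARD('n) \<alpha>) * class_const CARD('n) \<alpha> (diameter \<Omega>)"

definition poincare_const :: real where
  "poincare_const = diameter \<Omega> powr (2 * \<alpha>) * class_const CARD('n) \<alpha> (diameter \<Omega>)"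

text \<open>Everything is read off from the Borel representative. The two inner products turn out to
  be conjugate to each other, which is why the same bounds appear for the left and the right
  derivative.\<close>

lemma fractional_estimates:
  assumes u: "u \<in> sobolev10 \<Omega>"
  defines "hL \<equiv> \<lambda>Q. \<rho> Q *\<^sub>R kipriyanov \<alpha> P u Q" and "hR \<equiv> right_frac_deriv \<alpha> \<Omega> P (\<lambda>Q. \<rho> Q *\<^sub>R u Q)"
  shows "hL \<in> L2 \<Omega>" "hR \<in> L2 \<Omega>" "0 \<le> Re (l2_inner \<Omega> hL u)" "0 \<le> Re (l2_inner \<Omega> hR u)"
    "cmod (l2_inner \<Omega> hL u) \<le> pairing_bound * energy \<Omega> u" "cmod (l2_inner \<Omega> hR u) \<le> pairing_bound * energy \<Omega> u"
    "(l2_norm \<Omega> u)\<^sup>2 \<le> poincare_const * energy \<Omega> u"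
proof -
  let ?B = "class_const CARD('n) \<alpha> (diameter \<Omega>) * energy \<Omega> u"
  let ?D = "{x. P + x \<in> \<Omega>}"
  obtain w where ae: "AE x in lborel. P + x \<in> \<Omega> \<longrightarrow> u (P + x) = w x" and cl: "dilation_class ?D \<alpha> (diameter \<Omega>) ?B w"
    using sobolev10_dilation_class[OF card_ge_2 alpha \<Omega> P u] unfolding energy_def by blast
  interpret W: weighted_dilation_class ?D \<alpha> "diameter \<Omega>" ?B w rho R M \<kappa> by (rule weighted_class[OF cl])
  let ?g = "\<lambda>x. rho x *\<^sub>R w x"
  have [measurable]: "\<Omega> \<in> sets borel" using \<Omega>(1) by simp
  have uL: "u \<in> L2 \<Omega>" using u by (auto simp: sobolev10_def)
  have w_out: "w x = 0" if "P + x \<notin> \<Omega>" for x using W.w_out[of x] that by simp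
  have rho_out: "rho x = 0" if "P + x \<notin> \<Omega>" for x using that by (simp add: rho_def)
  note keq = kipriyanov_eq_frac_left[OF W.w_meas ae]
  let ?hl = "\<lambda>x. rho x *\<^sub>R frac_left \<alpha> w x"
  have aeL: "AE x in lborel. P + x \<in> \<Omega> \<longrightarrow> hL (P + x) = ?hl x"
    using keq by eventually_elim (auto simp: hL_def rho_def)
  have hLm: "hL \<in> borel_measurable (lebesgue_on \<Omega>)"
    by (rule transfer_to_borel(1)[OF \<Omega>(1) _ _ aeL]) (auto simp: rho_out)
  have "integrable (lebesgue_on \<Omega>) (\<lambda>Q. (cmod (hL Q))\<^sup>2) \<longleftrightarrow> integrable lborel (\<lambda>x. (cmod (?hl x))\<^sup>2)"
    by (rule transfer_to_borel(2)[OF \<Omega>(1), of _ P])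
      (use aeL in \<open>auto simp: rho_out elim!: eventually_mono\<close>)
  moreover have "integrable lborel (\<lambda>x. (cmod (?hl x))\<^sup>2)"
  proof (rule Bochner_Integration.integrable_bound[OF integrable_mult_right[OF W.frac_left_L2, of "R\<^sup>2"]])
    have "(rho x)\<^sup>2 * (cmod (frac_left \<alpha> w x))\<^sup>2 \<le> R\<^sup>2 * (cmod (frac_left \<alpha> w x))\<^sup>2" for x
      using power_mono[OF W.rho_le[of x] W.rho_nonneg[of x], of 2] by (intro mult_right_mono) auto
    then show "AE x in lborel. norm ((cmod (?hl x))\<^sup>2) \<le> norm (R\<^sup>2 * (cmod (frac_left \<alpha> w x))\<^sup>2)"
      by (auto simp: power_mult_distrib)
  qed measurable
  ultimately show hL2: "hL \<in> L2 \<Omega>" using hLm by (simp add: L2_def)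
  have "l2_inner \<Omega> hL u = (LINT x|lborel. ?hl x * cnj (w x))"
    unfolding l2_inner_def
  proof (rule transfer_to_borel(3)[OF \<Omega>(1)])
    show "AE x in lborel. P + x \<in> \<Omega> \<longrightarrow> hL (P + x) * cnj (u (P + x)) = ?hl x * cnj (w x)"
      using aeL ae by eventually_elim auto
  qed (auto simp: rho_out)
  also have "\<dots> = (LINT x|lborel. cnj (?g x * cnj (frac_left \<alpha> w x)))"
    by (simp add: mult_ac)
  also have "\<dots> = cnj W.pairing"
    unfolding W.pairing_def by (rule Bochner_Integration.integral_cnj)
  finally have innerL: "l2_inner \<Omega> hL u = cnj W.pairing" .
  let ?lim = "\<lambda>Q. indicator \<Omega> Q *\<^sub>R frac_right \<alpha> ?g (Q - P)"
  have lim: "l2_tendsto \<Omega> (\<lambda>\<epsilon>. right_frac_deriv_eps \<alpha> \<Omega> P \<epsilon> (\<lambda>Q. \<rho> Q *\<^sub>R u Q)) ?lim (at_right 0)"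
    by (rule right_frac_deriv_limit[OF ae cl])
  then have lim': "l2_tendsto \<Omega> (\<lambda>\<epsilon>. right_frac_deriv_eps \<alpha> \<Omega> P \<epsilon> (\<lambda>Q. \<rho> Q *\<^sub>R u Q)) hR (at_right 0)"
    \<comment> \<open>A limit exists by \<open>lim\<close>, so the selected function is one; it can
      differ from the explicit limit on a null set only, which does not affect the inner
      product.\<close>
    unfolding hR_def right_frac_deriv_def by (rule someI[where P="\<lambda>g. l2_tendsto \<Omega> _ g (at_right 0)"])
  then show hR2: "hR \<in> L2 \<Omega>" by (simp add: l2_tendsto_def)
  have g02: "?lim \<in> L2 \<Omega>" using lim by (simp add: l2_tendsto_def)
  have "AE Q in lebesgue_on \<Omega>. hR Q = ?lim Q"
    by (rule l2_tendsto_unique[OF _ lim' lim]) simp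
  then have "l2_inner \<Omega> hR u = l2_inner \<Omega> ?lim u"
    using hR2 g02 uL by (intro l2_inner_cong_AE L2_D(1))
  also have "\<dots> = (LINT x|lborel. frac_right \<alpha> ?g x * cnj (w x))"
    unfolding l2_inner_def
  proof (rule transfer_to_borel(3)[OF \<Omega>(1)])
    have [measurable]: "frac_right \<alpha> ?g \<in> borel_measurable borel" unfolding frac_right_def by measurable
    show "(\<lambda>x. frac_right \<alpha> ?g x * cnj (w x)) \<in> borel_measurable borel" by measurable
    show "AE x in lborel. P + x \<in> \<Omega> \<longrightarrow> ?lim (P + x) * cnj (u (P + x)) = frac_right \<alpha> ?g x * cnj (w x)"
      using ae by eventually_elim auto
  qed (auto simp: w_out)
  also have "\<dots> = W.pairing" by (rule W.frac_right_pairing)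
  finally have innerR: "l2_inner \<Omega> hR u = W.pairing" .
  show "0 \<le> Re (l2_inner \<Omega> hL u)" "0 \<le> Re (l2_inner \<Omega> hR u)"
    unfolding innerL innerR using W.Re_pairing_nonneg by simp_all
  have "cmod W.pairing \<le> pairing_bound * energy \<Omega> u"
    using W.norm_pairing_le by (simp add: pairing_bound_def mult_ac)
  then show "cmod (l2_inner \<Omega> hL u) \<le> pairing_bound * energy \<Omega> u" "cmod (l2_inner \<Omega> hR u) \<le> pairing_bound * energy \<Omega> u"
    unfolding innerL innerR by simp_all
  have "(l2_norm \<Omega> u)\<^sup>2 = (LINT x|lborel. (cmod (w x))\<^sup>2)"
    unfolding l2_norm_sq
    by (rule transfer_to_borel(3)[OF \<Omega>(1), of _ P]) (use ae in \<open>auto simp: w_out elim!: eventually_mono\<close>)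
  also have "\<dots> \<le> poincare_const * energy \<Omega> u"
    using W.w_L2_le by (simp add: poincare_const_def mult_ac)
  finally show "(l2_norm \<Omega> u)\<^sup>2 \<le> poincare_const * energy \<Omega> u" .
qed

end

section \<open>The second-order part and the numerical range\<close>

lemma op_domD: "u \<in> op_dom \<Omega> \<Longrightarrow> u \<in> sobolev10 \<Omega>"
  by (simp add: op_dom_def)

lemma C1_closure_bounded:
  assumes "bounded \<Omega>" "C1_closure \<Omega> a"
  shows "\<exists>c. \<forall>x\<in>closure \<Omega>. \<bar>a x\<bar> \<le> c"
proof -
  have "compact (closure \<Omega>)" using assms(1) by (simp add: compact_closure)
  moreover have "continuous_on (closure \<Omega>) a" using assms(2) by (simp add: C1_closure_def)
  ultimately have "bounded (a ` closure \<Omega>)" by (intro compact_imp_bounded compact_continuous_image)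
  then show ?thesis by (simp add: bounded_iff)
qed

lemma test_function_cnj:
  assumes "test_function \<Omega> \<phi>"
  shows "test_function \<Omega> (\<lambda>x. cnj (\<phi> x))"
  using assms by (auto simp: test_function_def intro: C_k_cnj)

lemma weak_partial_L2:
  assumes "u \<in> sobolev10 \<Omega>"
  shows "weak_partial \<Omega> i u \<in> L2 \<Omega>"
  using assms by (auto simp: sobolev10_def l2_tendsto_def)

text \<open>Testing the equation with \<open>cnj \<phi>\<close> for test functions \<open>\<phi>\<close> converging to
  \<open>u\<close> needs only that the sum of the second-order terms, not each of them, is square integrable.\<close>

lemma divergence_form:
  fixes b :: "'n \<Rightarrow> 'n \<Rightarrow> real^'n \<Rightarrow> real"
  assumes \<Omega>: "open \<Omega>" "bounded \<Omega>" and b: "\<And>i j. C1_closure \<Omega> (b i j)"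
    and u: "u \<in> op_dom \<Omega>" and f: "f \<in> L2 \<Omega>" and h: "h \<in> L2 \<Omega>"
    and eq: "AE x in lebesgue_on \<Omega>. f x = - (\<Sum>j\<in>UNIV. \<Sum>i\<in>UNIV. weak_partial \<Omega> j (\<lambda>x. b i j x *\<^sub>R weak_partial \<Omega> i u x) x) + h x"
  shows "l2_inner \<Omega> f u = (\<Sum>j\<in>UNIV. \<Sum>i\<in>UNIV. l2_inner \<Omega> (\<lambda>x. b i j x *\<^sub>R weak_partial \<Omega> i u x) (weak_partial \<Omega> j u)) + l2_inner \<Omega> h u"
proof -
  let ?v = "\<lambda>i. weak_partial \<Omega> i u"
  let ?w = "\<lambda>i j. weak_partial \<Omega> j (\<lambda>x. b i j x *\<^sub>R ?v i x)"
  have u10: "u \<in> sobolev10 \<Omega>" using u by (rule op_domD)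
  have vL2: "?v i \<in> L2 \<Omega>" for i using u10 by (rule weak_partial_L2)
  have bc: "continuous_on (closure \<Omega>) (b i j)" for i j using b by (auto simp: C1_closure_def)
  have bv: "(\<lambda>x. b i j x *\<^sub>R ?v i x) \<in> L2 \<Omega>" for i j
  proof -
    obtain c where c: "\<And>x. x \<in> closure \<Omega> \<Longrightarrow> \<bar>b i j x\<bar> \<le> c"
      using C1_closure_bounded[OF \<Omega>(2) b] by blast
    show ?thesis
      using closure_subset by (intro L2_bounded_mult[OF \<Omega>(1) vL2]) (auto intro: continuous_on_subset[OF bc] c)
  qed
  have wp: "has_weak_partial \<Omega> j (\<lambda>x. b i j x *\<^sub>R ?v i x) (?w i j)" for i j
    by (rule op_dom_weak_partials(2)[OF u \<Omega>(1) b])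
  have wloc: "locally_integrable \<Omega> (?w i j)" for i j
    using wp[where i=i and j=j] unfolding has_weak_partial_def by (elim conjE)
  have wpt: "(LINT x|lebesgue_on \<Omega>. b i j x *\<^sub>R ?v i x * partial j \<psi> x) = - (LINT x|lebesgue_on \<Omega>. ?w i j x * \<psi> x)"
    if "test_function \<Omega> \<psi>" for i j \<psi>
    using wp[where i=i and j=j] that unfolding has_weak_partial_def by (elim conjE allE impE)
  obtain \<phi> where \<phi>: "\<And>k::nat. test_function \<Omega> (\<phi> k)" "l2_tendsto \<Omega> \<phi> u sequentially"
    "\<And>i. l2_tendsto \<Omega> (\<lambda>k. partial i (\<phi> k)) (?v i) sequentially"
    using u10 by (auto simp: sobolev10_def)
  \<comment> \<open>Almost everywhere W is the sum of all second-order terms. As a difference of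
    \<open>h\<close> and \<open>f\<close> it is square integrable, while the single terms are known
    to be locally integrable only.\<close>
  define W where "W x = h x - f x" for x
  have WL2: "W \<in> L2 \<Omega>" unfolding W_def by (rule L2_diff[OF h f])
  have W: "AE x in lebesgue_on \<Omega>. W x = (\<Sum>j\<in>UNIV. \<Sum>i\<in>UNIV. ?w i j x)"
    using eq by eventually_elim (simp add: W_def)
  have test: "l2_inner \<Omega> W (\<phi> k) = - (\<Sum>j\<in>UNIV. \<Sum>i\<in>UNIV. l2_inner \<Omega> (\<lambda>x. b i j x *\<^sub>R ?v i x) (partial j (\<phi> k)))" for k
  proof -
    let ?K = "closure {x. \<phi> k x \<noteq> 0}"
    have K: "compact ?K" "?K \<subseteq> \<Omega>" and \<phi>C: "C_k 1 (\<phi> k)" using \<phi>(1)[of k] by (auto simp: test_function_def)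
    have \<phi>0: "cnj (\<phi> k x) = 0" if "x \<notin> ?K" for x using that closure_subset[of "{x. \<phi> k x \<noteq> 0}"] by auto
    have cc: "continuous_on S (\<lambda>x. cnj (\<phi> k x))" for S
      by (intro continuous_intros continuous_on_subset[OF C_k_continuous[OF \<phi>C]]) simp
    have iw: "integrable (lebesgue_on \<Omega>) (\<lambda>x. ?w i j x * cnj (\<phi> k x))" for i j
      by (rule integrable_locally_mult(1)[OF \<Omega>(1) wloc K cc \<phi>0])
    have "l2_inner \<Omega> W (\<phi> k) = (LINT x|lebesgue_on \<Omega>. (\<Sum>j\<in>UNIV. \<Sum>i\<in>UNIV. ?w i j x * cnj (\<phi> k x)))"
      unfolding l2_inner_def
    proof (rule integral_cong_AE)
      show "(\<lambda>x. W x * cnj (\<phi> k x)) \<in> borel_measurable (lebesgue_on \<Omega>)"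
      proof -
        have "\<phi> k \<in> borel_measurable (lebesgue_on \<Omega>)"
          using \<Omega>(1) by (intro continuous_imp_measurable_on_sets_lebesgue continuous_on_subset[OF C_k_continuous[OF \<phi>C]]) simp_all
        then show ?thesis using L2_D(1)[OF WL2] by measurable
      qed
      show "(\<lambda>x. \<Sum>j\<in>UNIV. \<Sum>i\<in>UNIV. ?w i j x * cnj (\<phi> k x)) \<in> borel_measurable (lebesgue_on \<Omega>)"
        by (intro borel_measurable_sum borel_measurable_integrable iw)
      show "AE x in lebesgue_on \<Omega>. W x * cnj (\<phi> k x) = (\<Sum>j\<in>UNIV. \<Sum>i\<in>UNIV. ?w i j x * cnj (\<phi> k x))"
        using W by eventually_elim (simp add: sum_distrib_right)
    qed
    also have "\<dots> = (\<Sum>j\<in>UNIV. \<Sum>i\<in>UNIV. (LINT x|lebesgue_on \<Omega>. ?w i j x * cnj (\<phi> k x)))"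
      by (subst Bochner_Integration.integral_sum, intro Bochner_Integration.integrable_sum iw,
        intro sum.cong refl Bochner_Integration.integral_sum iw)
    also have "\<dots> = (\<Sum>j\<in>UNIV. \<Sum>i\<in>UNIV. - l2_inner \<Omega> (\<lambda>x. b i j x *\<^sub>R ?v i x) (partial j (\<phi> k)))"
    proof (intro sum.cong refl)
      fix i j
      have "partial j (\<lambda>x. cnj (\<phi> k x)) = (\<lambda>x. cnj (partial j (\<phi> k) x))"
        using \<phi>C by (simp add: fun_eq_iff partial_cnj)
      then show "(LINT x|lebesgue_on \<Omega>. ?w i j x * cnj (\<phi> k x)) = - l2_inner \<Omega> (\<lambda>x. b i j x *\<^sub>R ?v i x) (partial j (\<phi> k))"
        using wpt[OF test_function_cnj[OF \<phi>(1)[of k]], of i j] by (simp only: l2_inner_def minus_minus)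
    qed
    finally show ?thesis by (simp add: sum_negf)
  qed
  have "(\<lambda>k. l2_inner \<Omega> W (\<phi> k)) \<longlonglongrightarrow> l2_inner \<Omega> W u"
    by (rule l2_tendsto_inner[OF l2_tendsto_const[OF WL2] \<phi>(2)])
  moreover have "(\<lambda>k. l2_inner \<Omega> W (\<phi> k)) \<longlonglongrightarrow> - (\<Sum>j\<in>UNIV. \<Sum>i\<in>UNIV. l2_inner \<Omega> (\<lambda>x. b i j x *\<^sub>R ?v i x) (?v j))"
    unfolding test by (intro tendsto_intros l2_tendsto_inner[OF l2_tendsto_const[OF bv] \<phi>(3)])
  ultimately have "l2_inner \<Omega> W u = - (\<Sum>j\<in>UNIV. \<Sum>i\<in>UNIV. l2_inner \<Omega> (\<lambda>x. b i j x *\<^sub>R ?v i x) (?v j))"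
    by (rule LIMSEQ_unique)
  moreover have "l2_inner \<Omega> W u = l2_inner \<Omega> h u - l2_inner \<Omega> f u"
    unfolding W_def using h f u10 by (intro l2_inner_diff) (auto simp: sobolev10_def)
  ultimately show ?thesis by (simp add: algebra_simps)
qed

text \<open>The coefficients are real, so the real part of the form is the sum of the forms in the
  real and in the imaginary parts of the gradient, and ellipticity applies to each. An antisymmetric
  part of the coefficients contributes to the imaginary part only; the modulus is therefore bounded
  through the size of the coefficients.\<close>

lemma elliptic_form_bounds:
  fixes b :: "'n \<Rightarrow> 'n \<Rightarrow> real^'n \<Rightarrow> real"
  assumes \<Omega>: "open \<Omega>" "bounded \<Omega>" and bc: "\<And>i j. continuous_on (closure \<Omega>) (b i j)"
    and bA: "\<And>i j x. x \<in> \<Omega> \<Longrightarrow> \<bar>b i j x\<bar> \<le> A"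
    and ell: "\<And>Q \<xi>. Q \<in> \<Omega> \<Longrightarrow> (\<Sum>j\<in>UNIV. \<Sum>i\<in>UNIV. b i j Q * \<xi> $ i * \<xi> $ j) \<ge> a0 * (norm (\<xi> :: real^'n))\<^sup>2"
    and u: "u \<in> sobolev10 \<Omega>"
  defines "S \<equiv> \<Sum>j\<in>UNIV. \<Sum>i\<in>UNIV. l2_inner \<Omega> (\<lambda>x. b i j x *\<^sub>R weak_partial \<Omega> i u x) (weak_partial \<Omega> j u)"
  shows "Re S \<ge> a0 * energy \<Omega> u" "cmod S \<le> A * real CARD('n) * energy \<Omega> u"
proof -
  let ?v = "\<lambda>i. weak_partial \<Omega> i u"
  have vL2: "?v i \<in> L2 \<Omega>" for i using u by (rule weak_partial_L2)
  have bv: "(\<lambda>x. b i j x *\<^sub>R ?v i x) \<in> L2 \<Omega>" for i j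
    using closure_subset by (intro L2_bounded_mult[OF \<Omega>(1) vL2, where c=A]) (auto intro: continuous_on_subset[OF bc] bA)
  have ib: "integrable (lebesgue_on \<Omega>) (\<lambda>x. b i j x *\<^sub>R ?v i x * cnj (?v j x))" for i j
    by (rule L2_cnj_mult(1)[OF bv vL2])
  define q where "q x = (\<Sum>j\<in>UNIV. \<Sum>i\<in>UNIV. b i j x *\<^sub>R ?v i x * cnj (?v j x))" for x
  define e where "e x = (\<Sum>i\<in>UNIV. (cmod (?v i x))\<^sup>2)" for x
  have iq: "integrable (lebesgue_on \<Omega>) q" unfolding q_def by (intro Bochner_Integration.integrable_sum ib)
  have S: "S = (LINT x|lebesgue_on \<Omega>. q x)"
    unfolding S_def q_def l2_inner_def using ib by (simp add: Bochner_Integration.integral_sum)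
  have ie: "integrable (lebesgue_on \<Omega>) e"
    unfolding e_def by (intro Bochner_Integration.integrable_sum L2_D(2) vL2)
  have E: "energy \<Omega> u = (LINT x|lebesgue_on \<Omega>. e x)"
    unfolding energy_def e_def l2_norm_sq using L2_D(2)[OF vL2] by (simp add: Bochner_Integration.integral_sum)
  have Re_q: "Re (q x) \<ge> a0 * e x" if x: "x \<in> \<Omega>" for x
  proof -
    define p where "p = (\<chi> i. Re (?v i x))"
    define r where "r = (\<chi> i. Im (?v i x))"
    have "Re (q x) = (\<Sum>j\<in>UNIV. \<Sum>i\<in>UNIV. b i j x * p $ i * p $ j) + (\<Sum>j\<in>UNIV. \<Sum>i\<in>UNIV. b i j x * r $ i * r $ j)"
      by (simp add: q_def p_def r_def sum.distrib[symmetric] algebra_simps)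
    also have "\<dots> \<ge> a0 * (norm p)\<^sup>2 + a0 * (norm r)\<^sup>2" by (intro add_mono ell x)
    also have "a0 * (norm p)\<^sup>2 + a0 * (norm r)\<^sup>2 = a0 * e x"
      by (simp add: e_def p_def r_def norm_vec_def L2_set_def sum_nonneg cmod_power2 sum.distrib distrib_left)
    finally show ?thesis by simp
  qed
  have q_le: "cmod (q x) \<le> A * real CARD('n) * e x" if x: "x \<in> \<Omega>" for x
  proof -
    have A0: "A \<ge> 0" using bA[OF x] by (meson abs_ge_zero order_trans)
    have "cmod (q x) \<le> (\<Sum>j\<in>UNIV. \<Sum>i\<in>UNIV. cmod (b i j x *\<^sub>R ?v i x * cnj (?v j x)))"
      unfolding q_def by (intro order_trans[OF norm_sum] sum_mono norm_sum)
    \<comment> \<open>In the double sum each squared derivative is counted n times with either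
      index, and the halves add up to n e(x).\<close>
    also have "\<dots> \<le> (\<Sum>j\<in>UNIV. \<Sum>i\<in>UNIV. A * (((cmod (?v i x))\<^sup>2 + (cmod (?v j x))\<^sup>2) / 2))"
    proof (intro sum_mono)
      fix i j
      have "cmod (?v i x) * cmod (?v j x) \<le> ((cmod (?v i x))\<^sup>2 + (cmod (?v j x))\<^sup>2) / 2"
        using sum_squares_bound[of "cmod (?v i x)" "cmod (?v j x)"] by simp
      then show "cmod (b i j x *\<^sub>R ?v i x * cnj (?v j x)) \<le> A * (((cmod (?v i x))\<^sup>2 + (cmod (?v j x))\<^sup>2) / 2)"
        using bA[OF x, of i j] A0 by (simp add: norm_mult mult.assoc) (intro mult_mono, auto)
    qed
    also have "\<dots> = A * real CARD('n) * e x"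
      by (simp add: e_def sum.distrib sum_distrib_left[symmetric] add_divide_distrib sum_divide_distrib[symmetric] distrib_left[symmetric])
    finally show ?thesis .
  qed
  have "a0 * energy \<Omega> u = (LINT x|lebesgue_on \<Omega>. a0 * e x)" by (simp add: E)
  also have "\<dots> \<le> (LINT x|lebesgue_on \<Omega>. Re (q x))"
    by (intro integral_mono integrable_mult_right ie integrable_Re iq) (simp add: Re_q space_restrict_space)
  also have "\<dots> = Re S" unfolding S by (rule integral_Re[OF iq])
  finally show "Re S \<ge> a0 * energy \<Omega> u" .
  have "cmod S \<le> (LINT x|lebesgue_on \<Omega>. A * real CARD('n) * e x)"
    unfolding S by (intro Bochner_Integration.integral_norm_bound_integral iq integrable_mult_right ie) (simp add: q_le space_restrict_space)
  then show "cmod S \<le> A * real CARD('n) * energy \<Omega> u" by (simp add: E)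
qed

text \<open>Both inequalities are non-strict between quantities that are continuous under
  convergence of u and f together. The premise on G is restricted to square integrable pairs, which
  the approximating sequence provides from some index on.\<close>

lemma op_closure_form_bounds:
  assumes G: "\<And>u f. (u, f) \<in> G \<Longrightarrow> u \<in> L2 \<Omega> \<Longrightarrow> f \<in> L2 \<Omega> \<Longrightarrow>
      c * (l2_norm \<Omega> u)\<^sup>2 \<le> Re (l2_inner \<Omega> f u) \<and> \<bar>Im (l2_inner \<Omega> f u)\<bar> \<le> K * Re (l2_inner \<Omega> f u)"
    and uf: "(u, f) \<in> op_closure \<Omega> G"
  shows "c * (l2_norm \<Omega> u)\<^sup>2 \<le> Re (l2_inner \<Omega> f u)" "\<bar>Im (l2_inner \<Omega> f u)\<bar> \<le> K * Re (l2_inner \<Omega> f u)"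
proof -
  obtain U F where UF: "\<And>k::nat. (U k, F k) \<in> G" "l2_tendsto \<Omega> U u sequentially" "l2_tendsto \<Omega> F f sequentially"
    using uf by (auto simp: op_closure_def)
  have inner: "(\<lambda>k. l2_inner \<Omega> (F k) (U k)) \<longlonglongrightarrow> l2_inner \<Omega> f u"
    by (rule l2_tendsto_inner[OF UF(3,2)])
  have norm: "(\<lambda>k. l2_norm \<Omega> (U k)) \<longlonglongrightarrow> l2_norm \<Omega> u" by (rule l2_tendsto_norm[OF UF(2)])
  have "\<forall>\<^sub>F k in sequentially. U k \<in> L2 \<Omega>" "\<forall>\<^sub>F k in sequentially. F k \<in> L2 \<Omega>"
    using UF by (auto simp: l2_tendsto_def)
  then have ev: "\<forall>\<^sub>F k in sequentially. c * (l2_norm \<Omega> (U k))\<^sup>2 \<le> Re (l2_inner \<Omega> (F k) (U k)) \<and>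
      \<bar>Im (l2_inner \<Omega> (F k) (U k))\<bar> \<le> K * Re (l2_inner \<Omega> (F k) (U k))"
    by eventually_elim (rule G[OF UF(1)])
  show "c * (l2_norm \<Omega> u)\<^sup>2 \<le> Re (l2_inner \<Omega> f u)"
    by (rule tendsto_le[OF sequentially_bot tendsto_Re[OF inner] tendsto_mult[OF tendsto_const tendsto_power[OF norm]]])
      (use ev in \<open>auto elim: eventually_mono\<close>)
  show "\<bar>Im (l2_inner \<Omega> f u)\<bar> \<le> K * Re (l2_inner \<Omega> f u)"
    by (rule tendsto_le[OF sequentially_bot tendsto_mult[OF tendsto_const tendsto_Re[OF inner]] tendsto_rabs[OF tendsto_Im[OF inner]]])
      (use ev in \<open>auto elim: eventually_mono\<close>)
qed

text \<open>If Re z = 0, the inequality leaves only z = 0, whose argument is 0 by convention;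
  otherwise the argument is the arctangent of Im z / Re z.\<close>

lemma in_sector_arctan:
  assumes "0 \<le> Re z" "\<bar>Im z\<bar> \<le> K * Re z" and K: "K \<ge> 0"
  shows "z \<in> sector 0 (arctan K)"
proof (cases "Re z = 0")
  case True
  then have "z = 0" using assms by (auto simp: complex_eq_iff)
  then show ?thesis using K by (simp add: sector_def Arg_zero)
next
  case False
  then have z: "Re z > 0" using assms by simp
  have "- K \<le> Im z / Re z" "Im z / Re z \<le> K" using assms(2) z by (auto simp: field_simps abs_le_iff)
  then have "arctan (- K) \<le> arctan (Im z / Re z)" "arctan (Im z / Re z) \<le> arctan K"
    by (simp_all only: arctan_le_iff)
  then have "\<bar>arctan (Im z / Re z)\<bar> \<le> arctan K" by (simp add: arctan_minus abs_le_iff)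
  then show ?thesis using arg_conv_arctan[OF z] by (simp add: sector_def)
qed

text \<open>Everything is compared with the Dirichlet integral: the real part is at least a0 times
  it, the imaginary part at most A n + |p| times it, and the squared norm of u at most q times it.
  The divisor |q| + 1 is positive whatever the sign of q. The coefficients b and the operator H are
  left open so that both operators are instances.\<close>

lemma perturbed_elliptic_bounds:
  fixes b :: "'n \<Rightarrow> 'n \<Rightarrow> real^'n \<Rightarrow> real" and H :: "(real^'n \<Rightarrow> complex) \<Rightarrow> real^'n \<Rightarrow> complex"
  assumes \<Omega>: "open \<Omega>" "bounded \<Omega>" and b: "\<And>i j. C1_closure \<Omega> (b i j)"
    and bA: "\<And>i j x. x \<in> \<Omega> \<Longrightarrow> \<bar>b i j x\<bar> \<le> A" and A: "A \<ge> 0" and a0: "a0 > 0"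
    and ell: "\<And>Q \<xi>. Q \<in> \<Omega> \<Longrightarrow> (\<Sum>j\<in>UNIV. \<Sum>i\<in>UNIV. b i j Q * \<xi> $ i * \<xi> $ j) \<ge> a0 * (norm (\<xi> :: real^'n))\<^sup>2"
    and H: "\<And>u. u \<in> sobolev10 \<Omega> \<Longrightarrow> H u \<in> L2 \<Omega> \<and> 0 \<le> Re (l2_inner \<Omega> (H u) u) \<and>
      cmod (l2_inner \<Omega> (H u) u) \<le> p * energy \<Omega> u \<and> (l2_norm \<Omega> u)\<^sup>2 \<le> q * energy \<Omega> u"
    and T: "\<And>u Q. T u Q = - (\<Sum>j\<in>UNIV. \<Sum>i\<in>UNIV. weak_partial \<Omega> j (\<lambda>x. b i j x *\<^sub>R weak_partial \<Omega> i u x) Q) + H u Q"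
    and uf: "(u, f) \<in> op_graph \<Omega> (op_dom \<Omega>) T" "f \<in> L2 \<Omega>"
  shows "a0 / (\<bar>q\<bar> + 1) * (l2_norm \<Omega> u)\<^sup>2 \<le> Re (l2_inner \<Omega> f u) \<and>
    \<bar>Im (l2_inner \<Omega> f u)\<bar> \<le> (A * real CARD('n) + \<bar>p\<bar>) / a0 * Re (l2_inner \<Omega> f u)"
proof -
  let ?E = "energy \<Omega> u"
  define S where "S = (\<Sum>j\<in>UNIV. \<Sum>i\<in>UNIV. l2_inner \<Omega> (\<lambda>x. b i j x *\<^sub>R weak_partial \<Omega> i u x) (weak_partial \<Omega> j u))"
  have u: "u \<in> op_dom \<Omega>" and eq: "AE x in lebesgue_on \<Omega>. f x = T u x" using uf(1) by (auto simp: op_graph_def)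
  have u10: "u \<in> sobolev10 \<Omega>" using u by (rule op_domD)
  have Hu: "H u \<in> L2 \<Omega>" "0 \<le> Re (l2_inner \<Omega> (H u) u)" "cmod (l2_inner \<Omega> (H u) u) \<le> p * ?E" "(l2_norm \<Omega> u)\<^sup>2 \<le> q * ?E"
    using H[OF u10] by auto
  have fu: "l2_inner \<Omega> f u = S + l2_inner \<Omega> (H u) u"
    unfolding S_def using eq by (intro divergence_form[OF \<Omega> b u uf(2) Hu(1)]) (simp add: T)
  have S: "Re S \<ge> a0 * ?E" "cmod S \<le> A * real CARD('n) * ?E"
    unfolding S_def using b by (intro elliptic_form_bounds[OF \<Omega> _ bA ell u10]; simp add: C1_closure_def)+
  note E0 = energy_nonneg[of \<Omega> u]
  have Re_ge: "Re (l2_inner \<Omega> f u) \<ge> a0 * ?E" using S(1) Hu(2) by (simp add: fu)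
  have "(l2_norm \<Omega> u)\<^sup>2 \<le> (\<bar>q\<bar> + 1) * ?E"
    using Hu(4) mult_right_mono[of q "\<bar>q\<bar> + 1" ?E] E0 by linarith
  then have "a0 / (\<bar>q\<bar> + 1) * (l2_norm \<Omega> u)\<^sup>2 \<le> a0 / (\<bar>q\<bar> + 1) * ((\<bar>q\<bar> + 1) * ?E)"
    using a0 by (intro mult_left_mono) auto
  also have "\<dots> = a0 * ?E" by (simp add: field_simps)
  also note Re_ge
  finally have 1: "a0 / (\<bar>q\<bar> + 1) * (l2_norm \<Omega> u)\<^sup>2 \<le> Re (l2_inner \<Omega> f u)" .
  have "\<bar>Im (l2_inner \<Omega> f u)\<bar> \<le> cmod S + cmod (l2_inner \<Omega> (H u) u)"
    unfolding fu by (rule order_trans[OF abs_Im_le_cmod norm_triangle_ineq])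
  also have "\<dots> \<le> A * real CARD('n) * ?E + \<bar>p\<bar> * ?E"
    using S(2) Hu(3) mult_right_mono[of p "\<bar>p\<bar>" ?E] E0 by linarith
  also have "\<dots> = (A * real CARD('n) + \<bar>p\<bar>) / a0 * (a0 * ?E)" using a0 by (simp add: field_simps)
  also have "\<dots> \<le> (A * real CARD('n) + \<bar>p\<bar>) / a0 * Re (l2_inner \<Omega> f u)"
    using A a0 by (intro mult_left_mono Re_ge) auto
  finally show ?thesis by (rule conjI[OF 1])
qed

theorem theorem4p2:
  fixes \<Omega> :: "(real^'n) set" and P :: "real^'n"
    and a :: "'n \<Rightarrow> 'n \<Rightarrow> real^'n \<Rightarrow> real" and \<rho> :: "real^'n \<Rightarrow> real"
    and \<alpha> \<kappa> M a0 :: real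
  assumes "CARD('n) \<ge> 2"
    and "0 < \<alpha>" "\<alpha> < 1"
    and "open \<Omega>" "convex \<Omega>" "bounded \<Omega>" "\<Omega> \<noteq> {}"
    and "P \<in> frontier \<Omega>"
    and "\<And>i j. C1_closure \<Omega> (a i j)"
    and "a0 > 0"
    and "\<And>Q \<xi>. Q \<in> \<Omega> \<Longrightarrow>
           (\<Sum>i\<in>UNIV. \<Sum>j\<in>UNIV. a i j Q * \<xi> $ i * \<xi> $ j) \<ge> a0 * (norm (\<xi> :: real^'n))\<^sup>2"
    and "\<And>Q. Q \<in> \<Omega> \<Longrightarrow> \<rho> Q > 0"
    and "\<alpha> < \<kappa>" "\<kappa> \<le> 1"
    and "\<And>Q1 Q2. Q1 \<in> closure \<Omega> \<Longrightarrow> Q2 \<in> closure \<Omega> \<Longrightarrow>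
           \<bar>\<rho> Q1 - \<rho> Q2\<bar> \<le> M * dist Q1 Q2 powr \<kappa>"
    and "(INF Q\<in>\<Omega>. \<rho> Q) > 0 \<and>
           mu_general CARD('n) \<alpha> \<kappa> M (INF Q\<in>\<Omega>. \<rho> Q) (diameter \<Omega>) > 0
         \<or> nonincreasing_on_rays \<Omega> P \<rho> \<and> mu_monotone CARD('n) \<alpha> (diameter \<Omega>) > 0"
  shows "strictly_accretive \<Omega> (op_closure \<Omega> (op_graph \<Omega> (op_dom \<Omega>) (L_op \<Omega> P \<alpha> a \<rho>))) \<and>
         strictly_accretive \<Omega> (op_closure \<Omega> (op_graph \<Omega> (op_dom \<Omega>) (Lplus_op \<Omega> P \<alpha> a \<rho>))) \<and>
         (\<exists>\<gamma> \<theta>. 0 \<le> \<theta> \<and> \<theta> < pi / 2 \<and>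
            numerical_range \<Omega> (op_closure \<Omega> (op_graph \<Omega> (op_dom \<Omega>) (L_op \<Omega> P \<alpha> a \<rho>)))
              \<subseteq> sector \<gamma> \<theta> \<and>
            numerical_range \<Omega> (op_closure \<Omega> (op_graph \<Omega> (op_dom \<Omega>) (Lplus_op \<Omega> P \<alpha> a \<rho>)))
              \<subseteq> sector \<gamma> \<theta>)"
proof -
  note a = assms(9) and a0 = assms(10) and ell = assms(11)
  have mu: "(INF Q\<in>\<Omega>. \<rho> Q) > 0 \<and> mu_general CARD('n) \<alpha> \<kappa> M (INF Q\<in>\<Omega>. \<rho> Q) (diameter \<Omega>) > 0
      \<or> nonincreasing_on_rays \<Omega> P \<rho>"
    using assms(16) by blast
  interpret kipriyanov_setting \<Omega> P \<rho> \<alpha> \<kappa> M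
    by (rule kipriyanov_setting.intro[OF assms(1-6,8,12,13,15) mu])
  have bdd: "\<exists>c. \<forall>x\<in>closure \<Omega>. \<bar>a i j x\<bar> \<le> c" for i j
    by (rule C1_closure_bounded[OF \<Omega>(3) a])
  define c where "c i j = (SOME c. \<forall>x\<in>closure \<Omega>. \<bar>a i j x\<bar> \<le> c)" for i j
  have c: "\<bar>a i j x\<bar> \<le> c i j" if "x \<in> closure \<Omega>" for i j x
    using someI_ex[OF bdd[of i j]] that unfolding c_def by (rule bspec)
  define A where "A = (\<Sum>i\<in>UNIV. \<Sum>j\<in>UNIV. \<bar>c i j\<bar>)"
  have A0: "A \<ge> 0" by (simp add: A_def sum_nonneg)
  have aA: "\<bar>a i j x\<bar> \<le> A" if "x \<in> \<Omega>" for i j x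
  proof -
    have "x \<in> closure \<Omega>" using that closure_subset by (rule subsetD[rotated])
    then have "\<bar>a i j x\<bar> \<le> \<bar>c i j\<bar>" using c[of x i j] by linarith
    also have "\<dots> \<le> (\<Sum>j\<in>UNIV. \<bar>c i j\<bar>)" by (rule member_le_sum) auto
    also have "\<dots> \<le> A" unfolding A_def by (rule member_le_sum) (auto intro: sum_nonneg)
    finally show ?thesis .
  qed
  \<comment> \<open>K is the quotient of the upper bound for the imaginary part and the lower bound
    for the real part, both relative to the Dirichlet integral. It involves only the domain, P and
    the coefficients, and is the same for both operators; the angle will be its arctangent.\<close>
  define K where "K = (A * real CARD('n) + \<bar>pairing_bound\<bar>) / a0"
  define C where "C = a0 / (\<bar>poincare_const\<bar> + 1)"
  have K0: "K \<ge> 0" using A0 a0 by (simp add: K_def)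
  have C0: "C > 0" using a0 by (simp add: C_def add_nonneg_pos)
  let ?GL = "op_graph \<Omega> (op_dom \<Omega>) (L_op \<Omega> P \<alpha> a \<rho>)" and ?GR = "op_graph \<Omega> (op_dom \<Omega>) (Lplus_op \<Omega> P \<alpha> a \<rho>)"
  have L: "C * (l2_norm \<Omega> u)\<^sup>2 \<le> Re (l2_inner \<Omega> f u) \<and> \<bar>Im (l2_inner \<Omega> f u)\<bar> \<le> K * Re (l2_inner \<Omega> f u)"
    if "(u, f) \<in> ?GL" "f \<in> L2 \<Omega>" for u f
    unfolding C_def K_def
  proof (rule perturbed_elliptic_bounds[OF \<Omega>(1,3) a aA A0 a0 _ _ _ that, where H="\<lambda>u Q. \<rho> Q *\<^sub>R kipriyanov \<alpha> P u Q"])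
    show "a0 * (norm \<xi>)\<^sup>2 \<le> (\<Sum>j\<in>UNIV. \<Sum>i\<in>UNIV. a i j Q * \<xi> $ i * \<xi> $ j)" if "Q \<in> \<Omega>" for Q \<xi>
      using ell[OF that, of \<xi>] by (subst sum.swap)
  next
    fix u assume u: "u \<in> sobolev10 \<Omega>"
    show "(\<lambda>Q. \<rho> Q *\<^sub>R kipriyanov \<alpha> P u Q) \<in> L2 \<Omega> \<and> 0 \<le> Re (l2_inner \<Omega> (\<lambda>Q. \<rho> Q *\<^sub>R kipriyanov \<alpha> P u Q) u) \<and>
        cmod (l2_inner \<Omega> (\<lambda>Q. \<rho> Q *\<^sub>R kipriyanov \<alpha> P u Q) u) \<le> pairing_bound * energy \<Omega> u \<and>
        (l2_norm \<Omega> u)\<^sup>2 \<le> poincare_const * energy \<Omega> u"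
      by (intro conjI fractional_estimates u)
  qed (simp_all add: L_op_def)
  have R: "C * (l2_norm \<Omega> u)\<^sup>2 \<le> Re (l2_inner \<Omega> f u) \<and> \<bar>Im (l2_inner \<Omega> f u)\<bar> \<le> K * Re (l2_inner \<Omega> f u)"
    if "(u, f) \<in> ?GR" "f \<in> L2 \<Omega>" for u f
    unfolding C_def K_def
  proof (rule perturbed_elliptic_bounds[OF \<Omega>(1,3) a aA A0 a0 _ _ _ that,
        where H="\<lambda>u. right_frac_deriv \<alpha> \<Omega> P (\<lambda>x. \<rho> x *\<^sub>R u x)"])
    \<comment> \<open>The formal adjoint has the transposed coefficients, and the quadratic form is
      invariant under transposition.\<close>
    show "a0 * (norm \<xi>)\<^sup>2 \<le> (\<Sum>j\<in>UNIV. \<Sum>i\<in>UNIV. a j i Q * \<xi> $ i * \<xi> $ j)" if "Q \<in> \<Omega>" for Q \<xi>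
      using ell[OF that, of \<xi>] by (simp add: mult_ac)
  next
    fix u assume u: "u \<in> sobolev10 \<Omega>"
    show "right_frac_deriv \<alpha> \<Omega> P (\<lambda>x. \<rho> x *\<^sub>R u x) \<in> L2 \<Omega> \<and>
        0 \<le> Re (l2_inner \<Omega> (right_frac_deriv \<alpha> \<Omega> P (\<lambda>x. \<rho> x *\<^sub>R u x)) u) \<and>
        cmod (l2_inner \<Omega> (right_frac_deriv \<alpha> \<Omega> P (\<lambda>x. \<rho> x *\<^sub>R u x)) u) \<le> pairing_bound * energy \<Omega> u \<and>
        (l2_norm \<Omega> u)\<^sup>2 \<le> poincare_const * energy \<Omega> u"
      by (intro conjI fractional_estimates u)
  qed (simp_all add: Lplus_op_def)
  have clL: "C * (l2_norm \<Omega> u)\<^sup>2 \<le> Re (l2_inner \<Omega> f u)" "\<bar>Im (l2_inner \<Omega> f u)\<bar> \<le> K * Re (l2_inner \<Omega> f u)"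
    if "(u, f) \<in> op_closure \<Omega> ?GL" for u f
    by (rule op_closure_form_bounds[OF L that]; assumption)+
  have clR: "C * (l2_norm \<Omega> u)\<^sup>2 \<le> Re (l2_inner \<Omega> f u)" "\<bar>Im (l2_inner \<Omega> f u)\<bar> \<le> K * Re (l2_inner \<Omega> f u)"
    if "(u, f) \<in> op_closure \<Omega> ?GR" for u f
    by (rule op_closure_form_bounds[OF R that]; assumption)+
  have accretive: "strictly_accretive \<Omega> (op_closure \<Omega> ?GL)" "strictly_accretive \<Omega> (op_closure \<Omega> ?GR)"
    unfolding strictly_accretive_def by (intro exI[of _ C] conjI C0 ballI, clarify, erule clL clR)+
  have sector: "z \<in> sector 0 (arctan K)"
    if "C * N\<^sup>2 \<le> Re z" "\<bar>Im z\<bar> \<le> K * Re z" for z and N :: real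
  proof (rule in_sector_arctan[OF _ that(2) K0])
    have "0 \<le> C * N\<^sup>2" using C0 by simp
    with that(1) show "0 \<le> Re z" by linarith
  qed
  have "numerical_range \<Omega> (op_closure \<Omega> ?GL) \<subseteq> sector 0 (arctan K)"
    unfolding numerical_range_def by clarify (rule sector[OF clL])
  moreover have "numerical_range \<Omega> (op_closure \<Omega> ?GR) \<subseteq> sector 0 (arctan K)"
    unfolding numerical_range_def by clarify (rule sector[OF clR])
  moreover have "0 \<le> arctan K" using K0 by simp
  moreover have "arctan K < pi / 2" by (rule arctan_ubound)
  ultimately show ?thesis using accretive by (intro conjI exI[of _ 0] exI[of _ "arctan K"])
qed

end
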